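(* Let $K$ be an infinite field. The group $\mathrm{Eq}(SL(2,K))$ is isomorphic to $I^2(K)$, and the (reduced) Witt class $w^I\in H^2(SL(2,K),I^2(K))$ is the universal equicommutative class of $SL(2,K)$; that is, $w^I$ is equicommutative, and for every abelian group $A$ and every equicommutative class $v\in H^2(SL(2,K),A)$ there is a unique homomorphism $f\colon I^2(K)\to A$ with $f_*w^I=v$.
   Context: All groups are discrete; $H^2(G,U)$ is group cohomology with constant (trivial) coefficients in an abelian group $U$, and 2-cocycles $c\colon G\times G\to U$ are non-homogeneous. Equicommutativity: a 2-cocycle $c$ is equicommutative if $c(g,h)=c(h,g)$ whenever $gh=hg$; a class in $H^2(G,U)$ is equicommutative if it is represented by an equicommutative cocycle. The group $\mathrm{Eq}(G)$: let $G$ be a perfect group ($SL(2,K)$ is perfect for $K$ infinite) and $H_2G=H_2(G,\mathbf Z)$. The universal coefficients map $H^2(G,H_2G)\to \mathrm{Hom}(H_2G,H_2G)$ is an isomorphism; the Moore (universal) class $u_G\in H^2(G,H_2G)$ is the class corresponding to $\mathrm{id}_{H_2G}$. Let $u$ be a cocycle representing $u_G$ and (writing $H_2G$ multiplicatively) let $G^{[,]}\le H_2G$ be the subgroup generated by $\{u(g,h)u(h,g)^{-1}\mid g,h\in G,\ gh=hg\}$ (this does not depend on the choice of $u$). Put $\mathrm{Eq}(G)=H_2G/G^{[,]}$. Witt ring: $K^*=K\setminus\{0\}$; $W(K)$ is the Witt ring of nondegenerate symmetric bilinear forms over $K$; for $a\in K^*$, $[a]\in W(K)$ is the class of the 1-dimensional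 form $\langle a\rangle$, and $[0]:=0$. $I(K)\subset W(K)$ is the fundamental ideal (classes of forms on even-dimensional spaces) and $I^2(K)$ is its square, regarded as an additive group. Witt class: the class $w\in H^2(SL(2,K),W(K))$ is represented by the cocycle $w(a,b)=[-a_{21}\cdot(ab)_{21}\cdot b_{21}]$, where $m_{21}$ is the $(2,1)$ entry of a matrix $m$. The inclusion $\iota\colon I^2(K)\to W(K)$ induces an injection $\iota_*\colon H^2(SL(2,K),I^2(K))\to H^2(SL(2,K),W(K))$ whose image contains $w$, and the reduced Witt class is $w^I=\iota_*^{-1}(w)$. Explicitly, $w^I$ is represented by the $I^2(K)$-valued cocycle $w(g,h)+n(g)-n(gh)+n(h)$, where $n(g)=[g_{21}]$ if $g_{21}\neq0$, and $n(g)=[1]-[g_{11}]$ if $g_{21}=0$. *)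

theory Defs
  imports
    "HOL-Algebra.Free_Abelian_Groups"
    "HOL-Algebra.Product_Groups"
    "HOL-Algebra.Generated_Groups"
    "HOL-Algebra.Ideal_Product"
    "Jordan_Normal_Form.Determinant"
begin

text \<open>Cochains are extensional functions on pairs, so that cohomology classes,
  being cosets, are sets of honest functions on the carrier.\<close>

definition cochains2 :: "('g, 'm) monoid_scheme \<Rightarrow> ('u, 'n) monoid_scheme \<Rightarrow> ('g \<times> 'g \<Rightarrow> 'u) monoid"
  where "cochains2 G U = product_group (carrier G \<times> carrier G) (\<lambda>_. U)"

definition cocycles2 :: "('g, 'm) monoid_scheme \<Rightarrow> ('u, 'n) monoid_scheme \<Rightarrow> ('g \<times> 'g \<Rightarrow> 'u) set"
  where "cocycles2 G U =
    {c \<in> carrier (cochains2 G U).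
       \<forall>g\<in>carrier G. \<forall>h\<in>carrier G. \<forall>k\<in>carrier G.
         c (h, k) \<otimes>\<^bsub>U\<^esub> c (g, h \<otimes>\<^bsub>G\<^esub> k) = c (g \<otimes>\<^bsub>G\<^esub> h, k) \<otimes>\<^bsub>U\<^esub> c (g, h)}"

definition coboundaries2 :: "('g, 'm) monoid_scheme \<Rightarrow> ('u, 'n) monoid_scheme \<Rightarrow> ('g \<times> 'g \<Rightarrow> 'u) set"
  where "coboundaries2 G U =
    {\<lambda>(g, h)\<in>carrier G \<times> carrier G. b g \<otimes>\<^bsub>U\<^esub> inv\<^bsub>U\<^esub> (b (g \<otimes>\<^bsub>G\<^esub> h)) \<otimes>\<^bsub>U\<^esub> b h | b.
       b \<in> carrier G \<rightarrow> carrier U}"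

definition cohomology2 ::
    "('g, 'm) monoid_scheme \<Rightarrow> ('u, 'n) monoid_scheme \<Rightarrow> ('g \<times> 'g \<Rightarrow> 'u) set monoid"
  where "cohomology2 G U = ((cochains2 G U)\<lparr>carrier := cocycles2 G U\<rparr>) Mod (coboundaries2 G U)"

definition cohomology_class ::
    "('g, 'm) monoid_scheme \<Rightarrow> ('u, 'n) monoid_scheme \<Rightarrow> ('g \<times> 'g \<Rightarrow> 'u) \<Rightarrow> ('g \<times> 'g \<Rightarrow> 'u) set"
  where "cohomology_class G U c = coboundaries2 G U #>\<^bsub>cochains2 G U\<^esub> c"

text \<open>The map \<open>f\<^sub>*\<close> induced by a homomorphism \<open>f\<close> from \<open>U\<close> to \<open>V\<close>; for such \<open>f\<close> all members of
  the union coincide. The source \<open>U\<close> is implicit in the class \<open>x\<close>.\<close>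

definition induced_map ::
    "('g, 'm) monoid_scheme \<Rightarrow> ('v, 'n) monoid_scheme \<Rightarrow> ('u \<Rightarrow> 'v) \<Rightarrow>
     ('g \<times> 'g \<Rightarrow> 'u) set \<Rightarrow> ('g \<times> 'g \<Rightarrow> 'v) set"
  where "induced_map G V f x =
    (\<Union>c\<in>x. cohomology_class G V (\<lambda>p\<in>carrier G \<times> carrier G. f (c p)))"

definition equicommutative_cocycle ::
    "('g, 'm) monoid_scheme \<Rightarrow> ('u, 'n) monoid_scheme \<Rightarrow> ('g \<times> 'g \<Rightarrow> 'u) \<Rightarrow> bool"
  where "equicommutative_cocycle G U c \<longleftrightarrow>
    c \<in> cocycles2 G U \<and>
    (\<forall>g\<in>carrier G. \<forall>h\<in>carrier G. g \<otimes>\<^bsub>G\<^esub> h = h \<otimes>\<^bsub>G\<^esub> g \<longrightarrow> c (g, h) = c (h, g))"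

definition equicommutative_class ::
    "('g, 'm) monoid_scheme \<Rightarrow> ('u, 'n) monoid_scheme \<Rightarrow> ('g \<times> 'g \<Rightarrow> 'u) set \<Rightarrow> bool"
  where "equicommutative_class G U x \<longleftrightarrow>
    x \<in> carrier (cohomology2 G U) \<and> (\<exists>c\<in>x. equicommutative_cocycle G U c)"

text \<open>\<open>H\<^sub>2(G, \<int>)\<close> is computed from the non-homogeneous bar complex.\<close>

definition bar_d2 :: "('g, 'm) monoid_scheme \<Rightarrow> ('g \<times> 'g \<Rightarrow>\<^sub>0 int) \<Rightarrow> ('g \<Rightarrow>\<^sub>0 int)"
  where "bar_d2 G = frag_extend (\<lambda>(g, h). frag_of h - frag_of (g \<otimes>\<^bsub>G\<^esub> h) + frag_of g)"

definition bar_d3 :: "('g, 'm) monoid_scheme \<Rightarrow> ('g \<times> 'g \<times> 'g \<Rightarrow>\<^sub>0 int) \<Rightarrow> ('g \<times> 'g \<Rightarrow>\<^sub>0 int)"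
  where "bar_d3 G = frag_extend (\<lambda>(g, h, k).
    frag_of (h, k) - frag_of (g \<otimes>\<^bsub>G\<^esub> h, k) + frag_of (g, h \<otimes>\<^bsub>G\<^esub> k) - frag_of (g, h))"

definition cycles2 :: "('g, 'm) monoid_scheme \<Rightarrow> ('g \<times> 'g \<Rightarrow>\<^sub>0 int) set"
  where "cycles2 G =
    kernel (free_Abelian_group (carrier G \<times> carrier G)) (free_Abelian_group (carrier G)) (bar_d2 G)"

definition boundaries2 :: "('g, 'm) monoid_scheme \<Rightarrow> ('g \<times> 'g \<Rightarrow>\<^sub>0 int) set"
  where "boundaries2 G =
    bar_d3 G ` carrier (free_Abelian_group (carrier G \<times> carrier G \<times> carrier G))"

definition homology2 :: "('g, 'm) monoid_scheme \<Rightarrow> ('g \<times> 'g \<Rightarrow>\<^sub>0 int) set monoid"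
  where "homology2 G =
    ((free_Abelian_group (carrier G \<times> carrier G))\<lparr>carrier := cycles2 G\<rparr>) Mod (boundaries2 G)"

definition eval_cochain ::
    "('u, 'n) monoid_scheme \<Rightarrow> ('g \<times> 'g \<Rightarrow> 'u) \<Rightarrow> ('g \<times> 'g \<Rightarrow>\<^sub>0 int) \<Rightarrow> 'u"
  where "eval_cochain U c z =
    finprod U (\<lambda>p. c p [^]\<^bsub>U\<^esub> Poly_Mapping.lookup z p) (Poly_Mapping.keys z)"

text \<open>The value \<open>eval_cochain U c z\<close> depends only on the classes of the cocycle \<open>c\<close> and the
  cycle \<open>z\<close>, so the image below is a singleton.\<close>

definition univ_coeff ::
    "('g, 'm) monoid_scheme \<Rightarrow> ('u, 'n) monoid_scheme \<Rightarrow> ('g \<times> 'g \<Rightarrow> 'u) set \<Rightarrow>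
     ('g \<times> 'g \<Rightarrow>\<^sub>0 int) set \<Rightarrow> 'u"
  where "univ_coeff G U x =
    (\<lambda>X\<in>carrier (homology2 G). the_elem ((\<lambda>(c, z). eval_cochain U c z) ` (x \<times> X)))"

text \<open>The following notions are meaningful for perfect groups \<open>G\<close>, for which the universal
  coefficients map is bijective.\<close>

definition moore_class ::
    "('g, 'm) monoid_scheme \<Rightarrow> ('g \<times> 'g \<Rightarrow> ('g \<times> 'g \<Rightarrow>\<^sub>0 int) set) set"
  where "moore_class G =
    the_inv_into (carrier (cohomology2 G (homology2 G))) (univ_coeff G (homology2 G))
      (\<lambda>X\<in>carrier (homology2 G). X)"

text \<open>The subgroup \<open>G\<^sup>[\<^sup>,\<^sup>]\<close> does not depend on the chosen representative \<open>u\<close>: a coboundary takes the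
  same value on \<open>(g, h)\<close> and \<open>(h, g)\<close> if \<open>g\<close> and \<open>h\<close> commute.\<close>

definition comm_subgroup :: "('g, 'm) monoid_scheme \<Rightarrow> ('g \<times> 'g \<Rightarrow>\<^sub>0 int) set set"
  where "comm_subgroup G =
    (let u = (SOME u. u \<in> moore_class G) in
     generate (homology2 G)
       {u (g, h) \<otimes>\<^bsub>homology2 G\<^esub> inv\<^bsub>homology2 G\<^esub> (u (h, g)) | g h.
          g \<in> carrier G \<and> h \<in> carrier G \<and> g \<otimes>\<^bsub>G\<^esub> h = h \<otimes>\<^bsub>G\<^esub> g})"

definition Eq_group :: "('g, 'm) monoid_scheme \<Rightarrow> ('g \<times> 'g \<Rightarrow>\<^sub>0 int) set set monoid"
  where "Eq_group G = homology2 G Mod comm_subgroup G"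

text \<open>A form on a vector space of dimension \<open>n\<close> is given, up to isometry, by its Gram matrix,
  that is, as a form on \<open>K\<^sup>n\<close>. The case \<open>n = 0\<close> is allowed, and so is characteristic 2.\<close>

definition bform :: "'a::field mat \<Rightarrow> 'a vec \<Rightarrow> 'a vec \<Rightarrow> 'a"
  where "bform A v w = v \<bullet> (A *\<^sub>v w)"

definition symmetric_forms :: "'a::field mat set"
  where "symmetric_forms =
    {A. square_mat A \<and>
        (\<forall>v\<in>carrier_vec (dim_row A). \<forall>w\<in>carrier_vec (dim_row A). bform A v w = bform A w v) \<and>
        (\<forall>v\<in>carrier_vec (dim_row A).
           (\<forall>w\<in>carrier_vec (dim_row A). bform A v w = 0) \<longrightarrow> v = 0\<^sub>v (dim_row A))}"

definition isometric :: "'a::field mat \<Rightarrow> 'a mat \<Rightarrow> bool"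
  where "isometric A B \<longleftrightarrow>
    dim_row A = dim_row B \<and>
    (\<exists>P\<in>carrier_mat (dim_row A) (dim_row A). invertible_mat P \<and>
       (\<forall>v\<in>carrier_vec (dim_row A). \<forall>w\<in>carrier_vec (dim_row A).
          bform B v w = bform A (P *\<^sub>v v) (P *\<^sub>v w)))"

definition orth_sum :: "'a::field mat \<Rightarrow> 'a mat \<Rightarrow> 'a mat"
  where "orth_sum A B =
    four_block_mat A (0\<^sub>m (dim_row A) (dim_col B)) (0\<^sub>m (dim_row B) (dim_col A)) B"

definition tensor_form :: "'a::field mat \<Rightarrow> 'a mat \<Rightarrow> 'a mat"
  where "tensor_form A B =
    mat (dim_row A * dim_row B) (dim_col A * dim_col B)
      (\<lambda>(i, j). A $$ (i div dim_row B, j div dim_col B) * B $$ (i mod dim_row B, j mod dim_col B))"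

text \<open>A form is metabolic if it has a subspace \<open>N\<close> equal to its own orthogonal complement. Any
  orthogonal complement is a subspace, so this need not be required separately. In characteristic
  different from 2 the metabolic forms are the hyperbolic ones; in characteristic 2 the Witt ring
  is obtained by dividing out the metabolic forms.\<close>

definition metabolic :: "'a::field mat \<Rightarrow> bool"
  where "metabolic A \<longleftrightarrow>
    A \<in> symmetric_forms \<and>
    (\<exists>N. N = {v \<in> carrier_vec (dim_row A). \<forall>w\<in>N. bform A v w = 0} \<and> N \<subseteq> carrier_vec (dim_row A))"

definition witt_equiv :: "('a::field mat \<times> 'a mat) set"
  where "witt_equiv =
    {(A, B). A \<in> symmetric_forms \<and> B \<in> symmetric_forms \<and>
       (\<exists>M N. metabolic M \<and> metabolic N \<and> isometric (orth_sum A M) (orth_sum B N))}"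

definition witt_class_of_form :: "'a::field mat \<Rightarrow> 'a mat set"
  where "witt_class_of_form A = witt_equiv `` {A}"

definition witt_rank1 :: "'a::field \<Rightarrow> 'a mat set"
  where "witt_rank1 a =
    (if a = 0 then witt_class_of_form (0\<^sub>m 0 0) else witt_class_of_form (mat 1 1 (\<lambda>_. a)))"

definition witt_ring :: "'a::field mat set ring"
  where "witt_ring =
    \<lparr>carrier = symmetric_forms // witt_equiv,
     monoid.mult = (\<lambda>X Y. \<Union>A\<in>X. \<Union>B\<in>Y. witt_class_of_form (tensor_form A B)),
     one = witt_rank1 1,
     zero = witt_class_of_form (0\<^sub>m 0 0),
     add = (\<lambda>X Y. \<Union>A\<in>X. \<Union>B\<in>Y. witt_class_of_form (orth_sum A B))\<rparr>"

definition fundamental_ideal :: "'a::field mat set set"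
  where "fundamental_ideal = {witt_class_of_form A | A. A \<in> symmetric_forms \<and> even (dim_row A)}"

definition I2_group :: "'a::field mat set monoid"
  where "I2_group =
    (add_monoid witt_ring)\<lparr>carrier := ideal_prod witt_ring fundamental_ideal fundamental_ideal\<rparr>"

text \<open>Matrix entries are indexed from 0, so \<open>m $$ (1, 0)\<close> is the entry \<open>m\<^sub>2\<^sub>1\<close>.\<close>

definition SL2 :: "'a::field mat monoid"
  where "SL2 = \<lparr>carrier = {A \<in> carrier_mat 2 2. det A = 1}, monoid.mult = (*), one = 1\<^sub>m 2\<rparr>"

definition witt_cocycle :: "'a::field mat \<times> 'a mat \<Rightarrow> 'a mat set"
  where "witt_cocycle =
    (\<lambda>(a, b)\<in>carrier SL2 \<times> carrier SL2. witt_rank1 (- (a $$ (1, 0)) * (a * b) $$ (1, 0) * b $$ (1, 0)))"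

definition witt_class :: "('a::field mat \<times> 'a mat \<Rightarrow> 'a mat set) set"
  where "witt_class = cohomology_class SL2 (add_monoid witt_ring) witt_cocycle"

text \<open>The identity function below is the inclusion of \<open>I\<^sup>2(K)\<close> in \<open>W(K)\<close>. The unique preimage has
  the representative \<open>w(g, h) + n(g) - n(gh) + n(h)\<close>, where \<open>n(g) = [g\<^sub>2\<^sub>1]\<close> if \<open>g\<^sub>2\<^sub>1 \<noteq> 0\<close> and
  \<open>n(g) = [1] - [g\<^sub>1\<^sub>1]\<close> otherwise.\<close>

definition reduced_witt_class :: "('a::field mat \<times> 'a mat \<Rightarrow> 'a mat set) set"
  where "reduced_witt_class =
    the_inv_into (carrier (cohomology2 SL2 I2_group))
      (induced_map SL2 (add_monoid witt_ring) (\<lambda>x. x)) witt_class"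

end

(* An equicommutative cocycle c with values in A is the same as a central extension of SL(2,K) by A in
   which elements with commuting images commute. In such an extension the unipotent subgroups lift
   canonically, because the commutator of lifts of a diagonal and a unipotent matrix does not depend on
   the lifts. Steinberg's relations, with commuting lifts of the torus, then produce lifts
   of the diagonal matrices whose cocycle is a symbol satisfying the relations of Pfister forms. As these
   relations present I^2(K), which follows from the chain equivalence of diagonal forms, the
   symbol extends to a homomorphism f on I^2(K), and in Bruhat normal form the multiplication of the
   lifts is exactly f applied to the reduced Witt cocycle; hence f pushes the Witt class to
   the class of c. Uniqueness of f amounts to solving for a cochain on unipotent and antidiagonal
   matrices. For the isomorphism, evaluation of the reduced Witt class gives a map from H_2 to I^2(K):
   its kernel is the subgroup generated by commuting pairs, by the existence part, and it is onto, by the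
   uniqueness part. *)
theory Submission
  imports Defs
begin

section \<open>Symmetric forms and Lagrangians\<close>

text \<open>In characteristic 2 Witt cancellation fails and a nonzero alternating form has no
  orthogonal basis. Witt classes are therefore compared through the difference
  \<open>orth_sum A (- B)\<close>, metabolic summands are removed by symplectic reduction, and a
  form is diagonalised only after \<open>diag_form [1, -1]\<close> has been added to it. The
  presentation of I^2(K) meets the same obstacle, since summands of diagonal forms cannot be
  cancelled up to isometry. Only forms of class zero are analysed, by splitting off planes <u, -u>
  one at a time; what is carried along is \<open>fold_sym\<close>, an analogue of the Hasse
  invariant with values in A. Symbols are not bilinear, because Pfister classes are bilinear only
  modulo I^3(K); they are 2-cocycles on the nonzero scalars, which is what a lift of the torus
  provides. An infinite K supplies a scalar e other than 0, 1 and -1: conjugation by diag(e, 1/e)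
  multiplies unipotent parameters by e^2, and e^2 - 1 \<noteq> 0 makes every unipotent matrix a
  commutator.\<close>

definition has_lagrangian :: "'v set \<Rightarrow> ('v \<Rightarrow> 'v \<Rightarrow> 'a::zero) \<Rightarrow> bool"
  where "has_lagrangian S b \<longleftrightarrow> (\<exists>N. N = {v \<in> S. \<forall>w\<in>N. b v w = 0} \<and> N \<subseteq> S)"

definition sum_form :: "('v \<Rightarrow> 'v \<Rightarrow> 'a::plus) \<Rightarrow> ('w \<Rightarrow> 'w \<Rightarrow> 'a) \<Rightarrow> 'v \<times> 'w \<Rightarrow> 'v \<times> 'w \<Rightarrow> 'a"
  where "sum_form b c = (\<lambda>x y. b (fst x) (fst y) + c (snd x) (snd y))"

lemma sum_form_simp [simp]: "sum_form b c (v, w) (v', w') = b v v' + c w w'"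
  by (simp add: sum_form_def)

lemma metabolic_iff:
  "metabolic A \<longleftrightarrow> A \<in> symmetric_forms \<and> has_lagrangian (carrier_vec (dim_row A)) (bform A)"
  by (simp add: metabolic_def has_lagrangian_def)

text \<open>Being equal to its own orthogonal complement depends only on the values of the form, so
  the bijection need not be linear and the Lagrangian is simply pulled back along it.\<close>

lemma has_lagrangian_transport:
  assumes bij: "bij_betw \<phi> S T"
    and eq: "\<And>v w. v \<in> S \<Longrightarrow> w \<in> S \<Longrightarrow> b v w = c (\<phi> v) (\<phi> w)"
    and T: "has_lagrangian T c"
  shows "has_lagrangian S b"
proof -
  obtain N where N: "N = {v \<in> T. \<forall>w\<in>N. c v w = 0}" "N \<subseteq> T"
    using T unfolding has_lagrangian_def by blast
  define N' where "N' = {v \<in> S. \<phi> v \<in> N}"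
  have im: "\<And>v. v \<in> S \<Longrightarrow> \<phi> v \<in> T" using bij by (auto simp: bij_betw_def)
  have surj: "\<And>w. w \<in> T \<Longrightarrow> \<exists>v\<in>S. w = \<phi> v" using bij by (auto simp: bij_betw_def)
  have "N' = {v \<in> S. \<forall>w\<in>N'. b v w = 0}"
  proof (intro equalityI subsetI)
    fix v assume "v \<in> N'"
    then show "v \<in> {v \<in> S. \<forall>w\<in>N'. b v w = 0}"
      unfolding N'_def using N(1) eq by auto
  next
    fix v assume v: "v \<in> {v \<in> S. \<forall>w\<in>N'. b v w = 0}"
    have "\<forall>w\<in>N. c (\<phi> v) w = 0"
    proof
      fix w assume w: "w \<in> N"
      then obtain u where "u \<in> S" "w = \<phi> u" using N(2) surj by blast
      then show "c (\<phi> v) w = 0" using v w eq[of v u] by (auto simp: N'_def)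
    qed
    then show "v \<in> N'" unfolding N'_def using N(1) im v by auto
  qed
  moreover have "N' \<subseteq> S" by (auto simp: N'_def)
  ultimately show ?thesis unfolding has_lagrangian_def by blast
qed

text \<open>The product of two Lagrangians is one for the sum. The elements \<open>s0\<close> and
  \<open>t0\<close> stand for the zero vectors: they lie in the Lagrangians, and testing against
  pairs that contain one of them separates the two components.\<close>

lemma has_lagrangian_sum:
  fixes b :: "'v \<Rightarrow> 'v \<Rightarrow> 'a::comm_monoid_add"
  assumes "has_lagrangian S b" "has_lagrangian T c"
    and z: "s0 \<in> S" "t0 \<in> T" "\<And>v. v \<in> S \<Longrightarrow> b v s0 = 0 \<and> b s0 v = 0" "\<And>v. v \<in> T \<Longrightarrow> c v t0 = 0 \<and> c t0 v = 0"
  shows "has_lagrangian (S \<times> T) (sum_form b c)"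
proof -
  obtain N M where N: "N = {v \<in> S. \<forall>w\<in>N. b v w = 0}" "N \<subseteq> S" and M: "M = {v \<in> T. \<forall>w\<in>M. c v w = 0}" "M \<subseteq> T"
    using assms unfolding has_lagrangian_def by blast
  have "s0 \<in> N" "t0 \<in> M" using N M z by blast+
  have nb: "\<And>v w. v \<in> N \<Longrightarrow> w \<in> N \<Longrightarrow> b v w = 0" using N(1) by blast
  have mb: "\<And>v w. v \<in> M \<Longrightarrow> w \<in> M \<Longrightarrow> c v w = 0" using M(1) by blast
  have "N \<times> M = {v \<in> S \<times> T. \<forall>w\<in>N \<times> M. sum_form b c v w = 0}"
  proof (intro equalityI subsetI)
    fix v assume "v \<in> N \<times> M"
    then show "v \<in> {v \<in> S \<times> T. \<forall>w\<in>N \<times> M. sum_form b c v w = 0}"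
      using N(2) M(2) by (auto simp: nb mb)
  next
    fix v assume v: "v \<in> {v \<in> S \<times> T. \<forall>w\<in>N \<times> M. sum_form b c v w = 0}"
    obtain s t where st: "v = (s, t)" "s \<in> S" "t \<in> T" using v by auto
    have all: "b s x + c t y = 0" if "x \<in> N" "y \<in> M" for x y using v st that by auto
    have "\<forall>x\<in>N. b s x = 0" using all[OF _ \<open>t0 \<in> M\<close>] z(4) st by auto
    moreover have "\<forall>y\<in>M. c t y = 0" using all[OF \<open>s0 \<in> N\<close>] z(3) st by auto
    ultimately show "v \<in> N \<times> M" using N(1) M(1) st by blast
  qed
  moreover have "N \<times> M \<subseteq> S \<times> T" using N M by blast
  ultimately show ?thesis unfolding has_lagrangian_def by blast
qed

section \<open>Nondegenerate symmetric forms on K^n and their orthogonal sums\<close>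

definition forms :: "nat \<Rightarrow> 'a::field mat set"
  where "forms n = {A \<in> carrier_mat n n. A \<in> symmetric_forms}"

lemma bform_add_left:
  "A \<in> carrier_mat n n \<Longrightarrow> u \<in> carrier_vec n \<Longrightarrow> v \<in> carrier_vec n \<Longrightarrow> w \<in> carrier_vec n \<Longrightarrow>
    bform A (u + v) w = bform A u w + bform A v w"
  unfolding bform_def by (rule add_scalar_prod_distrib) auto

lemma bform_smult_left:
  "A \<in> carrier_mat n n \<Longrightarrow> v \<in> carrier_vec n \<Longrightarrow> w \<in> carrier_vec n \<Longrightarrow>
    bform A (a \<cdot>\<^sub>v v) w = a * bform A v w"
  unfolding bform_def by (rule smult_scalar_prod_distrib) auto

lemma bform_zero_left:
  "A \<in> carrier_mat n n \<Longrightarrow> w \<in> carrier_vec n \<Longrightarrow> bform A (0\<^sub>v n) w = 0"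
  unfolding bform_def by simp

lemma formsD:
  assumes "A \<in> forms n"
  shows "A \<in> carrier_mat n n" "A \<in> symmetric_forms" "dim_row A = n" "dim_col A = n"
    "\<And>v w. v \<in> carrier_vec n \<Longrightarrow> w \<in> carrier_vec n \<Longrightarrow> bform A v w = bform A w v"
    "\<And>v. v \<in> carrier_vec n \<Longrightarrow> (\<And>w. w \<in> carrier_vec n \<Longrightarrow> bform A v w = 0) \<Longrightarrow> v = 0\<^sub>v n"
  using assms unfolding forms_def symmetric_forms_def by auto

lemma symmetric_forms_iff: "A \<in> symmetric_forms \<longleftrightarrow> A \<in> forms (dim_row A)"
  unfolding forms_def symmetric_forms_def by auto

lemma formsI:
  assumes "A \<in> carrier_mat n n"
    "\<And>v w. v \<in> carrier_vec n \<Longrightarrow> w \<in> carrier_vec n \<Longrightarrow> bform A v w = bform A w v"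
    "\<And>v. v \<in> carrier_vec n \<Longrightarrow> (\<And>w. w \<in> carrier_vec n \<Longrightarrow> bform A v w = 0) \<Longrightarrow> v = 0\<^sub>v n"
  shows "A \<in> forms n"
  using assms unfolding forms_def symmetric_forms_def by auto

lemma bform_add_right:
  "A \<in> forms n \<Longrightarrow> u \<in> carrier_vec n \<Longrightarrow> v \<in> carrier_vec n \<Longrightarrow> w \<in> carrier_vec n \<Longrightarrow>
    bform A w (u + v) = bform A w u + bform A w v"
  using formsD(5)[of A n] bform_add_left[OF formsD(1)] by (metis add_carrier_vec)

lemma bform_smult_right:
  "A \<in> forms n \<Longrightarrow> v \<in> carrier_vec n \<Longrightarrow> w \<in> carrier_vec n \<Longrightarrow>
    bform A w (a \<cdot>\<^sub>v v) = a * bform A w v"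
  using formsD(5)[of A n] bform_smult_left[OF formsD(1)] by (metis smult_carrier_vec)

lemma bform_zero_right:
  "A \<in> forms n \<Longrightarrow> w \<in> carrier_vec n \<Longrightarrow> bform A w (0\<^sub>v n) = 0"
  unfolding bform_def using formsD(1)[of A n] by (metis scalar_prod_right_zero mult_mat_vec_carrier bform_def bform_zero_left formsD(5) zero_carrier_vec)

lemma bform_uminus:
  "A \<in> carrier_mat n n \<Longrightarrow> v \<in> carrier_vec n \<Longrightarrow> w \<in> carrier_vec n \<Longrightarrow> bform (- A) v w = - bform A v w"
  unfolding bform_def by simp

lemma uminus_forms: "A \<in> forms n \<Longrightarrow> - A \<in> forms n"
proof (rule formsI)
  assume A: "A \<in> forms n"
  note a = formsD[OF A] and u = bform_uminus[OF formsD(1)[OF A]]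
  show "- A \<in> carrier_mat n n" using a(1) by simp
  show "bform (- A) v w = bform (- A) w v" if "v \<in> carrier_vec n" "w \<in> carrier_vec n" for v w
    using a(5)[OF that] u that by simp
  show "v = 0\<^sub>v n" if v: "v \<in> carrier_vec n" and 0: "\<And>w. w \<in> carrier_vec n \<Longrightarrow> bform (- A) v w = 0" for v
    by (rule a(6)[OF v]) (use 0 u[OF v] in auto)
qed

lemma bform_orth_sum:
  assumes "A \<in> carrier_mat n n" "B \<in> carrier_mat m m"
    "v \<in> carrier_vec n" "w \<in> carrier_vec m" "v' \<in> carrier_vec n" "w' \<in> carrier_vec m"
  shows "bform (orth_sum A B) (v @\<^sub>v w) (v' @\<^sub>v w') = bform A v v' + bform B w w'"
proof -
  have "orth_sum A B *\<^sub>v (v' @\<^sub>v w') = (A *\<^sub>v v') @\<^sub>v (B *\<^sub>v w')"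
    unfolding orth_sum_def using assms
    by (subst four_block_mat_mult_vec[of _ n n _ m _ m]) auto
  then show ?thesis unfolding bform_def
    using assms scalar_prod_append[of v n w m "A *\<^sub>v v'" "B *\<^sub>v w'"] by auto
qed

lemma orth_sum_carrier: "A \<in> carrier_mat n n \<Longrightarrow> B \<in> carrier_mat m m \<Longrightarrow> orth_sum A B \<in> carrier_mat (n + m) (n + m)"
  unfolding orth_sum_def by auto

lemma append_vec_bij: "bij_betw (\<lambda>(v, w). v @\<^sub>v w) (carrier_vec n \<times> carrier_vec m) (carrier_vec (n + m))"
proof (rule bij_betw_byWitness[where f' = "\<lambda>v. (vec_first v n, vec_last v m)"])
  show "\<forall>a\<in>carrier_vec n \<times> carrier_vec m. (case case a of (v, w) \<Rightarrow> v @\<^sub>v w of v \<Rightarrow> (vec_first v n, vec_last v m)) = a"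
    by (auto simp: vec_first_def vec_last_def)
  show "\<forall>a'\<in>carrier_vec (n + m). (case (vec_first a' n, vec_last a' m) of (v, w) \<Rightarrow> v @\<^sub>v w) = a'"
    by (auto simp: vec_first_def vec_last_def intro!: eq_vecI)
qed auto

lemma append_vec_cases:
  assumes "v \<in> carrier_vec (n + m)"
  obtains x y where "x \<in> carrier_vec n" "y \<in> carrier_vec m" "v = x @\<^sub>v y"
  by (rule that[of "vec_first v n" "vec_last v m"]) (use assms in \<open>auto simp: vec_first_def vec_last_def intro!: eq_vecI\<close>)

lemma zero_append_vec: "0\<^sub>v n @\<^sub>v 0\<^sub>v m = 0\<^sub>v (n + m)"
  by auto

lemma orth_sum_forms:
  assumes A: "A \<in> forms n" and B: "B \<in> forms m"
  shows "orth_sum A B \<in> forms (n + m)"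
proof (rule formsI)
  note a = formsD[OF A] and b = formsD[OF B]
  show "orth_sum A B \<in> carrier_mat (n + m) (n + m)" using a b by (intro orth_sum_carrier)
  show "bform (orth_sum A B) v w = bform (orth_sum A B) w v"
    if v: "v \<in> carrier_vec (n + m)" and w: "w \<in> carrier_vec (n + m)" for v w
    by (rule append_vec_cases[OF v], rule append_vec_cases[OF w]) (simp add: bform_orth_sum[OF a(1) b(1)] a b)
  show "v = 0\<^sub>v (n + m)" if v: "v \<in> carrier_vec (n + m)"
    and 0: "\<And>w. w \<in> carrier_vec (n + m) \<Longrightarrow> bform (orth_sum A B) v w = 0" for v
  proof -
    obtain x y where xy: "x \<in> carrier_vec n" "y \<in> carrier_vec m" "v = x @\<^sub>v y"
      using append_vec_cases[OF v] .
    have "bform A x w = 0" if "w \<in> carrier_vec n" for w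
      using 0[of "w @\<^sub>v 0\<^sub>v m"] that xy bform_zero_right[OF B] by (simp add: bform_orth_sum[OF a(1) b(1)])
    moreover have "bform B y w = 0" if "w \<in> carrier_vec m" for w
      using 0[of "0\<^sub>v n @\<^sub>v w"] that xy bform_zero_right[OF A] by (simp add: bform_orth_sum[OF a(1) b(1)])
    ultimately show ?thesis using a(6)[OF xy(1)] b(6)[OF xy(2)] xy(3) zero_append_vec by auto
  qed
qed

text \<open>A vector outside a subspace is separated from it by a linear functional. The subspace is
  given by its closure properties alone, and the induction on \<open>n\<close> splits off the first
  coordinate instead of choosing a basis.\<close>

lemma vec_separation:
  fixes S :: "'a::field vec set"
  assumes "S \<subseteq> carrier_vec n" "0\<^sub>v n \<in> S"
    and "\<And>v w. v \<in> S \<Longrightarrow> w \<in> S \<Longrightarrow> v + w \<in> S" "\<And>a v. v \<in> S \<Longrightarrow> a \<cdot>\<^sub>v v \<in> S"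
    and "x \<in> carrier_vec n" "x \<notin> S"
  obtains u where "u \<in> carrier_vec n" "\<And>s. s \<in> S \<Longrightarrow> u \<bullet> s = 0" "u \<bullet> x \<noteq> 0"
proof -
  have "\<exists>u\<in>carrier_vec n. (\<forall>s\<in>S. u \<bullet> s = 0) \<and> u \<bullet> x \<noteq> 0"
    using assms
  proof (induction n arbitrary: S x)
    case 0
    then show ?case by (metis carrier_vecD vec_of_dim_0)
  next
    case (Suc n)
    have dec: "\<exists>a. \<exists>w\<in>carrier_vec n. v = vCons a w" if "v \<in> carrier_vec (Suc n)" for v :: "'a vec"
      using that by (cases v) auto
    obtain b y where x: "x = vCons b y" "y \<in> carrier_vec n" using dec Suc.prems(5) by blast
    have plus: "vCons a v + vCons c w = vCons (a + c) (v + w)"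
      if "v \<in> carrier_vec n" "w \<in> carrier_vec n" for a c :: 'a and v w
      by (rule eq_vecI) (use that in \<open>auto simp: vec_index_vCons\<close>)
    have smult: "a \<cdot>\<^sub>v vCons c w = vCons (a * c) (a \<cdot>\<^sub>v w)" for a c :: 'a and w
      by (rule eq_vecI) (auto simp: vec_index_vCons)
    define S0 where "S0 = {v \<in> carrier_vec n. vCons 0 v \<in> S}"
    have S0: "S0 \<subseteq> carrier_vec n" "0\<^sub>v n \<in> S0" "\<And>v w. v \<in> S0 \<Longrightarrow> w \<in> S0 \<Longrightarrow> v + w \<in> S0"
      "\<And>a v. v \<in> S0 \<Longrightarrow> a \<cdot>\<^sub>v v \<in> S0"
      using Suc.prems(2) Suc.prems(4)[of "vCons 0 _"] Suc.prems(3)[of "vCons 0 _" "vCons 0 _", unfolded plus]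
      by (auto simp: S0_def zero_vec_Suc smult) (metis Suc.prems(3) plus add_0)
    show ?case
    proof (cases "\<exists>s\<in>S. s $ 0 \<noteq> 0")
      case True
      then obtain s where s: "s \<in> S" "s $ 0 \<noteq> 0" by blast
      obtain c w where cw: "s = vCons c w" "w \<in> carrier_vec n" using dec s Suc.prems(1) by blast
      \<comment> \<open>A vector of \<open>S\<close> is rescaled to first coordinate 1. Subtracting
        multiples of it clears the first coordinate without leaving \<open>S\<close>, which reduces
        membership in \<open>S\<close> to membership in the slice \<open>S0\<close>.\<close>
      define t where "t = (1 / c) \<cdot>\<^sub>v w"
      have c: "c \<noteq> 0" using s cw by simp
      have t: "t \<in> carrier_vec n" "vCons 1 t \<in> S"
        using cw Suc.prems(4)[OF s(1), of "1 / c"] c by (auto simp: t_def smult)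
      have red: "v + (- a) \<cdot>\<^sub>v t \<in> S0 \<longleftrightarrow> vCons a v \<in> S" if v: "v \<in> carrier_vec n" for a v
      proof
        assume "vCons a v \<in> S"
        from Suc.prems(3)[OF this Suc.prems(4)[OF t(2), of "- a"]]
        show "v + (- a) \<cdot>\<^sub>v t \<in> S0" using v t(1) by (simp add: S0_def smult plus)
      next
        assume "v + (- a) \<cdot>\<^sub>v t \<in> S0"
        then have "vCons 0 (v + (- a) \<cdot>\<^sub>v t) + a \<cdot>\<^sub>v vCons 1 t \<in> S"
          using Suc.prems(3,4) t by (auto simp: S0_def)
        moreover have "vCons 0 (v + (- a) \<cdot>\<^sub>v t) + a \<cdot>\<^sub>v vCons 1 t = vCons a v"
          by (rule eq_vecI) (use v t in \<open>auto simp: vec_index_vCons\<close>)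
        ultimately show "vCons a v \<in> S" by simp
      qed
      have "y + (- b) \<cdot>\<^sub>v t \<notin> S0" using red[OF x(2)] Suc.prems(6) x(1) by simp
      then obtain u where u: "u \<in> carrier_vec n" "\<And>s. s \<in> S0 \<Longrightarrow> u \<bullet> s = 0" "u \<bullet> (y + (- b) \<cdot>\<^sub>v t) \<noteq> 0"
        using Suc.IH[OF S0, of "y + (- b) \<cdot>\<^sub>v t"] x(2) t(1) by auto
      \<comment> \<open>The functional \<open>u\<close> applied after clearing the first coordinate;
        its own first coordinate is therefore - u . t.\<close>
      define u' where "u' = vCons (- (u \<bullet> t)) u"
      have u': "u' \<bullet> vCons a v = u \<bullet> (v + (- a) \<cdot>\<^sub>v t)" if "v \<in> carrier_vec n" for a v
        using that u(1) t(1) by (simp add: u'_def scalar_prod_add_distrib[of _ n])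
      have "u' \<bullet> v = 0" if v: "v \<in> S" for v
      proof -
        obtain a v' where "v = vCons a v'" "v' \<in> carrier_vec n" using dec v Suc.prems(1) by blast
        then show ?thesis using u' u(2) red v by auto
      qed
      moreover have "u' \<in> carrier_vec (Suc n)" using u(1) by (simp add: u'_def)
      moreover have "u' \<bullet> x \<noteq> 0" using u'[OF x(2)] x(1) u(3) by simp
      ultimately show ?thesis by blast
    next
      case False
      have zero: "v $ 0 = 0" if "v \<in> S" for v using that False by blast
      have inS0: "v' \<in> S0" if "vCons a v' \<in> S" "v' \<in> carrier_vec n" for a v'
        using zero[OF that(1)] that by (simp add: S0_def)
      show ?thesis
      proof (cases "b = 0")
        case True
        then have "y \<notin> S0" using x Suc.prems(6) by (auto simp: S0_def)
        then obtain u where u: "u \<in> carrier_vec n" "\<And>s. s \<in> S0 \<Longrightarrow> u \<bullet> s = 0" "u \<bullet> y \<noteq> 0"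
          using Suc.IH[OF S0 x(2)] by auto
        have "vCons 0 u \<bullet> v = 0" if v: "v \<in> S" for v
        proof -
          obtain a v' where "v = vCons a v'" "v' \<in> carrier_vec n" using dec v Suc.prems(1) by blast
          then show ?thesis using u(2) inS0 v by auto
        qed
        moreover have "vCons 0 u \<bullet> x \<noteq> 0" using u(3) x True by simp
        ultimately show ?thesis using u(1) by (intro bexI[of _ "vCons 0 u"]) auto
      next
        \<comment> \<open>All of \<open>S\<close> has first coordinate 0 but \<open>x\<close> has
          not, so the first coordinate itself is a separating functional.\<close>
        case False
        have "vCons 1 (0\<^sub>v n) \<bullet> v = 0" if v: "v \<in> S" for v
        proof -
          obtain a v' where "v = vCons a v'" "v' \<in> carrier_vec n" using dec v Suc.prems(1) by blast
          then show ?thesis using zero[OF v] by auto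
        qed
        then show ?thesis using x False by (intro bexI[of _ "vCons 1 (0\<^sub>v n)"]) auto
      qed
    qed
  qed
  then show ?thesis using that by blast
qed

text \<open>A kernel vector of the Gram matrix would be orthogonal to everything, so the matrix is
  invertible. Consequently every linear functional is of the form \<open>bform A y\<close>.\<close>

lemma forms_surj:
  assumes A: "A \<in> forms n" and u: "u \<in> carrier_vec n"
  obtains y where "y \<in> carrier_vec n" "A *\<^sub>v y = u"
proof -
  note a = formsD[OF A]
  have "det A \<noteq> 0"
  proof
    assume "det A = 0"
    then obtain v where v: "v \<in> carrier_vec n" "v \<noteq> 0\<^sub>v n" "A *\<^sub>v v = 0\<^sub>v n"
      using det_0_iff_vec_prod_zero_field[OF a(1)] by blast
    have "bform A v w = 0" if "w \<in> carrier_vec n" for w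
      using a(5)[OF v(1) that] that v by (simp add: bform_def)
    then show False using a(6) v by blast
  qed
  then obtain B where B: "B \<in> carrier_mat n n" "A * B = 1\<^sub>m n"
    using det_non_zero_imp_unit[OF a(1), of "()"] a(1) unfolding Units_def ring_mat_def by auto
  have "A *\<^sub>v (B *\<^sub>v u) = u" using assoc_mult_mat_vec[OF a(1) B(1) u] B u by simp
  then show ?thesis using that[of "B *\<^sub>v u"] B u by simp
qed

text \<open>Symplectic reduction: a Lagrangian of \<open>A \<oplus> M\<close> is intersected with \<open>L\<^sup>\<bottom>\<close> for a Lagrangian \<open>L\<close> of
  \<open>M\<close> and projected to \<open>A\<close>.\<close>

lemma has_lagrangian_cancel:
  assumes A: "A \<in> forms n" and M: "M \<in> forms m"
    and AM: "has_lagrangian (carrier_vec (n + m)) (bform (orth_sum A M))"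
    and lM: "has_lagrangian (carrier_vec m) (bform M)"
  shows "has_lagrangian (carrier_vec n) (bform A)"
proof -
  define Q where "Q = orth_sum A M"
  have Q: "Q \<in> forms (n + m)" unfolding Q_def by (rule orth_sum_forms[OF A M])
  note a = formsD[OF A] and b = formsD[OF M] and q = formsD[OF Q]
  note bil = bform_add_left[OF q(1)] bform_smult_left[OF q(1)] bform_zero_left[OF q(1)]
  note bilM = bform_add_left[OF b(1)] bform_smult_left[OF b(1)] bform_zero_left[OF b(1)]
  have Qsum: "bform Q (v @\<^sub>v w) (v' @\<^sub>v w') = bform A v v' + bform M w w'"
    if "v \<in> carrier_vec n" "w \<in> carrier_vec m" "v' \<in> carrier_vec n" "w' \<in> carrier_vec m" for v w v' w'
    unfolding Q_def using bform_orth_sum[OF a(1) b(1) that] .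
  obtain N where N: "N = {v \<in> carrier_vec (n + m). \<forall>w\<in>N. bform Q v w = 0}" "N \<subseteq> carrier_vec (n + m)"
    using AM unfolding has_lagrangian_def Q_def by blast
  obtain L where L: "L = {v \<in> carrier_vec m. \<forall>w\<in>L. bform M v w = 0}" "L \<subseteq> carrier_vec m"
    using lM unfolding has_lagrangian_def by blast
  have memN: "v \<in> N \<longleftrightarrow> v \<in> carrier_vec (n + m) \<and> (\<forall>w\<in>N. bform Q v w = 0)" for v using N(1) by blast
  have memL: "v \<in> L \<longleftrightarrow> v \<in> carrier_vec m \<and> (\<forall>w\<in>L. bform M v w = 0)" for v using L(1) by blast
  have NN: "bform Q v w = 0" if "v \<in> N" "w \<in> N" for v w using memN[of v] that by blast
  have LL: "bform M v w = 0" if "v \<in> L" "w \<in> L" for v w using memL[of v] that by blast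
  have subN: "0\<^sub>v (n + m) \<in> N" "\<And>v w. v \<in> N \<Longrightarrow> w \<in> N \<Longrightarrow> v + w \<in> N" "\<And>c v. v \<in> N \<Longrightarrow> c \<cdot>\<^sub>v v \<in> N"
  proof -
    show "0\<^sub>v (n + m) \<in> N" using N(2) bil(3) by (subst memN) auto
    fix v w c assume v: "v \<in> N"
    have vc: "u \<in> carrier_vec (n + m)" if "u \<in> N" for u using N(2) that by blast
    show "c \<cdot>\<^sub>v v \<in> N" using v vc by (subst memN) (auto simp: bil(2) NN)
    show "v + w \<in> N" if "w \<in> N" using v vc that by (subst memN) (auto simp: bil(1) NN)
  qed
  have subL: "0\<^sub>v m \<in> L" "\<And>v w. v \<in> L \<Longrightarrow> w \<in> L \<Longrightarrow> v + w \<in> L" "\<And>c v. v \<in> L \<Longrightarrow> c \<cdot>\<^sub>v v \<in> L"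
  proof -
    show "0\<^sub>v m \<in> L" using L(2) bilM(3) by (subst memL) auto
    fix v w c assume v: "v \<in> L"
    have vc: "u \<in> carrier_vec m" if "u \<in> L" for u using L(2) that by blast
    show "c \<cdot>\<^sub>v v \<in> L" using v vc by (subst memL) (auto simp: bilM(2) LL)
    show "v + w \<in> L" if "w \<in> L" using v vc that by (subst memL) (auto simp: bilM(1) LL)
  qed
  define N' where "N' = {x \<in> carrier_vec n. \<exists>l\<in>L. x @\<^sub>v l \<in> N}"
  have N'c: "N' \<subseteq> carrier_vec n" by (auto simp: N'_def)
  have "N' = {x \<in> carrier_vec n. \<forall>w\<in>N'. bform A x w = 0}"
  proof (intro equalityI subsetI)
    fix x assume x: "x \<in> N'"
    have "bform A x w = 0" if w: "w \<in> N'" for w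
    proof -
      obtain l l' where l: "l \<in> L" "x @\<^sub>v l \<in> N" "l' \<in> L" "w @\<^sub>v l' \<in> N" using x w by (auto simp: N'_def)
      have "bform Q (x @\<^sub>v l) (w @\<^sub>v l') = 0" "bform M l l' = 0"
        using l NN LL by blast+
      then show ?thesis using Qsum[of x l w l'] x w l N'c L(2) by auto
    qed
    then show "x \<in> {x \<in> carrier_vec n. \<forall>w\<in>N'. bform A x w = 0}" using x N'c by blast
  next
    fix x assume "x \<in> {x \<in> carrier_vec n. \<forall>w\<in>N'. bform A x w = 0}"
    then have x: "x \<in> carrier_vec n" "\<And>w. w \<in> N' \<Longrightarrow> bform A x w = 0" by auto
    \<comment> \<open>\<open>S\<close> is N + (0 + L). Its orthogonal complement consists of the
      vectors of N with second component in L, whose first components form \<open>N'\<close>. If (x,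
      0) were outside \<open>S\<close>, a separating functional would be represented by some y in
      that complement; but \<open>x\<close> is orthogonal to the first component of y, and (0,
      L)-components pair trivially with (x, 0). So (x, 0) = v + (0, l), and v = (x, -l) shows that
      \<open>x\<close> is in \<open>N'\<close>.\<close>
    define S where "S = {u + (0\<^sub>v n @\<^sub>v l) | u l. u \<in> N \<and> l \<in> L}"
    have Nc: "v \<in> carrier_vec (n + m)" if "v \<in> N" for v using that N(2) by blast
    have Lc: "v \<in> carrier_vec m" if "v \<in> L" for v using that L(2) by blast
    have zl: "0\<^sub>v n @\<^sub>v l \<in> carrier_vec (n + m)" if "l \<in> L" for l using Lc[OF that] by simp
    have "x @\<^sub>v 0\<^sub>v m \<in> S"
    proof (rule ccontr)
      assume xS: "x @\<^sub>v 0\<^sub>v m \<notin> S"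
      have NS: "u \<in> S" if "u \<in> N" for u
      proof -
        have "u = u + (0\<^sub>v n @\<^sub>v 0\<^sub>v m)" using Nc[OF that] by (simp add: zero_append_vec)
        then show ?thesis using that subL(1) unfolding S_def by blast
      qed
      have LS: "0\<^sub>v n @\<^sub>v l \<in> S" if "l \<in> L" for l
      proof -
        have "0\<^sub>v n @\<^sub>v l = 0\<^sub>v (n + m) + (0\<^sub>v n @\<^sub>v l)" using zl[OF that] by simp
        then show ?thesis using that subN(1) unfolding S_def by blast
      qed
      have 1: "S \<subseteq> carrier_vec (n + m)" using Nc zl by (auto simp: S_def)
      have 2: "0\<^sub>v (n + m) \<in> S" using NS subN(1) by blast
      have 3: "v + w \<in> S" if vw: "v \<in> S" "w \<in> S" for v w
      proof -
        obtain u l u' l' where e: "v = u + (0\<^sub>v n @\<^sub>v l)" "w = u' + (0\<^sub>v n @\<^sub>v l')" "u \<in> N" "l \<in> L" "u' \<in> N" "l' \<in> L"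
          using vw unfolding S_def by blast
        have "v + w = (u + u') + (0\<^sub>v n @\<^sub>v (l + l'))"
          unfolding e by (rule eq_vecI) (use Nc[OF e(3)] Nc[OF e(5)] Lc[OF e(4)] Lc[OF e(6)] in auto)
        then show ?thesis using subN(2)[OF e(3,5)] subL(2)[OF e(4,6)] unfolding S_def by blast
      qed
      have 4: "c \<cdot>\<^sub>v v \<in> S" if v: "v \<in> S" for c v
      proof -
        obtain u l where e: "v = u + (0\<^sub>v n @\<^sub>v l)" "u \<in> N" "l \<in> L" using v unfolding S_def by blast
        have "c \<cdot>\<^sub>v v = c \<cdot>\<^sub>v u + (0\<^sub>v n @\<^sub>v (c \<cdot>\<^sub>v l))"
          unfolding e by (rule eq_vecI) (use Nc[OF e(2)] Lc[OF e(3)] in \<open>auto simp: distrib_left\<close>)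
        then show ?thesis using subN(3)[OF e(2)] subL(3)[OF e(3)] unfolding S_def by blast
      qed
      have x0: "x @\<^sub>v 0\<^sub>v m \<in> carrier_vec (n + m)" using x by simp
      obtain u where u: "u \<in> carrier_vec (n + m)" "\<And>s. s \<in> S \<Longrightarrow> u \<bullet> s = 0" "u \<bullet> (x @\<^sub>v 0\<^sub>v m) \<noteq> 0"
        using vec_separation[OF 1 2 3 4 x0 xS] by blast
      obtain y where y: "y \<in> carrier_vec (n + m)" "Q *\<^sub>v y = u" using forms_surj[OF Q u(1)] .
      have uy: "u \<bullet> s = bform Q y s" if "s \<in> carrier_vec (n + m)" for s
        using comm_scalar_prod[OF u(1) that] q(5)[OF that y(1)] y(2) by (simp add: bform_def)
      obtain y1 y2 where y12: "y1 \<in> carrier_vec n" "y2 \<in> carrier_vec m" "y = y1 @\<^sub>v y2"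
        using append_vec_cases[OF y(1)] .
      have "bform Q y w = 0" if "w \<in> N" for w using u(2)[OF NS[OF that]] uy[OF Nc[OF that]] by simp
      then have yN: "y \<in> N" using y(1) memN[of y] by blast
      have "bform M y2 l = 0" if l: "l \<in> L" for l
        using u(2)[OF LS[OF l]] uy[OF zl[OF l]] Qsum[OF y12(1,2) _ Lc[OF l], of "0\<^sub>v n"] y12 bform_zero_right[OF A]
        by auto
      then have "y2 \<in> L" using memL y12 by blast
      then have "y1 \<in> N'" using yN y12 by (auto simp: N'_def)
      then have "bform A y1 x = 0" using x a(5) y12(1) by auto
      then have "u \<bullet> (x @\<^sub>v 0\<^sub>v m) = 0"
        using uy[OF x0] Qsum[OF y12(1,2) x(1), of "0\<^sub>v m"] y12 bform_zero_right[OF M] by auto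
      then show False using u(3) by blast
    qed
    then obtain v l where vl: "x @\<^sub>v 0\<^sub>v m = v + (0\<^sub>v n @\<^sub>v l)" "v \<in> N" "l \<in> L" unfolding S_def by blast
    have lc: "l \<in> carrier_vec m" using vl(3) Lc by blast
    obtain v1 v2 where v12: "v1 \<in> carrier_vec n" "v2 \<in> carrier_vec m" "v = v1 @\<^sub>v v2"
      using append_vec_cases[OF Nc[OF vl(2)]] .
    have "x @\<^sub>v 0\<^sub>v m = v1 @\<^sub>v (v2 + l)"
      using vl(1) v12 lc append_vec_add[OF v12(1) zero_carrier_vec v12(2) lc] by simp
    then have eq: "x = v1" "v2 + l = 0\<^sub>v m" using append_vec_eq[OF x(1) v12(1)] by auto
    have "v2 = (-1) \<cdot>\<^sub>v l"
    proof (rule eq_vecI)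
      fix i assume i: "i < dim_vec ((-1) \<cdot>\<^sub>v l)"
      have "(v2 + l) $ i = 0" using eq(2) i lc by simp
      then show "v2 $ i = ((-1) \<cdot>\<^sub>v l) $ i" using i v12 lc by (simp add: eq_neg_iff_add_eq_0)
    qed (use v12 lc in auto)
    then have "v2 \<in> L" using subL(3) vl(3) by simp
    then show "x \<in> N'" using vl(2) v12 eq by (auto simp: N'_def)
  qed
  then show ?thesis using N'c unfolding has_lagrangian_def by blast
qed

section \<open>The Witt group\<close>

lemma has_lagrangian_cong:
  assumes bij: "bij_betw \<phi> S T"
    and eq: "\<And>v w. v \<in> S \<Longrightarrow> w \<in> S \<Longrightarrow> b v w = c (\<phi> v) (\<phi> w)"
  shows "has_lagrangian S b \<longleftrightarrow> has_lagrangian T c"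
proof
  assume "has_lagrangian S b"
  moreover have bij': "bij_betw (inv_into S \<phi>) T S" by (rule bij_betw_inv_into[OF bij])
  moreover have "c v w = b (inv_into S \<phi> v) (inv_into S \<phi> w)" if "v \<in> T" "w \<in> T" for v w
    using eq[of "inv_into S \<phi> v" "inv_into S \<phi> w"] that bij
    by (simp add: bij_betw_inv_into_right bij_betw_apply[OF bij_betw_inv_into[OF bij]])
  ultimately show "has_lagrangian T c" 
    using has_lagrangian_transport[of "inv_into S \<phi>" T S c b] by blast
next
  assume "has_lagrangian T c"
  then show "has_lagrangian S b"
    using has_lagrangian_transport[of \<phi> S T b c] bij eq by blast
qed

text \<open>Lets a Lagrangian of a matrix form be sought on any set carrying an equivalent form. On
  nested products of sets, permuting orthogonal summands is a rearrangement of tuples and needs no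
  permutation matrices.\<close>

definition represents :: "'v set \<Rightarrow> ('v \<Rightarrow> 'v \<Rightarrow> 'a::field) \<Rightarrow> 'a mat \<Rightarrow> bool"
  where "represents S b A \<longleftrightarrow> A \<in> symmetric_forms \<and>
    (\<exists>\<phi>. bij_betw \<phi> S (carrier_vec (dim_row A)) \<and> (\<forall>v\<in>S. \<forall>w\<in>S. b v w = bform A (\<phi> v) (\<phi> w)))"

lemma represents_self: "A \<in> forms n \<Longrightarrow> represents (carrier_vec n) (bform A) A"
  unfolding represents_def using formsD(2,3)[of A n] by (auto intro!: exI[of _ "\<lambda>x. x"] simp: bij_betw_def)

lemma represents_orth_sum:
  assumes "represents S b A" "represents T c B"
  shows "represents (S \<times> T) (sum_form b c) (orth_sum A B)"
proof -
  define n m where "n = dim_row A" and "m = dim_row B"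
  obtain \<phi> \<psi> where A: "A \<in> forms n" "bij_betw \<phi> S (carrier_vec n)" "\<And>v w. v \<in> S \<Longrightarrow> w \<in> S \<Longrightarrow> b v w = bform A (\<phi> v) (\<phi> w)"
    and B: "B \<in> forms m" "bij_betw \<psi> T (carrier_vec m)" "\<And>v w. v \<in> T \<Longrightarrow> w \<in> T \<Longrightarrow> c v w = bform B (\<psi> v) (\<psi> w)"
    using assms unfolding represents_def n_def m_def symmetric_forms_iff by metis
  have Q: "orth_sum A B \<in> forms (n + m)" by (rule orth_sum_forms[OF A(1) B(1)])
  have d: "dim_row (orth_sum A B) = n + m" using formsD(3)[OF Q] .
  let ?f = "(\<lambda>(v, w). v @\<^sub>v w) \<circ> map_prod \<phi> \<psi>"
  have bij: "bij_betw ?f (S \<times> T) (carrier_vec (n + m))"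
    by (rule bij_betw_trans[OF bij_betw_map_prod[OF A(2) B(2)] append_vec_bij])
  have eq: "sum_form b c x y = bform (orth_sum A B) (?f x) (?f y)" if "x \<in> S \<times> T" "y \<in> S \<times> T" for x y
  proof -
    obtain v w v' w' where xy: "x = (v, w)" "y = (v', w')" by (metis surj_pair)
    with that have m: "v \<in> S" "v' \<in> S" "w \<in> T" "w' \<in> T" by auto
    have c: "\<phi> v \<in> carrier_vec n" "\<phi> v' \<in> carrier_vec n" "\<psi> w \<in> carrier_vec m" "\<psi> w' \<in> carrier_vec m"
      using bij_betw_apply[OF A(2)] bij_betw_apply[OF B(2)] m by auto
    show ?thesis using A(3)[OF m(1,2)] B(3)[OF m(3,4)]
        bform_orth_sum[OF formsD(1)[OF A(1)] formsD(1)[OF B(1)] c(1) c(3) c(2) c(4)] xy by simp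
  qed
  show ?thesis unfolding represents_def d
    by (rule conjI[OF formsD(2)[OF Q]], rule exI[of _ ?f]) (use bij eq in blast)
qed

lemma represents_uminus:
  assumes "represents S b A" shows "represents S (\<lambda>v w. - b v w) (- A)"
proof -
  define n where "n = dim_row A"
  obtain \<phi> where A: "A \<in> forms n" "bij_betw \<phi> S (carrier_vec n)" "\<And>v w. v \<in> S \<Longrightarrow> w \<in> S \<Longrightarrow> b v w = bform A (\<phi> v) (\<phi> w)"
    using assms unfolding represents_def n_def symmetric_forms_iff by metis
  have d: "dim_row (- A) = n" using formsD(3)[OF A(1)] by simp
  show ?thesis unfolding represents_def d
    by (rule conjI[OF formsD(2)[OF uminus_forms[OF A(1)]]], rule exI[of _ \<phi>])
      (use A bform_uminus[OF formsD(1)[OF A(1)] bij_betw_apply[OF A(2)] bij_betw_apply[OF A(2)]] in auto)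
qed

lemma metabolic_represents:
  assumes "represents S b A" shows "metabolic A \<longleftrightarrow> has_lagrangian S b"
  using assms has_lagrangian_cong[of _ S _ b "bform A"] unfolding represents_def metabolic_iff by blast

lemma metabolic_transfer:
  assumes "represents S b A" "represents T c B" "bij_betw \<phi> S T"
    and "\<And>v w. v \<in> S \<Longrightarrow> w \<in> S \<Longrightarrow> b v w = c (\<phi> v) (\<phi> w)" and "metabolic B"
  shows "metabolic A"
proof -
  have "has_lagrangian S b \<longleftrightarrow> has_lagrangian T c" by (rule has_lagrangian_cong[of \<phi>]) (use assms(3,4) in blast)+
  then show ?thesis using assms(5) metabolic_represents[OF assms(1)] metabolic_represents[OF assms(2)] by blast
qed

lemma metabolic_forms: "metabolic A \<Longrightarrow> A \<in> forms (dim_row A)"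
  by (simp add: metabolic_iff symmetric_forms_iff)

lemma represents_symmetric: "A \<in> symmetric_forms \<Longrightarrow> represents (carrier_vec (dim_row A)) (bform A) A"
  by (simp add: represents_self symmetric_forms_iff)

lemma orth_sum_symmetric: "A \<in> symmetric_forms \<Longrightarrow> B \<in> symmetric_forms \<Longrightarrow> orth_sum A B \<in> symmetric_forms"
  by (rule formsD(2)[OF orth_sum_forms[of A "dim_row A" B "dim_row B"]]) (simp_all only: symmetric_forms_iff)

lemma uminus_symmetric: "A \<in> symmetric_forms \<Longrightarrow> - A \<in> symmetric_forms"
  by (rule formsD(2)[OF uminus_forms[of A "dim_row A"]]) (simp only: symmetric_forms_iff)

lemma uminus_orth_sum: "- orth_sum A B = orth_sum (- A) (- B)" if "A \<in> symmetric_forms" "B \<in> symmetric_forms"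
  using that unfolding orth_sum_def symmetric_forms_def by (intro eq_matI) auto

lemma metabolic_orth_sum:
  assumes "metabolic A" "metabolic B" shows "metabolic (orth_sum A B)"
proof -
  have A: "A \<in> forms (dim_row A)" and B: "B \<in> forms (dim_row B)" using assms by (auto dest: metabolic_forms)
  have "has_lagrangian (carrier_vec (dim_row A) \<times> carrier_vec (dim_row B)) (sum_form (bform A) (bform B))"
    by (rule has_lagrangian_sum[of _ _ _ _ "0\<^sub>v (dim_row A)" "0\<^sub>v (dim_row B)"])
      (use assms bform_zero_right[OF A] bform_zero_right[OF B] bform_zero_left[OF formsD(1)[OF A]]
          bform_zero_left[OF formsD(1)[OF B]] in \<open>auto simp: metabolic_iff\<close>)
  then show ?thesis
    using metabolic_represents[OF represents_orth_sum[OF represents_self[OF A] represents_self[OF B]]] by blast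
qed

lemma metabolic_cancel:
  assumes A: "A \<in> symmetric_forms" and "metabolic (orth_sum A M)" "metabolic M"
  shows "metabolic A"
proof -
  have M: "M \<in> symmetric_forms" using assms(3) by (simp add: metabolic_iff)
  note f = A[unfolded symmetric_forms_iff] M[unfolded symmetric_forms_iff]
  have "dim_row (orth_sum A M) = dim_row A + dim_row M" using formsD(3)[OF orth_sum_forms[OF f]] .
  then show ?thesis using has_lagrangian_cancel[OF f] assms by (simp add: metabolic_iff)
qed

lemma swap_middle_bij:
  "bij_betw (\<lambda>((a, b), (c, d)). ((a, c), (b, d))) ((A \<times> B) \<times> (C \<times> D)) ((A \<times> C) \<times> (B \<times> D))"
  by (rule bij_betw_byWitness[where f' = "\<lambda>((a, b), (c, d)). ((a, c), (b, d))"]) auto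

lemma metabolic_swap_middle:
  assumes "A \<in> symmetric_forms" "B \<in> symmetric_forms" "C \<in> symmetric_forms" "D \<in> symmetric_forms"
    and "metabolic (orth_sum (orth_sum A C) (orth_sum B D))"
  shows "metabolic (orth_sum (orth_sum A B) (orth_sum C D))"
  by (rule metabolic_transfer[OF
        represents_orth_sum[OF represents_orth_sum[OF assms(1,2)[THEN represents_symmetric]]
          represents_orth_sum[OF assms(3,4)[THEN represents_symmetric]]]
        represents_orth_sum[OF represents_orth_sum[OF assms(1,3)[THEN represents_symmetric]]
          represents_orth_sum[OF assms(2,4)[THEN represents_symmetric]]] swap_middle_bij _ assms(5)])
    (auto simp: algebra_simps)

lemma metabolic_swap:
  assumes "A \<in> symmetric_forms" "B \<in> symmetric_forms" "metabolic (orth_sum A B)"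
  shows "metabolic (orth_sum B A)"
proof (rule metabolic_transfer[OF represents_orth_sum[OF assms(2,1)[THEN represents_symmetric]]
      represents_orth_sum[OF assms(1,2)[THEN represents_symmetric]] _ _ assms(3)])
  show "bij_betw prod.swap (carrier_vec (dim_row B) \<times> carrier_vec (dim_row A)) (carrier_vec (dim_row A) \<times> carrier_vec (dim_row B))"
    by (rule bij_betw_byWitness[where f' = prod.swap]) auto
qed (auto simp: algebra_simps)

lemma metabolic_uminus: "metabolic (- A)" if "metabolic A"
proof -
  have A: "A \<in> symmetric_forms" using that by (simp add: metabolic_iff)
  have "has_lagrangian (carrier_vec (dim_row A)) (\<lambda>v w. - bform A v w)"
    using that by (simp add: metabolic_iff has_lagrangian_def)
  then show ?thesis using metabolic_represents[OF represents_uminus[OF represents_symmetric[OF A]]] by blast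
qed

lemma invertible_mat_inverse:
  assumes "P \<in> carrier_mat n n" "invertible_mat P"
  obtains R where "R \<in> carrier_mat n n" "P * R = 1\<^sub>m n" "R * P = 1\<^sub>m n"
proof -
  obtain R where R: "inverts_mat P R" "inverts_mat R P" using assms(2) unfolding invertible_mat_def by blast
  have "dim_row R = n" using R assms(1) unfolding inverts_mat_def
    by (metis carrier_matD(2) index_mult_mat(3) index_one_mat(3))
  moreover have "dim_col R = n" using R assms(1) unfolding inverts_mat_def
    by (metis carrier_matD(1) index_mult_mat(3) index_one_mat(3))
  ultimately show ?thesis using that[of R] R assms(1) unfolding inverts_mat_def by auto
qed

text \<open>The graph of an isometry is a Lagrangian.\<close>

lemma isometric_metabolic:
  assumes A: "A \<in> symmetric_forms" and B: "B \<in> symmetric_forms" and iso: "isometric A B"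
  shows "metabolic (orth_sum A (- B))"
proof -
  define n where "n = dim_row A"
  have fA: "A \<in> forms n" and fB: "B \<in> forms n" using A B iso by (auto simp: n_def isometric_def symmetric_forms_iff)
  note a = formsD[OF fA] and b = formsD[OF fB]
  obtain P where P: "P \<in> carrier_mat n n" "invertible_mat P"
    and Peq: "\<And>v w. v \<in> carrier_vec n \<Longrightarrow> w \<in> carrier_vec n \<Longrightarrow> bform B v w = bform A (P *\<^sub>v v) (P *\<^sub>v w)"
    using iso unfolding isometric_def n_def by blast
  obtain R where R: "R \<in> carrier_mat n n" "P * R = 1\<^sub>m n" using invertible_mat_inverse[OF P] by blast
  let ?b = "sum_form (bform A) (\<lambda>v w. - bform B v w)"
  define N where "N = {(P *\<^sub>v v, v) | v. v \<in> carrier_vec n}"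
  have Nc: "N \<subseteq> carrier_vec n \<times> carrier_vec n" using P(1) by (auto simp: N_def)
  have "N = {z \<in> carrier_vec n \<times> carrier_vec n. \<forall>w\<in>N. ?b z w = 0}"
  proof (intro equalityI subsetI)
    fix z assume "z \<in> N"
    then show "z \<in> {z \<in> carrier_vec n \<times> carrier_vec n. \<forall>w\<in>N. ?b z w = 0}"
      using Nc by (auto simp: N_def Peq)
  next
    fix z assume z: "z \<in> {z \<in> carrier_vec n \<times> carrier_vec n. \<forall>w\<in>N. ?b z w = 0}"
    obtain x y where xy: "z = (x, y)" "x \<in> carrier_vec n" "y \<in> carrier_vec n" using z by auto
    define u where "u = R *\<^sub>v x"
    have u: "u \<in> carrier_vec n" "P *\<^sub>v u = x"
      using R xy(2) assoc_mult_mat_vec[OF P(1) R(1) xy(2)] by (auto simp: u_def)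
    \<comment> \<open>Pairing \<open>(x, y)\<close> with the graph element over \<open>v\<close>
      compares the preimage \<open>u\<close> of \<open>x\<close> with \<open>y\<close>;
      nondegeneracy of \<open>B\<close> then forces u = y.\<close>
    have "bform B u v = bform B y v" if "v \<in> carrier_vec n" for v
      using z that xy Peq[OF u(1) that] u(2) by (auto simp: N_def)
    then have "bform B (u + (-1) \<cdot>\<^sub>v y) v = 0" if "v \<in> carrier_vec n" for v
      using that u(1) xy(3) bform_add_left[OF b(1)] bform_smult_left[OF b(1)] by simp
    then have "u + (-1) \<cdot>\<^sub>v y = 0\<^sub>v n" using b(6)[of "u + (-1) \<cdot>\<^sub>v y"] u(1) xy(3) by simp
    have "u = y"
    proof (rule eq_vecI)
      fix i assume i: "i < dim_vec y"
      have "(u + (-1) \<cdot>\<^sub>v y) $ i = 0" using \<open>u + (-1) \<cdot>\<^sub>v y = 0\<^sub>v n\<close> i xy(3) by simp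
      then show "u $ i = y $ i" using i u(1) xy(3) by simp
    qed (use u(1) xy(3) in auto)
    then show "z \<in> N" using xy u unfolding N_def by blast
  qed
  then have "has_lagrangian (carrier_vec n \<times> carrier_vec n) ?b" using Nc unfolding has_lagrangian_def by blast
  then show ?thesis
    using metabolic_represents[OF represents_orth_sum[OF represents_self[OF fA] represents_uminus[OF represents_self[OF fB]]]]
    by blast
qed

lemma isometric_refl: "A \<in> symmetric_forms \<Longrightarrow> isometric A A"
  unfolding isometric_def
  by (auto intro!: bexI[of _ "1\<^sub>m (dim_row A)"] exI[of _ "1\<^sub>m (dim_row A)"]
      simp: invertible_mat_def inverts_mat_def)

lemma metabolic_diff_self: "A \<in> symmetric_forms \<Longrightarrow> metabolic (orth_sum A (- A))"
  by (intro isometric_metabolic isometric_refl)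

text \<open>Here an actual invertible matrix is required, because \<open>isometric\<close> asks for
  one. It exchanges the two blocks, and its invertibility is read off its trivial kernel.\<close>

lemma isometric_orth_sum_swap:
  assumes A: "A \<in> symmetric_forms" and B: "B \<in> symmetric_forms"
  shows "isometric (orth_sum A B) (orth_sum B A)"
proof -
  define n m where "n = dim_row A" and "m = dim_row B"
  have fA: "A \<in> forms n" and fB: "B \<in> forms m" using A B by (auto simp: n_def m_def symmetric_forms_iff)
  have cA: "A \<in> carrier_mat n n" and cB: "B \<in> carrier_mat m m" using formsD(1) fA fB by blast+
  have d: "dim_row (orth_sum A B) = n + m" "dim_row (orth_sum B A) = n + m"
    using formsD(3)[OF orth_sum_forms[OF fA fB]] formsD(3)[OF orth_sum_forms[OF fB fA]] by auto
  define P where "P = four_block_mat (0\<^sub>m n m) (1\<^sub>m n) (1\<^sub>m m) (0\<^sub>m m n :: 'a mat)"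
  have P: "P \<in> carrier_mat (n + m) (n + m)" unfolding P_def
    using four_block_carrier_mat[of "0\<^sub>m n m :: 'a mat" n m "0\<^sub>m m n" m n] by (simp add: add.commute)
  have Pv: "P *\<^sub>v (w @\<^sub>v v) = v @\<^sub>v w" if "v \<in> carrier_vec n" "w \<in> carrier_vec m" for v w
    unfolding P_def using that by (subst four_block_mat_mult_vec[of _ n m _ n _ m]) auto
  have "det P \<noteq> 0"
  proof
    assume "det P = 0"
    then obtain z where z: "z \<in> carrier_vec (n + m)" "z \<noteq> 0\<^sub>v (n + m)" "P *\<^sub>v z = 0\<^sub>v (n + m)"
      using det_0_iff_vec_prod_zero_field[OF P] by blast
    have "z \<in> carrier_vec (m + n)" using z(1) by (simp add: add.commute)
    then obtain w v where wv: "w \<in> carrier_vec m" "v \<in> carrier_vec n" "z = w @\<^sub>v v"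
      using append_vec_cases by blast
    have "v @\<^sub>v w = 0\<^sub>v n @\<^sub>v 0\<^sub>v m" using z(3) Pv wv by (simp add: zero_append_vec)
    then have "v = 0\<^sub>v n" "w = 0\<^sub>v m" using append_vec_eq[of v n "0\<^sub>v n" w "0\<^sub>v m"] wv by auto
    then show False using z(2) wv(3) by (simp add: zero_append_vec add.commute)
  qed
  then obtain R where "R \<in> carrier_mat (n + m) (n + m)" "P * R = 1\<^sub>m (n + m)" "R * P = 1\<^sub>m (n + m)"
    using det_non_zero_imp_unit[OF P, of "()"] unfolding Units_def ring_mat_def by auto
  then have inv: "invertible_mat P" using P unfolding invertible_mat_def inverts_mat_def by auto
  show ?thesis unfolding isometric_def d
  proof (intro conjI bexI[OF _ P] inv ballI refl)
    fix x y :: "'a vec" assume "x \<in> carrier_vec (n + m)" "y \<in> carrier_vec (n + m)"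
    then have xy: "x \<in> carrier_vec (m + n)" "y \<in> carrier_vec (m + n)" by (simp_all add: add.commute)
    obtain w v where wv: "w \<in> carrier_vec m" "v \<in> carrier_vec n" "x = w @\<^sub>v v"
      using append_vec_cases[OF xy(1)] by blast
    obtain w' v' where wv': "w' \<in> carrier_vec m" "v' \<in> carrier_vec n" "y = w' @\<^sub>v v'"
      using append_vec_cases[OF xy(2)] by blast
    show "bform (orth_sum B A) x y = bform (orth_sum A B) (P *\<^sub>v x) (P *\<^sub>v y)"
      using wv wv' by (simp add: Pv bform_orth_sum[OF cA cB] bform_orth_sum[OF cB cA])
  qed
qed

lemma orth_sum_assoc: "orth_sum (orth_sum A B) C = orth_sum A (orth_sum B C)"
  unfolding orth_sum_def using assoc_four_block_mat[of A B C] by simp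

lemma orth_sum_empty [simp]: "orth_sum A (0\<^sub>m 0 0) = A" "orth_sum (0\<^sub>m 0 0) A = A"
  unfolding orth_sum_def by (auto intro!: eq_matI)

lemma uminus_mat_00 [simp]: "- (0\<^sub>m 0 0) = (0\<^sub>m 0 0 :: 'a::field mat)" by (rule eq_matI) auto

text \<open>If A + M and B + N are isometric, the graph makes (A + M) - (B + N) metabolic, and the
  metabolic summand M - N can be cancelled. Conversely, A + (-B + B) and B + (A - B) are isometric
  and exhibit the two metabolic summands that the definition of \<open>witt_equiv\<close> asks
  for.\<close>

lemma witt_equiv_iff:
  "(A, B) \<in> witt_equiv \<longleftrightarrow> A \<in> symmetric_forms \<and> B \<in> symmetric_forms \<and> metabolic (orth_sum A (- B))"
proof (cases "A \<in> symmetric_forms \<and> B \<in> symmetric_forms")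
  case True
  then have A: "A \<in> symmetric_forms" and B: "B \<in> symmetric_forms" by auto
  have mB: "- B \<in> symmetric_forms" by (rule uminus_symmetric[OF B])
  show ?thesis
  proof
    assume "(A, B) \<in> witt_equiv"
    then obtain M N where MN: "metabolic M" "metabolic N" "isometric (orth_sum A M) (orth_sum B N)"
      unfolding witt_equiv_def by blast
    have sM: "M \<in> symmetric_forms" and sN: "N \<in> symmetric_forms" using MN by (auto simp: metabolic_iff)
    have "metabolic (orth_sum (orth_sum A M) (orth_sum (- B) (- N)))"
      using isometric_metabolic[OF orth_sum_symmetric[OF A sM] orth_sum_symmetric[OF B sN] MN(3)]
      by (simp add: uminus_orth_sum[OF B sN])
    then have "metabolic (orth_sum (orth_sum A (- B)) (orth_sum M (- N)))"
      by (rule metabolic_swap_middle[OF A mB sM uminus_symmetric[OF sN]])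
    then have "metabolic (orth_sum A (- B))"
      by (rule metabolic_cancel[OF orth_sum_symmetric[OF A mB] _ metabolic_orth_sum[OF MN(1) metabolic_uminus[OF MN(2)]]])
    then show "A \<in> symmetric_forms \<and> B \<in> symmetric_forms \<and> metabolic (orth_sum A (- B))" using True by blast
  next
    assume m: "A \<in> symmetric_forms \<and> B \<in> symmetric_forms \<and> metabolic (orth_sum A (- B))"
    have "isometric (orth_sum A (orth_sum (- B) B)) (orth_sum B (orth_sum A (- B)))"
      unfolding orth_sum_assoc[symmetric]
      using isometric_orth_sum_swap[OF orth_sum_symmetric[OF A mB] B] by (simp add: orth_sum_assoc)
    moreover have "metabolic (orth_sum (- B) B)"
      by (rule metabolic_swap[OF B mB metabolic_diff_self[OF B]])
    ultimately show "(A, B) \<in> witt_equiv" unfolding witt_equiv_def using True m by blast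
  qed
qed (auto simp: witt_equiv_def)

lemma equiv_witt_equiv: "equiv symmetric_forms (witt_equiv :: ('a::field mat \<times> 'a mat) set)"
proof (rule equivI)
  show "witt_equiv \<subseteq> symmetric_forms \<times> symmetric_forms" by (auto simp: witt_equiv_iff)
  show "refl_on symmetric_forms witt_equiv"
    by (auto simp: refl_on_def witt_equiv_iff metabolic_diff_self)
  show "sym (witt_equiv :: ('a mat \<times> 'a mat) set)"
  proof (rule symI)
    fix A B :: "'a mat" assume "(A, B) \<in> witt_equiv"
    then have A: "A \<in> symmetric_forms" and B: "B \<in> symmetric_forms" and m: "metabolic (orth_sum A (- B))"
      by (auto simp: witt_equiv_iff)
    have "metabolic (orth_sum (- A) B)"
      using metabolic_uminus[OF m] uminus_orth_sum[OF A uminus_symmetric[OF B]] by simp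
    then show "(B, A) \<in> witt_equiv"
      using metabolic_swap[OF uminus_symmetric[OF A] B] A B by (simp add: witt_equiv_iff)
  qed
  show "trans (witt_equiv :: ('a mat \<times> 'a mat) set)"
  proof (rule transI)
    fix A B C :: "'a mat" assume "(A, B) \<in> witt_equiv" "(B, C) \<in> witt_equiv"
    then have A: "A \<in> symmetric_forms" and B: "B \<in> symmetric_forms" and C: "C \<in> symmetric_forms"
      and m: "metabolic (orth_sum A (- B))" "metabolic (orth_sum B (- C))"
      by (auto simp: witt_equiv_iff)
    note mA = uminus_symmetric[OF A] and mB = uminus_symmetric[OF B] and mC = uminus_symmetric[OF C]
    \<comment> \<open>The sum of the differences A - B and B - C is regrouped so that -B + B appears
      as a metabolic summand to be cancelled.\<close>
    have "metabolic (orth_sum (orth_sum A (- B)) (orth_sum (- C) B))"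
      by (rule metabolic_orth_sum[OF m(1) metabolic_swap[OF B mC m(2)]])
    then have "metabolic (orth_sum (orth_sum A (- C)) (orth_sum (- B) B))"
      by (rule metabolic_swap_middle[OF A mC mB B])
    then have "metabolic (orth_sum A (- C))"
      by (rule metabolic_cancel[OF orth_sum_symmetric[OF A mC] _ metabolic_swap[OF B mB metabolic_diff_self[OF B]]])
    then show "(A, C) \<in> witt_equiv" using A C by (simp add: witt_equiv_iff)
  qed
qed

lemma witt_equiv_orth_sum:
  assumes "(A, A') \<in> witt_equiv" "(B, B') \<in> witt_equiv"
  shows "(orth_sum A B, orth_sum A' B') \<in> witt_equiv"
proof -
  have s: "A \<in> symmetric_forms" "A' \<in> symmetric_forms" "B \<in> symmetric_forms" "B' \<in> symmetric_forms"
    using assms by (auto simp: witt_equiv_iff)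
  have "metabolic (orth_sum (orth_sum A B) (orth_sum (- A') (- B')))"
    by (rule metabolic_swap_middle[OF s(1,3) s(2,4)[THEN uminus_symmetric] metabolic_orth_sum])
      (use assms in \<open>auto simp: witt_equiv_iff\<close>)
  then show ?thesis using s by (simp add: witt_equiv_iff orth_sum_symmetric uminus_orth_sum)
qed

lemma witt_class_eq_iff:
  "A \<in> symmetric_forms \<Longrightarrow> B \<in> symmetric_forms \<Longrightarrow>
    witt_class_of_form A = witt_class_of_form B \<longleftrightarrow> metabolic (orth_sum A (- B))"
  unfolding witt_class_of_form_def using eq_equiv_class_iff[OF equiv_witt_equiv] witt_equiv_iff by blast

lemma zero_form: "0\<^sub>m 0 0 \<in> (symmetric_forms :: 'a::field mat set)" "metabolic (0\<^sub>m 0 0 :: 'a::field mat)"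
proof -
  show *: "0\<^sub>m 0 0 \<in> (symmetric_forms :: 'a mat set)" unfolding symmetric_forms_def by (auto simp: bform_def scalar_prod_def)
  show "metabolic (0\<^sub>m 0 0 :: 'a mat)" unfolding metabolic_def
    using * by (auto intro!: exI[of _ "{vNil}"] simp: bform_def scalar_prod_def)
qed

lemma witt_class_eq_0_iff:
  "A \<in> symmetric_forms \<Longrightarrow> witt_class_of_form A = witt_class_of_form (0\<^sub>m 0 0) \<longleftrightarrow> metabolic A"
  using witt_class_eq_iff[of A "0\<^sub>m 0 0"] zero_form by simp

lemma witt_carrier: "carrier witt_ring = witt_class_of_form ` symmetric_forms"
  unfolding witt_ring_def quotient_def witt_class_of_form_def by auto

lemma witt_zero: "zero witt_ring = witt_class_of_form (0\<^sub>m 0 0)"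
  unfolding witt_ring_def by simp

lemma witt_class_mem: "B \<in> witt_class_of_form A \<longleftrightarrow> (A, B) \<in> witt_equiv"
  by (simp add: witt_class_of_form_def)

lemma witt_class_cong: "(A, B) \<in> witt_equiv \<Longrightarrow> witt_class_of_form A = witt_class_of_form B"
  unfolding witt_class_of_form_def by (rule equiv_class_eq[OF equiv_witt_equiv])

lemma witt_refl: "A \<in> symmetric_forms \<Longrightarrow> (A, A) \<in> witt_equiv"
  using equiv_witt_equiv by (auto simp: equiv_def refl_on_def)

lemma witt_add:
  assumes "A \<in> symmetric_forms" "B \<in> symmetric_forms"
  shows "witt_class_of_form A \<oplus>\<^bsub>witt_ring\<^esub> witt_class_of_form B = witt_class_of_form (orth_sum A B)"
proof -
  have "witt_class_of_form (orth_sum A' B') = witt_class_of_form (orth_sum A B)"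
    if "(A, A') \<in> witt_equiv" "(B, B') \<in> witt_equiv" for A' B'
    using witt_class_cong[OF witt_equiv_orth_sum[OF that]] by simp
  then have 1: "(\<Union>B'\<in>witt_class_of_form B. witt_class_of_form (orth_sum A' B')) = witt_class_of_form (orth_sum A B)"
    if "(A, A') \<in> witt_equiv" for A'
    by (intro UN_constant_eq[of B]) (use that witt_refl[OF assms(2)] in \<open>simp_all add: witt_class_mem\<close>)
  have "(\<Union>A'\<in>witt_class_of_form A. \<Union>B'\<in>witt_class_of_form B. witt_class_of_form (orth_sum A' B')) =
      witt_class_of_form (orth_sum A B)"
    by (rule UN_constant_eq[of A]) (use 1 witt_refl[OF assms(1)] in \<open>simp_all add: witt_class_mem\<close>)
  then show ?thesis by (simp add: witt_ring_def)
qed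

lemma witt_abelian_group: "abelian_group (witt_ring :: 'a::field mat set ring)"
proof (rule abelian_groupI)
  fix x y z :: "'a mat set"
  assume "x \<in> carrier witt_ring" "y \<in> carrier witt_ring" "z \<in> carrier witt_ring"
  then obtain A B C where s: "A \<in> symmetric_forms" "B \<in> symmetric_forms" "C \<in> symmetric_forms"
    and e: "x = witt_class_of_form A" "y = witt_class_of_form B" "z = witt_class_of_form C"
    by (auto simp: witt_carrier)
  show "x \<oplus>\<^bsub>witt_ring\<^esub> y \<oplus>\<^bsub>witt_ring\<^esub> z = x \<oplus>\<^bsub>witt_ring\<^esub> (y \<oplus>\<^bsub>witt_ring\<^esub> z)"
    by (simp add: s e witt_add orth_sum_symmetric orth_sum_assoc)
next
  fix x y :: "'a mat set"
  assume "x \<in> carrier witt_ring" "y \<in> carrier witt_ring"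
  then obtain A B where s: "A \<in> symmetric_forms" "B \<in> symmetric_forms"
    and e: "x = witt_class_of_form A" "y = witt_class_of_form B"
    by (auto simp: witt_carrier)
  show "x \<oplus>\<^bsub>witt_ring\<^esub> y \<in> carrier witt_ring"
    using s by (simp add: e witt_add orth_sum_symmetric witt_carrier)
  show "x \<oplus>\<^bsub>witt_ring\<^esub> y = y \<oplus>\<^bsub>witt_ring\<^esub> x"
    using s isometric_metabolic[OF orth_sum_symmetric[OF s] orth_sum_symmetric[OF s(2,1)] isometric_orth_sum_swap[OF s]]
    by (simp add: e witt_add witt_class_eq_iff orth_sum_symmetric)
next
  show "\<zero>\<^bsub>witt_ring\<^esub> \<in> (carrier witt_ring :: 'a mat set set)" using zero_form(1) by (auto simp: witt_zero witt_carrier)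
  fix x :: "'a mat set" assume "x \<in> carrier witt_ring"
  then obtain A where s: "A \<in> symmetric_forms" and e: "x = witt_class_of_form A"
    by (auto simp: witt_carrier)
  show "\<zero>\<^bsub>witt_ring\<^esub> \<oplus>\<^bsub>witt_ring\<^esub> x = x" using s by (simp add: e witt_add witt_zero zero_form)
  have "metabolic (orth_sum (- A) A)" by (rule metabolic_swap[OF s uminus_symmetric[OF s] metabolic_diff_self[OF s]])
  then show "\<exists>y\<in>carrier witt_ring. y \<oplus>\<^bsub>witt_ring\<^esub> x = \<zero>\<^bsub>witt_ring\<^esub>"
    using s uminus_symmetric[OF s] unfolding witt_carrier
    by (auto simp: e witt_add witt_zero witt_class_eq_0_iff orth_sum_symmetric intro!: bexI[of _ "- A"])
qed

section \<open>Diagonal forms and the classes of one-dimensional forms\<close>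

definition diag_form :: "'a::field list \<Rightarrow> 'a mat"
  where "diag_form l = mat (length l) (length l) (\<lambda>(i, j). if i = j then l ! i else 0)"

lemma diag_form_carrier [simp]: "diag_form l \<in> carrier_mat (length l) (length l)"
  "dim_row (diag_form l) = length l" "dim_col (diag_form l) = length l"
  by (auto simp: diag_form_def)

lemma diag_form_index [simp]:
  "i < length l \<Longrightarrow> j < length l \<Longrightarrow> diag_form l $$ (i, j) = (if i = j then l ! i else 0)"
  by (simp add: diag_form_def)

lemma diag_form_mult_vec:
  assumes "w \<in> carrier_vec (length l)" "i < length l"
  shows "(diag_form l *\<^sub>v w) $ i = l ! i * w $ i"
proof -
  have "(diag_form l *\<^sub>v w) $ i = (\<Sum>j\<in>{0..<length l}. (if i = j then l ! i else 0) * w $ j)"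
    using assms by (auto simp: scalar_prod_def intro!: sum.cong)
  also have "\<dots> = (\<Sum>j\<in>{0..<length l}. if j = i then l ! i * w $ i else 0)"
    by (rule sum.cong) auto
  also have "\<dots> = l ! i * w $ i" using assms by simp
  finally show ?thesis .
qed

lemma bform_diag_form:
  assumes "v \<in> carrier_vec (length l)" "w \<in> carrier_vec (length l)"
  shows "bform (diag_form l) v w = (\<Sum>i<length l. l ! i * (v $ i * w $ i))"
proof -
  have "bform (diag_form l) v w = (\<Sum>i\<in>{0..<length l}. v $ i * (diag_form l *\<^sub>v w) $ i)"
    using assms by (simp add: bform_def scalar_prod_def)
  also have "\<dots> = (\<Sum>i<length l. l ! i * (v $ i * w $ i))"
    unfolding atLeast0LessThan by (rule sum.cong) (auto simp: diag_form_mult_vec[OF assms(2)] simp del: index_mult_mat_vec)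
  finally show ?thesis .
qed

lemma diag_form_forms:
  assumes "0 \<notin> set l" shows "diag_form l \<in> forms (length l)"
proof (rule formsI)
  show "bform (diag_form l) v w = bform (diag_form l) w v"
    if "v \<in> carrier_vec (length l)" "w \<in> carrier_vec (length l)" for v w
    using that by (simp add: bform_diag_form mult.commute[of "v $ _"])
  show "v = 0\<^sub>v (length l)" if v: "v \<in> carrier_vec (length l)"
    and 0: "\<And>w. w \<in> carrier_vec (length l) \<Longrightarrow> bform (diag_form l) v w = 0" for v
  proof (rule eq_vecI)
    fix i assume "i < dim_vec (0\<^sub>v (length l) :: 'a vec)"
    then have i: "i < length l" by simp
    have "bform (diag_form l) v (unit_vec (length l) i) = (\<Sum>j<length l. if j = i then l ! i * v $ i else 0)"
      unfolding bform_diag_form[OF v unit_vec_carrier] by (rule sum.cong) (use i in auto)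
    then have "l ! i * v $ i = 0" using 0[OF unit_vec_carrier] i by simp
    moreover have "l ! i \<noteq> 0" using i assms by (metis nth_mem)
    ultimately show "v $ i = 0\<^sub>v (length l) $ i" using i by simp
  qed (use v in auto)
qed auto

lemma diag_form_symmetric [simp]: "0 \<notin> set l \<Longrightarrow> diag_form l \<in> symmetric_forms"
  by (rule formsD(2)[OF diag_form_forms])

lemma diag_form_append: "orth_sum (diag_form l) (diag_form k) = diag_form (l @ k)"
  unfolding orth_sum_def by (rule eq_matI) (auto simp: nth_append)

lemma diag_form_Nil: "diag_form [] = 0\<^sub>m 0 0"
  by (rule eq_matI) auto

lemma diag_form_single: "diag_form [a] = mat 1 1 (\<lambda>_. a)"
  by (rule eq_matI) auto

lemma uminus_diag_form: "- diag_form l = diag_form (map uminus l)"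
  by (rule eq_matI) auto

definition witt_sum :: "'a::field list \<Rightarrow> 'a mat set"
  where "witt_sum l = foldr (\<lambda>a x. witt_rank1 a \<oplus>\<^bsub>witt_ring\<^esub> x) l \<zero>\<^bsub>witt_ring\<^esub>"

interpretation W: abelian_group "witt_ring :: 'a::field mat set ring"
  by (rule witt_abelian_group)

lemma witt_rank1_eq: "a \<noteq> 0 \<Longrightarrow> witt_rank1 a = witt_class_of_form (diag_form [a])"
  by (simp add: witt_rank1_def diag_form_single)

lemma witt_rank1_0 [simp]: "witt_rank1 0 = \<zero>\<^bsub>witt_ring\<^esub>"
  by (simp add: witt_rank1_def witt_zero)

lemma witt_rank1_closed [simp, intro]: "witt_rank1 a \<in> carrier witt_ring"
proof (cases "a = 0")
  case False
  then show ?thesis by (simp add: witt_rank1_eq witt_carrier)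
qed simp

lemma witt_sum_Nil [simp]: "witt_sum [] = \<zero>\<^bsub>witt_ring\<^esub>"
  and witt_sum_Cons [simp]: "witt_sum (a # l) = witt_rank1 a \<oplus>\<^bsub>witt_ring\<^esub> witt_sum l"
  by (simp_all add: witt_sum_def)

lemma witt_sum_closed [simp, intro]: "witt_sum l \<in> carrier witt_ring"
  by (induction l) auto

lemma witt_sum_append: "witt_sum (l @ k) = witt_sum l \<oplus>\<^bsub>witt_ring\<^esub> witt_sum k"
  by (induction l) (auto simp: W.a_assoc)

lemma witt_sum_eq: "0 \<notin> set l \<Longrightarrow> witt_sum l = witt_class_of_form (diag_form l)"
proof (induction l)
  case Nil
  then show ?case by (simp add: diag_form_Nil witt_zero)
next
  case (Cons a l)
  then show ?case using witt_add[of "diag_form [a]" "diag_form l"] by (simp add: witt_rank1_eq diag_form_append)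
qed

lemma isometricI:
  assumes A: "A \<in> carrier_mat n n" and P: "P \<in> carrier_mat n n" "det P \<noteq> 0"
    and B: "B = P\<^sup>T * (A * P)"
  shows "isometric A B"
proof -
  obtain R where "R \<in> carrier_mat n n" "P * R = 1\<^sub>m n" "R * P = 1\<^sub>m n"
    using det_non_zero_imp_unit[OF P, of "()"] unfolding Units_def ring_mat_def by auto
  then have inv: "invertible_mat P" using P unfolding invertible_mat_def inverts_mat_def by auto
  have "bform B v w = bform A (P *\<^sub>v v) (P *\<^sub>v w)" if v: "v \<in> carrier_vec n" and w: "w \<in> carrier_vec n" for v w
  proof -
    have PT: "P\<^sup>T \<in> carrier_mat n n" using P by simp
    have "B *\<^sub>v w = P\<^sup>T *\<^sub>v (A *\<^sub>v (P *\<^sub>v w))"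
      unfolding B assoc_mult_mat_vec[OF PT mult_carrier_mat[OF A P(1)] w] assoc_mult_mat_vec[OF A P(1) w] ..
    then have "bform B v w = (P\<^sup>T *\<^sub>v (A *\<^sub>v (P *\<^sub>v w))) \<bullet> v"
      unfolding bform_def using comm_scalar_prod[OF v, of "P\<^sup>T *\<^sub>v (A *\<^sub>v (P *\<^sub>v w))"] A P w PT
      by simp
    also have "\<dots> = (A *\<^sub>v (P *\<^sub>v w)) \<bullet> (P *\<^sub>v v)"
      by (rule transpose_vec_mult_scalar[OF P(1) v]) (use A P w in auto)
    also have "\<dots> = bform A (P *\<^sub>v v) (P *\<^sub>v w)"
      unfolding bform_def by (rule comm_scalar_prod[of _ n]) (use A P v w in auto)
    finally show ?thesis .
  qed
  moreover have "dim_row A = n" "dim_row B = n" using A P B by auto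
  ultimately show ?thesis unfolding isometric_def using P(1) inv by auto
qed

lemma isometric_witt_class:
  assumes "A \<in> symmetric_forms" "B \<in> symmetric_forms" "isometric A B"
  shows "witt_class_of_form A = witt_class_of_form B"
  using isometric_metabolic[OF assms] witt_class_eq_iff[OF assms(1,2)] by blast

lemma less_2_cases_eq: "(i < (2::nat)) \<longleftrightarrow> i = 0 \<or> i = 1" by auto

lemma witt_rank1_square: "b \<noteq> 0 \<Longrightarrow> witt_rank1 (a * b\<^sup>2) = witt_rank1 (a :: 'a::field)"
proof (cases "a = 0")
  case False
  assume b: "b \<noteq> 0"
  have "isometric (diag_form [a]) (diag_form [a * b\<^sup>2])"
  proof (rule isometricI[of _ 1 "diag_form [b]"])
    show "det (diag_form [b]) \<noteq> 0" using b by (subst det_single) auto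
    show "diag_form [a * b\<^sup>2] = (diag_form [b])\<^sup>T * (diag_form [a] * diag_form [b])"
      by (rule eq_matI) (auto simp: scalar_prod_def power2_eq_square)
  qed (use diag_form_carrier[of "[_]"] in auto)
  then show ?thesis using isometric_witt_class[of "diag_form [a]" "diag_form [a * b\<^sup>2]"] False b
    by (simp add: witt_rank1_eq)
qed simp

lemma witt_rank1_uminus: "witt_rank1 a \<oplus>\<^bsub>witt_ring\<^esub> witt_rank1 (- a) = \<zero>\<^bsub>witt_ring\<^esub>"
proof (cases "a = 0")
  case False
  then show ?thesis using metabolic_diff_self[of "diag_form [a]"] witt_class_eq_0_iff[of "diag_form [a, - a]"]
    by (simp add: witt_rank1_eq witt_add diag_form_append uminus_diag_form witt_zero)
qed simp

lemma witt_rank1_inv: "witt_rank1 (- a) = \<ominus>\<^bsub>witt_ring\<^esub> witt_rank1 a"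
  using W.minus_equality[of "witt_rank1 (- a)" "witt_rank1 a"] witt_rank1_uminus[of a]
  by (simp add: W.a_comm)

lemma det_2x2: "det (mat 2 2 f) = f (0, 0) * f (1, 1) - f (0, 1) * f (1, 0 :: nat)" for f :: "nat \<times> nat \<Rightarrow> 'a::comm_ring_1"
proof -
  let ?A = "mat 2 2 f"
  have "det (mat_delete ?A 0 0) = f (1, 1)" "det (mat_delete ?A 0 1) = f (1, 0)"
    by (subst det_single; simp add: mat_delete_def)+
  moreover have "det ?A = (\<Sum>j<2. ?A $$ (0, j) * cofactor ?A 0 j)"
    by (rule laplace_expansion_row) auto
  moreover have "{..<2} = {0, 1 :: nat}" by auto
  ultimately show ?thesis by (simp add: cofactor_def)
qed

text \<open>In the form <a, b> the vector (1, 1) has value a + b, and (-b, a) is orthogonal to it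
  with value ab(a + b). These are the columns of \<open>P\<close>, whose determinant is a + b. If
  \<open>a\<close> or \<open>b\<close> is zero the identity is trivial because
  \<open>witt_rank1 0\<close> is the zero class.\<close>

lemma witt_rank1_add:
  fixes a b :: "'a::field"
  assumes "a + b \<noteq> 0"
  shows "witt_rank1 a \<oplus>\<^bsub>witt_ring\<^esub> witt_rank1 b =
    witt_rank1 (a + b) \<oplus>\<^bsub>witt_ring\<^esub> witt_rank1 (a * b * (a + b))"
proof (cases "a = 0 \<or> b = 0")
  case False
  define P where "P = mat 2 2 (\<lambda>(i, j). if j = 0 then 1 else if i = 0 then - b else a)"
  have d: "det P = a + b" unfolding P_def by (simp add: det_2x2)
  have "isometric (diag_form [a, b]) (diag_form [a + b, a * b * (a + b)])"
  proof (rule isometricI[of _ 2 P])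
    show "diag_form [a + b, a * b * (a + b)] = P\<^sup>T * (diag_form [a, b] * P)"
      by (rule eq_matI) (auto simp: P_def scalar_prod_def numeral_2_eq_2 less_Suc_eq algebra_simps)
  qed (use d assms in \<open>auto simp: P_def diag_form_def\<close>)
  then have "witt_sum [a, b] = witt_sum [a + b, a * b * (a + b)]"
    using isometric_witt_class[of "diag_form [a, b]" "diag_form [a + b, a * b * (a + b)]"] False assms
    by (simp add: witt_sum_eq del: witt_sum_Cons)
  then show ?thesis by simp
qed (auto simp: W.a_comm)

section \<open>Orthogonal bases in arbitrary characteristic\<close>

lemma wide_kernel:
  fixes A :: "'a::field mat"
  assumes A: "A \<in> carrier_mat m k" and "m < k"
  obtains v where "v \<in> carrier_vec k" "v \<noteq> 0\<^sub>v k" "A *\<^sub>v v = 0\<^sub>v m"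
proof -
  \<comment> \<open>Zero rows are appended to make the matrix square. The transpose then kills the
    unit vector of index \<open>m\<close>, so the determinant vanishes and a kernel vector
    exists.\<close>
  define B where "B = mat k k (\<lambda>(i, j). if i < m then A $$ (i, j) else 0)"
  have B: "B \<in> carrier_mat k k" by (simp add: B_def)
  have "B\<^sup>T *\<^sub>v unit_vec k m = 0\<^sub>v k"
    by (rule eq_vecI) (use assms in \<open>auto simp: B_def\<close>)
  moreover have "unit_vec k m \<noteq> (0\<^sub>v k :: 'a vec)"
    using assms(2) by (metis index_unit_vec(1) index_zero_vec(1) zero_neq_one)
  ultimately have "det B\<^sup>T = 0" using det_0_iff_vec_prod_zero_field[of "B\<^sup>T" k] B unit_vec_carrier[of k m] by (metis transpose_carrier_mat)
  then have "det B = 0" using det_transpose[OF B] by simp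
  then obtain v where v: "v \<in> carrier_vec k" "v \<noteq> 0\<^sub>v k" "B *\<^sub>v v = 0\<^sub>v k"
    using det_0_iff_vec_prod_zero_field[OF B] by blast
  have "A *\<^sub>v v = 0\<^sub>v m"
  proof (rule eq_vecI)
    fix i assume i: "i < dim_vec (0\<^sub>v m :: 'a vec)"
    have "row A i = row B i" by (rule eq_vecI) (use i assms in \<open>auto simp: B_def\<close>)
    then have "(A *\<^sub>v v) $ i = (B *\<^sub>v v) $ i" using i assms B by simp
    then show "(A *\<^sub>v v) $ i = 0\<^sub>v m $ i" using v(3) i assms(2) by simp
  qed (use A in auto)
  then show ?thesis using that v by blast
qed

definition orth_list :: "'a::field mat \<Rightarrow> nat \<Rightarrow> 'a vec list \<Rightarrow> bool"
  where "orth_list A n vs \<longleftrightarrow> set vs \<subseteq> carrier_vec n \<and>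
    (\<forall>i<length vs. \<forall>j<length vs. bform A (vs ! i) (vs ! j) = 0 \<longleftrightarrow> i \<noteq> j)"

lemma orth_list_gram:
  assumes "orth_list A n vs" "A \<in> carrier_mat n n"
  shows "(mat_of_cols n vs)\<^sup>T * (A * mat_of_cols n vs) = diag_form (map (\<lambda>v. bform A v v) vs)"
proof (rule eq_matI)
  fix i j assume "i < dim_row (diag_form (map (\<lambda>v. bform A v v) vs))" "j < dim_col (diag_form (map (\<lambda>v. bform A v v) vs))"
  then have ij: "i < length vs" "j < length vs" by auto
  then have c: "vs ! i \<in> carrier_vec n" "vs ! j \<in> carrier_vec n" using assms(1) unfolding orth_list_def by (meson nth_mem subsetD)+
  have "col (A * mat_of_cols n vs) j = A *\<^sub>v (vs ! j)"
    using ij c assms(2) by (subst col_mult2[of _ n n _ "length vs"]) auto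
  then have "((mat_of_cols n vs)\<^sup>T * (A * mat_of_cols n vs)) $$ (i, j) = bform A (vs ! i) (vs ! j)"
    using ij c assms(2) by (simp add: bform_def)
  then show "((mat_of_cols n vs)\<^sup>T * (A * mat_of_cols n vs)) $$ (i, j) = diag_form (map (\<lambda>v. bform A v v) vs) $$ (i, j)"
    using ij assms(1) by (auto simp: orth_list_def)
qed auto

lemma orth_list_nonzero: "orth_list A n vs \<Longrightarrow> 0 \<notin> set (map (\<lambda>v. bform A v v) vs)"
  by (auto simp: orth_list_def in_set_conv_nth)

text \<open>The Gram matrix of the vectors is diagonal with nonzero entries, hence injective. This
  yields both the linear independence of the vectors and the fact that their span meets its
  orthogonal complement only in zero.\<close>

lemma orth_list_kernel:
  assumes o: "orth_list A n vs" and A: "A \<in> carrier_mat n n" and c: "c \<in> carrier_vec (length vs)"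
    and 0: "(mat_of_cols n vs)\<^sup>T *\<^sub>v (A *\<^sub>v (mat_of_cols n vs *\<^sub>v c)) = 0\<^sub>v (length vs)"
  shows "c = 0\<^sub>v (length vs)"
proof -
  let ?V = "mat_of_cols n vs" and ?l = "map (\<lambda>v. bform A v v) vs"
  have V: "?V \<in> carrier_mat n (length vs)" "?V\<^sup>T \<in> carrier_mat (length vs) n" by auto
  have "diag_form ?l *\<^sub>v c = 0\<^sub>v (length vs)"
    unfolding orth_list_gram[OF o A, symmetric] assoc_mult_mat_vec[OF V(2) mult_carrier_mat[OF A V(1)] c]
      assoc_mult_mat_vec[OF A V(1) c] by (rule 0)
  then have "l' * c $ i = 0" if "i < length vs" "l' = ?l ! i" for i l'
    using diag_form_mult_vec[of c ?l i] c that by simp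
  moreover have "?l ! i \<noteq> 0" if "i < length vs" for i
    using orth_list_nonzero[OF o] that by (metis length_map nth_mem)
  ultimately show ?thesis using c by (intro eq_vecI) auto
qed

lemma orth_list_length: "orth_list A n vs \<Longrightarrow> A \<in> carrier_mat n n \<Longrightarrow> length vs \<le> n"
proof (rule ccontr)
  assume o: "orth_list A n vs" and A: "A \<in> carrier_mat n n" and "\<not> length vs \<le> n"
  then have "n < length vs" by simp
  then obtain c where c: "c \<in> carrier_vec (length vs)" "c \<noteq> 0\<^sub>v (length vs)" "mat_of_cols n vs *\<^sub>v c = 0\<^sub>v n"
    using wide_kernel[OF mat_of_cols_carrier(1)[of n vs]] by blast
  have "A *\<^sub>v 0\<^sub>v n = 0\<^sub>v n" by (rule eq_vecI) (use A in auto)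
  moreover have "(mat_of_cols n vs)\<^sup>T *\<^sub>v 0\<^sub>v n = 0\<^sub>v (length vs)" by (rule eq_vecI) auto
  ultimately show False using orth_list_kernel[OF o A c(1)] c by simp
qed

lemma orth_list_Cons:
  assumes "A \<in> forms n"
  shows "orth_list A n (v # vs) \<longleftrightarrow> v \<in> carrier_vec n \<and> bform A v v \<noteq> 0 \<and> (\<forall>w\<in>set vs. bform A v w = 0) \<and> orth_list A n vs"
    (is "?l \<longleftrightarrow> ?r")
proof
  assume l: ?l
  have lD: "(bform A ((v # vs) ! i) ((v # vs) ! j) = 0) = (i \<noteq> j)" if "i < Suc (length vs)" "j < Suc (length vs)" for i j
    using l that unfolding orth_list_def by simp
  have "bform A v w = 0" if w: "w \<in> set vs" for w
  proof -
    obtain j where j: "j < length vs" "vs ! j = w" using w unfolding in_set_conv_nth by blast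
    show ?thesis
      using lD[of 0 "Suc j"] j by simp
  qed
  moreover have "orth_list A n vs"
    unfolding orth_list_def
  proof (intro conjI allI impI)
    fix i j assume "i < length vs" "j < length vs"
    then show "bform A (vs ! i) (vs ! j) = 0 \<longleftrightarrow> i \<noteq> j"
      using lD[of "Suc i" "Suc j"] by simp
  qed (use l in \<open>auto simp: orth_list_def\<close>)
  moreover have "bform A v v \<noteq> 0"
    using lD[of 0 0] by simp
  ultimately show ?r using l by (auto simp: orth_list_def)
next
  assume r: ?r
  show ?l unfolding orth_list_def
  proof (intro conjI allI impI)
    fix i j assume ij: "i < length (v # vs)" "j < length (v # vs)"
    have m: "vs ! k \<in> set vs \<and> vs ! k \<in> carrier_vec n" if "k < length vs" for k
      using r that unfolding orth_list_def by auto
    show "bform A ((v # vs) ! i) ((v # vs) ! j) = 0 \<longleftrightarrow> i \<noteq> j"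
    proof (cases i)
      case 0
      then show ?thesis using r ij m by (cases j) auto
    next
      case (Suc i')
      have vm: "bform A (vs ! i') v = 0" using r m[of i'] Suc ij formsD(5)[OF assms, of "vs ! i'" v] by simp
      show ?thesis using Suc vm ij r unfolding orth_list_def by (cases j) auto
    qed
  qed (use r in \<open>auto simp: orth_list_def\<close>)
qed

text \<open>A single anisotropic vector suffices for an orthogonal basis, also in characteristic 2.
  In a list of maximal length that is too short, the orthogonal complement is alternating; one
  member \<open>w\<close> of the list together with a hyperbolic pair of the complement then spans a
  space with an orthogonal basis of three anisotropic vectors, contradicting maximality.\<close>

lemma orth_list_ex:
  assumes A: "A \<in> forms n" and v: "v \<in> carrier_vec n" "bform A v v \<noteq> 0"
  obtains vs where "orth_list A n vs" "length vs = n"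
proof -
  note a = formsD[OF A]
  have one: "orth_list A n [v]" using v by (simp add: orth_list_Cons[OF A]) (simp add: orth_list_def)
  define k where "k = (GREATEST k. \<exists>vs. orth_list A n vs \<and> length vs = k)"
  have bound: "\<And>k. \<exists>vs. orth_list A n vs \<and> length vs = k \<Longrightarrow> k \<le> n" using orth_list_length[OF _ a(1)] by blast
  have ex: "\<exists>vs. orth_list A n vs \<and> length vs = 1" using one by (intro exI[of _ "[v]"]) simp
  obtain vs where vs: "orth_list A n vs" "length vs = k"
    using GreatestI_nat[of "\<lambda>k. \<exists>vs. orth_list A n vs \<and> length vs = k", OF ex] bound unfolding k_def by blast
  have max: "length ws \<le> k" if "orth_list A n ws" for ws
    unfolding k_def by (rule Greatest_le_nat[of "\<lambda>k. \<exists>vs. orth_list A n vs \<and> length vs = k" _ n]) (use that bound in blast)+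
  have "k \<ge> 1" using max[OF one] by simp
  have "k = n"
  proof (rule ccontr)
    assume "k \<noteq> n"
    then have kn: "k < n" using bound vs by (metis le_neq_implies_less)
    let ?V = "mat_of_cols n vs"
    have V: "?V \<in> carrier_mat n k" "?V\<^sup>T \<in> carrier_mat k n" using vs(2) by auto
    obtain x where x: "x \<in> carrier_vec n" "x \<noteq> 0\<^sub>v n" "(?V\<^sup>T * A) *\<^sub>v x = 0\<^sub>v k"
      using wide_kernel[OF mult_carrier_mat[OF V(2) a(1)] kn] by blast
    have VAx: "?V\<^sup>T *\<^sub>v (A *\<^sub>v x) = 0\<^sub>v k" using x assoc_mult_mat_vec[OF V(2) a(1) x(1)] by simp
    have vc: "w \<in> carrier_vec n" if "w \<in> set vs" for w using vs(1) that unfolding orth_list_def by blast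
    have vx: "bform A w x = 0" if w: "w \<in> set vs" for w
    proof -
      obtain i where i: "i < k" "w = vs ! i" using w vs(2) by (metis in_set_conv_nth)
      have "(?V\<^sup>T *\<^sub>v (A *\<^sub>v x)) $ i = bform A w x"
        using i vs(2) vc[OF that] by (simp add: bform_def)
      then show ?thesis using VAx i by simp
    qed
    \<comment> \<open>Maximality: an anisotropic vector orthogonal to \<open>vs\<close> would
      prolong the list.\<close>
    have noext: "bform A y y = 0" if "y \<in> carrier_vec n" "\<And>w. w \<in> set vs \<Longrightarrow> bform A w y = 0" for y
    proof (rule ccontr)
      assume "bform A y y \<noteq> 0"
      then have "orth_list A n (y # vs)" using that vs(1) vc a(5) by (simp add: orth_list_Cons[OF A])
      then show False using max[of "y # vs"] vs(2) by simp
    qed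
    \<comment> \<open>The span of \<open>vs\<close>. It does not contain \<open>x\<close>, so a
      functional vanishing on it separates \<open>x\<close>; the vector representing this functional
      is orthogonal to \<open>vs\<close> and, rescaled to \<open>z\<close>, pairs to 1 with
      \<open>x\<close>.\<close>
    define S where "S = (\<lambda>c. ?V *\<^sub>v c) ` carrier_vec k"
    have S0: "x \<notin> S"
    proof
      assume "x \<in> S"
      then obtain c where c: "c \<in> carrier_vec k" "x = ?V *\<^sub>v c" unfolding S_def by blast
      have "c = 0\<^sub>v k" using orth_list_kernel[OF vs(1) a(1), of c] c VAx vs(2) by simp
      then have "x = 0\<^sub>v n" using c V by (intro eq_vecI) auto
      then show False using x by simp
    qed
    have S1: "S \<subseteq> carrier_vec n" using V unfolding S_def by auto
    have S2: "0\<^sub>v n \<in> S" unfolding S_def by (rule image_eqI[of _ _ "0\<^sub>v k"]) (use V vs(2) in \<open>auto intro!: eq_vecI\<close>)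
    have S3: "u + w \<in> S" if "u \<in> S" "w \<in> S" for u w
      using that V unfolding S_def by (auto simp: mult_add_distrib_mat_vec[OF V(1), symmetric])
    have S4: "c \<cdot>\<^sub>v u \<in> S" if "u \<in> S" for c u
      using that V unfolding S_def by (auto simp: mult_mat_vec[OF V(1), symmetric])
    obtain u where u: "u \<in> carrier_vec n" "\<And>s. s \<in> S \<Longrightarrow> u \<bullet> s = 0" "u \<bullet> x \<noteq> 0"
      using vec_separation[OF S1 S2 S3 S4 x(1) S0] by blast
    obtain y where y: "y \<in> carrier_vec n" "A *\<^sub>v y = u" using forms_surj[OF A u(1)] .
    have yb: "bform A w y = u \<bullet> w" if "w \<in> carrier_vec n" for w
      unfolding bform_def y(2) by (rule comm_scalar_prod[OF that u(1)])
    have vy: "bform A w y = 0" if w: "w \<in> set vs" for w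
    proof -
      obtain i where i: "i < k" "w = vs ! i" using w vs(2) by (metis in_set_conv_nth)
      have "?V *\<^sub>v unit_vec k i = col ?V i"
        by (rule eq_vecI) (use i V in auto)
      then have "w \<in> S" unfolding S_def using i vs(2) vc[OF that] by (auto intro!: image_eqI[of _ _ "unit_vec k i"])
      then show ?thesis using yb[OF vc[OF that]] u(2) by simp
    qed
    define z where "z = (1 / bform A x y) \<cdot>\<^sub>v y"
    have xy0: "bform A x y \<noteq> 0" using yb[OF x(1)] u(3) by simp
    have z: "z \<in> carrier_vec n" using y(1) by (simp add: z_def)
    have xz: "bform A x z = 1" using xy0 by (simp add: z_def bform_smult_right[OF A y(1) x(1)])
    have vz: "bform A w z = 0" if "w \<in> set vs" for w
      using vy[OF that] by (simp add: z_def bform_smult_right[OF A y(1) vc[OF that]])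
    obtain w ws where ws: "vs = w # ws" using \<open>k \<ge> 1\<close> vs(2) by (cases vs) auto
    have w: "w \<in> carrier_vec n" "bform A w w \<noteq> 0" "\<And>t. t \<in> set ws \<Longrightarrow> bform A w t = 0" "orth_list A n ws"
      using vs(1) ws by (auto simp: orth_list_Cons[OF A])
    define p where "p = bform A w w"
    \<comment> \<open>With w of value p and x, z isotropic, orthogonal to w and pairing to 1, these
      vectors have the values p, p and -p. They are mutually orthogonal because each mixed product
      is p - p.\<close>
    define e1 e2 e3 where "e1 = w + x" and "e2 = w + (- p) \<cdot>\<^sub>v z" and "e3 = w + x + (- p) \<cdot>\<^sub>v z"
    have ec: "e1 \<in> carrier_vec n" "e2 \<in> carrier_vec n" "e3 \<in> carrier_vec n"
      using w x z by (auto simp: e1_def e2_def e3_def)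
    have sc: "(- p) \<cdot>\<^sub>v z \<in> carrier_vec n" "w + x \<in> carrier_vec n" using w x z by auto
    note bl = bform_add_left[OF a(1)] bform_smult_left[OF a(1)] bform_add_right[OF A] bform_smult_right[OF A]
    have f: "bform A x x = 0" "bform A z z = 0" "bform A w x = 0" "bform A x w = 0" "bform A w z = 0" "bform A z w = 0"
      "bform A x z = 1" "bform A z x = 1" "bform A w w = p"
      using noext[OF x(1) vx] noext[OF z vz] vx[of w] vz[of w] ws xz a(5) w(1) x(1) z by (auto simp: p_def)
    have g: "bform A w t = 0" "bform A x t = 0" "bform A z t = 0" "t \<in> carrier_vec n" if "t \<in> set ws" for t
      using w(3)[OF that] vx[of t] vz[of t] vc[of t] that ws a(5) x(1) z by auto
    have "orth_list A n (e1 # e2 # e3 # ws)"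
      unfolding orth_list_Cons[OF A]
      using ec w(2,4) g
      by (auto simp: e1_def e2_def e3_def bl f w(1) x(1) z sc p_def[symmetric])
    then show False using max[of "e1 # e2 # e3 # ws"] vs(2) ws by simp
  qed
  then show ?thesis using that vs by blast
qed

text \<open>Adding <1, -1> leaves the class unchanged and provides an anisotropic vector, so that
  alternating forms are covered as well. The length n + 2 is recorded because its parity is that of
  the dimension, which matters for the fundamental ideal.\<close>

lemma witt_diagonalise:
  assumes A: "A \<in> forms n"
  obtains l where "0 \<notin> set l" "length l = n + 2" "witt_class_of_form A = witt_sum l"
proof -
  let ?H = "diag_form [1, -1 :: 'a]"
  have H: "?H \<in> forms 2" using diag_form_forms[of "[1, -1 :: 'a]"] by (simp add: numeral_2_eq_2)
  define B where "B = orth_sum A ?H"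
  have B: "B \<in> forms (n + 2)" unfolding B_def by (rule orth_sum_forms[OF A H])
  note b = formsD[OF B]
  let ?v = "0\<^sub>v n @\<^sub>v unit_vec 2 0 :: 'a vec"
  have "bform B ?v ?v = bform A (0\<^sub>v n) (0\<^sub>v n) + bform ?H (unit_vec 2 0) (unit_vec 2 0)"
    unfolding B_def by (rule bform_orth_sum[OF formsD(1)[OF A] formsD(1)[OF H]]) auto
  also have "\<dots> = 1"
    using bform_zero_right[OF A, of "0\<^sub>v n"] by (simp add: bform_diag_form numeral_2_eq_2)
  finally have v: "bform B ?v ?v \<noteq> 0" by simp
  obtain vs where vs: "orth_list B (n + 2) vs" "length vs = n + 2"
    using orth_list_ex[OF B append_carrier_vec[OF zero_carrier_vec unit_vec_carrier] v] by blast
  let ?l = "map (\<lambda>v. bform B v v) vs" and ?V = "mat_of_cols (n + 2) vs"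
  have V: "?V \<in> carrier_mat (n + 2) (n + 2)" using vs by auto
  have det: "det ?V \<noteq> 0"
  proof
    assume "det ?V = 0"
    then obtain c where c: "c \<in> carrier_vec (n + 2)" "c \<noteq> 0\<^sub>v (n + 2)" "?V *\<^sub>v c = 0\<^sub>v (n + 2)"
      using det_0_iff_vec_prod_zero_field[OF V] by blast
    have "B *\<^sub>v 0\<^sub>v (n + 2) = 0\<^sub>v (n + 2)" by (rule eq_vecI) (use b(1) in auto)
    moreover have "?V\<^sup>T *\<^sub>v 0\<^sub>v (n + 2) = 0\<^sub>v (length vs)" by (rule eq_vecI) auto
    ultimately show False using orth_list_kernel[OF vs(1) b(1), of c] c vs(2) by simp
  qed
  have "isometric B (diag_form ?l)"
    by (rule isometricI[OF b(1) V det]) (simp only: orth_list_gram[OF vs(1) b(1)])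
  then have "witt_class_of_form B = witt_sum ?l"
    using isometric_witt_class[OF b(2) diag_form_symmetric] orth_list_nonzero[OF vs(1)] by (simp add: witt_sum_eq)
  moreover have "witt_class_of_form B = witt_class_of_form A"
  proof -
    have "witt_class_of_form ?H = \<zero>\<^bsub>witt_ring\<^esub>"
      using witt_rank1_uminus[of "1::'a"] witt_sum_eq[of "[1, -1::'a]"] by simp
    moreover have "witt_class_of_form A \<in> carrier witt_ring" using A by (auto simp: witt_carrier forms_def)
    ultimately show ?thesis using witt_add[of A ?H] A by (simp add: B_def forms_def)
  qed
  ultimately show ?thesis using that[of ?l] orth_list_nonzero[OF vs(1)] vs(2) by simp
qed

section \<open>The Witt ring\<close>

lemma sum_lessThan_prod: "(\<Sum>p<n * m. f p) = (\<Sum>i<n. \<Sum>j<m. f (i * m + j :: nat) :: 'a::comm_monoid_add)"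
proof -
  have "(\<Sum>p<n * m. f p) = (\<Sum>i<n. sum f {i * m..<i * m + m})" by (rule sum.nat_group[symmetric])
  also have "\<dots> = (\<Sum>i<n. \<Sum>j<m. f (i * m + j))"
    by (rule sum.cong) (auto simp: sum.atLeastLessThan_shift_0[of f "_ * m"] atLeast0LessThan)
  finally show ?thesis .
qed

lemma bform_sum:
  assumes "A \<in> carrier_mat n n" "v \<in> carrier_vec n" "w \<in> carrier_vec n"
  shows "bform A v w = (\<Sum>i<n. \<Sum>k<n. v $ i * A $$ (i, k) * w $ k)"
proof -
  have "bform A v w = (\<Sum>i<n. v $ i * (A *\<^sub>v w) $ i)"
    using assms by (simp add: bform_def scalar_prod_def atLeast0LessThan)
  also have "\<dots> = (\<Sum>i<n. \<Sum>k<n. v $ i * A $$ (i, k) * w $ k)"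
  proof (rule sum.cong[OF refl])
    fix i assume "i \<in> {..<n}"
    then have "(A *\<^sub>v w) $ i = (\<Sum>k<n. A $$ (i, k) * w $ k)"
      using assms by (auto simp: scalar_prod_def atLeast0LessThan intro!: sum.cong)
    then show "v $ i * (A *\<^sub>v w) $ i = (\<Sum>k<n. v $ i * A $$ (i, k) * w $ k)"
      by (simp add: sum_distrib_left mult.assoc)
  qed
  finally show ?thesis .
qed

section \<open>Tensor products of forms\<close>

lemma tensor_form_carrier:
  "A \<in> carrier_mat n n \<Longrightarrow> B \<in> carrier_mat m m \<Longrightarrow> tensor_form A B \<in> carrier_mat (n * m) (n * m)"
  by (auto simp: tensor_form_def)

text \<open>Coordinates of the tensor product of K^n and K^m are indexed by i * m + j. A vector is
  the sum over j of its slice tensored with the basis vector e_j of K^m.\<close>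

definition slice :: "nat \<Rightarrow> nat \<Rightarrow> 'a vec \<Rightarrow> nat \<Rightarrow> 'a vec"
  where "slice n m x j = vec n (\<lambda>i. x $ (i * m + j))"

lemma slice_carrier [simp]: "slice n m x j \<in> carrier_vec n"
  by (simp add: slice_def)

lemma div_mod_block: "j < m \<Longrightarrow> (i * m + j) div m = i \<and> (i * m + j) mod m = (j::nat)"
  by (simp add: add.commute)

lemma block_less: "i < n \<Longrightarrow> j < m \<Longrightarrow> i * m + j < n * (m::nat)"
proof -
  assume "i < n" "j < m"
  then have "i * m + j < Suc i * m" "Suc i * m \<le> n * m" by (simp, intro mult_le_mono1, simp)
  then show ?thesis by linarith
qed

lemma bform_tensor_form:
  assumes A: "A \<in> carrier_mat n n" and B: "B \<in> carrier_mat m m"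
    and x: "x \<in> carrier_vec (n * m)" and y: "y \<in> carrier_vec (n * m)"
  shows "bform (tensor_form A B) x y =
    (\<Sum>j<m. \<Sum>j'<m. B $$ (j, j') * bform A (slice n m x j) (slice n m y j'))"
proof -
  let ?F = "\<lambda>i j i' j'. x $ (i * m + j) * (A $$ (i, i') * B $$ (j, j')) * y $ (i' * m + j')"
  have "bform (tensor_form A B) x y = (\<Sum>p<n * m. \<Sum>q<n * m. x $ p * tensor_form A B $$ (p, q) * y $ q)"
    by (rule bform_sum[OF tensor_form_carrier[OF A B] x y])
  also have "\<dots> = (\<Sum>i<n. \<Sum>j<m. \<Sum>i'<n. \<Sum>j'<m. ?F i j i' j')"
    unfolding sum_lessThan_prod
    by (intro sum.cong refl) (use A B in \<open>simp add: tensor_form_def block_less div_mod_block\<close>)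
  also have "\<dots> = (\<Sum>j<m. \<Sum>i<n. \<Sum>i'<n. \<Sum>j'<m. ?F i j i' j')" by (rule sum.swap)
  also have "\<dots> = (\<Sum>j<m. \<Sum>i<n. \<Sum>j'<m. \<Sum>i'<n. ?F i j i' j')"
    by (rule sum.cong[OF refl], rule sum.cong[OF refl], rule sum.swap)
  also have "\<dots> = (\<Sum>j<m. \<Sum>j'<m. \<Sum>i<n. \<Sum>i'<n. ?F i j i' j')"
    by (rule sum.cong[OF refl], rule sum.swap)
  also have "\<dots> = (\<Sum>j<m. \<Sum>j'<m. B $$ (j, j') * bform A (slice n m x j) (slice n m y j'))"
    unfolding bform_sum[OF A slice_carrier slice_carrier] sum_distrib_left
    by (intro sum.cong refl) (simp add: slice_def ac_simps)
  finally show ?thesis .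
qed

lemma forms_index_sym:
  assumes "A \<in> forms n" "i < n" "j < n" shows "A $$ (i, j) = A $$ (j, i)"
proof -
  have "A $$ (i, j) = bform A (unit_vec n i) (unit_vec n j)" if "i < n" "j < n" for i j
    using that formsD(1)[OF assms(1)] by (simp add: bform_def)
  then show ?thesis using assms formsD(5)[OF assms(1), of "unit_vec n i" "unit_vec n j"] by simp
qed

lemma forms_kernel:
  assumes "A \<in> forms n" "z \<in> carrier_vec n" "\<And>i. i < n \<Longrightarrow> (\<Sum>k<n. A $$ (i, k) * z $ k) = 0"
  shows "z = 0\<^sub>v n"
proof (rule formsD(6)[OF assms(1,2)])
  fix w :: "'a vec" assume w: "w \<in> carrier_vec n"
  have "bform A w z = (\<Sum>i<n. w $ i * (\<Sum>k<n. A $$ (i, k) * z $ k))"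
    unfolding bform_sum[OF formsD(1)[OF assms(1)] w assms(2)] by (simp add: sum_distrib_left mult.assoc)
  then show "bform A z w = 0" using assms(3) formsD(5)[OF assms(1) w assms(2)] by simp
qed

text \<open>If y is orthogonal to N tensored with K^m, then all its slices are orthogonal to N, by
  nondegeneracy of \<open>B\<close>. With N the whole space this gives nondegeneracy of the tensor
  form, and with N a Lagrangian it gives a Lagrangian of the tensor form.\<close>

lemma tensor_form_perp:
  assumes A: "A \<in> forms n" and B: "B \<in> forms m" and N: "0\<^sub>v n \<in> N" "N \<subseteq> carrier_vec n"
    and y: "y \<in> carrier_vec (n * m)"
    and perp: "\<And>x. x \<in> carrier_vec (n * m) \<Longrightarrow> (\<forall>j<m. slice n m x j \<in> N) \<Longrightarrow> bform (tensor_form A B) y x = 0"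
    and v: "v \<in> N" and j': "j' < m"
  shows "bform A (slice n m y j') v = 0"
proof -
  have vc: "v \<in> carrier_vec n" using v N by blast
  define z where "z = vec m (\<lambda>j'. bform A (slice n m y j') v)"
  have "(\<Sum>k<m. B $$ (j, k) * z $ k) = 0" if j: "j < m" for j
  proof -
    \<comment> \<open>The pure tensor of \<open>v\<close> and the basis vector e_j. Testing
      \<open>y\<close> against it yields the j-th coordinate of B z, where z collects the products
      of the slices of \<open>y\<close> with \<open>v\<close>.\<close>
    define x where "x = vec (n * m) (\<lambda>p. if p mod m = j then v $ (p div m) else 0)"
    have sl: "slice n m x k = (if k = j then v else 0\<^sub>v n)" if "k < m" for k
      by (rule eq_vecI) (use that vc j in \<open>auto simp: slice_def x_def block_less div_mod_block\<close>)
    have x: "x \<in> carrier_vec (n * m)" by (simp add: x_def)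
    have "0 = bform (tensor_form A B) y x" using perp[OF x] sl v N by auto
    also have "\<dots> = (\<Sum>k<m. \<Sum>j'<m. B $$ (k, j') * bform A (slice n m y k) (slice n m x j'))"
      by (rule bform_tensor_form[OF formsD(1)[OF A] formsD(1)[OF B] y x])
    also have "\<dots> = (\<Sum>k<m. \<Sum>j'<m. if j' = j then B $$ (j, k) * z $ k else 0)"
    proof (intro sum.cong refl)
      fix k j' assume "k \<in> {..<m}" "j' \<in> {..<m}"
      then show "B $$ (k, j') * bform A (slice n m y k) (slice n m x j') = (if j' = j then B $$ (j, k) * z $ k else 0)"
        using sl[of j'] forms_index_sym[OF B, of k j] j bform_zero_right[OF A slice_carrier] by (simp add: z_def)
    qed
    also have "\<dots> = (\<Sum>k<m. B $$ (j, k) * z $ k)" using j by simp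
    finally show ?thesis by simp
  qed
  then have "z = 0\<^sub>v m" by (intro forms_kernel[OF B]) (auto simp: z_def)
  then have "z $ j' = 0" using j' by simp
  then show ?thesis using j' by (simp add: z_def)
qed

lemma tensor_form_forms:
  assumes A: "A \<in> forms n" and B: "B \<in> forms m"
  shows "tensor_form A B \<in> forms (n * m)"
proof (rule formsI)
  note a = formsD[OF A] and b = formsD[OF B]
  show "tensor_form A B \<in> carrier_mat (n * m) (n * m)" by (rule tensor_form_carrier[OF a(1) b(1)])
  show "bform (tensor_form A B) x y = bform (tensor_form A B) y x"
    if x: "x \<in> carrier_vec (n * m)" and y: "y \<in> carrier_vec (n * m)" for x y
  proof -
    have "bform (tensor_form A B) x y =
        (\<Sum>j'<m. \<Sum>j<m. B $$ (j, j') * bform A (slice n m x j) (slice n m y j'))"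
      unfolding bform_tensor_form[OF a(1) b(1) x y] by (rule sum.swap)
    also have "\<dots> = bform (tensor_form A B) y x"
      unfolding bform_tensor_form[OF a(1) b(1) y x]
    proof (intro sum.cong refl)
      fix j' j assume "j' \<in> {..<m}" "j \<in> {..<m}"
      then show "B $$ (j, j') * bform A (slice n m x j) (slice n m y j') =
          B $$ (j', j) * bform A (slice n m y j') (slice n m x j)"
        using forms_index_sym[OF B, of j j'] a(5)[OF slice_carrier slice_carrier, of m x j m y j'] by simp
    qed
    finally show ?thesis .
  qed
  show "y = 0\<^sub>v (n * m)" if y: "y \<in> carrier_vec (n * m)"
    and 0: "\<And>w. w \<in> carrier_vec (n * m) \<Longrightarrow> bform (tensor_form A B) y w = 0" for y
  proof (rule eq_vecI)
    have s0: "slice n m y j = 0\<^sub>v n" if "j < m" for j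
      by (rule a(6)[OF slice_carrier]) (rule tensor_form_perp[OF A B zero_carrier_vec subset_refl y 0 _ that])
    fix p assume "p < dim_vec (0\<^sub>v (n * m) :: 'a vec)"
    then have p: "p < n * m" by simp
    then have "m > 0" by (cases m) auto
    then have pm: "p div m < n" "p mod m < m" using p by (auto simp: less_mult_imp_div_less)
    have "slice n m y (p mod m) $ (p div m) = y $ p" using pm by (simp add: slice_def)
    then show "y $ p = 0\<^sub>v (n * m) $ p" using s0[OF pm(2)] pm(1) p by simp
  qed (use y in auto)
qed

text \<open>The Lagrangian is N tensored with K^m, that is, the vectors all of whose slices lie in a
  Lagrangian N of \<open>A\<close>.\<close>

lemma metabolic_tensor_form:
  assumes "metabolic A" "B \<in> symmetric_forms"
  shows "metabolic (tensor_form A B)"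
proof -
  define n m where "n = dim_row A" and "m = dim_row B"
  have A: "A \<in> forms n" and B: "B \<in> forms m"
    using assms metabolic_forms by (auto simp: n_def m_def symmetric_forms_iff)
  note a = formsD[OF A] and b = formsD[OF B]
  have T: "tensor_form A B \<in> forms (n * m)" by (rule tensor_form_forms[OF A B])
  have "has_lagrangian (carrier_vec n) (bform A)" using assms(1) by (simp add: metabolic_iff n_def)
  then obtain N where N: "N = {v \<in> carrier_vec n. \<forall>w\<in>N. bform A v w = 0}" "N \<subseteq> carrier_vec n"
    unfolding has_lagrangian_def by blast
  have NN: "bform A v w = 0" if "v \<in> N" "w \<in> N" for v w using N(1) that by blast
  have memN: "v \<in> N" if "v \<in> carrier_vec n" "\<And>w. w \<in> N \<Longrightarrow> bform A v w = 0" for v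
    by (subst N(1)) (use that in simp)
  have N0: "0\<^sub>v n \<in> N" by (rule memN[OF zero_carrier_vec bform_zero_left[OF a(1)]]) (use N(2) in auto)
  define N' where "N' = {x \<in> carrier_vec (n * m). \<forall>j<m. slice n m x j \<in> N}"
  have "N' = {v \<in> carrier_vec (n * m). \<forall>w\<in>N'. bform (tensor_form A B) v w = 0}"
  proof (intro equalityI subsetI)
    fix x assume x: "x \<in> N'"
    then show "x \<in> {v \<in> carrier_vec (n * m). \<forall>w\<in>N'. bform (tensor_form A B) v w = 0}"
      by (auto simp: N'_def bform_tensor_form[OF a(1) b(1)] NN)
  next
    fix y assume "y \<in> {v \<in> carrier_vec (n * m). \<forall>w\<in>N'. bform (tensor_form A B) v w = 0}"
    then have y: "y \<in> carrier_vec (n * m)" "\<And>w. w \<in> N' \<Longrightarrow> bform (tensor_form A B) y w = 0" by auto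
    have "slice n m y j \<in> N" if j: "j < m" for j
    proof -
      have "bform A (slice n m y j) v = 0" if "v \<in> N" for v
        by (rule tensor_form_perp[OF A B N0 N(2) y(1) _ that j]) (use y(2) in \<open>auto simp: N'_def\<close>)
      then show ?thesis by (rule memN[OF slice_carrier])
    qed
    then show "y \<in> N'" using y(1) by (simp add: N'_def)
  qed
  moreover have "N' \<subseteq> carrier_vec (n * m)" by (auto simp: N'_def)
  ultimately show ?thesis
    using formsD(2,3)[OF T] unfolding metabolic_iff has_lagrangian_def by auto
qed

lemma tensor_form_symmetric:
  "A \<in> symmetric_forms \<Longrightarrow> B \<in> symmetric_forms \<Longrightarrow> tensor_form A B \<in> symmetric_forms"
  by (rule formsD(2)[OF tensor_form_forms[of A "dim_row A" B "dim_row B"]]) (simp_all only: symmetric_forms_iff)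

lemma tensor_form_uminus_left: "tensor_form (- A) B = - tensor_form A B"
  if "A \<in> symmetric_forms" "B \<in> symmetric_forms"
  using that by (intro eq_matI) (auto simp: tensor_form_def symmetric_forms_def less_mult_imp_div_less)

text \<open>An equality of matrices, because the index of the left factor is the leading part of i *
  m + j and the blocks stay contiguous. On the right the blocks are interleaved, and equality is
  available for a one-dimensional left factor.\<close>

lemma tensor_form_orth_sum_left:
  assumes "A \<in> symmetric_forms" "A' \<in> symmetric_forms" "B \<in> symmetric_forms"
  shows "tensor_form (orth_sum A A') B = orth_sum (tensor_form A B) (tensor_form A' B)"
proof -
  define n n' m where "n = dim_row A" and "n' = dim_row A'" and "m = dim_row B"
  have d: "A \<in> carrier_mat n n" "A' \<in> carrier_mat n' n'" "B \<in> carrier_mat m m"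
    using assms by (auto simp: symmetric_forms_def n_def n'_def m_def)
  have T: "tensor_form A B \<in> carrier_mat (n * m) (n * m)" "tensor_form A' B \<in> carrier_mat (n' * m) (n' * m)"
    using tensor_form_carrier d by blast+
  have O: "orth_sum A A' \<in> carrier_mat (n + n') (n + n')" using orth_sum_carrier d by blast
  have lt: "p div m < n \<longleftrightarrow> p < n * m" if "m > 0" for p using that by (simp add: div_less_iff_less_mult)
  have sub: "(p - n * m) div m = p div m - n" "(p - n * m) mod m = p mod m" if "n * m \<le> p" for p
  proof -
    define q where "q = p - n * m"
    have q: "p = n * m + q" using that by (simp add: q_def)
    show "(p - n * m) div m = p div m - n" "(p - n * m) mod m = p mod m"
      unfolding q by (cases "m = 0"; simp add: add.commute)+
  qed
  have sub': "p - n * m < n' * m" if "p < (n + n') * m" "n * m \<le> p" for p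
    using that by (simp add: distrib_right less_diff_conv2)
  show ?thesis
  proof (rule eq_matI)
    fix i j assume "i < dim_row (orth_sum (tensor_form A B) (tensor_form A' B))"
      "j < dim_col (orth_sum (tensor_form A B) (tensor_form A' B))"
    then have ij: "i < (n + n') * m" "j < (n + n') * m"
      using orth_sum_carrier[OF T] by (auto simp: distrib_right)
    have m: "m > 0" using ij by (cases m) auto
    have k: "k div m < n + n'" if "k < (n + n') * m" for k using that by (simp add: less_mult_imp_div_less)
    have L: "tensor_form (orth_sum A A') B $$ (i, j) =
        orth_sum A A' $$ (i div m, j div m) * B $$ (i mod m, j mod m)"
      using ij O d by (simp add: tensor_form_def)
    have R: "orth_sum (tensor_form A B) (tensor_form A' B) $$ (i, j) =
      (if i < n * m then if j < n * m then A $$ (i div m, j div m) * B $$ (i mod m, j mod m) else 0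
       else if j < n * m then 0 else A' $$ (i div m - n, j div m - n) * B $$ (i mod m, j mod m))"
      using ij d T unfolding orth_sum_def tensor_form_def
      by (auto simp: distrib_right sub sub' not_less)
    show "tensor_form (orth_sum A A') B $$ (i, j) = orth_sum (tensor_form A B) (tensor_form A' B) $$ (i, j)"
      unfolding L R using d k[OF ij(1)] k[OF ij(2)] unfolding orth_sum_def by (auto simp: lt[OF m, symmetric])
  qed (use orth_sum_carrier[OF T] tensor_form_carrier[OF O d(3)] in \<open>auto simp: distrib_right\<close>)
qed

lemma tensor_form_single: "tensor_form (diag_form [a]) B = a \<cdot>\<^sub>m B" if "B \<in> symmetric_forms"
  using that by (intro eq_matI) (auto simp: tensor_form_def symmetric_forms_def)

lemma smult_orth_sum: "a \<cdot>\<^sub>m orth_sum A B = orth_sum (a \<cdot>\<^sub>m A) (a \<cdot>\<^sub>m B)"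
  if "A \<in> symmetric_forms" "B \<in> symmetric_forms"
  using that unfolding orth_sum_def symmetric_forms_def by (intro eq_matI) auto

lemma tensor_form_orth_sum_right:
  assumes "B \<in> symmetric_forms" "C \<in> symmetric_forms"
  shows "tensor_form (diag_form [a]) (orth_sum B C) = orth_sum (tensor_form (diag_form [a]) B) (tensor_form (diag_form [a]) C)"
  using assms by (simp add: tensor_form_single orth_sum_symmetric smult_orth_sum)

lemma tensor_form_uminus_right: "tensor_form (diag_form [a]) (- B) = - tensor_form (diag_form [a]) B"
  if "B \<in> symmetric_forms"
  using that by (simp add: tensor_form_single uminus_symmetric) (auto intro!: eq_matI)

lemma metabolic_tensor_single:
  assumes "metabolic B" "a \<noteq> 0" shows "metabolic (tensor_form (diag_form [a]) B)"
proof -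
  have B: "B \<in> symmetric_forms" using assms by (simp add: metabolic_iff)
  define n where "n = dim_row B"
  have c: "B \<in> carrier_mat n n" using B by (auto simp: n_def symmetric_forms_def)
  have T: "tensor_form (diag_form [a]) B = a \<cdot>\<^sub>m B" "tensor_form (diag_form [a]) B \<in> symmetric_forms"
    using tensor_form_single[OF B] tensor_form_symmetric[OF diag_form_symmetric B, of "[a]"] assms(2) by auto
  have bf: "bform (a \<cdot>\<^sub>m B) v w = a * bform B v w" if "v \<in> carrier_vec n" "w \<in> carrier_vec n" for v w
    unfolding bform_sum[OF smult_carrier_mat[OF c] that] bform_sum[OF c that] sum_distrib_left
    using c by (intro sum.cong refl) auto
  have "has_lagrangian (carrier_vec n) (bform B)" using assms(1) by (simp add: metabolic_iff n_def)
  then obtain N where N: "N = {v \<in> carrier_vec n. \<forall>w\<in>N. bform B v w = 0}" "N \<subseteq> carrier_vec n"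
    unfolding has_lagrangian_def by blast
  have "{v \<in> carrier_vec n. \<forall>w\<in>N. bform (a \<cdot>\<^sub>m B) v w = 0} = {v \<in> carrier_vec n. \<forall>w\<in>N. bform B v w = 0}"
    using bf N(2) assms(2) by (auto simp: subset_iff)
  then have "N = {v \<in> carrier_vec n. \<forall>w\<in>N. bform (a \<cdot>\<^sub>m B) v w = 0}" using N(1) by simp
  then show ?thesis using T N(2) c unfolding metabolic_iff has_lagrangian_def by auto
qed

lemma witt_equiv_tensor_left:
  assumes "(A, A') \<in> witt_equiv" "B \<in> symmetric_forms"
  shows "(tensor_form A B, tensor_form A' B) \<in> witt_equiv"
proof -
  have s: "A \<in> symmetric_forms" "A' \<in> symmetric_forms" and m: "metabolic (orth_sum A (- A'))"
    using assms by (auto simp: witt_equiv_iff)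
  show ?thesis
    using metabolic_tensor_form[OF m assms(2)] s assms(2)
    by (simp add: witt_equiv_iff tensor_form_symmetric tensor_form_orth_sum_left uminus_symmetric tensor_form_uminus_left)
qed

lemma witt_equiv_tensor_single:
  assumes "(B, B') \<in> witt_equiv" "a \<noteq> 0"
  shows "(tensor_form (diag_form [a]) B, tensor_form (diag_form [a]) B') \<in> witt_equiv"
proof -
  have s: "B \<in> symmetric_forms" "B' \<in> symmetric_forms" and m: "metabolic (orth_sum B (- B'))"
    using assms by (auto simp: witt_equiv_iff)
  show ?thesis
    using metabolic_tensor_single[OF m assms(2)] s assms(2)
    by (simp add: witt_equiv_iff tensor_form_symmetric tensor_form_orth_sum_right uminus_symmetric tensor_form_uminus_right)
qed

lemma witt_class_tensor_Cons:
  assumes "0 \<notin> set (a # l)" "B \<in> symmetric_forms"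
  shows "witt_class_of_form (tensor_form (diag_form (a # l)) B) =
    witt_class_of_form (tensor_form (diag_form [a]) B) \<oplus>\<^bsub>witt_ring\<^esub> witt_class_of_form (tensor_form (diag_form l) B)"
  using assms tensor_form_orth_sum_left[of "diag_form [a]" "diag_form l" B]
  by (simp add: diag_form_append witt_add tensor_form_symmetric)

text \<open>The left factor is replaced by an equivalent diagonal form. For each of its
  one-dimensional summands, tensoring is a rescaling, which respects Witt equivalence in the right
  factor.\<close>

lemma witt_equiv_tensor_right:
  assumes "A \<in> symmetric_forms" "(B, B') \<in> witt_equiv"
  shows "witt_class_of_form (tensor_form A B) = witt_class_of_form (tensor_form A B')"
proof -
  have s: "B \<in> symmetric_forms" "B' \<in> symmetric_forms" using assms by (auto simp: witt_equiv_iff)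
  obtain l where l: "0 \<notin> set l" "witt_class_of_form A = witt_sum l"
    using witt_diagonalise[OF assms(1)[unfolded symmetric_forms_iff]] by metis
  have Al: "(A, diag_form l) \<in> witt_equiv"
    using l witt_class_eq_iff[OF assms(1) diag_form_symmetric[OF l(1)]] assms(1)
    by (simp add: witt_sum_eq witt_equiv_iff)
  have 1: "witt_class_of_form (tensor_form A C) = witt_class_of_form (tensor_form (diag_form l) C)"
    if "C \<in> symmetric_forms" for C by (rule witt_class_cong[OF witt_equiv_tensor_left[OF Al that]])
  have e: "tensor_form (diag_form []) C = 0\<^sub>m 0 0" for C :: "'a mat" by (rule eq_matI) (auto simp: tensor_form_def)
  have "witt_class_of_form (tensor_form (diag_form l) B) = witt_class_of_form (tensor_form (diag_form l) B')"
    using l(1)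
  proof (induction l)
    case (Cons a l)
    then show ?case
      using witt_class_tensor_Cons[OF Cons.prems s(1)] witt_class_tensor_Cons[OF Cons.prems s(2)]
        witt_class_cong[OF witt_equiv_tensor_single[OF assms(2), of a]] by simp
  qed (simp add: e)
  then show ?thesis using 1 s by simp
qed

lemma witt_mult:
  assumes "A \<in> symmetric_forms" "B \<in> symmetric_forms"
  shows "witt_class_of_form A \<otimes>\<^bsub>witt_ring\<^esub> witt_class_of_form B = witt_class_of_form (tensor_form A B)"
proof -
  have "witt_class_of_form (tensor_form A' B') = witt_class_of_form (tensor_form A B)"
    if "(A, A') \<in> witt_equiv" "(B, B') \<in> witt_equiv" for A' B'
  proof -
    have "A' \<in> symmetric_forms" using that by (simp add: witt_equiv_iff)
    then show ?thesis
      using witt_class_cong[OF witt_equiv_tensor_left[OF that(1) assms(2)]] witt_equiv_tensor_right[OF _ that(2)] by simp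
  qed
  then have 1: "(\<Union>B'\<in>witt_class_of_form B. witt_class_of_form (tensor_form A' B')) = witt_class_of_form (tensor_form A B)"
    if "(A, A') \<in> witt_equiv" for A'
    by (intro UN_constant_eq[of B]) (use that witt_refl[OF assms(2)] in \<open>simp_all add: witt_class_mem\<close>)
  have "(\<Union>A'\<in>witt_class_of_form A. \<Union>B'\<in>witt_class_of_form B. witt_class_of_form (tensor_form A' B')) =
      witt_class_of_form (tensor_form A B)"
    by (rule UN_constant_eq[of A]) (use 1 witt_refl[OF assms(1)] in \<open>simp_all add: witt_class_mem\<close>)
  then show ?thesis by (simp add: witt_ring_def)
qed

section \<open>The ring axioms, checked on diagonal representatives\<close>

lemma witt_carrier_sum: "x \<in> carrier witt_ring \<longleftrightarrow> (\<exists>l. 0 \<notin> set l \<and> x = witt_sum l)"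
proof
  assume "x \<in> carrier witt_ring"
  then obtain A where "A \<in> symmetric_forms" "x = witt_class_of_form A" by (auto simp: witt_carrier)
  then show "\<exists>l. 0 \<notin> set l \<and> x = witt_sum l"
    using witt_diagonalise[of A "dim_row A"] symmetric_forms_iff[of A] by metis
qed auto

lemma witt_l_distr:
  assumes "x \<in> carrier witt_ring" "y \<in> carrier witt_ring" "z \<in> carrier witt_ring"
  shows "(x \<oplus>\<^bsub>witt_ring\<^esub> y) \<otimes>\<^bsub>witt_ring\<^esub> z = x \<otimes>\<^bsub>witt_ring\<^esub> z \<oplus>\<^bsub>witt_ring\<^esub> y \<otimes>\<^bsub>witt_ring\<^esub> z"
proof -
  obtain A B C where s: "A \<in> symmetric_forms" "B \<in> symmetric_forms" "C \<in> symmetric_forms"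
    and e: "x = witt_class_of_form A" "y = witt_class_of_form B" "z = witt_class_of_form C"
    using assms by (auto simp: witt_carrier)
  show ?thesis
    by (simp add: s e witt_add witt_mult orth_sum_symmetric tensor_form_symmetric tensor_form_orth_sum_left)
qed

lemma witt_mult_closed:
  "x \<in> carrier witt_ring \<Longrightarrow> y \<in> carrier witt_ring \<Longrightarrow> x \<otimes>\<^bsub>witt_ring\<^esub> y \<in> carrier witt_ring"
  by (auto simp: witt_carrier witt_mult tensor_form_symmetric)

lemma witt_rank1_mult:
  fixes a b :: "'a::field"
  assumes "a \<noteq> 0" "b \<noteq> 0"
  shows "witt_rank1 a \<otimes>\<^bsub>witt_ring\<^esub> witt_rank1 b = witt_rank1 (a * b)"
proof -
  have "tensor_form (diag_form [a]) (diag_form [b]) = diag_form [a * b]"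
    by (rule eq_matI) (auto simp: tensor_form_def)
  then show ?thesis using assms by (simp add: witt_rank1_eq witt_mult)
qed

lemma witt_single_r_distr:
  assumes "a \<noteq> 0" "x \<in> carrier witt_ring" "y \<in> carrier witt_ring"
  shows "witt_rank1 a \<otimes>\<^bsub>witt_ring\<^esub> (x \<oplus>\<^bsub>witt_ring\<^esub> y) =
    witt_rank1 a \<otimes>\<^bsub>witt_ring\<^esub> x \<oplus>\<^bsub>witt_ring\<^esub> witt_rank1 a \<otimes>\<^bsub>witt_ring\<^esub> y"
proof -
  obtain A B where s: "A \<in> symmetric_forms" "B \<in> symmetric_forms"
    and e: "x = witt_class_of_form A" "y = witt_class_of_form B"
    using assms by (auto simp: witt_carrier)
  show ?thesis
    using assms(1) by (simp add: s e witt_rank1_eq witt_add witt_mult orth_sum_symmetric tensor_form_symmetric tensor_form_orth_sum_right)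
qed

lemma witt_zero_mult: "x \<in> carrier witt_ring \<Longrightarrow> \<zero>\<^bsub>witt_ring\<^esub> \<otimes>\<^bsub>witt_ring\<^esub> x = \<zero>\<^bsub>witt_ring\<^esub>"
  using witt_l_distr[of "\<zero>\<^bsub>witt_ring\<^esub>" "\<zero>\<^bsub>witt_ring\<^esub>" x] witt_mult_closed[of "\<zero>\<^bsub>witt_ring\<^esub>" x]
  by (metis W.l_zero W.zero_closed W.add.l_cancel_one)

lemma witt_rank1_mult_sum:
  "a \<noteq> 0 \<Longrightarrow> 0 \<notin> set l \<Longrightarrow> witt_rank1 a \<otimes>\<^bsub>witt_ring\<^esub> witt_sum l = witt_sum (map ((*) a) l)"
proof (induction l)
  case Nil
  then have "witt_rank1 a \<otimes>\<^bsub>witt_ring\<^esub> \<zero>\<^bsub>witt_ring\<^esub> =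
      witt_rank1 a \<otimes>\<^bsub>witt_ring\<^esub> \<zero>\<^bsub>witt_ring\<^esub> \<oplus>\<^bsub>witt_ring\<^esub> witt_rank1 a \<otimes>\<^bsub>witt_ring\<^esub> \<zero>\<^bsub>witt_ring\<^esub>"
    using witt_single_r_distr[of a "\<zero>\<^bsub>witt_ring\<^esub>" "\<zero>\<^bsub>witt_ring\<^esub>"] by simp
  then show ?case using witt_mult_closed[of "witt_rank1 a" "\<zero>\<^bsub>witt_ring\<^esub>"] by (simp add: W.add.l_cancel_one)
qed (auto simp: witt_single_r_distr witt_rank1_mult)

lemma witt_sum_mult_rank1:
  "a \<noteq> 0 \<Longrightarrow> 0 \<notin> set l \<Longrightarrow> witt_sum l \<otimes>\<^bsub>witt_ring\<^esub> witt_rank1 a = witt_sum (map ((*) a) l)"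
  by (induction l) (auto simp: witt_zero_mult witt_l_distr witt_rank1_mult mult.commute)

text \<open>Right distributivity in general (\<open>r\<close> in the proof) comes from diagonalising
  the left factor, since it is known for \<open>witt_rank1\<close>. After that both factors are sums
  of one-dimensional classes, where the product is multiplication of scalars.\<close>

lemma witt_mult_comm:
  assumes "x \<in> carrier witt_ring" "y \<in> carrier witt_ring"
  shows "x \<otimes>\<^bsub>witt_ring\<^esub> y = y \<otimes>\<^bsub>witt_ring\<^esub> x"
proof -
  obtain k where k: "0 \<notin> set k" "y = witt_sum k" using assms(2) unfolding witt_carrier_sum by blast
  obtain A where A: "A \<in> symmetric_forms" "x = witt_class_of_form A" using assms(1) by (auto simp: witt_carrier)
  obtain l where l: "0 \<notin> set l" "x = witt_sum l" using assms(1) unfolding witt_carrier_sum by blast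
  have r: "u \<otimes>\<^bsub>witt_ring\<^esub> (v \<oplus>\<^bsub>witt_ring\<^esub> w) = u \<otimes>\<^bsub>witt_ring\<^esub> v \<oplus>\<^bsub>witt_ring\<^esub> u \<otimes>\<^bsub>witt_ring\<^esub> w"
    if "u \<in> carrier witt_ring" "v \<in> carrier witt_ring" "w \<in> carrier witt_ring" for u v w :: "'a mat set"
  proof -
    from that(1) obtain h where h: "0 \<notin> set h" "u = witt_sum h" unfolding witt_carrier_sum by blast
    show ?thesis unfolding h(2) using h(1)
    proof (induction h)
      case (Cons a h)
      then show ?case using that
        by (auto simp: witt_l_distr witt_single_r_distr witt_mult_closed W.a_ac)
    qed (simp add: witt_zero_mult that)
  qed
  have z: "u \<otimes>\<^bsub>witt_ring\<^esub> \<zero>\<^bsub>witt_ring\<^esub> = \<zero>\<^bsub>witt_ring\<^esub>" if "u \<in> carrier witt_ring" for u :: "'a mat set"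
    using r[OF that, of "\<zero>\<^bsub>witt_ring\<^esub>" "\<zero>\<^bsub>witt_ring\<^esub>"] witt_mult_closed[OF that, of "\<zero>\<^bsub>witt_ring\<^esub>"]
    by (simp add: W.add.l_cancel_one)
  show ?thesis unfolding l(2) k(2) using l(1)
  proof (induction l)
    case (Cons a l)
    then show ?case using k(1)
      by (auto simp: witt_l_distr r witt_rank1_mult_sum witt_sum_mult_rank1)
  qed (simp add: witt_zero_mult z)
qed

lemma witt_mult_assoc:
  assumes "x \<in> carrier witt_ring" "y \<in> carrier witt_ring" "z \<in> carrier witt_ring"
  shows "x \<otimes>\<^bsub>witt_ring\<^esub> y \<otimes>\<^bsub>witt_ring\<^esub> z = x \<otimes>\<^bsub>witt_ring\<^esub> (y \<otimes>\<^bsub>witt_ring\<^esub> z)"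
proof -
  obtain l k h where l: "0 \<notin> set l" "x = witt_sum l" and k: "0 \<notin> set k" "y = witt_sum k"
    and h: "0 \<notin> set h" "z = witt_sum h" using assms unfolding witt_carrier_sum by blast
  have 1: "witt_rank1 a \<otimes>\<^bsub>witt_ring\<^esub> witt_sum k \<otimes>\<^bsub>witt_ring\<^esub> witt_sum h =
      witt_rank1 a \<otimes>\<^bsub>witt_ring\<^esub> (witt_sum k \<otimes>\<^bsub>witt_ring\<^esub> witt_sum h)" if a: "a \<noteq> 0" for a
    using k(1)
  proof (induction k)
    case (Cons b k)
    then have b: "b \<noteq> 0" "0 \<notin> set k" by auto
    have "witt_rank1 (a * b) \<otimes>\<^bsub>witt_ring\<^esub> witt_sum h = witt_rank1 a \<otimes>\<^bsub>witt_ring\<^esub> (witt_rank1 b \<otimes>\<^bsub>witt_ring\<^esub> witt_sum h)"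
      using a b h(1) arg_cong[of "map ((*) (a * b)) h" "map (\<lambda>x. a * (b * x)) h" witt_sum]
      by (simp add: witt_rank1_mult_sum image_iff o_def mult.assoc)
    then show ?case using Cons a b
      by (simp add: witt_single_r_distr witt_l_distr witt_mult_closed witt_rank1_mult)
  next
    case Nil
    then show ?case using a witt_rank1_mult_sum[of a "[]"] by (simp add: witt_zero_mult)
  qed
  show ?thesis unfolding l(2) k(2) h(2) using l(1)
    by (induction l) (auto simp: witt_l_distr witt_mult_closed witt_zero_mult 1)
qed

lemma witt_cring: "cring (witt_ring :: 'a::field mat set ring)"
proof (rule cringI)
  show "abelian_group witt_ring" by (rule witt_abelian_group)
  show "comm_monoid (witt_ring :: 'a mat set ring)"
  proof (rule comm_monoidI)
    have one: "\<one>\<^bsub>witt_ring\<^esub> = witt_rank1 (1 :: 'a)" by (simp add: witt_ring_def)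
    show "\<one>\<^bsub>witt_ring\<^esub> \<in> (carrier witt_ring :: 'a mat set set)" by (simp add: one)
    show "\<one>\<^bsub>witt_ring\<^esub> \<otimes>\<^bsub>witt_ring\<^esub> x = x" if "x \<in> carrier witt_ring" for x :: "'a mat set"
    proof -
      from that obtain l where "0 \<notin> set l" "x = witt_sum l" unfolding witt_carrier_sum by blast
      then show ?thesis using witt_rank1_mult_sum[of "1 :: 'a" l] map_idI[of l "(*) 1"]
        by (simp add: one)
    qed
  qed (fact witt_mult_closed witt_mult_assoc witt_mult_comm)+
qed (rule witt_l_distr)

section \<open>The square of the fundamental ideal\<close>

interpretation WR: cring "witt_ring :: 'a::field mat set ring"
  by (rule witt_cring)

definition unit_diff :: "'a::field \<Rightarrow> 'a mat set"
  where "unit_diff a = witt_rank1 1 \<ominus>\<^bsub>witt_ring\<^esub> witt_rank1 a"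

text \<open>The class of the Pfister form <<a, b>> = <1, -a, -b, ab>, in the sign convention <<a>> =
  <1, -a>.\<close>

definition pfister :: "'a::field \<Rightarrow> 'a \<Rightarrow> 'a mat set"
  where "pfister a b = unit_diff a \<otimes>\<^bsub>witt_ring\<^esub> unit_diff b"

lemma unit_diff_closed [simp]: "unit_diff a \<in> carrier witt_ring"
  by (simp add: unit_diff_def)

lemma pfister_closed [simp]: "pfister a b \<in> carrier witt_ring"
  by (simp add: pfister_def)

lemma pfister_eq_sum:
  "a \<noteq> 0 \<Longrightarrow> b \<noteq> 0 \<Longrightarrow> pfister a b = witt_sum [1, - a, - b, a * b]"
proof -
  assume ab: "a \<noteq> 0" "b \<noteq> 0"
  have "pfister a b = (witt_rank1 1 \<oplus>\<^bsub>witt_ring\<^esub> witt_rank1 (- a)) \<otimes>\<^bsub>witt_ring\<^esub> (witt_rank1 1 \<oplus>\<^bsub>witt_ring\<^esub> witt_rank1 (- b))"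
    by (simp add: pfister_def unit_diff_def a_minus_def witt_rank1_inv)
  also have "\<dots> = witt_sum [1, - a, - b, a * b]"
    using ab by (simp add: WR.l_distr WR.r_distr witt_rank1_mult W.a_ac)
  finally show ?thesis .
qed

lemma unit_diff_eq_sum: "unit_diff a = witt_sum [1, - a]"
  by (simp add: unit_diff_def a_minus_def witt_rank1_inv)

lemma unit_diff_fundamental: "a \<noteq> 0 \<Longrightarrow> unit_diff a \<in> fundamental_ideal"
  unfolding fundamental_ideal_def
  by (auto simp: unit_diff_eq_sum witt_sum_eq simp del: witt_sum_Cons intro!: exI[of _ "diag_form [1, - a]"])

text \<open>Entries are taken off in pairs: [a] + [b] = -(1 - [a]) + (1 - [-b]).\<close>

lemma witt_sum_even:
  "0 \<notin> set l \<Longrightarrow> length l = 2 * k \<Longrightarrow>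
    witt_sum l \<in> generate (add_monoid witt_ring) (unit_diff ` {a. a \<noteq> 0})"
proof (induction k arbitrary: l)
  case 0
  then show ?case using generate.one[of "add_monoid witt_ring"] by simp
next
  case (Suc k)
  let ?G = "generate (add_monoid witt_ring) (unit_diff ` {a :: 'a. a \<noteq> 0})"
  obtain a b m where l: "l = a # b # m" using Suc.prems(2) by (cases l; cases "tl l") auto
  have ab: "a \<noteq> 0" "b \<noteq> 0" using Suc.prems l by auto
  have m: "witt_sum m \<in> ?G" using Suc l by auto
  have 1: "unit_diff (- b) \<in> ?G" using ab by (intro generate.incl) auto
  have 2: "\<ominus>\<^bsub>witt_ring\<^esub> unit_diff a \<in> ?G"
    using ab generate.inv[of "unit_diff a" "unit_diff ` {a. a \<noteq> 0}" "add_monoid witt_ring"] by (simp add: a_inv_def)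
  have "witt_sum l = (\<ominus>\<^bsub>witt_ring\<^esub> unit_diff a \<oplus>\<^bsub>witt_ring\<^esub> unit_diff (- b)) \<oplus>\<^bsub>witt_ring\<^esub> witt_sum m"
    unfolding l unit_diff_def a_minus_def witt_rank1_inv witt_sum_Cons
    using witt_rank1_closed[of a] witt_rank1_closed[of b] witt_rank1_closed[of "1::'a"] witt_sum_closed[of m]
    by algebra
  then show ?case using generate.eng[OF generate.eng[OF 2 1] m] by simp
qed

text \<open>Diagonalisation raises the dimension by 2 and so keeps it even.\<close>

lemma fundamental_ideal_generate:
  "fundamental_ideal \<subseteq> generate (add_monoid witt_ring) (unit_diff ` {a :: 'a::field. a \<noteq> 0})"
proof
  fix x :: "'a mat set" assume "x \<in> fundamental_ideal"
  then obtain A where A: "x = witt_class_of_form A" "A \<in> symmetric_forms" "even (dim_row A)"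
    unfolding fundamental_ideal_def by blast
  obtain l where l: "0 \<notin> set l" "length l = dim_row A + 2" "x = witt_sum l"
    using witt_diagonalise[of A "dim_row A"] A symmetric_forms_iff[of A] by metis
  have "even (length l)" using l A by simp
  then obtain k where "length l = 2 * k" by blast
  then show "x \<in> generate (add_monoid witt_ring) (unit_diff ` {a. a \<noteq> 0})"
    unfolding l(3) by (rule witt_sum_even[OF l(1)])
qed

lemma generate_additive_map:
  fixes \<phi> :: "'a::field mat set \<Rightarrow> 'a mat set"
  assumes x: "x \<in> generate (add_monoid witt_ring) U" and U: "U \<subseteq> carrier witt_ring"
    and add: "\<And>x y. x \<in> carrier witt_ring \<Longrightarrow> y \<in> carrier witt_ring \<Longrightarrow> \<phi> (x \<oplus>\<^bsub>witt_ring\<^esub> y) = \<phi> x \<oplus>\<^bsub>witt_ring\<^esub> \<phi> y"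
    and inv: "\<And>x. x \<in> carrier witt_ring \<Longrightarrow> \<phi> (\<ominus>\<^bsub>witt_ring\<^esub> x) = \<ominus>\<^bsub>witt_ring\<^esub> \<phi> x"
    and zero: "\<phi> \<zero>\<^bsub>witt_ring\<^esub> = \<zero>\<^bsub>witt_ring\<^esub>"
    and P: "subgroup P (add_monoid witt_ring)" and \<phi>: "\<And>u. u \<in> U \<Longrightarrow> \<phi> u \<in> P"
  shows "\<phi> x \<in> P"
  using x
proof (induction rule: generate.induct)
  case one
  then show ?case using subgroup.one_closed[OF P] zero by simp
next
  case (incl h)
  then show ?case by (rule \<phi>)
next
  case (inv h)
  then show ?case using subgroup.m_inv_closed[OF P \<phi>[OF inv]] assms(4)[of h] U by (auto simp: a_inv_def)
next
  case (eng h1 h2)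
  have "h1 \<in> carrier witt_ring" "h2 \<in> carrier witt_ring"
    using eng.hyps W.add.generate_in_carrier[OF U] by auto
  then show ?case using subgroup.m_closed[OF P eng.IH] add by simp
qed

definition pfister_set :: "'a::field mat set set"
  where "pfister_set = {pfister a b | a b. a \<noteq> 0 \<and> b \<noteq> 0}"

lemma pfister_set_carrier: "pfister_set \<subseteq> carrier witt_ring"
  by (auto simp: pfister_set_def)

text \<open>The fundamental ideal is additively generated by the classes 1 - [a], so its square is
  additively generated by their products. The additivity argument is applied to one factor at a
  time.\<close>

lemma I2_carrier: "carrier I2_group = generate (add_monoid witt_ring) (pfister_set :: 'a::field mat set set)"
proof -
  let ?I = "ideal_prod witt_ring fundamental_ideal fundamental_ideal :: 'a mat set set"
  let ?U = "unit_diff ` {a :: 'a. a \<noteq> 0}"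
  let ?P = "generate (add_monoid witt_ring) (pfister_set :: 'a mat set set)"
  have P: "subgroup ?P (add_monoid witt_ring)" by (rule W.add.generate_is_subgroup[OF pfister_set_carrier])
  have U: "?U \<subseteq> carrier witt_ring" by auto
  have Uc: "x \<in> carrier witt_ring" if "x \<in> generate (add_monoid witt_ring) ?U" for x
    using W.add.generate_in_carrier[OF U that] .
  have 1: "x \<otimes>\<^bsub>witt_ring\<^esub> unit_diff b \<in> ?P" if "x \<in> generate (add_monoid witt_ring) ?U" "b \<noteq> 0" for x and b :: 'a
    by (rule generate_additive_map[OF that(1) U, of "\<lambda>x. x \<otimes>\<^bsub>witt_ring\<^esub> unit_diff b", OF _ _ _ P])
      (use that(2) in \<open>auto simp: WR.l_distr WR.l_minus pfister_set_def pfister_def intro!: generate.incl\<close>)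
  have 2: "x \<otimes>\<^bsub>witt_ring\<^esub> y \<in> ?P"
    if x: "x \<in> generate (add_monoid witt_ring) ?U" and y: "y \<in> generate (add_monoid witt_ring) ?U" for x y
    by (rule generate_additive_map[OF y U, of "\<lambda>y. x \<otimes>\<^bsub>witt_ring\<^esub> y", OF _ _ _ P])
      (use Uc[OF x] 1[OF x] in \<open>auto simp: WR.r_distr WR.r_minus\<close>)
  have "x \<in> ?P" if "x \<in> ?I" for x
    using that
  proof (induction rule: ideal_prod.induct)
    case (prod i j)
    then show ?case using 2 fundamental_ideal_generate by blast
  next
    case (sum s1 s2)
    then show ?case using subgroup.m_closed[OF P] by simp
  qed
  moreover have "x \<in> ?I" if "x \<in> ?P" for x
    using that
  proof (induction rule: generate.induct)
    case one
    \<comment> \<open>\<open>ideal_prod\<close> is built from products and sums alone. Zero is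
      obtained as the product of 1 - [1] with itself, and for negatives one uses that -(1 - [a]) is
      the class of <-1, a>, again of even rank.\<close>
    have "unit_diff 1 \<otimes>\<^bsub>witt_ring\<^esub> unit_diff 1 \<in> ?I"
      by (rule ideal_prod.prod) (auto intro: unit_diff_fundamental)
    moreover have "unit_diff (1 :: 'a) = \<zero>\<^bsub>witt_ring\<^esub>" using W.r_neg[of "witt_rank1 1"] by (simp add: unit_diff_def a_minus_def)
    ultimately show ?case by simp
  next
    case (incl h)
    then show ?case by (auto simp: pfister_set_def pfister_def intro!: ideal_prod.prod unit_diff_fundamental)
  next
    case (inv h)
    then obtain a b :: 'a where h: "h = pfister a b" "a \<noteq> 0" "b \<noteq> 0" by (auto simp: pfister_set_def)
    have "\<ominus>\<^bsub>witt_ring\<^esub> unit_diff a \<in> fundamental_ideal"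
      unfolding fundamental_ideal_def
      using h(2) by (auto simp: unit_diff_def witt_sum_eq[symmetric] a_minus_def W.minus_add witt_rank1_inv[symmetric]
          simp del: witt_rank1_inv intro!: exI[of _ "diag_form [- 1, a]"])
    then have "\<ominus>\<^bsub>witt_ring\<^esub> unit_diff a \<otimes>\<^bsub>witt_ring\<^esub> unit_diff b \<in> ?I"
      using h(3) by (intro ideal_prod.prod unit_diff_fundamental)
    then show ?case by (simp add: h pfister_def WR.l_minus) (simp add: a_inv_def)
  next
    case (eng h1 h2)
    then show ?case using ideal_prod.sum[OF eng.IH] by simp
  qed
  ultimately show ?thesis by (auto simp: I2_group_def)
qed

lemma I2_simps [simp]:
  "monoid.mult I2_group = add witt_ring" "one I2_group = \<zero>\<^bsub>witt_ring\<^esub>"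
  by (simp_all add: I2_group_def)

lemma I2_subgroup: "subgroup (carrier I2_group) (add_monoid (witt_ring :: 'a::field mat set ring))"
  unfolding I2_carrier by (rule W.add.generate_is_subgroup[OF pfister_set_carrier])

lemma I2_comm_group: "comm_group (I2_group :: 'a::field mat set monoid)"
proof -
  have "group ((add_monoid witt_ring)\<lparr>carrier := carrier (I2_group :: 'a mat set monoid)\<rparr>)"
    by (rule subgroup.subgroup_is_group[OF I2_subgroup W.add.is_group])
  then have "group (I2_group :: 'a mat set monoid)" by (simp add: I2_group_def)
  then show ?thesis
    by (rule group.group_comm_groupI) (use subgroup.subset[OF I2_subgroup] in \<open>auto intro!: W.a_comm\<close>)
qed

lemma I2_inv: "x \<in> carrier I2_group \<Longrightarrow> inv\<^bsub>I2_group\<^esub> x = \<ominus>\<^bsub>witt_ring\<^esub> x"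
  using W.add.m_inv_consistent[OF I2_subgroup] by (simp add: I2_group_def)

lemma I2_subset: "x \<in> carrier I2_group \<Longrightarrow> x \<in> carrier witt_ring"
  using subgroup.subset[OF I2_subgroup] by auto

lemma pfister_I2 [simp]: "a \<noteq> 0 \<Longrightarrow> b \<noteq> 0 \<Longrightarrow> pfister a b \<in> carrier I2_group"
  unfolding I2_carrier by (rule generate.incl) (auto simp: pfister_set_def)

section \<open>A presentation of \<open>I\<^sup>2(K)\<close>\<close>

text \<open>A metabolic diagonal form of positive dimension has a nonzero vector in its Lagrangian,
  for if the Lagrangian were zero its complement would be everything. Such a vector is orthogonal to
  itself.\<close>

lemma isotropic_vector:
  fixes l :: "'a::field list"
  assumes "0 \<notin> set l" "l \<noteq> []" "witt_sum l = \<zero>\<^bsub>witt_ring\<^esub>"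
  obtains vs where "length vs = length l" "\<exists>v\<in>set vs. v \<noteq> 0" "sum_list (map2 (\<lambda>a v. a * v\<^sup>2) l vs) = 0"
proof -
  define n where "n = length l"
  have f: "diag_form l \<in> forms n" unfolding n_def by (rule diag_form_forms[OF assms(1)])
  have "metabolic (diag_form l)"
    using assms(3) witt_class_eq_0_iff[OF diag_form_symmetric[OF assms(1)]] by (simp add: witt_sum_eq[OF assms(1)] witt_zero)
  then have "has_lagrangian (carrier_vec n) (bform (diag_form l))" by (simp add: metabolic_iff n_def)
  then obtain N where N: "N = {v \<in> carrier_vec n. \<forall>w\<in>N. bform (diag_form l) v w = 0}" "N \<subseteq> carrier_vec n"
    unfolding has_lagrangian_def by blast
  have "\<exists>v\<in>N. v \<noteq> 0\<^sub>v n"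
  proof (rule ccontr)
    assume "\<not> ?thesis"
    then have 0: "w = 0\<^sub>v n" if "w \<in> N" for w using that by blast
    have "unit_vec n 0 \<in> N"
    proof (subst N(1), intro CollectI conjI ballI)
      fix w assume "w \<in> N"
      then show "bform (diag_form l) (unit_vec n 0) w = 0" using 0[of w] bform_zero_right[OF f] by simp
    qed simp
    then have "unit_vec n 0 = (0\<^sub>v n :: 'a vec)" by (rule 0)
    then have "unit_vec n 0 $ 0 = (0\<^sub>v n :: 'a vec) $ 0" by simp
    then show False using assms(2) by (simp add: n_def)
  qed
  then obtain v where v: "v \<in> N" "v \<noteq> 0\<^sub>v n" by blast
  have vc: "v \<in> carrier_vec n" using v(1) N(2) by blast
  have "v \<in> {v \<in> carrier_vec n. \<forall>w\<in>N. bform (diag_form l) v w = 0}" using v(1) N(1) by simp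
  then have "bform (diag_form l) v v = 0" using v(1) by blast
  then have *: "(\<Sum>i<n. l ! i * (v $ i * v $ i)) = 0" using vc by (simp add: bform_diag_form n_def)
  show thesis
  proof (rule that[of "list_of_vec v"])
    show "length (list_of_vec v) = length l" using vc by (simp add: n_def)
    have "\<exists>i<n. v $ i \<noteq> 0"
    proof (rule ccontr)
      assume "\<not> ?thesis"
      then have "v = 0\<^sub>v n" using vc by (intro eq_vecI) auto
      then show False using v(2) by simp
    qed
    then show "\<exists>v\<in>set (list_of_vec v). v \<noteq> 0" using vc by (metis carrier_vecD length_list_of_vec list_of_vec_index nth_mem)
    have "map2 (\<lambda>a v. a * v\<^sup>2) l (list_of_vec v) = map (\<lambda>i. l ! i * (v $ i * v $ i)) [0..<n]"
      by (rule nth_equalityI) (use vc in \<open>auto simp: n_def power2_eq_square list_of_vec_index\<close>)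
    then have "sum_list (map2 (\<lambda>a v. a * v\<^sup>2) l (list_of_vec v)) = (\<Sum>i<n. l ! i * (v $ i * v $ i))"
      by (simp add: sum_list_distinct_conv_sum_set atLeast0LessThan interv_sum_list_conv_sum_set_nat)
    then show "sum_list (map2 (\<lambda>a v. a * v\<^sup>2) l (list_of_vec v)) = 0" using * by simp
  qed
qed

text \<open>The relations presenting I^2(K). They hold for \<open>pfister\<close>: both sides of
  \<open>cocycle\<close> become 2[1] - [a] - [b] - [c] + [abc], \<open>neg_inverse\<close> is the
  hyperbolicity of <1, -a, 1/a, -1>, and \<open>add\<close> reflects the isometry of <a, b> with <a
  + b, ab(a + b)>.\<close>

locale pfister_symbol = A: comm_group A for A (structure) +
  fixes \<sigma> :: "'k::field \<Rightarrow> 'k \<Rightarrow> 'b"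
  assumes closed [simp, intro]: "a \<noteq> 0 \<Longrightarrow> b \<noteq> 0 \<Longrightarrow> \<sigma> a b \<in> carrier A"
    and cocycle: "a \<noteq> 0 \<Longrightarrow> b \<noteq> 0 \<Longrightarrow> c \<noteq> 0 \<Longrightarrow> \<sigma> b c \<otimes> \<sigma> a (b * c) = \<sigma> a b \<otimes> \<sigma> (a * b) c"
    and sym: "a \<noteq> 0 \<Longrightarrow> b \<noteq> 0 \<Longrightarrow> \<sigma> a b = \<sigma> b a"
    and square: "a \<noteq> 0 \<Longrightarrow> b \<noteq> 0 \<Longrightarrow> \<sigma> a (b\<^sup>2) = \<one>"
    and neg_inverse: "a \<noteq> 0 \<Longrightarrow> \<sigma> a (- (1 / a)) = \<one>"
    and add: "a \<noteq> 0 \<Longrightarrow> b \<noteq> 0 \<Longrightarrow> a + b \<noteq> 0 \<Longrightarrow> \<sigma> a b = \<sigma> (a + b) (a * b / (a + b))"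
begin

lemma one_right [simp]: "a \<noteq> 0 \<Longrightarrow> \<sigma> a 1 = \<one>"
  using square[of a 1] by simp

lemma one_left [simp]: "a \<noteq> 0 \<Longrightarrow> \<sigma> 1 a = \<one>"
  using sym[of 1 a] by simp

lemma square_right: "a \<noteq> 0 \<Longrightarrow> b \<noteq> 0 \<Longrightarrow> c \<noteq> 0 \<Longrightarrow> \<sigma> a (b * c\<^sup>2) = \<sigma> a b"
  using cocycle[of a b "c\<^sup>2"] square[of b c] square[of "a * b" c] by simp

lemma square_left: "a \<noteq> 0 \<Longrightarrow> b \<noteq> 0 \<Longrightarrow> c \<noteq> 0 \<Longrightarrow> \<sigma> (a * c\<^sup>2) b = \<sigma> a b"
  using square_right[of b a c] sym[of "a * c\<^sup>2" b] sym[of a b] by simp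

lemma neg_right: "a \<noteq> 0 \<Longrightarrow> \<sigma> a (- a) = \<one>"
  using square_right[of a "- (1 / a)" a] neg_inverse[of a] by (simp add: power2_eq_square)

lemma add': "a \<noteq> 0 \<Longrightarrow> b \<noteq> 0 \<Longrightarrow> a + b \<noteq> 0 \<Longrightarrow> \<sigma> (a + b) (a * b * (a + b)) = \<sigma> a b"
  using square_right[of "a + b" "a * b / (a + b)" "a + b"] add[of a b] by (simp add: power2_eq_square mult.assoc)

text \<open>The counterpart of <<a, -ab>> = <<a, b>>. The cocycle relation at (a, b, -b) writes
  \<sigma>(a, -1) as \<sigma>(a, b) times \<sigma>(ab, -b); replacing b by -ab gives the same second
  factor and \<sigma>(a, -ab) as the first.\<close>

lemma mult_neg_right:
  assumes "a \<noteq> 0" "b \<noteq> 0" shows "\<sigma> a (- (a * b)) = \<sigma> a b"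
proof -
  have 1: "\<sigma> a (- 1) = \<sigma> a b \<otimes> \<sigma> (a * b) (- b)" if "b \<noteq> 0" for b
    using cocycle[of a b "- b"] neg_right[of b] square_right[of a "- 1" b] assms that by (simp add: power2_eq_square)
  have 2: "\<sigma> a (- 1) = \<sigma> a (- (a * b)) \<otimes> \<sigma> (- b) (a * b)"
    using 1[of "- (a * b)"] square_left[of "- b" "a * b" a] assms by (simp add: power2_eq_square mult_ac)
  have "\<sigma> a (- (a * b)) \<otimes> \<sigma> (- b) (a * b) = \<sigma> a b \<otimes> \<sigma> (- b) (a * b)"
    using 1[of b] 2 sym[of "a * b" "- b"] assms by simp
  then show ?thesis using assms by simp
qed

text \<open>The left side is \<open>fold_sym [1, - a, - b, a * b]\<close> times \<sigma>(a, b), up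
  to squares. The value \<sigma>(-1, -1) is what two hyperbolic planes contribute, so this is the
  normalisation that relates a symbol to the invariant of its Pfister form.\<close>

lemma sum_neg:
  assumes "a \<noteq> 0" "b \<noteq> 0"
  shows "\<sigma> (- b) (a * b) \<otimes> \<sigma> (- a) (- a) \<otimes> \<sigma> a b = \<sigma> (- 1) (- 1)"
proof -
  have 1: "\<sigma> a b \<otimes> \<sigma> (- b) (a * b) = \<sigma> (- 1) a"
    using cocycle[of "- b" b a] neg_right[of "- b"] square_left[of "- 1" a b] sym[of b a] assms
    by (simp add: power2_eq_square mult.commute)
  have 2: "\<sigma> (- 1) (- 1) = \<sigma> (- 1) a \<otimes> \<sigma> (- a) (- a)"
    using cocycle[of "- 1" a "- a"] neg_right[of a] square_right[of "- 1" "- 1" a] assms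
    by (simp add: power2_eq_square)
  show ?thesis unfolding 2 1[symmetric] using assms by (simp add: A.m_ac)
qed

text \<open>If H is a section with cocycle \<sigma> in an extension of the nonzero scalars, this is
  the factor by which H(a_1)...H(a_n) differs from H(a_1...a_n). For bilinear \<sigma> it is the
  Hasse invariant, the product of \<sigma>(a_i, a_j) over i < j.\<close>

fun fold_sym :: "'k list \<Rightarrow> 'b"
  where "fold_sym [] = \<one>" | "fold_sym (a # l) = fold_sym l \<otimes> \<sigma> a (prod_list l)"

lemma prod_list_nonzero [simp]: "0 \<notin> set l \<Longrightarrow> prod_list l \<noteq> (0 :: 'k)"
  by (induction l) auto

lemma fold_sym_closed [simp]: "0 \<notin> set l \<Longrightarrow> fold_sym l \<in> carrier A"
  by (induction l) auto

lemma fold_sym_append: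
  "0 \<notin> set l \<Longrightarrow> 0 \<notin> set k \<Longrightarrow> fold_sym (l @ k) = fold_sym l \<otimes> fold_sym k \<otimes> \<sigma> (prod_list l) (prod_list k)"
proof (induction l)
  case (Cons a l)
  then have n: "a \<noteq> 0" "0 \<notin> set l" "prod_list l \<noteq> 0" "prod_list k \<noteq> 0" by auto
  have "fold_sym ((a # l) @ k) = fold_sym l \<otimes> fold_sym k \<otimes> (\<sigma> (prod_list l) (prod_list k) \<otimes> \<sigma> a (prod_list l * prod_list k))"
    using Cons n by (simp add: A.m_ac)
  also have "\<dots> = fold_sym l \<otimes> fold_sym k \<otimes> (\<sigma> a (prod_list l) \<otimes> \<sigma> (a * prod_list l) (prod_list k))"
    using cocycle[OF n(1,3,4)] by simp
  also have "\<dots> = fold_sym (a # l) \<otimes> fold_sym k \<otimes> \<sigma> (prod_list (a # l)) (prod_list k)"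
    using Cons.prems n by (simp add: A.m_ac)
  finally show ?case .
qed simp

text \<open>Chain equivalence is replaced by equality of the data that it preserves. The
  discriminant up to squares belongs to them because \<open>fold_sym\<close> of a concatenation
  involves the symbol of the two discriminants.\<close>

definition equivalent :: "'k list \<Rightarrow> 'k list \<Rightarrow> bool"
  where "equivalent l k \<longleftrightarrow> 0 \<notin> set l \<and> 0 \<notin> set k \<and> length l = length k \<and> witt_sum l = witt_sum k \<and>
    fold_sym l = fold_sym k \<and> (\<exists>c. c \<noteq> 0 \<and> prod_list k = prod_list l * c\<^sup>2)"

lemma equivalent_refl: "0 \<notin> set l \<Longrightarrow> equivalent l l"
  unfolding equivalent_def by (auto intro!: exI[of _ 1])

lemma equivalent_trans [trans]: "equivalent l k \<Longrightarrow> equivalent k m \<Longrightarrow> equivalent l m"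
  unfolding equivalent_def by clarsimp (metis mult.assoc no_zero_divisors power_mult_distrib)

lemma equivalent_append:
  assumes "equivalent l k" "0 \<notin> set m" shows "equivalent (l @ m) (k @ m)"
proof -
  obtain c where c: "c \<noteq> 0" "prod_list k = prod_list l * c\<^sup>2" using assms(1) unfolding equivalent_def by blast
  have l: "0 \<notin> set l" "0 \<notin> set k" using assms(1) by (auto simp: equivalent_def)
  have "fold_sym (l @ m) = fold_sym (k @ m)"
    using assms square_left[of "prod_list l" "prod_list m" c] c l
    by (simp add: fold_sym_append equivalent_def)
  moreover have "prod_list (k @ m) = prod_list (l @ m) * c\<^sup>2" using c by (simp add: mult_ac)
  ultimately show ?thesis using assms c(1) unfolding equivalent_def by (auto simp: witt_sum_append)
qed

lemma equivalent_swap: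
  assumes "0 \<notin> set l" "0 \<notin> set k" shows "equivalent (l @ k) (k @ l)"
  unfolding equivalent_def
  using assms sym[of "prod_list l" "prod_list k"]
  by (auto simp: fold_sym_append witt_sum_append W.a_comm A.m_comm[of "fold_sym l"] mult.commute intro!: exI[of _ 1])

lemma equivalent_prepend:
  assumes "equivalent l k" "0 \<notin> set m" shows "equivalent (m @ l) (m @ k)"
proof -
  have l: "0 \<notin> set l" "0 \<notin> set k" using assms(1) by (auto simp: equivalent_def)
  show ?thesis
    by (rule equivalent_trans[OF equivalent_swap equivalent_trans[OF equivalent_append[OF assms] equivalent_swap]])
      (use l assms in auto)
qed

lemma equivalent_perm: "mset l = mset k \<Longrightarrow> 0 \<notin> set l \<Longrightarrow> equivalent l k"
proof (induction l arbitrary: k)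
  case Nil
  then show ?case by (simp add: equivalent_refl)
next
  case (Cons a l)
  have "a \<in> set k" using Cons.prems(1) by (metis list.set_intros(1) set_mset_mset)
  then obtain k1 k2 where k: "k = k1 @ a # k2" by (meson split_list)
  have m: "mset l = mset (k1 @ k2)" using Cons.prems(1) k by simp
  have z: "0 \<notin> set (k1 @ k2)" "a \<noteq> 0" using Cons.prems m by (metis list.set_intros(2) set_mset_mset) (use Cons.prems in auto)
  have "equivalent ([a] @ l) ([a] @ (k1 @ k2))"
    by (rule equivalent_prepend) (use Cons m z in auto)
  moreover have "equivalent (([a] @ k1) @ k2) ((k1 @ [a]) @ k2)"
    by (rule equivalent_append[OF equivalent_swap]) (use z in auto)
  ultimately show ?case using equivalent_trans k by simp
qed

lemma equivalent_pair:
  assumes "a \<noteq> 0" "b \<noteq> 0" "a + b \<noteq> 0"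
  shows "equivalent [a, b] [a + b, a * b * (a + b)]"
  unfolding equivalent_def
  using assms add'[OF assms] witt_rank1_add[OF assms(3)]
  by (auto simp: power2_eq_square mult_ac intro!: exI[of _ "a + b"])

lemma equivalent_single: "a \<noteq> 0 \<Longrightarrow> c \<noteq> 0 \<Longrightarrow> equivalent [a] [a * c\<^sup>2]"
  unfolding equivalent_def by (auto simp: witt_rank1_square intro!: exI[of _ c])

lemma equivalent_scale:
  "0 \<notin> set l \<Longrightarrow> length vs = length l \<Longrightarrow> 0 \<notin> set vs \<Longrightarrow> equivalent l (map2 (\<lambda>a v. a * v\<^sup>2) l vs)"
proof (induction l arbitrary: vs)
  case (Cons a l)
  then obtain v ws where vs: "vs = v # ws" by (cases vs) auto
  have e: "equivalent l (map2 (\<lambda>a v. a * v\<^sup>2) l ws)" using Cons vs by auto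
  have "equivalent ([a] @ l) ([a * v\<^sup>2] @ l)"
    by (rule equivalent_append[OF equivalent_single]) (use Cons.prems vs in auto)
  also have "equivalent \<dots> ([a * v\<^sup>2] @ map2 (\<lambda>a v. a * v\<^sup>2) l ws)"
    by (rule equivalent_prepend[OF e]) (use Cons.prems vs in auto)
  finally show ?case using vs by simp
qed (simp add: equivalent_refl)

text \<open>The entries a, b at the front are replaced by a + b and ab(a + b). The second is set
  aside while the first joins the remaining entries, whose sum is still 0, until two neighbours are
  opposite.\<close>

lemma equivalent_hyperbolic_sum:
  "0 \<notin> set bs \<Longrightarrow> bs \<noteq> [] \<Longrightarrow> sum_list bs = 0 \<Longrightarrow> \<exists>u rest. equivalent bs (u # - u # rest)"
proof (induction "length bs" arbitrary: bs rule: less_induct)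
  case less
  obtain a cs where bs: "bs = a # cs" using less.prems by (cases bs) auto
  obtain b ds where cs: "cs = b # ds" using less.prems bs by (cases cs) auto
  have ab: "a \<noteq> 0" "b \<noteq> 0" "0 \<notin> set ds" using less.prems bs cs by auto
  show ?case
  proof (cases "a + b = 0")
    case True
    then have "b = - a" by (simp add: eq_neg_iff_add_eq_0 add.commute)
    then show ?thesis using equivalent_refl[OF less.prems(1)] bs cs by blast
  next
    case False
    let ?p = "a * b * (a + b)"
    have p: "?p \<noteq> 0" using ab False by simp
    have "\<exists>u rest. equivalent ((a + b) # ds) (u # - u # rest)"
      by (rule less.hyps) (use less.prems bs cs False in \<open>auto simp: add.assoc\<close>)
    then obtain u rest where u: "equivalent ((a + b) # ds) (u # - u # rest)" by blast
    have "equivalent bs ([a + b, ?p] @ ds)"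
      unfolding bs cs using equivalent_append[OF equivalent_pair[OF ab(1,2) False] ab(3)] by simp
    also have "equivalent \<dots> (((a + b) # ds) @ [?p])"
      by (rule equivalent_perm) (use ab False p in auto)
    also have "equivalent \<dots> ((u # - u # rest) @ [?p])" by (rule equivalent_append[OF u]) (use p in auto)
    finally show ?thesis by auto
  qed
qed

text \<open>An isotropic vector is turned into (1, ..., 1): the entries at which it vanishes are
  moved to the end, and the other entries are multiplied by the squares of its coordinates. The
  remaining entries then sum to zero.\<close>

lemma equivalent_hyperbolic:
  assumes "0 \<notin> set l" "l \<noteq> []" "witt_sum l = \<zero>\<^bsub>witt_ring\<^esub>"
  obtains u rest where "equivalent l (u # - u # rest)"
proof -
  obtain vs where vs: "length vs = length l" "\<exists>v\<in>set vs. v \<noteq> 0" "sum_list (map2 (\<lambda>a v. a * v\<^sup>2) l vs) = 0"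
    by (rule isotropic_vector[OF assms])
  define ps qs where "ps = filter (\<lambda>p. snd p \<noteq> 0) (zip l vs)" and "qs = filter (\<lambda>p. snd p = 0) (zip l vs)"
  have zl: "l = map fst (zip l vs)" using vs(1) by simp
  have "mset (zip l vs) = mset (ps @ qs)"
    unfolding ps_def qs_def using multiset_partition[of "mset (zip l vs)" "\<lambda>p. snd p \<noteq> 0"] by simp
  then have "mset (map fst (zip l vs)) = mset (map fst (ps @ qs))" by (simp only: mset_map)
  then have 1: "equivalent l (map fst ps @ map fst qs)"
    using equivalent_perm[of l "map fst (ps @ qs)"] assms(1) zl by simp
  have z: "0 \<notin> set (map fst ps)" "0 \<notin> set (map fst qs)" using 1 by (auto simp: equivalent_def)
  let ?bs = "map (\<lambda>p. fst p * (snd p)\<^sup>2) ps"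
  have "map2 (\<lambda>a v. a * v\<^sup>2) (map fst ps) (map snd ps) = ?bs" by (induction ps) auto
  moreover have "0 \<notin> set (map snd ps)" by (auto simp: ps_def)
  ultimately have 2: "equivalent (map fst ps) ?bs"
    using equivalent_scale[OF z(1), of "map snd ps"] by simp
  have sl: "sum_list (map (\<lambda>p. fst p * (snd p)\<^sup>2) zs) = sum_list (map (\<lambda>p. fst p * (snd p)\<^sup>2) (filter (\<lambda>p. snd p \<noteq> 0) zs))"
    for zs :: "('k \<times> 'k) list" by (induction zs) auto
  from sl[of "zip l vs"] have s: "sum_list ?bs = 0"
    using vs(3) unfolding ps_def by (simp add: case_prod_beta')
  have "ps \<noteq> []"
  proof -
    obtain i where "i < length vs" "vs ! i \<noteq> 0" using vs(2) by (metis in_set_conv_nth)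
    then have "(l ! i, vs ! i) \<in> set ps" using vs(1) by (auto simp: ps_def set_zip)
    then show ?thesis by auto
  qed
  then obtain u rest where u: "equivalent ?bs (u # - u # rest)"
    using equivalent_hyperbolic_sum[of ?bs] s 2 unfolding equivalent_def by blast
  have "equivalent l ((u # - u # rest) @ map fst qs)"
    using equivalent_trans[OF 1 equivalent_append[OF equivalent_trans[OF 2 u] z(2)]] .
  then show thesis using that by simp
qed

lemma prod_list_neg_one: "prod_list (replicate m (- 1)) = (- 1 :: 'k) ^ m"
  by (induction m) auto

text \<open>Hyperbolic planes are split off one at a time. Each contributes -1 to the discriminant
  up to squares, and to \<open>fold_sym\<close> the same factor as one further entry -1. Hence the
  invariant of a form of class zero depends on its dimension alone.\<close>

lemma fold_sym_zero:
  "0 \<notin> set l \<Longrightarrow> witt_sum l = \<zero>\<^bsub>witt_ring\<^esub> \<Longrightarrow>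
    \<exists>m c. length l = 2 * m \<and> c \<noteq> 0 \<and> prod_list l = (- 1) ^ m * c\<^sup>2 \<and> fold_sym l = fold_sym (replicate m (- 1))"
proof (induction "length l" arbitrary: l rule: less_induct)
  case less
  show ?case
  proof (cases "l = []")
    case True
    then show ?thesis by (intro exI[of _ 0] exI[of _ 1]) simp
  next
    case False
    obtain u r where e: "equivalent l (u # - u # r)" by (rule equivalent_hyperbolic[OF less.prems(1) False less.prems(2)])
    have z: "u \<noteq> 0" "0 \<notin> set r" and len: "length l = length r + 2" using e by (auto simp: equivalent_def)
    have "witt_rank1 u \<oplus>\<^bsub>witt_ring\<^esub> (witt_rank1 (- u) \<oplus>\<^bsub>witt_ring\<^esub> witt_sum r) = witt_sum r"
      using witt_rank1_uminus[of u] by (simp add: W.a_assoc[symmetric])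
    then have "witt_sum r = \<zero>\<^bsub>witt_ring\<^esub>" using e less.prems(2) by (simp add: equivalent_def)
    then obtain m c where m: "length r = 2 * m" "c \<noteq> 0" "prod_list r = (- 1) ^ m * c\<^sup>2" "fold_sym r = fold_sym (replicate m (- 1))"
      using less.hyps[of r] len z(2) by auto
    obtain d where d: "d \<noteq> 0" "prod_list (u # - u # r) = prod_list l * d\<^sup>2" using e unfolding equivalent_def by blast
    have pr: "prod_list r \<noteq> 0" "(-1::'k) ^ m \<noteq> 0" using z by auto
    have "fold_sym l = fold_sym r \<otimes> (\<sigma> (- u) (prod_list r) \<otimes> \<sigma> u (- u * prod_list r))"
      using e z pr by (simp add: equivalent_def A.m_ac)
    \<comment> \<open>The cocycle relation at (u, -u, R), with R the product of \<open>r\<close>: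
      since \<sigma>(u, -u) is trivial, what remains is the symbol of -u^2 and R, and the square
      drops out.\<close>
    also have "\<dots> = fold_sym r \<otimes> \<sigma> (- 1) (prod_list r)"
      using cocycle[of u "- u" "prod_list r"] neg_right[of u] square_left[of "- 1" "prod_list r" u] z pr
      by (simp add: power2_eq_square)
    also have "\<dots> = fold_sym (replicate (Suc m) (- 1))"
      using square_right[of "- 1" "(- 1) ^ m" c] m pr by (simp add: prod_list_neg_one)
    finally have "fold_sym l = fold_sym (replicate (Suc m) (- 1))" .
    moreover have "prod_list l = (- 1) ^ Suc m * (u * c / d)\<^sup>2"
      using d m(3) by (simp add: field_simps power2_eq_square)
    ultimately show ?thesis using len m(1,2) d(1) z(1)
      by (intro exI[of _ "Suc m"] exI[of _ "u * c / d"]) auto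
  qed
qed

text \<open>The homomorphism on \<open>I\<^sup>2(K)\<close> is constructed as its graph; that the graph is single-valued is the
  injectivity of the presentation, which reduces to chain equivalence with a hyperbolic form.\<close>

definition graph_group :: "('k mat set \<times> 'b) monoid"
  where "graph_group = add_monoid (witt_ring :: 'k mat set ring) \<times>\<times> A"

definition graph_gens :: "('k mat set \<times> 'b) set"
  where "graph_gens = {(pfister a b, \<sigma> a b) | a b. a \<noteq> 0 \<and> b \<noteq> 0}"

definition graph :: "('k mat set \<times> 'b) set"
  where "graph = generate graph_group graph_gens"

lemma group_graph: "group graph_group"
  unfolding graph_group_def by (rule DirProd_group[OF W.add.is_group A.is_group])

lemma graph_gens_carrier: "graph_gens \<subseteq> carrier graph_group"
  by (auto simp: graph_gens_def graph_group_def)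

lemma subgroup_graph: "subgroup graph graph_group"
  unfolding graph_def by (rule group.generate_is_subgroup[OF group_graph graph_gens_carrier])

lemma graph_mult: "(x, y) \<otimes>\<^bsub>graph_group\<^esub> (x', y') = (x \<oplus>\<^bsub>witt_ring\<^esub> x', y \<otimes> y')"
  by (simp add: graph_group_def)

lemma graph_inv: "x \<in> carrier witt_ring \<Longrightarrow> y \<in> carrier A \<Longrightarrow>
    inv\<^bsub>graph_group\<^esub> (x, y) = (\<ominus>\<^bsub>witt_ring\<^esub> x, inv y)"
  unfolding graph_group_def using inv_DirProd[OF W.add.is_group A.is_group, of x y] by (simp add: a_inv_def)

text \<open>The value of \<open>fold_sym\<close> on a list of length 4k and Witt class zero, by
  \<open>fold_sym_zero\<close> with m = 2k. Since the discriminant of 2k entries -1 is 1, these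
  values are multiplicative in k.\<close>

abbreviation neg_ones :: "nat \<Rightarrow> 'b" where "neg_ones k \<equiv> fold_sym (replicate (2 * k) (- 1))"

lemma neg_ones_add: "neg_ones (k + k') = neg_ones k \<otimes> neg_ones k'"
proof -
  have "replicate (2 * (k + k')) (- 1 :: 'k) = replicate (2 * k) (- 1) @ replicate (2 * k') (- 1)"
    by (simp add: replicate_add[symmetric] distrib_left)
  then show ?thesis
    using fold_sym_append[of "replicate (2 * k) (- 1)" "replicate (2 * k') (- 1)"] by (simp add: prod_list_neg_one)
qed

lemma neg_ones_1: "neg_ones 1 = \<sigma> (- 1) (- 1)"
  by (simp add: numeral_2_eq_2)

text \<open>Over each point (x, y) of the graph there is a diagonal form of class x whose invariant
  determines y. For a generator it is <1, -a, -b, ab>, for the inverse of a generator <-1, a, b,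
  -ab>, and products correspond to concatenation. Square discriminants make the cross term of
  \<open>fold_sym_append\<close> trivial, and lengths divisible by 4 keep the reference value of the
  form \<open>neg_ones k\<close>.\<close>

lemma graph_list:
  assumes "p \<in> graph"
  shows "fst p \<in> carrier witt_ring \<and> snd p \<in> carrier A \<and>
    (\<exists>l k c. 0 \<notin> set l \<and> length l = 4 * k \<and> c \<noteq> 0 \<and> prod_list l = c\<^sup>2 \<and> witt_sum l = fst p \<and> fold_sym l \<otimes> snd p = neg_ones k)"
  using assms unfolding graph_def
proof (induction rule: generate.induct)
  case one
  show ?case unfolding graph_group_def
    by (auto intro!: exI[of _ "[]"] exI[of _ "0::nat"] exI[of _ "1::'k"])
next
  case (incl h)
  then obtain a b where h: "h = (pfister a b, \<sigma> a b)" "a \<noteq> 0" "b \<noteq> 0" by (auto simp: graph_gens_def)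
  have "\<sigma> (- a) (- b * (a * b)) = \<sigma> (- a) (- a)"
    using square_right[of "- a" "- a" b] h by (simp add: power2_eq_square mult_ac)
  then have "fold_sym [1, - a, - b, a * b] \<otimes> \<sigma> a b = \<sigma> (- 1) (- 1)"
    using sum_neg[OF h(2,3)] h(2,3) by simp
  moreover have "prod_list [1, - a, - b, a * b] = (a * b)\<^sup>2" by (simp add: power2_eq_square mult_ac)
  ultimately show ?case using h neg_ones_1 pfister_eq_sum[OF h(2,3)]
    by (auto simp del: fold_sym.simps prod_list.Cons witt_sum_Cons intro!: exI[of _ "[1, - a, - b, a * b]"] exI[of _ "1::nat"] exI[of _ "a * b"])
next
  case (inv h)
  then obtain a b where h: "h = (pfister a b, \<sigma> a b)" "a \<noteq> 0" "b \<noteq> 0" by (auto simp: graph_gens_def)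
  have 1: "\<sigma> a (b * - (a * b)) = \<one>" "\<sigma> (- 1) (a * (b * - (a * b))) = \<sigma> (- 1) (- 1)"
    using square_right[of a "- a" b] neg_right[of a] square_right[of "- 1" "- 1" "a * b"] h
    by (simp_all add: power2_eq_square mult_ac)
  have "\<sigma> b (- (a * b)) = \<sigma> a b"
    using mult_neg_right[of b a] sym[of a b] h by (simp add: mult.commute)
  then have "fold_sym [- 1, a, b, - (a * b)] = \<sigma> (- 1) (- 1) \<otimes> \<sigma> a b"
    using h 1 by (simp add: A.m_ac)
  then have "fold_sym [- 1, a, b, - (a * b)] \<otimes> inv \<sigma> a b = \<sigma> (- 1) (- 1)"
    using h by (simp add: A.m_assoc del: fold_sym.simps)
  moreover have "prod_list [- 1, a, b, - (a * b)] = (a * b)\<^sup>2" by (simp add: power2_eq_square mult_ac)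
  moreover have "witt_sum [- 1, a, b, - (a * b)] = \<ominus>\<^bsub>witt_ring\<^esub> pfister a b"
    by (simp add: pfister_eq_sum[OF h(2,3)] witt_rank1_inv W.minus_add)
  ultimately show ?case using h neg_ones_1 graph_inv[of "pfister a b" "\<sigma> a b"]
    by (auto simp del: fold_sym.simps prod_list.Cons witt_sum_Cons intro!: exI[of _ "[- 1, a, b, - (a * b)]"] exI[of _ "1::nat"] exI[of _ "a * b"])
next
  case (eng p q)
  obtain x y x' y' where pq: "p = (x, y)" "q = (x', y')" by (metis surj_pair)
  note IH = eng.IH[unfolded pq fst_conv snd_conv]
  have c: "x \<in> carrier witt_ring" "y \<in> carrier A" "x' \<in> carrier witt_ring" "y' \<in> carrier A"
    using IH by blast+
  from IH(1) obtain l k c where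
    l: "0 \<notin> set l" "length l = 4 * k" "c \<noteq> 0" "prod_list l = c\<^sup>2" "witt_sum l = x" "fold_sym l \<otimes> y = neg_ones k"
    by blast
  from IH(2) obtain l' k' c' where
    l': "0 \<notin> set l'" "length l' = 4 * k'" "c' \<noteq> 0" "prod_list l' = c'\<^sup>2" "witt_sum l' = x'" "fold_sym l' \<otimes> y' = neg_ones k'"
    by blast
  have "fold_sym (l @ l') = fold_sym l \<otimes> fold_sym l'"
    using fold_sym_append[OF l(1) l'(1)] square[of "c\<^sup>2" c'] l(1,3,4) l'(1,3,4) by simp
  then have "fold_sym (l @ l') \<otimes> (y \<otimes> y') = (fold_sym l \<otimes> y) \<otimes> (fold_sym l' \<otimes> y')"
    using c l(1) l'(1) by (simp add: A.m_ac)
  then have "fold_sym (l @ l') \<otimes> (y \<otimes> y') = neg_ones (k + k')"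
    using l(6) l'(6) neg_ones_add by simp
  moreover have "0 \<notin> set (l @ l')" "length (l @ l') = 4 * (k + k')" "c * c' \<noteq> 0"
    "prod_list (l @ l') = (c * c')\<^sup>2" "witt_sum (l @ l') = x \<oplus>\<^bsub>witt_ring\<^esub> x'"
    using l l' by (auto simp: witt_sum_append power_mult_distrib)
  ultimately have "\<exists>l k c. 0 \<notin> set l \<and> length l = 4 * k \<and> c \<noteq> 0 \<and> prod_list l = c\<^sup>2 \<and>
      witt_sum l = x \<oplus>\<^bsub>witt_ring\<^esub> x' \<and> fold_sym l \<otimes> (y \<otimes> y') = neg_ones k" by blast
  then show ?case using c unfolding pq graph_mult fst_conv snd_conv by simp
qed

text \<open>The quotient of two points over the same x lies over zero. The form found there has
  class zero, so its invariant equals the reference value and the second component is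
  trivial.\<close>

lemma graph_unique:
  assumes "(x, y) \<in> graph" "(x, y') \<in> graph" shows "y = y'"
proof -
  have c: "x \<in> carrier witt_ring" "y \<in> carrier A" "y' \<in> carrier A" using graph_list[OF assms(1)] graph_list[OF assms(2)] by auto
  have "(x, y) \<otimes>\<^bsub>graph_group\<^esub> inv\<^bsub>graph_group\<^esub> (x, y') \<in> graph"
    using subgroup.m_closed[OF subgroup_graph assms(1) subgroup.m_inv_closed[OF subgroup_graph assms(2)]] .
  then have "(\<zero>\<^bsub>witt_ring\<^esub>, y \<otimes> inv y') \<in> graph"
    using graph_inv[OF c(1,3)] c by (simp add: graph_mult W.r_neg)
  from graph_list[OF this] obtain l k where l: "0 \<notin> set l" "length l = 4 * k" "witt_sum l = \<zero>\<^bsub>witt_ring\<^esub>"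
    "fold_sym l \<otimes> (y \<otimes> inv y') = neg_ones k" by auto
  obtain m where "length l = 2 * m" "fold_sym l = fold_sym (replicate m (- 1))" using fold_sym_zero[OF l(1,3)] by blast
  then have "fold_sym l = neg_ones k" using l(2) by (simp add: mult.assoc[symmetric])
  then have "fold_sym l \<otimes> (y \<otimes> inv y') = fold_sym l" using l(4) by simp
  then have "y \<otimes> inv y' = \<one>" using l(1) c A.l_cancel_one'[of "fold_sym l" "y \<otimes> inv y'"] by auto
  then show ?thesis using c A.inv_solve_right'[of \<one> y "y'"] by simp
qed

lemma graph_total: "x \<in> carrier I2_group \<Longrightarrow> \<exists>y. (x, y) \<in> graph"
  unfolding I2_carrier
proof (induction rule: generate.induct)
  case one
  have "(\<zero>\<^bsub>witt_ring\<^esub>, \<one>) \<in> graph"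
    using subgroup.one_closed[OF subgroup_graph] by (simp add: graph_group_def)
  then show ?case by auto
next
  case (incl h)
  then show ?case unfolding graph_def pfister_set_def graph_gens_def by (auto intro!: generate.incl)
next
  case (inv h)
  then obtain a b where h: "h = pfister a b" "a \<noteq> 0" "b \<noteq> 0" by (auto simp: pfister_set_def)
  then have "(h, \<sigma> a b) \<in> graph" unfolding graph_def graph_gens_def by (auto intro!: generate.incl)
  from subgroup.m_inv_closed[OF subgroup_graph this] show ?case
    using graph_inv[of h "\<sigma> a b"] h by (auto simp: a_inv_def)
next
  case (eng h1 h2)
  then obtain y y' where "(h1, y) \<in> graph" "(h2, y') \<in> graph" by blast
  from subgroup.m_closed[OF subgroup_graph this] show ?case by (auto simp: graph_mult)
qed

theorem I2_presentation:
  obtains f where "f \<in> hom I2_group A" "f \<in> extensional (carrier I2_group)"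
    "\<And>a b. a \<noteq> 0 \<Longrightarrow> b \<noteq> 0 \<Longrightarrow> f (pfister a b) = \<sigma> a b"
proof -
  define f where "f = (\<lambda>x\<in>carrier I2_group. THE y. (x, y) \<in> graph)"
  have f: "(x, f x) \<in> graph" if x: "x \<in> carrier I2_group" for x
  proof -
    have "\<exists>!y. (x, y) \<in> graph" using graph_total[OF x] graph_unique by blast
    then show ?thesis unfolding f_def using theI'[of "\<lambda>y. (x, y) \<in> graph"] x by simp
  qed
  have feq: "f x = y" if "(x, y) \<in> graph" "x \<in> carrier I2_group" for x y
    using graph_unique[OF f[OF that(2)] that(1)] .
  interpret I: comm_group "I2_group :: 'k mat set monoid" by (rule I2_comm_group)
  show thesis
  proof (rule that[of f])
    show "f \<in> hom I2_group A"
    proof (rule homI)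
      show "f x \<in> carrier A" if "x \<in> carrier I2_group" for x using graph_list[OF f[OF that]] by simp
      show "f (x \<otimes>\<^bsub>I2_group\<^esub> y) = f x \<otimes> f y" if "x \<in> carrier I2_group" "y \<in> carrier I2_group" for x y
        using subgroup.m_closed[OF subgroup_graph f[OF that(1)] f[OF that(2)]] I.m_closed[OF that]
        by (intro feq) (auto simp: graph_mult)
    qed
    show "f (pfister a b) = \<sigma> a b" if "a \<noteq> 0" "b \<noteq> 0" for a b
      using that by (intro feq) (auto simp: graph_def graph_gens_def intro!: generate.incl)
  qed (simp add: f_def)
qed

end

section \<open>The Witt cocycle of \<open>SL(2, K)\<close>\<close>

definition mat22 :: "'a \<Rightarrow> 'a \<Rightarrow> 'a \<Rightarrow> 'a \<Rightarrow> 'a mat"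
  where "mat22 a b c d = mat 2 2 (\<lambda>(i, j). if i = 0 then if j = 0 then a else b else if j = 0 then c else d)"

lemma mat22_carrier [simp]: "mat22 a b c d \<in> carrier_mat 2 2"
  by (simp add: mat22_def)

lemma mat22_index [simp]:
  "mat22 a b c d $$ (0, 0) = a" "mat22 a b c d $$ (0, Suc 0) = b"
  "mat22 a b c d $$ (Suc 0, 0) = c" "mat22 a b c d $$ (Suc 0, Suc 0) = d"
  by (simp_all add: mat22_def)

lemma mat22_eq_iff [simp]: "mat22 a b c d = mat22 a' b' c' d' \<longleftrightarrow> a = a' \<and> b = b' \<and> c = c' \<and> d = d'"
  by (metis mat22_index)

lemma mat22_cases:
  assumes "g \<in> carrier_mat 2 2"
  shows "g = mat22 (g $$ (0, 0)) (g $$ (0, 1)) (g $$ (1, 0)) (g $$ (1, 1))"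
  by (rule eq_matI) (use assms in \<open>auto simp: mat22_def less_2_cases_eq\<close>)

lemma mat22_mult [simp]:
  "mat22 a b c d * mat22 a' b' c' d' =
    mat22 (a * a' + b * c') (a * b' + b * d') (c * a' + d * c') (c * b' + d * d' :: 'a::comm_ring_1)"
  by (rule eq_matI) (auto simp: mat22_def scalar_prod_def less_2_cases_eq atLeast0LessThan lessThan_Suc numeral_2_eq_2)

lemma one_mat22: "1\<^sub>m 2 = mat22 1 0 0 (1 :: 'a::comm_ring_1)"
  by (rule eq_matI) (auto simp: mat22_def less_2_cases_eq)

lemma det_mat22 [simp]: "det (mat22 a b c d) = a * d - b * (c :: 'a::comm_ring_1)"
  unfolding mat22_def by (simp add: det_2x2)

lemma SL2_simps [simp]: "monoid.mult SL2 = (*)" "one SL2 = mat22 1 0 0 (1 :: 'a::field)"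
  by (simp_all add: SL2_def one_mat22)

lemma mat22_SL2 [simp]: "mat22 a b c d \<in> carrier SL2 \<longleftrightarrow> a * d - b * c = (1 :: 'a::field)"
  by (simp add: SL2_def)

lemma SL2_cases:
  assumes "g \<in> carrier SL2"
  obtains a b c d where "g = mat22 a b c d" "a * d - b * c = (1 :: 'a::field)"
proof -
  have c: "g \<in> carrier_mat 2 2" using assms by (simp add: SL2_def)
  have "mat22 (g $$ (0, 0)) (g $$ (0, 1)) (g $$ (1, 0)) (g $$ (1, 1)) \<in> carrier SL2"
    using assms mat22_cases[OF c] by simp
  then show thesis using that mat22_cases[OF c] by simp
qed

lemma SL2_group: "group (SL2 :: 'a::field mat monoid)"
proof (rule groupI)
  fix x y z :: "'a mat" assume xyz: "x \<in> carrier SL2" "y \<in> carrier SL2" "z \<in> carrier SL2"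
  then show "x \<otimes>\<^bsub>SL2\<^esub> y \<otimes>\<^bsub>SL2\<^esub> z = x \<otimes>\<^bsub>SL2\<^esub> (y \<otimes>\<^bsub>SL2\<^esub> z)"
    using assoc_mult_mat[of x 2 2 y 2 z 2] by (simp add: SL2_def)
next
  fix x y :: "'a mat" assume "x \<in> carrier SL2" "y \<in> carrier SL2"
  then show "x \<otimes>\<^bsub>SL2\<^esub> y \<in> carrier SL2" using det_mult[of x 2 y] by (auto simp: SL2_def)
next
  fix x :: "'a mat" assume "x \<in> carrier SL2"
  then obtain a b c d where x: "x = mat22 a b c d" "a * d - b * c = 1" by (rule SL2_cases)
  show "\<one>\<^bsub>SL2\<^esub> \<otimes>\<^bsub>SL2\<^esub> x = x" by (simp add: x)
  show "\<exists>y\<in>carrier SL2. y \<otimes>\<^bsub>SL2\<^esub> x = \<one>\<^bsub>SL2\<^esub>"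
    by (rule bexI[of _ "mat22 d (- b) (- c) a"]) (use x(2) in \<open>auto simp: x algebra_simps\<close>)
qed auto

interpretation SL: group "SL2 :: 'a::field mat monoid"
  by (rule SL2_group)

lemma SL2_mult_closed [simp]: "x \<in> carrier SL2 \<Longrightarrow> y \<in> carrier SL2 \<Longrightarrow> x * y \<in> carrier SL2"
  using SL.m_closed[of x y] by simp

lemma SL2_inv: "a * d - b * c = 1 \<Longrightarrow> inv\<^bsub>SL2\<^esub> (mat22 a b c d) = mat22 d (- b) (- c) (a :: 'a::field)"
  by (rule SL.inv_equality) (auto simp: algebra_simps)

text \<open>The commutator of diag(a, 1/a) with the unipotent matrix of parameter s is unipotent of
  parameter (a^2 - 1) s, so for such a scalar all unipotent matrices are commutators.\<close>

definition nondegenerate_scale :: "'a::field \<Rightarrow> bool"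
  where "nondegenerate_scale a \<longleftrightarrow> a \<noteq> 0 \<and> a\<^sup>2 - 1 \<noteq> 0"

lemma nondegenerate_scale_ex:
  assumes "infinite (UNIV :: 'a::field set)" obtains a :: "'a::field" where "nondegenerate_scale a"
proof -
  obtain a :: 'a where "a \<notin> {0, 1, - 1}"
    using ex_new_if_finite[OF assms, of "{0, 1, - 1}"] by auto
  then have "nondegenerate_scale a" by (auto simp: nondegenerate_scale_def power2_eq_1_iff)
  then show thesis by (rule that)
qed

lemma SL2_perfect:
  assumes inf: "infinite (UNIV :: 'a::field set)"
  shows "derived SL2 (carrier SL2) = (carrier SL2 :: 'a mat set)"
proof
  let ?D = "derived SL2 (carrier SL2) :: 'a mat set"
  have sub: "subgroup ?D SL2" by (rule SL.derived_is_subgroup) simp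
  then show "?D \<subseteq> carrier SL2" by (rule subgroup.subset)
  obtain e :: 'a where e: "e \<noteq> 0" "e\<^sup>2 - 1 \<noteq> 0" using nondegenerate_scale_ex[OF inf] unfolding nondegenerate_scale_def by blast
  have comm: "x \<otimes>\<^bsub>SL2\<^esub> y \<otimes>\<^bsub>SL2\<^esub> inv\<^bsub>SL2\<^esub> x \<otimes>\<^bsub>SL2\<^esub> inv\<^bsub>SL2\<^esub> y \<in> ?D" if "x \<in> carrier SL2" "y \<in> carrier SL2" for x y
    unfolding derived_def by (rule generate.incl, intro UN_I[OF that(1)] UN_I[OF that(2)] singletonI)
  have X: "mat22 1 t 0 1 \<in> ?D" for t :: 'a
  proof -
    have "mat22 1 ((e\<^sup>2 - 1) * s) 0 1 \<in> ?D" for s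
      using comm[of "mat22 e 0 0 (1 / e)" "mat22 1 s 0 1"] e by (simp add: SL2_inv algebra_simps power2_eq_square)
    from this[of "t / (e\<^sup>2 - 1)"] show ?thesis using e by simp
  qed
  have Y: "mat22 1 0 t 1 \<in> ?D" for t :: 'a
  proof -
    have "mat22 1 0 ((e\<^sup>2 - 1) * s) 1 \<in> ?D" for s
      using comm[of "mat22 (1 / e) 0 0 e" "mat22 1 0 s 1"] e by (simp add: SL2_inv algebra_simps power2_eq_square)
    from this[of "t / (e\<^sup>2 - 1)"] show ?thesis using e by simp
  qed
  have m: "x * y \<in> ?D" if "x \<in> ?D" "y \<in> ?D" for x y
    using subgroup.m_closed[OF sub that] by simp
  have big: "mat22 a b c d \<in> ?D" if "a * d - b * c = 1" "c \<noteq> 0" for a b c d :: 'a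
  proof -
    have "mat22 a b c d = mat22 1 ((a - 1) / c) 0 1 * mat22 1 0 c 1 * mat22 1 ((d - 1) / c) 0 1"
      using that by (simp add: field_simps)
    then show ?thesis using m[OF m[OF X Y] X] by metis
  qed
  show "carrier SL2 \<subseteq> ?D"
  proof
    fix g :: "'a mat" assume "g \<in> carrier SL2"
    then obtain a b c d where g: "g = mat22 a b c d" "a * d - b * c = 1" by (rule SL2_cases)
    show "g \<in> ?D"
    proof (cases "c = 0")
      case True
      then have "a \<noteq> 0" using g(2) by auto
      \<comment> \<open>For vanishing lower left entry, one lower unipotent factor moves the matrix
        into the big cell: the new lower left entry is \<open>a\<close>, which is nonzero.\<close>
      have "g = mat22 1 0 (- 1) 1 * mat22 a b a (b + d)" using g True by simp
      then show ?thesis using m[OF Y[of "- 1"] big[of a "b + d" b a]] \<open>a \<noteq> 0\<close> g(2) True by (simp add: algebra_simps)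
    qed (use big g in simp)
  qed
qed

section \<open>The cocycle identity for the Witt cocycle\<close>

lemma witt_rank1_cong: "x * y = c\<^sup>2 \<Longrightarrow> c \<noteq> 0 \<Longrightarrow> witt_rank1 x = witt_rank1 (y :: 'a::field)"
proof -
  assume a: "x * y = c\<^sup>2" "c \<noteq> 0"
  then have "y \<noteq> 0" by auto
  then have "x = y * (c / y)\<^sup>2" using a by (simp add: field_simps power2_eq_square)
  then show ?thesis using witt_rank1_square[of "c / y" y] a \<open>y \<noteq> 0\<close> by simp
qed

lemma witt_rank1_cancel:
  assumes "x * y = - (c\<^sup>2)" "c \<noteq> (0 :: 'a::field)"
  shows "witt_rank1 x \<oplus>\<^bsub>witt_ring\<^esub> witt_rank1 y = \<zero>\<^bsub>witt_ring\<^esub>"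
  using witt_rank1_cong[of x "- y" c] assms witt_rank1_uminus[of "- y"] by (simp add: W.a_comm)

text \<open>The variables are the \<open>2 \<times> 2\<close> minors of four nonzero vectors of \<open>K\<^sup>2\<close>; the side conditions
  express the transitivity of proportionality.\<close>

lemma witt_plucker:
  fixes p q r s t z :: "'a::field"
  assumes pl: "r * t = p * s + z * q"
    and 012: "p = 0 \<Longrightarrow> q = 0 \<Longrightarrow> r = 0" "p = 0 \<Longrightarrow> r = 0 \<Longrightarrow> q = 0" "q = 0 \<Longrightarrow> r = 0 \<Longrightarrow> p = 0"
    and 123: "q = 0 \<Longrightarrow> s = 0 \<Longrightarrow> t = 0" "q = 0 \<Longrightarrow> t = 0 \<Longrightarrow> s = 0" "s = 0 \<Longrightarrow> t = 0 \<Longrightarrow> q = 0"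
    and 013: "p = 0 \<Longrightarrow> t = 0 \<Longrightarrow> z = 0" "p = 0 \<Longrightarrow> z = 0 \<Longrightarrow> t = 0" "t = 0 \<Longrightarrow> z = 0 \<Longrightarrow> p = 0"
    and 023: "r = 0 \<Longrightarrow> s = 0 \<Longrightarrow> z = 0" "r = 0 \<Longrightarrow> z = 0 \<Longrightarrow> s = 0" "s = 0 \<Longrightarrow> z = 0 \<Longrightarrow> r = 0"
  shows "witt_rank1 (- q * t * s) \<oplus>\<^bsub>witt_ring\<^esub> witt_rank1 (- p * z * t) =
    witt_rank1 (- r * z * s) \<oplus>\<^bsub>witt_ring\<^esub> witt_rank1 (- p * r * q)"
proof (cases "p = 0 \<or> q = 0 \<or> r = 0 \<or> s = 0 \<or> t = 0 \<or> z = 0")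
  case False
  \<comment> \<open>Multiplying the Pluecker relation by \<open>?D\<close> turns it into a sum u + v
    with u = D z q and v = D p s. Up to squares u, v, u + v and uv(u + v) are exactly the four
    entries of the claim, so \<open>witt_rank1_add\<close> applies.\<close>
  let ?D = "- t * s * z"
  have sum: "?D * (z * q) + ?D * (p * s) = ?D * (r * t)" using pl by (simp add: algebra_simps)
  have 1: "witt_rank1 (- q * t * s) = witt_rank1 (?D * (z * q))"
    by (rule witt_rank1_cong[of _ _ "q * t * s * z"]) (use False in \<open>auto simp: power2_eq_square mult_ac\<close>)
  have 2: "witt_rank1 (- p * z * t) = witt_rank1 (?D * (p * s))"
    by (rule witt_rank1_cong[of _ _ "p * z * t * s"]) (use False in \<open>auto simp: power2_eq_square mult_ac\<close>)
  have 3: "witt_rank1 (- r * z * s) = witt_rank1 (?D * (r * t))"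
    by (rule witt_rank1_cong[of _ _ "r * z * s * t"]) (use False in \<open>auto simp: power2_eq_square mult_ac\<close>)
  have 4: "witt_rank1 (- p * r * q) = witt_rank1 (?D * (z * q) * (?D * (p * s)) * (?D * (r * t)))"
    by (rule witt_rank1_cong[of _ _ "p * r * q * t\<^sup>2 * s\<^sup>2 * z\<^sup>2"]) (use False in \<open>auto simp: power2_eq_square mult_ac\<close>)
  show ?thesis unfolding 1 2 3 4 using witt_rank1_add[of "?D * (z * q)" "?D * (p * s)"] False unfolding sum by simp
next
  case True
  \<comment> \<open>If a minor vanishes, then so do the two classes that contain it. The other two
    share a common factor \<open>u\<close>; their cofactors have a square as product, or minus a
    square if the two classes are on the same side, or both vanish. The side conditions provide the
    last alternative.\<close>
  have gen: "witt_rank1 (u * x) = witt_rank1 (u * y)"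
    if "u = 0 \<or> (x = 0 \<and> y = 0) \<or> (\<exists>c. c \<noteq> 0 \<and> x * y = c\<^sup>2)" for u x y :: 'a
  proof (cases "u = 0 \<or> (x = 0 \<and> y = 0)")
    case False
    with that obtain c where "c \<noteq> 0" "x * y = c\<^sup>2" by blast
    then show ?thesis using False
      by (intro witt_rank1_cong[of _ _ "u * c"]) (auto simp: power2_eq_square mult_ac)
  qed auto
  have gen': "witt_rank1 (u * x) \<oplus>\<^bsub>witt_ring\<^esub> witt_rank1 (u * y) = \<zero>\<^bsub>witt_ring\<^esub>"
    if "u = 0 \<or> (x = 0 \<and> y = 0) \<or> (\<exists>c. c \<noteq> 0 \<and> x * y = - (c\<^sup>2))" for u x y :: 'a
  proof (cases "u = 0 \<or> (x = 0 \<and> y = 0)")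
    case False
    with that obtain c where "c \<noteq> 0" "x * y = - (c\<^sup>2)" by blast
    then show ?thesis using False
      by (intro witt_rank1_cancel[of _ _ "u * c"]) (auto simp: power2_eq_square mult_ac)
  qed auto
  consider "q = 0" | "s = 0" | "p = 0" | "z = 0" | "r = 0" | "t = 0" using True by blast
  then show ?thesis
  proof cases
    case 1
    have "(p * t = 0 \<and> r * s = 0) \<or> (p * s \<noteq> 0 \<and> (p * t) * (r * s) = (p * s)\<^sup>2)"
    proof (cases "p * s = 0")
      case True
      then show ?thesis using 1 012 123 unfolding mult_eq_0_iff by blast
    next
      case False
      have "(p * t) * (r * s) = (r * t) * (p * s)" by (simp add: mult_ac)
      then show ?thesis using False pl 1 by (simp add: power2_eq_square)
    qed
    then have "witt_rank1 (- z * (p * t)) = witt_rank1 (- z * (r * s))" by (intro gen) blast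
    then show ?thesis using 1 by (simp add: mult_ac W.a_comm)
  next
    case 2
    have "(z * t = 0 \<and> r * q = 0) \<or> (r * t \<noteq> 0 \<and> (z * t) * (r * q) = (r * t)\<^sup>2)"
    proof (cases "r * t = 0")
      case True
      then show ?thesis using 2 023 123 unfolding mult_eq_0_iff by blast
    next
      case False
      have "(z * t) * (r * q) = (z * q) * (r * t)" by (simp add: mult_ac)
      then show ?thesis using False pl 2 by (simp add: power2_eq_square)
    qed
    then have "witt_rank1 (- p * (z * t)) = witt_rank1 (- p * (r * q))" by (intro gen) blast
    then show ?thesis using 2 by (simp add: mult_ac)
  next
    case 3
    have "(q * t = 0 \<and> r * z = 0) \<or> (r * t \<noteq> 0 \<and> (q * t) * (r * z) = (r * t)\<^sup>2)"
    proof (cases "r * t = 0")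
      case True
      then show ?thesis using 3 012 013 unfolding mult_eq_0_iff by blast
    next
      case False
      have "(q * t) * (r * z) = (z * q) * (r * t)" by (simp add: mult_ac)
      then show ?thesis using False pl 3 by (simp add: power2_eq_square)
    qed
    then have "witt_rank1 (- s * (q * t)) = witt_rank1 (- s * (r * z))" by (intro gen) blast
    then show ?thesis using 3 by (simp add: mult_ac)
  next
    case 4
    have "(t * s = 0 \<and> p * r = 0) \<or> (r * t \<noteq> 0 \<and> (t * s) * (p * r) = (r * t)\<^sup>2)"
    proof (cases "r * t = 0")
      case True
      then show ?thesis using 4 023 013 unfolding mult_eq_0_iff by blast
    next
      case False
      have "(t * s) * (p * r) = (p * s) * (r * t)" by (simp add: mult_ac)
      then show ?thesis using False pl 4 by (simp add: power2_eq_square)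
    qed
    then have "witt_rank1 (- q * (t * s)) = witt_rank1 (- q * (p * r))" by (intro gen) blast
    then show ?thesis using 4 by (simp add: mult_ac)
  next
    case 5
    have pz: "p * s = - (z * q)" using pl 5 by (simp add: eq_neg_iff_add_eq_0)
    have "(q * s = 0 \<and> p * z = 0) \<or> (z * q \<noteq> 0 \<and> (q * s) * (p * z) = - ((z * q)\<^sup>2))"
    proof (cases "z * q = 0")
      case True
      moreover have "p * s = 0" using pz True by simp
      ultimately show ?thesis using 5 012 023 unfolding mult_eq_0_iff by blast
    next
      case False
      have "(q * s) * (p * z) = (z * q) * (p * s)" by (simp add: mult_ac)
      then show ?thesis using False pz by (simp add: power2_eq_square)
    qed
    then have "witt_rank1 (- t * (q * s)) \<oplus>\<^bsub>witt_ring\<^esub> witt_rank1 (- t * (p * z)) = \<zero>\<^bsub>witt_ring\<^esub>" by (intro gen') blast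
    then show ?thesis using 5 by (simp add: mult_ac)
  next
    case 6
    have pz: "p * s = - (z * q)" using pl 6 by (simp add: eq_neg_iff_add_eq_0)
    have "(z * s = 0 \<and> p * q = 0) \<or> (z * q \<noteq> 0 \<and> (z * s) * (p * q) = - ((z * q)\<^sup>2))"
    proof (cases "z * q = 0")
      case True
      moreover have "p * s = 0" using pz True by simp
      ultimately show ?thesis using 6 123 013 unfolding mult_eq_0_iff by blast
    next
      case False
      have "(z * s) * (p * q) = (z * q) * (p * s)" by (simp add: mult_ac)
      then show ?thesis using False pz by (simp add: power2_eq_square)
    qed
    then have "witt_rank1 (- r * (z * s)) \<oplus>\<^bsub>witt_ring\<^esub> witt_rank1 (- r * (p * q)) = \<zero>\<^bsub>witt_ring\<^esub>" by (intro gen') blast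
    then show ?thesis using 6 by (simp add: mult_ac)
  qed
qed

definition witt_value :: "'a::field mat \<Rightarrow> 'a mat \<Rightarrow> 'a mat set"
  where "witt_value g h = witt_rank1 (- (g $$ (1, 0)) * (g * h) $$ (1, 0) * h $$ (1, 0))"

lemma witt_value_closed [simp]: "witt_value g h \<in> carrier witt_ring"
  by (simp add: witt_value_def)

text \<open>The lower left entries of g, h, k, gh, hk and ghk are the minors of the vectors e_1, g
  e_1, gh e_1 and ghk e_1, because determinant-one matrices preserve minors. The identity is thus
  the Pluecker relation of these four vectors, in the form of \<open>witt_plucker\<close>.\<close>

lemma witt_value_cocycle:
  fixes g h k :: "'a::field mat"
  assumes "g \<in> carrier SL2" "h \<in> carrier SL2" "k \<in> carrier SL2"
  shows "witt_value h k \<oplus>\<^bsub>witt_ring\<^esub> witt_value g (h * k) = witt_value (g * h) k \<oplus>\<^bsub>witt_ring\<^esub> witt_value g h"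
proof -
  obtain a b c d where g: "g = mat22 a b c d" "a * d - b * c = 1" using assms(1) by (rule SL2_cases)
  obtain a' b' c' d' where h: "h = mat22 a' b' c' d'" "a' * d' - b' * c' = 1" using assms(2) by (rule SL2_cases)
  obtain a'' b'' c'' d'' where k: "k = mat22 a'' b'' c'' d''" "a'' * d'' - b'' * c'' = 1" using assms(3) by (rule SL2_cases)
  define r s where "r = c * a' + d * c'" and "s = c * b' + d * d'"
  define t where "t = c' * a'' + d' * c''"
  define z where "z = r * a'' + s * c''"
  have z': "z = c * (a' * a'' + b' * c'') + d * t" by (simp add: z_def r_def s_def t_def algebra_simps)
  have hd: "a' * d' = 1 + b' * c'" using h(2) by (simp add: algebra_simps)
  have inv1: "c = r * d' - s * c'"
  proof -
    have "r * d' - s * c' = c * (a' * d' - b' * c')" by (simp add: r_def s_def algebra_simps)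
    then show ?thesis using h(2) by simp
  qed
  have pl: "r * t = c * c'' + z * c'"
  proof -
    have "c * c'' + z * c' = (r * d' - s * c') * c'' + (r * a'' + s * c'') * c'" using inv1 z_def by simp
    also have "\<dots> = r * t" by (simp add: t_def algebra_simps)
    finally show ?thesis by simp
  qed
  have nz: "c = 0 \<Longrightarrow> d \<noteq> 0" "c' = 0 \<Longrightarrow> a' \<noteq> 0 \<and> d' \<noteq> 0" "c'' = 0 \<Longrightarrow> a'' \<noteq> 0" using g h k by auto
  have rs: "r = 0 \<Longrightarrow> s \<noteq> 0"
  proof
    assume rs: "r = 0" "s = 0"
    then have c0: "c = 0" using inv1 by simp
    then have "d * c' = 0" "d * d' = 0" using rs by (auto simp: r_def s_def)
    then show False using nz(1)[OF c0] h(2) by auto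
  qed
  have e: "c * a' + d * c' = r" "c' * a'' + d' * c'' = t" "c * (a' * a'' + b' * c'') + d * (c' * a'' + d' * c'') = z"
    "(c * a' + d * c') * a'' + (c * b' + d * d') * c'' = z"
    "c * (a' * a'' + b' * c'') + d * t = z" "r * a'' + (c * b' + d * d') * c'' = z"
    using z' by (auto simp: r_def t_def z_def s_def)
  have tz: "t = 0 \<Longrightarrow> z = c * (a' * a'' + b' * c'')" using z' by simp
  have tnz: "a' * a'' + b' * c'' \<noteq> 0" if "t = 0"
  proof
    assume w: "a' * a'' + b' * c'' = 0"
    have "d' * (a' * a'' + b' * c'') - b' * t = a'' * (a' * d' - b' * c')" by (simp add: t_def algebra_simps)
    then have "a'' = 0" using h(2) w that by simp
    moreover have "a' * t - c' * (a' * a'' + b' * c'') = c'' * (a' * d' - b' * c')" by (simp add: t_def algebra_simps)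
    then have "c'' = 0" using h(2) w that by simp
    ultimately show False using k(2) by simp
  qed
  show ?thesis unfolding witt_value_def g(1) h(1) k(1) mat22_mult One_nat_def mat22_index e
  proof (rule witt_plucker[OF pl])
    show "c = 0 \<Longrightarrow> c' = 0 \<Longrightarrow> r = 0" by (simp add: r_def)
    show "c = 0 \<Longrightarrow> r = 0 \<Longrightarrow> c' = 0" using nz(1) by (auto simp: r_def)
    show "c' = 0 \<Longrightarrow> r = 0 \<Longrightarrow> c = 0" using nz(2) by (auto simp: r_def)
    show "c' = 0 \<Longrightarrow> c'' = 0 \<Longrightarrow> t = 0" by (simp add: t_def)
    show "c' = 0 \<Longrightarrow> t = 0 \<Longrightarrow> c'' = 0" using nz(2) by (auto simp: t_def)
    show "c'' = 0 \<Longrightarrow> t = 0 \<Longrightarrow> c' = 0" using nz(3) by (auto simp: t_def)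
    show "c = 0 \<Longrightarrow> t = 0 \<Longrightarrow> z = 0" by (simp add: z')
    show "c = 0 \<Longrightarrow> z = 0 \<Longrightarrow> t = 0" using nz(1) by (auto simp: z')
    show "t = 0 \<Longrightarrow> z = 0 \<Longrightarrow> c = 0" using tz tnz by auto
    show "r = 0 \<Longrightarrow> c'' = 0 \<Longrightarrow> z = 0" by (simp add: z_def)
    show "r = 0 \<Longrightarrow> z = 0 \<Longrightarrow> c'' = 0" using rs by (auto simp: z_def)
    show "c'' = 0 \<Longrightarrow> z = 0 \<Longrightarrow> r = 0" using nz(3) by (auto simp: z_def)
  qed
qed

text \<open>The cochain n of the reduced Witt class; its coboundary moves the Witt cocycle into
  I^2(K).\<close>

definition witt_correction :: "'a::field mat \<Rightarrow> 'a mat set"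
  where "witt_correction g = (if g $$ (1, 0) = 0 then unit_diff (g $$ (0, 0)) else witt_rank1 (g $$ (1, 0)))"

definition reduced_value :: "'a::field mat \<Rightarrow> 'a mat \<Rightarrow> 'a mat set"
  where "reduced_value g h = witt_value g h \<oplus>\<^bsub>witt_ring\<^esub>
    (witt_correction g \<ominus>\<^bsub>witt_ring\<^esub> witt_correction (g * h) \<oplus>\<^bsub>witt_ring\<^esub> witt_correction h)"

lemma witt_correction_closed [simp]: "witt_correction g \<in> carrier witt_ring"
  by (simp add: witt_correction_def)

lemma pfister_expand:
  "a \<noteq> 0 \<Longrightarrow> b \<noteq> 0 \<Longrightarrow> pfister a b = witt_rank1 1 \<oplus>\<^bsub>witt_ring\<^esub> (\<ominus>\<^bsub>witt_ring\<^esub> witt_rank1 a \<oplus>\<^bsub>witt_ring\<^esub>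
    (\<ominus>\<^bsub>witt_ring\<^esub> witt_rank1 b \<oplus>\<^bsub>witt_ring\<^esub> witt_rank1 (a * b)))"
  by (simp add: pfister_eq_sum witt_rank1_inv)

lemma witt_rank1_inverse: "witt_rank1 (1 / a) = witt_rank1 (a :: 'a::field)"
  by (cases "a = 0") (auto intro!: witt_rank1_cong[of _ _ 1])

lemma witt_rank1_divide: "witt_rank1 (b / a) = witt_rank1 (a * b :: 'a::field)"
proof (cases "a = 0 \<or> b = 0")
  case False
  then show ?thesis by (intro witt_rank1_cong[of _ _ b]) (auto simp: power2_eq_square)
qed auto

text \<open>The additive identities behind four Bruhat cases of the reduced cocycle: u stands for
  [1], x and y for the classes of two scalars, and z for that of their product or quotient. The
  generic case is \<open>pfister_arith'\<close>.\<close>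

lemma (in abelian_group) pfister_arith:
  assumes "u \<in> carrier G" "x \<in> carrier G" "y \<in> carrier G" "z \<in> carrier G"
  shows "u \<oplus> \<ominus> x \<oplus> \<ominus> (u \<oplus> \<ominus> z) \<oplus> (u \<oplus> \<ominus> y) = u \<oplus> (\<ominus> x \<oplus> (\<ominus> y \<oplus> z))"
    and "u \<oplus> \<ominus> x \<oplus> \<ominus> z \<oplus> y = u \<oplus> (\<ominus> x \<oplus> (y \<oplus> \<ominus> z))"
    and "x \<oplus> \<ominus> z \<oplus> (u \<oplus> \<ominus> y) = u \<oplus> (x \<oplus> (\<ominus> y \<oplus> \<ominus> z))"
    and "x \<oplus> \<ominus> (u \<oplus> z) \<oplus> y = \<ominus> (u \<oplus> (\<ominus> x \<oplus> (z \<oplus> \<ominus> y)))"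
proof -
  have "u \<oplus> \<ominus> x \<oplus> \<ominus> (u \<oplus> \<ominus> z) \<oplus> (u \<oplus> \<ominus> y) = (u \<oplus> \<ominus> u) \<oplus> (u \<oplus> (\<ominus> x \<oplus> (\<ominus> y \<oplus> z)))"
    using assms by (simp only: a_ac a_closed a_inv_closed minus_add minus_minus)
  then show "u \<oplus> \<ominus> x \<oplus> \<ominus> (u \<oplus> \<ominus> z) \<oplus> (u \<oplus> \<ominus> y) = u \<oplus> (\<ominus> x \<oplus> (\<ominus> y \<oplus> z))"
    using assms by (simp add: r_neg)
qed (use assms in \<open>simp_all only: a_ac a_closed a_inv_closed minus_add minus_minus\<close>)

lemma (in abelian_group) pfister_arith':
  assumes "u \<in> carrier G" "x \<in> carrier G" "y \<in> carrier G" "z \<in> carrier G" "v \<in> carrier G" "w \<in> carrier G"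
  shows "\<ominus> v \<oplus> (x \<oplus> \<ominus> z \<oplus> y) =
      u \<oplus> (x \<oplus> (y \<oplus> w)) \<oplus> (u \<oplus> (\<ominus> w \<oplus> (\<ominus> v \<oplus> z)) \<oplus> \<ominus> (u \<oplus> (z \<oplus> (z \<oplus> u))))"
proof -
  define m where "m = \<ominus> v \<oplus> (x \<oplus> y)"
  have m: "m \<in> carrier G" using assms by (simp add: m_def)
  have "u \<oplus> (x \<oplus> (y \<oplus> w)) \<oplus> (u \<oplus> (\<ominus> w \<oplus> (\<ominus> v \<oplus> z))) = (u \<oplus> u \<oplus> z \<oplus> m) \<oplus> (w \<oplus> \<ominus> w)"
    using assms unfolding m_def by (simp only: a_ac a_closed a_inv_closed)
  also have "\<dots> = u \<oplus> u \<oplus> z \<oplus> m" using assms m by (simp add: r_neg)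
  finally have 1: "u \<oplus> (x \<oplus> (y \<oplus> w)) \<oplus> (u \<oplus> (\<ominus> w \<oplus> (\<ominus> v \<oplus> z))) = u \<oplus> u \<oplus> z \<oplus> m" .
  have "u \<oplus> (x \<oplus> (y \<oplus> w)) \<oplus> (u \<oplus> (\<ominus> w \<oplus> (\<ominus> v \<oplus> z)) \<oplus> \<ominus> (u \<oplus> (z \<oplus> (z \<oplus> u)))) =
      (u \<oplus> u \<oplus> z \<oplus> m) \<oplus> \<ominus> (u \<oplus> (z \<oplus> (z \<oplus> u)))"
    unfolding 1[symmetric] by (rule a_assoc[symmetric]) (use assms in simp_all)
  also have "\<dots> = ((u \<oplus> u \<oplus> z) \<oplus> \<ominus> (u \<oplus> u \<oplus> z)) \<oplus> (m \<oplus> \<ominus> z)"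
    using assms m by (simp only: a_ac a_closed a_inv_closed minus_add)
  also have "\<dots> = m \<oplus> \<ominus> z" using assms m by (simp add: r_neg)
  also have "\<dots> = \<ominus> v \<oplus> (x \<oplus> \<ominus> z \<oplus> y)" using assms unfolding m_def by (simp only: a_ac a_closed a_inv_closed)
  finally show ?thesis by simp
qed

text \<open>In this and the following Bruhat cases the arguments of \<open>pfister\<close> are kept
  in the form in which they occur as arguments of \<open>symbol\<close> when lifts are multiplied in
  \<open>sect_upper_upper\<close> to \<open>sect_big_big\<close>, so that the two computations match
  term by term.\<close>

lemma reduced_value_upper_upper:
  assumes "a \<noteq> 0" "a' \<noteq> 0"
  shows "reduced_value (mat22 a b 0 d) (mat22 a' b' 0 d') = pfister a a'"
  unfolding reduced_value_def witt_value_def witt_correction_def unit_diff_def a_minus_def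
  using assms witt_rank1_closed[of 1] witt_rank1_closed[of a] witt_rank1_closed[of a'] witt_rank1_closed[of "a * a'"]
  by (simp add: pfister_expand) (rule W.pfister_arith(1); simp)

lemma reduced_value_upper_big:
  assumes "a \<noteq> 0" "d = 1 / a" "q \<noteq> (0 :: 'a::field)"
  shows "reduced_value (mat22 a b 0 d) (mat22 a' b' q d') = pfister (1 / a) (- q)"
proof -
  have 1: "witt_rank1 (- (q / a)) = \<ominus>\<^bsub>witt_ring\<^esub> witt_rank1 (q / a)" "witt_rank1 (- q) = \<ominus>\<^bsub>witt_ring\<^esub> witt_rank1 q"
    by (rule witt_rank1_inv)+
  show ?thesis
    unfolding reduced_value_def witt_value_def witt_correction_def unit_diff_def a_minus_def
    using assms witt_rank1_closed[of "1::'a"] witt_rank1_closed[of a] witt_rank1_closed[of q] witt_rank1_closed[of "q / a"]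
    by (simp add: pfister_expand witt_rank1_inverse 1) (rule W.pfister_arith(2); simp)
qed

lemma reduced_value_big_upper:
  assumes "a \<noteq> 0" "p \<noteq> (0 :: 'a::field)"
  shows "reduced_value (mat22 a' b' p d') (mat22 a b 0 d) = pfister (- p) a"
proof -
  have 1: "witt_rank1 (- (p * a)) = \<ominus>\<^bsub>witt_ring\<^esub> witt_rank1 (p * a)" "witt_rank1 (- p) = \<ominus>\<^bsub>witt_ring\<^esub> witt_rank1 p"
    by (rule witt_rank1_inv)+
  show ?thesis
    unfolding reduced_value_def witt_value_def witt_correction_def unit_diff_def a_minus_def
    using assms witt_rank1_closed[of "1::'a"] witt_rank1_closed[of a] witt_rank1_closed[of p] witt_rank1_closed[of "p * a"]
    by (simp add: pfister_expand 1) (rule W.pfister_arith(3); simp)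
qed

lemma reduced_value_big_big_0:
  assumes "p \<noteq> 0" "q \<noteq> (0 :: 'a::field)" "p * a' + d * q = 0" "a * a' + b * q = - (q / p)"
  shows "reduced_value (mat22 a b p d) (mat22 a' b' q d') = \<ominus>\<^bsub>witt_ring\<^esub> pfister p (- (q / p))"
proof -
  have 1: "witt_rank1 (- (q / p)) = \<ominus>\<^bsub>witt_ring\<^esub> witt_rank1 (q / p)" "witt_rank1 (- q) = \<ominus>\<^bsub>witt_ring\<^esub> witt_rank1 q"
    by (rule witt_rank1_inv)+
  show ?thesis
    unfolding reduced_value_def witt_value_def witt_correction_def unit_diff_def a_minus_def
    using assms witt_rank1_closed[of "1::'a"] witt_rank1_closed[of q] witt_rank1_closed[of p] witt_rank1_closed[of "q / p"]
    by (simp add: pfister_expand 1) (rule W.pfister_arith(4); simp)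
qed

lemma reduced_value_big_big:
  assumes "p \<noteq> 0" "q \<noteq> (0 :: 'a::field)" "p * a' + d * q = r" "r \<noteq> 0"
  shows "reduced_value (mat22 a b p d) (mat22 a' b' q d') =
    pfister (- p) (- q) \<oplus>\<^bsub>witt_ring\<^esub> (pfister (p * q) (r / (p * q)) \<ominus>\<^bsub>witt_ring\<^esub> pfister (- (1 / r)) (- r))"
proof -
  have 1: "witt_rank1 (- p) = \<ominus>\<^bsub>witt_ring\<^esub> witt_rank1 p" "witt_rank1 (- q) = \<ominus>\<^bsub>witt_ring\<^esub> witt_rank1 q"
    "witt_rank1 (- r) = \<ominus>\<^bsub>witt_ring\<^esub> witt_rank1 r" "witt_rank1 (- (1 / r)) = \<ominus>\<^bsub>witt_ring\<^esub> witt_rank1 r"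
    "witt_rank1 (r / (p * q)) = witt_rank1 (p * q * r)" "witt_rank1 (- (p * r * q)) = \<ominus>\<^bsub>witt_ring\<^esub> witt_rank1 (p * q * r)"
    using witt_rank1_inv[of "p * r * q"]
    by (simp_all add: witt_rank1_inv witt_rank1_inverse witt_rank1_divide mult_ac)
  have "witt_value (mat22 a b p d) (mat22 a' b' q d') = witt_rank1 (- (p * r * q))"
    unfolding witt_value_def using assms(3) by simp
  moreover have "witt_correction (mat22 a b p d * mat22 a' b' q d') = witt_rank1 r"
    unfolding witt_correction_def using assms by simp
  ultimately show ?thesis
    unfolding reduced_value_def a_minus_def
    using assms witt_rank1_closed[of "1::'a"] witt_rank1_closed[of q] witt_rank1_closed[of p] witt_rank1_closed[of r]
      witt_rank1_closed[of "p * q"] witt_rank1_closed[of "p * q * r"]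
    by (simp add: pfister_expand 1 witt_correction_def del: mat22_mult) (rule W.pfister_arith'; simp)
qed

section \<open>Equicommutative extensions of \<open>SL(2, K)\<close>\<close>

locale equicommutative_extension =
  E: group E + A: comm_group A for E :: "('e, 'm) monoid_scheme" (structure) and A :: "('b, 'n) monoid_scheme" +
  fixes \<pi> :: "'e \<Rightarrow> 'a::field mat" and \<iota> :: "'b \<Rightarrow> 'e"
  assumes infinite_field: "infinite (UNIV :: 'a set)"
    and \<pi>_closed [simp]: "u \<in> carrier E \<Longrightarrow> \<pi> u \<in> carrier SL2"
    and \<pi>_mult [simp]: "u \<in> carrier E \<Longrightarrow> v \<in> carrier E \<Longrightarrow> \<pi> (u \<otimes> v) = \<pi> u * \<pi> v"
    and \<pi>_surj: "g \<in> carrier SL2 \<Longrightarrow> \<exists>u\<in>carrier E. \<pi> u = g"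
    and \<iota>_closed [simp]: "z \<in> carrier A \<Longrightarrow> \<iota> z \<in> carrier E"
    and \<iota>_mult: "z \<in> carrier A \<Longrightarrow> z' \<in> carrier A \<Longrightarrow> \<iota> (z \<otimes>\<^bsub>A\<^esub> z') = \<iota> z \<otimes> \<iota> z'"
    and \<iota>_inj: "z \<in> carrier A \<Longrightarrow> z' \<in> carrier A \<Longrightarrow> \<iota> z = \<iota> z' \<Longrightarrow> z = z'"
    and \<pi>_\<iota> [simp]: "z \<in> carrier A \<Longrightarrow> \<pi> (\<iota> z) = mat22 1 0 0 1"
    and kernel: "u \<in> carrier E \<Longrightarrow> \<pi> u = mat22 1 0 0 1 \<Longrightarrow> \<exists>z\<in>carrier A. u = \<iota> z"
    and commute: "u \<in> carrier E \<Longrightarrow> v \<in> carrier E \<Longrightarrow> \<pi> u * \<pi> v = \<pi> v * \<pi> u \<Longrightarrow> u \<otimes> v = v \<otimes> u"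
begin

lemma \<pi>_one [simp]: "\<pi> \<one> = mat22 1 0 0 1"
proof -
  have "\<pi> \<one> \<otimes>\<^bsub>SL2\<^esub> \<pi> \<one> = \<pi> \<one>" using \<pi>_mult[of \<one> \<one>] by simp
  then have "\<pi> \<one> = \<one>\<^bsub>SL2\<^esub>" using SL.l_cancel_one[of "\<pi> \<one>" "\<pi> \<one>"] by simp
  then show ?thesis by simp
qed

lemma \<pi>_inv: "u \<in> carrier E \<Longrightarrow> \<pi> (inv u) = inv\<^bsub>SL2\<^esub> (\<pi> u)"
  using \<pi>_mult[of "inv u" u] by (intro SL.inv_equality[symmetric]) auto

lemma \<pi>_inv_eq: "u \<in> carrier E \<Longrightarrow> \<pi> u = mat22 a b c d \<Longrightarrow> \<pi> (inv u) = mat22 d (- b) (- c) a"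
  using \<pi>_closed[of u] by (simp add: \<pi>_inv SL2_inv)

text \<open>Centrality of the kernel is the case of \<open>commute\<close> in which one image is the
  identity matrix.\<close>

lemma \<iota>_comm: "z \<in> carrier A \<Longrightarrow> u \<in> carrier E \<Longrightarrow> \<iota> z \<otimes> u = u \<otimes> \<iota> z"
proof -
  assume z: "z \<in> carrier A" "u \<in> carrier E"
  have "\<pi> u \<in> carrier SL2" using z by simp
  then obtain a b c d where "\<pi> u = mat22 a b c d" by (rule SL2_cases)
  then show ?thesis using z by (intro commute) auto
qed

lemma \<iota>_one [simp]: "\<iota> \<one>\<^bsub>A\<^esub> = \<one>"
  using \<iota>_mult[of "\<one>\<^bsub>A\<^esub>" "\<one>\<^bsub>A\<^esub>"] by simp

lemma \<iota>_inv: "z \<in> carrier A \<Longrightarrow> \<iota> (inv\<^bsub>A\<^esub> z) = inv (\<iota> z)"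
  using \<iota>_mult[of "inv\<^bsub>A\<^esub> z" z] by (intro E.inv_equality[symmetric]) auto

lemma same_image:
  assumes "u \<in> carrier E" "v \<in> carrier E" "\<pi> u = \<pi> v"
  obtains z where "z \<in> carrier A" "u = \<iota> z \<otimes> v"
proof -
  have "\<pi> (u \<otimes> inv v) = \<pi> v \<otimes>\<^bsub>SL2\<^esub> inv\<^bsub>SL2\<^esub> (\<pi> v)" using assms by (simp add: \<pi>_inv)
  then have "\<pi> (u \<otimes> inv v) = mat22 1 0 0 1" using assms SL.r_inv[of "\<pi> v"] by simp
  then obtain z where "z \<in> carrier A" "u \<otimes> inv v = \<iota> z" using kernel[of "u \<otimes> inv v"] assms by auto
  moreover from this have "u = \<iota> z \<otimes> v" using assms by (metis E.inv_solve_right' \<iota>_closed)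
  ultimately show thesis using that by blast
qed

definition conj_by :: "'e \<Rightarrow> 'e \<Rightarrow> 'e"
  where "conj_by u v = u \<otimes> v \<otimes> inv u"

lemma conj_closed [simp]: "u \<in> carrier E \<Longrightarrow> v \<in> carrier E \<Longrightarrow> conj_by u v \<in> carrier E"
  by (simp add: conj_by_def)

lemma conj_mult: "u \<in> carrier E \<Longrightarrow> v \<in> carrier E \<Longrightarrow> w \<in> carrier E \<Longrightarrow>
    conj_by u (v \<otimes> w) = conj_by u v \<otimes> conj_by u w"
  by (simp add: conj_by_def E.m_assoc E.inv_solve_left)

lemma conj_inv: "u \<in> carrier E \<Longrightarrow> v \<in> carrier E \<Longrightarrow> conj_by u (inv v) = inv (conj_by u v)"
  by (simp add: conj_by_def E.m_assoc E.inv_mult_group)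

lemma conj_conj: "u \<in> carrier E \<Longrightarrow> v \<in> carrier E \<Longrightarrow> w \<in> carrier E \<Longrightarrow>
    conj_by u (conj_by v w) = conj_by (u \<otimes> v) w"
  by (simp add: conj_by_def E.m_assoc E.inv_mult_group)

lemma conj_one: "v \<in> carrier E \<Longrightarrow> conj_by \<one> v = v"
  by (simp add: conj_by_def)

lemma conj_inverse': "u \<in> carrier E \<Longrightarrow> v \<in> carrier E \<Longrightarrow> conj_by u (conj_by (inv u) v) = v"
  by (simp add: conj_conj conj_one)

lemma mult_conj: "u \<in> carrier E \<Longrightarrow> v \<in> carrier E \<Longrightarrow> conj_by u v \<otimes> u = u \<otimes> v"
  by (simp add: conj_by_def E.m_assoc)

lemma conj_commute: "u \<in> carrier E \<Longrightarrow> v \<in> carrier E \<Longrightarrow> \<pi> u * \<pi> v = \<pi> v * \<pi> u \<Longrightarrow> conj_by u v = v"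
  using commute[of u v] by (simp add: conj_by_def E.m_assoc)

section \<open>Canonical lifts of the upper unipotent matrices\<close>

definition lift :: "'a mat \<Rightarrow> 'e"
  where "lift g = (SOME u. u \<in> carrier E \<and> \<pi> u = g)"

lemma lift: "g \<in> carrier SL2 \<Longrightarrow> lift g \<in> carrier E \<and> \<pi> (lift g) = g"
  unfolding lift_def by (rule someI_ex) (use \<pi>_surj in blast)

definition e0 :: 'a where "e0 = (SOME a. nondegenerate_scale a)"

lemma e0: "e0 \<noteq> 0" "e0\<^sup>2 - 1 \<noteq> 0"
proof -
  have "nondegenerate_scale e0" unfolding e0_def
    using nondegenerate_scale_ex[OF infinite_field] by (metis someI_ex)
  then show "e0 \<noteq> 0" "e0\<^sup>2 - 1 \<noteq> 0" by (auto simp: nondegenerate_scale_def)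
qed

definition d0 :: 'e where "d0 = lift (mat22 e0 0 0 (1 / e0))"

lemma d0 [simp]: "d0 \<in> carrier E" "\<pi> d0 = mat22 e0 0 0 (1 / e0)"
  using lift[of "mat22 e0 0 0 (1 / e0)"] e0 by (auto simp: d0_def)

text \<open>The commutator of two lifts does not depend on the lifts, which gives a canonical lift of
  the unipotent matrices.\<close>

definition X :: "'a \<Rightarrow> 'e"
  where "X t = (let u = lift (mat22 1 (t / (e0\<^sup>2 - 1)) 0 1) in conj_by d0 u \<otimes> inv u)"

text \<open>Another lift differs by a central factor, which cancels in the commutator with
  \<open>d0\<close>. The division by e0^2 - 1 compensates the factor that this commutator introduces
  into the parameter.\<close>

lemma X_eq:
  assumes u: "u \<in> carrier E" "\<pi> u = mat22 1 (t / (e0\<^sup>2 - 1)) 0 1"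
  shows "X t = conj_by d0 u \<otimes> inv u"
proof -
  let ?v = "lift (mat22 1 (t / (e0\<^sup>2 - 1)) 0 1)"
  have v: "?v \<in> carrier E" "\<pi> ?v = \<pi> u" using lift[of "mat22 1 (t / (e0\<^sup>2 - 1)) 0 1"] u by auto
  obtain z where z: "z \<in> carrier A" "?v = \<iota> z \<otimes> u" using same_image[OF v(1) u(1) v(2)] .
  have c: "conj_by d0 (\<iota> z) = \<iota> z" using z(1) \<iota>_comm[OF z(1), of d0, symmetric] by (simp add: conj_by_def E.m_assoc)
  have "conj_by d0 ?v \<otimes> inv ?v = \<iota> z \<otimes> (conj_by d0 u \<otimes> (inv u \<otimes> inv (\<iota> z)))"
    using z u by (simp add: conj_mult c E.inv_mult_group E.m_assoc)
  also have "\<dots> = \<iota> z \<otimes> (conj_by d0 u \<otimes> inv u) \<otimes> inv (\<iota> z)" using z u by (simp add: E.m_assoc)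
  also have "\<dots> = conj_by d0 u \<otimes> inv u"
    using z(1) u \<iota>_comm[OF z(1), of "conj_by d0 u \<otimes> inv u"] by (simp add: E.m_assoc)
  finally show ?thesis by (simp add: X_def Let_def)
qed

lemma X_ex:
  obtains u where "u \<in> carrier E" "\<pi> u = mat22 1 (t / (e0\<^sup>2 - 1)) 0 1" "X t = conj_by d0 u \<otimes> inv u"
  using lift[of "mat22 1 (t / (e0\<^sup>2 - 1)) 0 1"] X_eq[of "lift (mat22 1 (t / (e0\<^sup>2 - 1)) 0 1)" t] that by auto

lemma X_closed [simp]: "X t \<in> carrier E"
  by (rule X_ex[of t]) simp

lemma \<pi>_conj: "u \<in> carrier E \<Longrightarrow> v \<in> carrier E \<Longrightarrow> \<pi> (conj_by u v) = \<pi> u * \<pi> v * \<pi> (inv u)"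
  by (simp add: conj_by_def)

lemma X_image [simp]: "\<pi> (X t) = mat22 1 t 0 1"
proof -
  obtain u where u: "u \<in> carrier E" "\<pi> u = mat22 1 (t / (e0\<^sup>2 - 1)) 0 1" "X t = conj_by d0 u \<otimes> inv u"
    by (rule X_ex)
  define s where "s = t / (e0\<^sup>2 - 1)"
  have t: "t = (e0\<^sup>2 - 1) * s" using e0 by (simp add: s_def)
  have us: "\<pi> u = mat22 1 s 0 1" using u(2) by (simp add: s_def)
  have "\<pi> (X t) = mat22 1 ((e0\<^sup>2 - 1) * s) 0 1"
    unfolding u(3) using u(1) us \<pi>_inv_eq[OF u(1) us] \<pi>_inv_eq[OF d0] e0(1)
    by (simp add: \<pi>_conj algebra_simps power2_eq_square)
  then show ?thesis using t by simp
qed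

text \<open>The commutator of d with uv is that of d with u, times the u-conjugate of that of d with
  v. The conjugation is trivial because \<open>u\<close> and \<open>X t\<close> have commuting
  unipotent images.\<close>

lemma X_add: "X (s + t) = X s \<otimes> X t"
proof -
  obtain u where u: "u \<in> carrier E" "\<pi> u = mat22 1 (s / (e0\<^sup>2 - 1)) 0 1" "X s = conj_by d0 u \<otimes> inv u"
    by (rule X_ex)
  obtain v where v: "v \<in> carrier E" "\<pi> v = mat22 1 (t / (e0\<^sup>2 - 1)) 0 1" "X t = conj_by d0 v \<otimes> inv v"
    by (rule X_ex)
  have c: "inv u \<otimes> X t = X t \<otimes> inv u"
    using u(1) \<pi>_inv_eq[OF u(1,2)] by (intro commute) (auto simp: add.commute)
  have "X (s + t) = conj_by d0 (u \<otimes> v) \<otimes> inv (u \<otimes> v)"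
    by (rule X_eq) (use u v in \<open>auto simp: add_divide_distrib add.commute\<close>)
  also have "\<dots> = conj_by d0 u \<otimes> (X t \<otimes> inv u)"
    using u(1) v by (simp add: conj_mult E.inv_mult_group E.m_assoc)
  also have "\<dots> = conj_by d0 u \<otimes> (inv u \<otimes> X t)" using c by simp
  also have "\<dots> = X s \<otimes> X t" using u by (simp add: E.m_assoc)
  finally show ?thesis .
qed

lemma X_zero [simp]: "X 0 = \<one>"
  using X_add[of 0 0] by simp

lemma X_inv: "inv (X t) = X (- t)"
  using X_add[of "- t" t] by (intro E.inv_equality) auto

text \<open>Lifts of diagonal matrices commute, so \<open>w\<close> fixes \<open>d0\<close> and
  carries the commutator defining \<open>X t\<close> to the one defining
  \<open>X (a^2 t)\<close>.\<close>

lemma conj_diag_X: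
  assumes w: "w \<in> carrier E" "\<pi> w = mat22 a 0 0 (1 / a)" and a: "a \<noteq> 0"
  shows "conj_by w (X t) = X (a\<^sup>2 * t)"
proof -
  obtain u where u: "u \<in> carrier E" "\<pi> u = mat22 1 (t / (e0\<^sup>2 - 1)) 0 1" "X t = conj_by d0 u \<otimes> inv u"
    by (rule X_ex)
  have wd: "w \<otimes> d0 = d0 \<otimes> w" using w a e0 by (intro commute) auto
  have "\<pi> (conj_by w u) = mat22 1 (a\<^sup>2 * t / (e0\<^sup>2 - 1)) 0 1"
    using w u(1,2) \<pi>_inv_eq[OF w] a by (simp add: \<pi>_conj power2_eq_square)
  then have "X (a\<^sup>2 * t) = conj_by d0 (conj_by w u) \<otimes> inv (conj_by w u)"
    using w u by (intro X_eq) auto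
  also have "\<dots> = conj_by w (X t)"
    using w(1) u wd by (simp add: conj_mult conj_inv conj_conj)
  finally show ?thesis by simp
qed

section \<open>Lower unipotent matrices and Steinberg's lifts of antidiagonal matrices\<close>

definition w0 :: 'e where "w0 = lift (mat22 0 (- 1) 1 0)"

lemma w0 [simp]: "w0 \<in> carrier E" "\<pi> w0 = mat22 0 (- 1) 1 0"
  using lift[of "mat22 0 (- 1) 1 0"] by (auto simp: w0_def)

lemma w0_inv [simp]: "\<pi> (inv w0) = mat22 0 1 (- 1) 0"
  using \<pi>_inv_eq[OF w0] by simp

text \<open>Defined by conjugation, so that additivity is inherited from \<open>X\<close>. The
  kernel being central, the choice of the lift \<open>w0\<close> does not affect the result.\<close>

definition Y :: "'a \<Rightarrow> 'e" where "Y p = conj_by w0 (X (- p))"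

lemma Y_closed [simp]: "Y p \<in> carrier E"
  by (simp add: Y_def)

lemma Y_image [simp]: "\<pi> (Y p) = mat22 1 0 p 1"
  by (simp add: Y_def \<pi>_conj)

lemma Y_add: "Y (p + q) = Y p \<otimes> Y q"
  using X_add[of "- p" "- q"] by (simp add: Y_def conj_mult add.commute)

lemma Y_zero [simp]: "Y 0 = \<one>"
  using Y_add[of 0 0] by simp

lemma Y_inv: "inv (Y p) = Y (- p)"
  by (simp add: Y_def X_inv conj_inv[symmetric])

text \<open>An antidiagonal lift is \<open>w0\<close> times a diagonal lift, so the claim reduces to
  \<open>conj_diag_X\<close> and the definition of \<open>Y\<close>.\<close>

lemma conj_anti_X:
  assumes u: "u \<in> carrier E" "\<pi> u = mat22 0 (- (1 / q)) q 0" and q: "q \<noteq> 0"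
  shows "conj_by u (X t) = Y (- (q\<^sup>2 * t))"
proof -
  have "\<pi> (inv w0 \<otimes> u) = mat22 q 0 0 (1 / q)" using u by simp
  then have "conj_by (inv w0 \<otimes> u) (X t) = X (q\<^sup>2 * t)" using u(1) q by (intro conj_diag_X) auto
  moreover have "conj_by u (X t) = conj_by w0 (conj_by (inv w0 \<otimes> u) (X t))"
    using u(1) by (simp add: conj_conj E.m_assoc[symmetric])
  ultimately show ?thesis by (simp add: Y_def)
qed

lemma conj_anti_Y:
  assumes u: "u \<in> carrier E" "\<pi> u = mat22 0 (- (1 / q)) q 0" and q: "q \<noteq> 0"
  shows "conj_by u (Y t) = X (- (t / q\<^sup>2))"
proof -
  have "\<pi> (inv u) = mat22 0 (- (1 / - q)) (- q) 0" using \<pi>_inv_eq[OF u] by simp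
  then have "conj_by (inv u) (X (- (t / q\<^sup>2))) = Y t"
    using conj_anti_X[of "inv u" "- q" "- (t / q\<^sup>2)"] u(1) q by simp
  then show ?thesis using conj_inverse'[OF u(1) X_closed] by metis
qed

lemma conj_diag_Y:
  assumes u: "u \<in> carrier E" "\<pi> u = mat22 a 0 0 (1 / a)" and a: "a \<noteq> 0"
  shows "conj_by u (Y t) = Y (t / a\<^sup>2)"
proof -
  have "\<pi> (inv w0 \<otimes> u \<otimes> w0) = mat22 (1 / a) 0 0 (1 / (1 / a))" using u by simp
  then have "conj_by (inv w0 \<otimes> u \<otimes> w0) (X (- t)) = X ((1 / a)\<^sup>2 * - t)" using u(1) a by (intro conj_diag_X) auto
  moreover have "conj_by u (Y t) = conj_by w0 (conj_by (inv w0 \<otimes> u \<otimes> w0) (X (- t)))"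
    using u(1) by (simp add: Y_def conj_conj E.m_assoc[symmetric])
  ultimately show ?thesis by (simp add: Y_def power_divide)
qed

text \<open>Steinberg's element w, a word in unipotent lifts and therefore canonical.\<close>

definition W :: "'a \<Rightarrow> 'e" where "W p = X (- (1 / p)) \<otimes> Y p \<otimes> X (- (1 / p))"

lemma W_closed [simp]: "W p \<in> carrier E"
  by (simp add: W_def)

lemma W_image [simp]: "p \<noteq> 0 \<Longrightarrow> \<pi> (W p) = mat22 0 (- (1 / p)) p 0"
  by (simp add: W_def)

lemma W_inv: "inv (W p) = W (- p)"
  by (simp add: W_def E.inv_mult_group X_inv Y_inv E.m_assoc)

lemma conj_diag_W:
  assumes u: "u \<in> carrier E" "\<pi> u = mat22 a 0 0 (1 / a)" and a: "a \<noteq> 0" "p \<noteq> 0"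
  shows "conj_by u (W p) = W (p / a\<^sup>2)"
  using u(1) a conj_diag_X[OF u a(1)] conj_diag_Y[OF u a(1)] by (simp add: W_def conj_mult)

text \<open>Conjugating \<open>W p\<close> by itself changes nothing, but it exchanges the X and Y
  factors of the defining word.\<close>

lemma W_alt: "p \<noteq> 0 \<Longrightarrow> W p = Y p \<otimes> X (- (1 / p)) \<otimes> Y p"
proof -
  assume p: "p \<noteq> 0"
  have "W p = conj_by (W p) (W p)" by (simp add: conj_by_def E.m_assoc)
  also have "\<dots> = conj_by (W p) (X (- (1 / p))) \<otimes> conj_by (W p) (Y p) \<otimes> conj_by (W p) (X (- (1 / p)))"
    by (subst (2) W_def) (simp add: conj_mult)
  also have "\<dots> = Y p \<otimes> X (- (1 / p)) \<otimes> Y p"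
    using p conj_anti_X[OF W_closed W_image] conj_anti_Y[OF W_closed W_image] by (simp add: power2_eq_square)
  finally show ?thesis .
qed

lemma conj_anti_W:
  assumes u: "u \<in> carrier E" "\<pi> u = mat22 0 (- (1 / q)) q 0" and q: "q \<noteq> 0" "p \<noteq> 0"
  shows "conj_by u (W p) = W (q\<^sup>2 / p)"
proof -
  have "conj_by u (W p) = Y (q\<^sup>2 / p) \<otimes> X (- (p / q\<^sup>2)) \<otimes> Y (q\<^sup>2 / p)"
    using u(1) conj_anti_X[OF u q(1)] conj_anti_Y[OF u q(1)] by (simp add: W_def conj_mult)
  also have "\<dots> = W (q\<^sup>2 / p)" using W_alt[of "q\<^sup>2 / p"] q by simp
  finally show ?thesis .
qed

text \<open>Steinberg's lift of diag(a, 1/a). The factor \<open>W 1\<close> normalises it to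
  \<open>H 1 = \<one>\<close>, since \<open>W (- 1)\<close> is the inverse of
  \<open>W 1\<close>.\<close>

definition H :: "'a \<Rightarrow> 'e" where "H a = W 1 \<otimes> W (- a)"

lemma H_closed [simp]: "H a \<in> carrier E"
  by (simp add: H_def)

lemma H_image [simp]: "a \<noteq> 0 \<Longrightarrow> \<pi> (H a) = mat22 a 0 0 (1 / a)"
  by (simp add: H_def)

lemma H_one [simp]: "H 1 = \<one>"
proof -
  have "W (- 1) = inv (W 1)" by (simp add: W_inv)
  then show ?thesis by (simp add: H_def)
qed

lemma W_H: "W p = W (- 1) \<otimes> H (- p)"
proof -
  have "W (- 1) = inv (W 1)" by (simp add: W_inv)
  then show ?thesis by (simp add: H_def E.m_assoc[symmetric])
qed

lemma W_H_swap: "c \<noteq> 0 \<Longrightarrow> W (- 1) \<otimes> H c = H (1 / c) \<otimes> W (- 1)"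
proof -
  assume c: "c \<noteq> 0"
  have i: "\<pi> (W (- 1)) = mat22 0 (- (1 / - 1)) (- 1) 0" using W_image[of "- 1"] by simp
  have "conj_by (W (- 1)) (H c) = H (1 / c)"
    using conj_anti_W[OF W_closed i, of 1] conj_anti_W[OF W_closed i, of "- c"] c by (simp add: H_def conj_mult)
  then show ?thesis using mult_conj[of "W (- 1)" "H c"] by simp
qed

lemma W_W: "W (- 1) \<otimes> W (- 1) = inv (H (- 1))"
  using W_inv[of 1] by (simp add: H_def E.inv_mult_group)

section \<open>Relations between lifts of diagonal matrices\<close>

definition diag :: "'e set" where "diag = {u \<in> carrier E. \<exists>a. a \<noteq> 0 \<and> \<pi> u = mat22 a 0 0 (1 / a)}"

text \<open>In a general central extension the lifts of the torus need not commute;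
  equicommutativity enters here, and this is what makes the symbol symmetric and trivial on
  squares.\<close>

lemma diag_comm: "u \<in> diag \<Longrightarrow> v \<in> diag \<Longrightarrow> u \<otimes> v = v \<otimes> u"
  unfolding diag_def by (auto intro!: commute simp: mult.commute)

lemma diag_closed [simp]: "u \<in> diag \<Longrightarrow> u \<in> carrier E"
  by (simp add: diag_def)

lemma diag_mult [simp]: "u \<in> diag \<Longrightarrow> v \<in> diag \<Longrightarrow> u \<otimes> v \<in> diag"
proof -
  assume uv: "u \<in> diag" "v \<in> diag"
  obtain a where a: "a \<noteq> 0" "\<pi> u = mat22 a 0 0 (1 / a)" using uv(1) unfolding diag_def by blast
  obtain b where b: "b \<noteq> 0" "\<pi> v = mat22 b 0 0 (1 / b)" using uv(2) unfolding diag_def by blast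
  have c: "u \<in> carrier E" "v \<in> carrier E" using uv unfolding diag_def by blast+
  have "\<pi> (u \<otimes> v) = mat22 (a * b) 0 0 (1 / (a * b))" using c a b by simp
  moreover have "u \<otimes> v \<in> carrier E" "a * b \<noteq> 0" using c a b by simp_all
  ultimately show ?thesis unfolding diag_def by blast
qed

lemma diag_inv [simp]: "u \<in> diag \<Longrightarrow> inv u \<in> diag"
proof -
  assume u: "u \<in> diag"
  obtain a where a: "a \<noteq> 0" "\<pi> u = mat22 a 0 0 (1 / a)" using u unfolding diag_def by blast
  have c: "u \<in> carrier E" using u unfolding diag_def by blast
  have "\<pi> (inv u) = mat22 (1 / a) 0 0 (1 / (1 / a))" using \<pi>_inv_eq[OF c a(2)] by simp
  moreover have "1 / a \<noteq> 0" using a by simp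
  ultimately show ?thesis using c unfolding diag_def by blast
qed

lemma H_diag [simp]: "a \<noteq> 0 \<Longrightarrow> H a \<in> diag"
  unfolding diag_def by auto

lemma \<iota>_diag [simp]: "z \<in> carrier A \<Longrightarrow> \<iota> z \<in> diag"
  unfolding diag_def by (auto intro!: exI[of _ 1])

lemma one_diag [simp]: "\<one> \<in> diag"
  unfolding diag_def by (auto intro!: exI[of _ 1])

lemma diag_lcomm: "u \<in> diag \<Longrightarrow> v \<in> diag \<Longrightarrow> w \<in> diag \<Longrightarrow> u \<otimes> (v \<otimes> w) = v \<otimes> (u \<otimes> w)"
  using diag_comm[of u v] by (simp add: E.m_assoc[symmetric])

lemma W_W_H: "p \<noteq> 0 \<Longrightarrow> q \<noteq> 0 \<Longrightarrow> W p \<otimes> W q = H (- (1 / p)) \<otimes> inv (H (- 1)) \<otimes> H (- q)"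
proof -
  assume p: "p \<noteq> 0" "q \<noteq> 0"
  have "W p \<otimes> W q = W (- 1) \<otimes> H (- p) \<otimes> (W (- 1) \<otimes> H (- q))" using W_H[of p] W_H[of q] by simp
  also have "\<dots> = H (1 / - p) \<otimes> (W (- 1) \<otimes> W (- 1)) \<otimes> H (- q)"
    using W_H_swap[of "- p"] p by (simp add: E.m_assoc)
  finally show ?thesis by (simp add: W_W)
qed

text \<open>Conjugation by \<open>H b\<close> fixes \<open>H a\<close>, as both are diagonal.
  Computed on the two W factors of \<open>H a\<close> it divides their parameters by b^2, and
  rewriting the result in terms of \<open>H\<close> gives the identity.\<close>

lemma H_square_split: "a \<noteq> 0 \<Longrightarrow> b \<noteq> 0 \<Longrightarrow> H a = H (- (b\<^sup>2)) \<otimes> inv (H (- 1)) \<otimes> H (a / b\<^sup>2)"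
proof -
  assume a: "a \<noteq> 0" "b \<noteq> 0"
  have "H a = conj_by (H b) (H a)" using a by (intro conj_commute[symmetric]) (auto simp: mult.commute)
  also have "\<dots> = W (1 / b\<^sup>2) \<otimes> W (- (a / b\<^sup>2))"
    using a conj_diag_W[OF H_closed H_image, of b 1] conj_diag_W[OF H_closed H_image, of b "- a"]
    by (subst (2) H_def) (simp add: conj_mult)
  also have "\<dots> = H (- (b\<^sup>2)) \<otimes> inv (H (- 1)) \<otimes> H (a / b\<^sup>2)"
    using W_W_H[of "1 / b\<^sup>2" "- (a / b\<^sup>2)"] a by simp
  finally show ?thesis .
qed

lemma H_square: "a \<noteq> 0 \<Longrightarrow> b \<noteq> 0 \<Longrightarrow> H (a * b\<^sup>2) = H a \<otimes> H (b\<^sup>2)"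
proof -
  assume a: "a \<noteq> 0" "b \<noteq> 0"
  have "H (b\<^sup>2) = H (- (b\<^sup>2)) \<otimes> inv (H (- 1))" using H_square_split[of "b\<^sup>2" b] a by simp
  then have "H (a * b\<^sup>2) = H (b\<^sup>2) \<otimes> H a" using H_square_split[of "a * b\<^sup>2" b] a by simp
  then show ?thesis using a by (simp add: diag_comm)
qed

text \<open>The inverse of \<open>H a\<close> is \<open>W a \<otimes> W (- 1)\<close>, and
  \<open>W_W_H\<close> expresses this product by lifts of diagonal matrices.\<close>

lemma H_neg: "a \<noteq> 0 \<Longrightarrow> H a \<otimes> H (- (1 / a)) = H (- 1)"
proof -
  assume a: "a \<noteq> 0"
  have "inv (H a) = W a \<otimes> W (- 1)" using W_inv[of "- a"] W_inv[of 1] by (simp add: H_def E.inv_mult_group)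
  also have "\<dots> = H (- (1 / a)) \<otimes> inv (H (- 1))" using W_W_H[of a "- 1"] a by simp
  finally have "H (- (1 / a)) = inv (H a) \<otimes> H (- 1)" using E.inv_solve_right[of "inv (H a)" "H (- (1 / a))" "H (- 1)"] by simp
  then show ?thesis by (simp add: E.m_assoc[symmetric])
qed

text \<open>Solving \<open>W_alt\<close> at -1/v for its middle factor gives X v = Y(1/v) W(-1/v)
  Y(1/v). Passing the outer Y factors through \<open>W p\<close> and \<open>W q\<close> turns them
  into X factors.\<close>

lemma W_X_W:
  assumes "p \<noteq> 0" "q \<noteq> 0" "v \<noteq> 0"
  shows "W p \<otimes> X v \<otimes> W q = X (- (1 / (p\<^sup>2 * v))) \<otimes> (W p \<otimes> W (- (1 / v)) \<otimes> W q) \<otimes> X (- (1 / (q\<^sup>2 * v)))"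
proof -
  have "Y (1 / v) \<otimes> W (- (1 / v)) \<otimes> Y (1 / v) =
      (Y (1 / v) \<otimes> Y (- (1 / v))) \<otimes> X v \<otimes> (Y (- (1 / v)) \<otimes> Y (1 / v))"
    using W_alt[of "- (1 / v)"] assms by (simp add: E.m_assoc)
  also have "\<dots> = X v" by (simp add: Y_add[symmetric])
  finally have Xv: "X v = Y (1 / v) \<otimes> W (- (1 / v)) \<otimes> Y (1 / v)" by simp
  have 1: "W p \<otimes> Y (1 / v) = X (- (1 / (p\<^sup>2 * v))) \<otimes> W p"
    using mult_conj[of "W p" "Y (1 / v)"] conj_anti_Y[OF W_closed W_image, of p "1 / v"] assms by (simp add: mult.commute)
  have "\<pi> (inv (W q)) = mat22 0 (- (1 / - q)) (- q) 0" using W_image[of "- q"] assms by (simp add: W_inv)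
  then have "conj_by (inv (W q)) (Y (1 / v)) = X (- (1 / (q\<^sup>2 * v)))"
    using conj_anti_Y[of "inv (W q)" "- q" "1 / v"] assms by (simp add: mult.commute)
  moreover have "conj_by (W q) (conj_by (inv (W q)) (Y (1 / v))) = Y (1 / v)" by (rule conj_inverse') simp_all
  ultimately have 2: "Y (1 / v) \<otimes> W q = W q \<otimes> X (- (1 / (q\<^sup>2 * v)))"
    using mult_conj[of "W q" "conj_by (inv (W q)) (Y (1 / v))"] by simp
  have "W p \<otimes> X v \<otimes> W q = (W p \<otimes> Y (1 / v)) \<otimes> W (- (1 / v)) \<otimes> (Y (1 / v) \<otimes> W q)"
    by (simp add: Xv E.m_assoc)
  then show ?thesis by (simp add: 1 2 E.m_assoc)
qed

text \<open>\<open>Y (p + q)\<close> is rewritten in two ways by Y r = X(1/r) W r X(1/r): directly,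
  and as the product of \<open>Y p\<close> and \<open>Y q\<close>, where the inner X factors merge
  and \<open>W_X_W\<close> applies. The outer X factors agree and cancel.\<close>

lemma W_triple: "p \<noteq> 0 \<Longrightarrow> q \<noteq> 0 \<Longrightarrow> p + q \<noteq> 0 \<Longrightarrow> W p \<otimes> W (- (p * q / (p + q))) \<otimes> W q = W (p + q)"
proof -
  assume p: "p \<noteq> 0" "q \<noteq> 0" "p + q \<noteq> 0"
  define v where "v = (p + q) / (p * q)"
  have v: "v \<noteq> 0" "1 / p + 1 / q = v" "1 / v = p * q / (p + q)" using p by (auto simp: v_def field_simps)
  have YX: "Y r = X (1 / r) \<otimes> W r \<otimes> X (1 / r)" for r
  proof -
    have "X (1 / r) \<otimes> W r \<otimes> X (1 / r) = (X (1 / r) \<otimes> X (- (1 / r))) \<otimes> Y r \<otimes> (X (- (1 / r)) \<otimes> X (1 / r))"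
      by (simp add: W_def E.m_assoc)
    then show ?thesis by (simp add: X_add[symmetric])
  qed
  define T where "T = W p \<otimes> W (- (1 / v)) \<otimes> W q"
  have T: "T \<in> carrier E" by (simp add: T_def)
  have e: "1 / p - 1 / (p\<^sup>2 * v) = 1 / (p + q)" "1 / q - 1 / (q\<^sup>2 * v) = 1 / (p + q)"
    using p by (auto simp: v_def divide_simps power2_eq_square)
  have "Y (p + q) = X (1 / p) \<otimes> (W p \<otimes> X v \<otimes> W q) \<otimes> X (1 / q)"
    using X_add[of "1 / p" "1 / q"] v(2) by (simp add: Y_add YX[of p] YX[of q] E.m_assoc)
  also have "\<dots> = (X (1 / p) \<otimes> X (- (1 / (p\<^sup>2 * v)))) \<otimes> T \<otimes> (X (- (1 / (q\<^sup>2 * v))) \<otimes> X (1 / q))"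
    unfolding W_X_W[OF p(1,2) v(1)] T_def[symmetric] using T by (simp add: E.m_assoc)
  also have "\<dots> = X (1 / (p + q)) \<otimes> T \<otimes> X (1 / (p + q))"
    using e by (simp add: X_add[symmetric])
  finally have "X (1 / (p + q)) \<otimes> W (p + q) \<otimes> X (1 / (p + q)) = X (1 / (p + q)) \<otimes> T \<otimes> X (1 / (p + q))"
    using YX[of "p + q"] by simp
  then have "W (p + q) = T" using T by (simp add: E.m_assoc)
  then show ?thesis unfolding T_def v(3) by simp
qed

lemma W_W_W:
  assumes "p \<noteq> 0" "q \<noteq> 0" "m \<noteq> 0"
  shows "W p \<otimes> W (- (1 / m)) \<otimes> W q = W (- 1) \<otimes> (H (- p) \<otimes> H m \<otimes> inv (H (- 1)) \<otimes> H (- q))"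
proof -
  have "W p \<otimes> W (- (1 / m)) \<otimes> W q = W (- 1) \<otimes> H (- p) \<otimes> (W (- (1 / m)) \<otimes> W q)"
    using W_H[of p] by (simp add: E.m_assoc)
  also have "W (- (1 / m)) \<otimes> W q = H m \<otimes> inv (H (- 1)) \<otimes> H (- q)"
    using W_W_H[of "- (1 / m)" q] assms by simp
  finally show ?thesis by (simp add: E.m_assoc)
qed

text \<open>\<open>W_triple\<close> at -a and -b, rewritten by means of \<open>H\<close>. The choice
  of \<open>m\<close> makes -1/m equal to ab/(a + b), so that \<open>H_neg\<close> relates
  \<open>H m\<close> to the last factor of the claim.\<close>

lemma H_add:
  assumes "a \<noteq> 0" "b \<noteq> 0" "a + b \<noteq> 0"
  shows "H a \<otimes> H b = H (a + b) \<otimes> H (a * b / (a + b))"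
proof -
  have ab: "- a + - b \<noteq> 0" using assms by (metis add.inverse_distrib_swap add.commute neg_equal_0_iff_equal)
  define m where "m = - ((a + b) / (a * b))"
  have m: "m \<noteq> 0" "- (1 / m) = a * b / (a + b)" using assms by (auto simp: m_def)
  have "W (- a) \<otimes> W (- (1 / m)) \<otimes> W (- b) = W (- (a + b))"
  proof -
    have "- (- a * - b / (- a + - b)) = a * b / (a + b)"
      by (metis add.commute minus_add_distrib minus_divide_right minus_minus minus_mult_minus)
    then show ?thesis using W_triple[of "- a" "- b"] ab assms(1,2) m(2) by simp
  qed
  then have "W (- 1) \<otimes> (H a \<otimes> H m \<otimes> inv (H (- 1)) \<otimes> H b) = W (- 1) \<otimes> H (a + b)"
    using W_W_W[of "- a" "- b" m] W_H[of "- (a + b)"] assms m(1) by (simp add: add.commute)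
  then have 1: "H a \<otimes> H m \<otimes> inv (H (- 1)) \<otimes> H b = H (a + b)" by simp
  have 2: "H m \<otimes> H (a * b / (a + b)) = H (- 1)" using H_neg[OF m(1)] m(2) by simp
  have c: "H a \<in> diag" "H b \<in> diag" "H m \<in> diag" "H (a * b / (a + b)) \<in> diag" "H (- 1) \<in> diag" using assms m by auto
  have "H (a + b) \<otimes> H (a * b / (a + b)) = H a \<otimes> H b \<otimes> (H m \<otimes> H (a * b / (a + b))) \<otimes> inv (H (- 1))"
    unfolding 1[symmetric] using c by (simp add: E.m_assoc diag_comm diag_lcomm)
  also have "\<dots> = H a \<otimes> H b" unfolding 2 by (simp add: E.m_assoc)
  finally show ?thesis by simp
qed

section \<open>The symbol as cocycle of the section \<open>H\<close> over the torus\<close>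

definition symbol :: "'a \<Rightarrow> 'a \<Rightarrow> 'b"
  where "symbol a b = (THE z. z \<in> carrier A \<and> H a \<otimes> H b = \<iota> z \<otimes> H (a * b))"

lemma symbol:
  assumes "a \<noteq> 0" "b \<noteq> 0"
  shows "symbol a b \<in> carrier A \<and> H a \<otimes> H b = \<iota> (symbol a b) \<otimes> H (a * b)"
  unfolding symbol_def
proof (rule theI')
  have "H a \<otimes> H b \<in> carrier E" "\<pi> (H a \<otimes> H b) = \<pi> (H (a * b))" using assms by auto
  then obtain z where z: "z \<in> carrier A" "H a \<otimes> H b = \<iota> z \<otimes> H (a * b)" using same_image[OF _ H_closed] by blast
  show "\<exists>!z. z \<in> carrier A \<and> H a \<otimes> H b = \<iota> z \<otimes> H (a * b)"
  proof (rule ex1I[of _ z])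
    fix z' assume "z' \<in> carrier A \<and> H a \<otimes> H b = \<iota> z' \<otimes> H (a * b)"
    then show "z' = z" using z E.right_cancel[of "H (a * b)" "\<iota> z'" "\<iota> z"] by (intro \<iota>_inj) auto
  qed (use z in blast)
qed

lemma symbol_closed [simp]: "a \<noteq> 0 \<Longrightarrow> b \<noteq> 0 \<Longrightarrow> symbol a b \<in> carrier A"
  using symbol by blast

lemma H_H: "a \<noteq> 0 \<Longrightarrow> b \<noteq> 0 \<Longrightarrow> H a \<otimes> H b = \<iota> (symbol a b) \<otimes> H (a * b)"
  using symbol by blast

lemma symbol_unique:
  assumes "a \<noteq> 0" "b \<noteq> 0" "z \<in> carrier A" "H a \<otimes> H b = \<iota> z \<otimes> H (a * b)"
  shows "symbol a b = z"
  using assms H_H[of a b] E.right_cancel[of "H (a * b)" "\<iota> (symbol a b)" "\<iota> z"] by (intro \<iota>_inj) auto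

text \<open>Each axiom is a relation between lifts: associativity gives \<open>cocycle\<close>,
  commutativity of the torus lifts gives \<open>sym\<close>, and \<open>H_square\<close>,
  \<open>H_neg\<close> and \<open>H_add\<close> give the other three.\<close>

sublocale pfister_symbol A symbol
proof (unfold_locales)
  fix a b c :: 'a
  assume n: "a \<noteq> 0" "b \<noteq> 0" "c \<noteq> 0"
  have "\<iota> (symbol b c) \<otimes> (\<iota> (symbol a (b * c)) \<otimes> H (a * (b * c))) = H a \<otimes> (H b \<otimes> H c)"
    using n H_H[of b c] H_H[of a "b * c", symmetric] diag_lcomm[of "H a" "\<iota> (symbol b c)" "H (b * c)"] by simp
  also have "\<dots> = (H a \<otimes> H b) \<otimes> H c" by (simp add: E.m_assoc)
  also have "\<dots> = \<iota> (symbol a b) \<otimes> (\<iota> (symbol (a * b) c) \<otimes> H (a * b * c))"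
    using n by (simp add: H_H[of a b] H_H[of "a * b" c, symmetric] E.m_assoc)
  finally have "\<iota> (symbol b c \<otimes>\<^bsub>A\<^esub> symbol a (b * c)) \<otimes> H (a * b * c) = \<iota> (symbol a b \<otimes>\<^bsub>A\<^esub> symbol (a * b) c) \<otimes> H (a * b * c)"
    using n by (simp add: \<iota>_mult E.m_assoc mult.assoc)
  then show "symbol b c \<otimes>\<^bsub>A\<^esub> symbol a (b * c) = symbol a b \<otimes>\<^bsub>A\<^esub> symbol (a * b) c"
    using n by (intro \<iota>_inj) (auto simp: E.right_cancel)
next
  fix a b :: 'a assume n: "a \<noteq> 0" "b \<noteq> 0"
  show "symbol a b \<in> carrier A" using n by simp
  show "symbol a b = symbol b a"
    using n H_H[of b a] diag_comm[of "H a" "H b"] by (intro symbol_unique) (auto simp: mult.commute)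
  show "symbol a (b\<^sup>2) = \<one>\<^bsub>A\<^esub>" using n H_square[of a b] by (intro symbol_unique) auto
  show "symbol a b = symbol (a + b) (a * b / (a + b))" if "a + b \<noteq> 0"
    using n that H_add[OF n that] H_H[of "a + b" "a * b / (a + b)"] by (intro symbol_unique) auto
next
  fix a :: 'a assume n: "a \<noteq> 0"
  show "symbol a (- (1 / a)) = \<one>\<^bsub>A\<^esub>" using n H_neg[of a] by (intro symbol_unique) auto
qed

text \<open>A section over SL(2, K) in Bruhat normal form. In the upper triangular case the
  parameter is the product of two entries because X(s) times diag(a, 1/a) has upper right entry
  s/a.\<close>

definition sect :: "'a mat \<Rightarrow> 'e"
  where "sect g = (if g $$ (1, 0) = 0 then X (g $$ (0, 1) * g $$ (0, 0)) \<otimes> H (g $$ (0, 0))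
    else X (g $$ (0, 0) / g $$ (1, 0)) \<otimes> W (g $$ (1, 0)) \<otimes> X (g $$ (1, 1) / g $$ (1, 0)))"

lemma sect_upper: "sect (mat22 a b 0 d) = X (b * a) \<otimes> H a"
  and sect_big: "c \<noteq> 0 \<Longrightarrow> sect (mat22 a b c d) = X (a / c) \<otimes> W c \<otimes> X (d / c)"
  by (simp_all add: sect_def)

lemma sect_closed [simp]: "sect g \<in> carrier E"
  by (simp add: sect_def)

lemma sect_image:
  assumes "g \<in> carrier SL2" shows "\<pi> (sect g) = g"
proof -
  obtain a b c d where g: "g = mat22 a b c d" "a * d - b * c = 1" using assms by (rule SL2_cases)
  show ?thesis
  proof (cases "c = 0")
    case True
    then have "a \<noteq> 0" using g(2) by auto
    moreover from this have "d = 1 / a" using g(2) True by (simp add: eq_divide_eq mult.commute)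
    ultimately have "a \<noteq> 0" "d = 1 / a" by simp_all
    then show ?thesis using g(1) True by (simp add: sect_upper)
  next
    case False
    then have "b = (a * d - 1) / c" using g(2) by (simp add: field_simps)
    then show ?thesis using g(1) False by (simp add: sect_big) (simp add: field_simps)
  qed
qed

lemma H_X: "a \<noteq> 0 \<Longrightarrow> H a \<otimes> X t = X (a\<^sup>2 * t) \<otimes> H a"
  using mult_conj[of "H a" "X t"] conj_diag_X[OF H_closed H_image, of a t] by simp

lemma X_H: "a \<noteq> 0 \<Longrightarrow> X t \<otimes> H a = H a \<otimes> X (t / a\<^sup>2)"
  using H_X[of a "t / a\<^sup>2"] by simp

lemma \<iota>_lcomm: "z \<in> carrier A \<Longrightarrow> u \<in> carrier E \<Longrightarrow> v \<in> carrier E \<Longrightarrow> u \<otimes> (\<iota> z \<otimes> v) = \<iota> z \<otimes> (u \<otimes> v)"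
  using \<iota>_comm[of z u] by (simp add: E.m_assoc[symmetric])

definition pullback :: "('a mat set \<Rightarrow> 'b) \<Rightarrow> bool"
  where "pullback f \<longleftrightarrow> f \<in> hom I2_group A \<and> (\<forall>a b. a \<noteq> 0 \<longrightarrow> b \<noteq> 0 \<longrightarrow> f (pfister a b) = symbol a b)"

lemma X_X: "v \<in> carrier E \<Longrightarrow> X s \<otimes> (X t \<otimes> v) = X (s + t) \<otimes> v"
  by (simp add: X_add E.m_assoc)

lemma sect_upper_upper:
  assumes "a \<noteq> 0" "a' \<noteq> 0" "d = 1 / a" "d' = 1 / a'"
  shows "sect (mat22 a b 0 d) \<otimes> sect (mat22 a' b' 0 d') = \<iota> (symbol a a') \<otimes> sect (mat22 a b 0 d * mat22 a' b' 0 d')"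
proof -
  have "sect (mat22 a b 0 d) \<otimes> sect (mat22 a' b' 0 d') = X (b * a) \<otimes> ((H a \<otimes> X (b' * a')) \<otimes> H a')"
    by (simp add: sect_upper E.m_assoc)
  also have "\<dots> = X (b * a + a\<^sup>2 * (b' * a')) \<otimes> (H a \<otimes> H a')"
    using assms by (simp add: H_X E.m_assoc X_X)
  also have "\<dots> = \<iota> (symbol a a') \<otimes> (X (b * a + a\<^sup>2 * (b' * a')) \<otimes> H (a * a'))"
    using assms by (simp add: H_H \<iota>_lcomm)
  also have "b * a + a\<^sup>2 * (b' * a') = (a * b' + b * d') * (a * a')"
    using assms by (simp add: field_simps power2_eq_square)
  finally show ?thesis by (simp add: sect_upper)
qed

lemma H_W: "a \<noteq> 0 \<Longrightarrow> q \<noteq> 0 \<Longrightarrow> H a \<otimes> W q = \<iota> (symbol (1 / a) (- q)) \<otimes> W (q / a)"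
proof -
  assume a: "a \<noteq> 0" "q \<noteq> 0"
  have "H a \<otimes> W q = W (- 1) \<otimes> (H (1 / a) \<otimes> H (- q))"
    using W_H[of q] W_H_swap[of "1 / a"] a by (simp add: E.m_assoc[symmetric])
  also have "\<dots> = \<iota> (symbol (1 / a) (- q)) \<otimes> (W (- 1) \<otimes> H (- (q / a)))"
    using a by (simp add: H_H \<iota>_lcomm)
  finally show ?thesis using W_H[of "q / a"] by simp
qed

lemma W_H': "a \<noteq> 0 \<Longrightarrow> p \<noteq> 0 \<Longrightarrow> W p \<otimes> H a = \<iota> (symbol (- p) a) \<otimes> W (p * a)"
proof -
  assume a: "a \<noteq> 0" "p \<noteq> 0"
  have "W p \<otimes> H a = W (- 1) \<otimes> (H (- p) \<otimes> H a)" using W_H[of p] by (simp add: E.m_assoc)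
  also have "\<dots> = \<iota> (symbol (- p) a) \<otimes> (W (- 1) \<otimes> H (- (p * a)))"
    using a by (simp add: H_H \<iota>_lcomm)
  finally show ?thesis using W_H[of "p * a"] by simp
qed

lemma sect_upper_big:
  assumes "a \<noteq> 0" "q \<noteq> 0" "d = 1 / a" "a' * d' - b' * q = 1"
  shows "sect (mat22 a b 0 d) \<otimes> sect (mat22 a' b' q d') = \<iota> (symbol (1 / a) (- q)) \<otimes> sect (mat22 a b 0 d * mat22 a' b' q d')"
proof -
  have "sect (mat22 a b 0 d) \<otimes> sect (mat22 a' b' q d') = X (b * a) \<otimes> ((H a \<otimes> X (a' / q)) \<otimes> (W q \<otimes> X (d' / q)))"
    using assms by (simp add: sect_upper sect_big E.m_assoc)
  also have "\<dots> = X (b * a + a\<^sup>2 * (a' / q)) \<otimes> ((H a \<otimes> W q) \<otimes> X (d' / q))"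
    using assms by (simp add: H_X E.m_assoc X_X)
  also have "\<dots> = \<iota> (symbol (1 / a) (- q)) \<otimes> (X (b * a + a\<^sup>2 * (a' / q)) \<otimes> (W (q / a) \<otimes> X (d' / q)))"
    using assms by (simp add: H_W \<iota>_lcomm E.m_assoc)
  also have "b * a + a\<^sup>2 * (a' / q) = (a * a' + b * q) / (q / a)"
    using assms by (simp add: field_simps power2_eq_square)
  also have "d' / q = (d' / a) / (q / a)" using assms by simp
  finally show ?thesis using assms by (simp add: sect_big E.m_assoc)
qed

lemma sect_big_upper:
  assumes "a \<noteq> 0" "p \<noteq> 0" "d = 1 / a"
  shows "sect (mat22 a' b' p d') \<otimes> sect (mat22 a b 0 d) = \<iota> (symbol (- p) a) \<otimes> sect (mat22 a' b' p d' * mat22 a b 0 d)"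
proof -
  have "sect (mat22 a' b' p d') \<otimes> sect (mat22 a b 0 d) = X (a' / p) \<otimes> (W p \<otimes> (X (d' / p + b * a) \<otimes> H a))"
    using assms by (simp add: sect_upper sect_big E.m_assoc X_X)
  also have "\<dots> = X (a' / p) \<otimes> ((W p \<otimes> H a) \<otimes> X ((d' / p + b * a) / a\<^sup>2))"
    using assms by (simp add: X_H E.m_assoc)
  also have "\<dots> = \<iota> (symbol (- p) a) \<otimes> (X (a' / p) \<otimes> (W (p * a) \<otimes> X ((d' / p + b * a) / a\<^sup>2)))"
    using assms by (simp add: W_H' \<iota>_lcomm E.m_assoc)
  also have "(d' / p + b * a) / a\<^sup>2 = (p * b + d' * d) / (p * a)"
    using assms by (simp add: field_simps power2_eq_square)
  finally show ?thesis using assms by (simp add: sect_big E.m_assoc)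
qed

lemma sect_big_big_0:
  assumes "p \<noteq> 0" "q \<noteq> 0" "a * d - b * p = 1" "a' * d' - b' * q = 1" "p * a' + d * q = 0"
  shows "sect (mat22 a b p d) \<otimes> sect (mat22 a' b' q d') =
    \<iota> (inv\<^bsub>A\<^esub> symbol p (- (q / p))) \<otimes> sect (mat22 a b p d * mat22 a' b' q d')"
    and "a * a' + b * q = - (q / p)"
proof -
  have a': "a' = - (d * q / p)" using assms by (simp add: field_simps eq_neg_iff_add_eq_0)
  have b: "b = (a * d - 1) / p" using assms by (simp add: field_simps)
  show e: "a * a' + b * q = - (q / p)" unfolding a' b using assms(1) by (simp add: field_simps)
  have b': "b' = (a' * d' - 1) / q" using assms by (simp add: field_simps)
  have z: "d / p + a' / q = 0" using a' assms(1,2) by simp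
  have "sect (mat22 a b p d) \<otimes> sect (mat22 a' b' q d') = X (a / p) \<otimes> (W p \<otimes> (X (d / p + a' / q) \<otimes> (W q \<otimes> X (d' / q))))"
    using assms by (simp add: sect_big E.m_assoc X_X)
  also have "\<dots> = X (a / p) \<otimes> ((W p \<otimes> W q) \<otimes> X (d' / q))" by (simp add: z E.m_assoc)
  also have "W p \<otimes> W q = inv (H p) \<otimes> H (- q)"
  proof -
    have "H (- (1 / p)) \<otimes> inv (H (- 1)) = inv (H p)"
      using assms(1) by (simp add: H_neg[OF assms(1), symmetric] E.inv_mult_group E.m_assoc[symmetric])
    then show ?thesis using W_W_H[OF assms(1,2)] by simp
  qed
  also have "\<dots> = \<iota> (inv\<^bsub>A\<^esub> symbol p (- (q / p))) \<otimes> H (- (q / p))"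
  proof -
    have "H p \<otimes> H (- (q / p)) = \<iota> (symbol p (- (q / p))) \<otimes> H (- q)" using assms by (simp add: H_H)
    then have "\<iota> (inv\<^bsub>A\<^esub> symbol p (- (q / p))) \<otimes> (H p \<otimes> H (- (q / p))) = H (- q)"
      using assms by (simp add: \<iota>_inv E.m_assoc[symmetric])
    then have "inv (H p) \<otimes> H (- q) = inv (H p) \<otimes> (\<iota> (inv\<^bsub>A\<^esub> symbol p (- (q / p))) \<otimes> (H p \<otimes> H (- (q / p))))" by simp
    also have "\<dots> = \<iota> (inv\<^bsub>A\<^esub> symbol p (- (q / p))) \<otimes> H (- (q / p))"
      using assms by (simp add: \<iota>_lcomm) (simp add: E.m_assoc[symmetric])
    finally show ?thesis .
  qed
  also have "X (a / p) \<otimes> (\<iota> (inv\<^bsub>A\<^esub> symbol p (- (q / p))) \<otimes> H (- (q / p)) \<otimes> X (d' / q)) =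
      \<iota> (inv\<^bsub>A\<^esub> symbol p (- (q / p))) \<otimes> (X (a / p + (q / p)\<^sup>2 * (d' / q)) \<otimes> H (- (q / p)))"
    using assms H_X[of "- (q / p)" "d' / q"] by (simp add: E.m_assoc \<iota>_lcomm X_X)
  also have "a / p + (q / p)\<^sup>2 * (d' / q) = (a * b' + b * d') * (a * a' + b * q)"
    unfolding e b' b a' using assms(1,2) by (simp add: field_simps power2_eq_square)
  finally show "sect (mat22 a b p d) \<otimes> sect (mat22 a' b' q d') =
    \<iota> (inv\<^bsub>A\<^esub> symbol p (- (q / p))) \<otimes> sect (mat22 a b p d * mat22 a' b' q d')"
    using assms(5) e by (simp add: sect_upper)
qed

lemma sect_big_big:
  assumes "p \<noteq> 0" "q \<noteq> 0" "a * d - b * p = 1" "a' * d' - b' * q = 1" "p * a' + d * q = r" "r \<noteq> 0"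
  shows "sect (mat22 a b p d) \<otimes> sect (mat22 a' b' q d') =
    \<iota> (symbol (- p) (- q) \<otimes>\<^bsub>A\<^esub> (symbol (p * q) (r / (p * q)) \<otimes>\<^bsub>A\<^esub> inv\<^bsub>A\<^esub> symbol (- (1 / r)) (- r))) \<otimes>
    sect (mat22 a b p d * mat22 a' b' q d')"
proof -
  \<comment> \<open>The parameter of the unipotent between \<open>W p\<close> and \<open>W q\<close>
    after merging the two inner factors. It is nonzero exactly when the product lies in the big
    cell.\<close>
  define m where "m = r / (p * q)"
  have m: "m \<noteq> 0" "d / p + a' / q = m" "p * q * m = r" using assms by (auto simp: m_def field_simps)
  have b: "b = (a * d - 1) / p" using assms by (simp add: field_simps)
  have b': "b' = (a' * d' - 1) / q" using assms by (simp add: field_simps)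
  let ?z = "symbol (- p) (- q) \<otimes>\<^bsub>A\<^esub> (symbol (p * q) m \<otimes>\<^bsub>A\<^esub> inv\<^bsub>A\<^esub> symbol (- (1 / r)) (- r))"
  have zc: "?z \<in> carrier A" using assms m by simp
  have d: "H (- p) \<in> diag" "H (- q) \<in> diag" "H m \<in> diag" "H (- 1) \<in> diag" "H (p * q) \<in> diag" "H r \<in> diag" "H (- r) \<in> diag"
    "H (- (1 / r)) \<in> diag"
    using assms m by auto
  \<comment> \<open>By \<open>H_neg\<close> the left side is the inverse of H(-1/r), and H(-1/r)
    times H(-r) is the pure symbol factor because \<open>H 1\<close> is trivial. This is the origin
    of the term with arguments -1/r and -r.\<close>
  have Hr: "H r \<otimes> inv (H (- 1)) = \<iota> (inv\<^bsub>A\<^esub> symbol (- (1 / r)) (- r)) \<otimes> H (- r)"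
  proof -
    let ?K = "H (- (1 / r))"
    have K: "?K \<otimes> H (- r) = \<iota> (symbol (- (1 / r)) (- r))" using H_H[of "- (1 / r)" "- r"] assms by simp
    have "inv (H (- 1)) = inv ?K \<otimes> inv (H r)"
      unfolding H_neg[OF assms(6), symmetric] by (rule E.inv_mult_group) simp_all
    then have 1: "H r \<otimes> inv (H (- 1)) = inv ?K"
      using d diag_comm[of "H r" "inv ?K \<otimes> inv (H r)"] by (simp add: E.m_assoc)
    have "\<iota> (inv\<^bsub>A\<^esub> symbol (- (1 / r)) (- r)) \<otimes> H (- r) = inv (H (- r)) \<otimes> inv ?K \<otimes> H (- r)"
      using assms K[symmetric] by (simp add: \<iota>_inv E.inv_mult_group)
    also have "\<dots> = inv ?K" using d diag_comm[of "inv ?K" "H (- r)"] by (simp add: E.m_assoc) (simp add: E.m_assoc[symmetric])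
    finally show ?thesis using 1 by simp
  qed
  have "W p \<otimes> W (- (1 / m)) \<otimes> W q = W (- 1) \<otimes> (H (- p) \<otimes> H (- q) \<otimes> H m \<otimes> inv (H (- 1)))"
    unfolding W_W_W[OF assms(1,2) m(1)] using d by (simp add: E.m_assoc diag_comm diag_lcomm)
  also have "H (- p) \<otimes> H (- q) \<otimes> H m \<otimes> inv (H (- 1)) =
      \<iota> (symbol (- p) (- q)) \<otimes> (\<iota> (symbol (p * q) m) \<otimes> (H r \<otimes> inv (H (- 1))))"
    using assms m by (simp add: H_H[of "- p" "- q"] E.m_assoc) (simp add: H_H[of "p * q" m] flip: E.m_assoc)
  also have "\<dots> = \<iota> ?z \<otimes> H (- r)"
    unfolding Hr using assms m by (simp add: \<iota>_mult E.m_assoc)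
  finally have www: "W p \<otimes> W (- (1 / m)) \<otimes> W q = \<iota> ?z \<otimes> W r"
    using zc W_H[of r] by (simp add: \<iota>_lcomm)
  have "sect (mat22 a b p d) \<otimes> sect (mat22 a' b' q d') = X (a / p) \<otimes> (W p \<otimes> (X (d / p + a' / q) \<otimes> (W q \<otimes> X (d' / q))))"
    using assms by (simp add: sect_big E.m_assoc X_X)
  also have "\<dots> = X (a / p) \<otimes> ((W p \<otimes> X m \<otimes> W q) \<otimes> X (d' / q))" by (simp add: m E.m_assoc)
  also have "\<dots> = X (a / p) \<otimes> (X (- (1 / (p\<^sup>2 * m))) \<otimes> (\<iota> ?z \<otimes> W r) \<otimes> X (- (1 / (q\<^sup>2 * m))) \<otimes> X (d' / q))"
    unfolding W_X_W[OF assms(1,2) m(1)] www ..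
  also have "\<dots> = \<iota> ?z \<otimes> (X (a / p + - (1 / (p\<^sup>2 * m))) \<otimes> W r \<otimes> X (- (1 / (q\<^sup>2 * m)) + d' / q))"
  proof -
    have "X (- (1 / (q\<^sup>2 * m))) \<otimes> X (d' / q) = X (- (1 / (q\<^sup>2 * m)) + d' / q)" by (simp only: X_add)
    then show ?thesis using zc by (simp add: E.m_assoc X_X \<iota>_lcomm)
  qed
  also have "a / p + - (1 / (p\<^sup>2 * m)) = (a * a' + b * q) / r"
  proof -
    have "r * (a / p) - q / p = a * a' + b * q"
      unfolding b assms(5)[symmetric] using assms(1) by (simp add: field_simps)
    moreover have "1 / (p\<^sup>2 * m) = q / p / r" using assms by (simp add: m_def power2_eq_square)
    ultimately show ?thesis using assms(6) by (simp add: field_simps)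
  qed
  also have "- (1 / (q\<^sup>2 * m)) + d' / q = (p * b' + d * d') / r"
  proof -
    have "r * (d' / q) - p / q = p * b' + d * d'"
      unfolding b' assms(5)[symmetric] using assms(2) by (simp add: field_simps)
    moreover have "1 / (q\<^sup>2 * m) = p / q / r" using assms by (simp add: m_def power2_eq_square)
    ultimately show ?thesis using assms(6) by (simp add: field_simps)
  qed
  finally show ?thesis using assms by (simp add: sect_big m_def)
qed

lemma I2_hom_values:
  assumes "pullback f" shows "f \<in> hom I2_group A" "\<And>a b. a \<noteq> 0 \<Longrightarrow> b \<noteq> 0 \<Longrightarrow> f (pfister a b) = symbol a b"
    "\<And>x y. x \<in> carrier I2_group \<Longrightarrow> y \<in> carrier I2_group \<Longrightarrow> f (x \<oplus>\<^bsub>witt_ring\<^esub> y) = f x \<otimes>\<^bsub>A\<^esub> f y"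
    "\<And>x. x \<in> carrier I2_group \<Longrightarrow> f (\<ominus>\<^bsub>witt_ring\<^esub> x) = inv\<^bsub>A\<^esub> f x"
proof -
  interpret I: comm_group "I2_group :: 'a mat set monoid" by (rule I2_comm_group)
  interpret f: group_hom "I2_group :: 'a mat set monoid" A f
    using assms by (simp add: pullback_def group_hom_def group_hom_axioms_def I.is_group A.is_group)
  show "f \<in> hom I2_group A" "\<And>a b. a \<noteq> 0 \<Longrightarrow> b \<noteq> 0 \<Longrightarrow> f (pfister a b) = symbol a b"
    using assms by (auto simp: pullback_def)
  show "f (x \<oplus>\<^bsub>witt_ring\<^esub> y) = f x \<otimes>\<^bsub>A\<^esub> f y" if "x \<in> carrier I2_group" "y \<in> carrier I2_group" for x y
    using f.hom_mult[OF that] by simp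
  show "f (\<ominus>\<^bsub>witt_ring\<^esub> x) = inv\<^bsub>A\<^esub> f x" if "x \<in> carrier I2_group" for x
    using f.hom_inv[OF that] that by (simp add: I2_inv)
qed

text \<open>The computation of lifts and that of the reduced cocycle run through the same five
  Bruhat cases. In each of them f maps the expression in Pfister classes to the same expression in
  symbols.\<close>

lemma sect_mult:
  assumes g: "g \<in> carrier SL2" and h: "h \<in> carrier SL2" and f: "pullback f"
  shows "sect g \<otimes> sect h = \<iota> (f (reduced_value g h)) \<otimes> sect (g * h)"
proof -
  note fv = I2_hom_values[OF f]
  interpret I: comm_group "I2_group :: 'a mat set monoid" by (rule I2_comm_group)
  obtain a b p d where G: "g = mat22 a b p d" "a * d - b * p = 1" using g by (rule SL2_cases)
  obtain a' b' q d' where K: "h = mat22 a' b' q d'" "a' * d' - b' * q = 1" using h by (rule SL2_cases)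
  have up: "x \<noteq> 0 \<and> y = 1 / x" if "x * y = 1" for x y :: 'a
    using that by (cases "x = 0") (auto simp: eq_divide_eq mult.commute)
  consider "p = 0" "q = 0" | "p = 0" "q \<noteq> 0" | "p \<noteq> 0" "q = 0" | "p \<noteq> 0" "q \<noteq> 0" "p * a' + d * q = 0"
    | "p \<noteq> 0" "q \<noteq> 0" "p * a' + d * q \<noteq> 0" by blast
  then show ?thesis
  proof cases
    case 1
    then have "a \<noteq> 0" "d = 1 / a" "a' \<noteq> 0" "d' = 1 / a'" using up G(2) K(2) by auto
    then show ?thesis using sect_upper_upper[of a a' d d' b b'] reduced_value_upper_upper[of a a' b d b' d'] fv(2) 1
      by (simp add: G(1) K(1) del: mat22_mult)
  next
    case 2
    then have "a \<noteq> 0" "d = 1 / a" using up G(2) by auto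
    then show ?thesis using sect_upper_big[of a q d a' d' b' b] reduced_value_upper_big[of a d q b a' b' d'] fv(2) 2 K(2)
      by (simp add: G(1) K(1) del: mat22_mult)
  next
    case 3
    then have "a' \<noteq> 0" "d' = 1 / a'" using up K(2) by auto
    then show ?thesis using sect_big_upper[of a' p d' a b d b'] reduced_value_big_upper[of a' p a b d b' d'] fv(2) 3
      by (simp add: G(1) K(1) del: mat22_mult)
  next
    case 4
    then show ?thesis using sect_big_big_0[OF 4(1,2) G(2) K(2) 4(3)] reduced_value_big_big_0[OF 4(1,2,3), of a b b' d'] fv(2,4)
      by (simp add: G(1) K(1) del: mat22_mult)
  next
    case 5
    define r where "r = p * a' + d * q"
    have r: "r \<noteq> 0" using 5(3) by (simp add: r_def)
    have c: "pfister (- p) (- q) \<in> carrier I2_group" "pfister (p * q) (r / (p * q)) \<in> carrier I2_group"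
      "pfister (- (1 / r)) (- r) \<in> carrier I2_group"
      using 5(1,2) r by (auto intro!: pfister_I2)
    have n: "- (1 / r) \<noteq> 0" "- r \<noteq> 0" "- p \<noteq> 0" "- q \<noteq> 0" "p * q \<noteq> 0" "r / (p * q) \<noteq> 0"
      using 5(1,2) r by auto
    have m: "\<ominus>\<^bsub>witt_ring\<^esub> pfister (- (1 / r)) (- r) \<in> carrier I2_group"
      using I.inv_closed[OF c(3)] I2_inv[OF c(3)] by simp
    have "f (reduced_value g h) = symbol (- p) (- q) \<otimes>\<^bsub>A\<^esub> (symbol (p * q) (r / (p * q)) \<otimes>\<^bsub>A\<^esub> inv\<^bsub>A\<^esub> symbol (- (1 / r)) (- r))"
      unfolding G(1) K(1) reduced_value_big_big[OF 5(1,2) r_def[symmetric] r] a_minus_def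
      using fv(3)[OF c(1), OF I.m_closed[OF c(2) m, unfolded I2_simps]] fv(3)[OF c(2) m] fv(4)[OF c(3)]
        fv(2)[OF n(3,4)] fv(2)[OF n(5,6)] fv(2)[OF n(1,2)] by simp
    then show ?thesis using sect_big_big[OF 5(1,2) G(2) K(2) r_def[symmetric] r] by (simp add: G(1) K(1) del: mat22_mult)
  qed
qed

lemma pullback_ex: obtains f where "pullback f" "f \<in> extensional (carrier I2_group)"
  using I2_presentation unfolding pullback_def by metis

end

section \<open>Cohomology and homology in degree 2\<close>

text \<open>If the coboundary of b takes values in S, then b is a homomorphism modulo S into an
  abelian group and is trivial on commutators, hence on a perfect group. The lemma gives both the
  vanishing of H_1 and the injectivity of the change of coefficients from I^2(K) to W(K).\<close>

lemma (in group) perfect_values: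
  assumes perfect: "derived G (carrier G) = carrier G"
    and Q: "comm_group Q" and S: "subgroup S Q" and b: "b \<in> carrier G \<rightarrow> carrier Q"
    and cong: "\<And>g h. g \<in> carrier G \<Longrightarrow> h \<in> carrier G \<Longrightarrow> b g \<otimes>\<^bsub>Q\<^esub> inv\<^bsub>Q\<^esub> b (g \<otimes> h) \<otimes>\<^bsub>Q\<^esub> b h \<in> S"
    and g: "g \<in> carrier G"
  shows "b g \<in> S"
proof -
  interpret Q: comm_group Q by (rule Q)
  interpret N: normal S Q by (rule Q.subgroup_imp_normal[OF S])
  interpret F: comm_group "Q Mod S" by (rule Q.abelian_FactGroup[OF S])
  have Sc: "S \<subseteq> carrier Q" by (rule subgroup.subset[OF S])
  have bc: "b x \<in> carrier Q" if "x \<in> carrier G" for x using b that by auto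
  define \<phi> where "\<phi> x = S #>\<^bsub>Q\<^esub> b x" for x
  have \<phi>c: "\<phi> x \<in> carrier (Q Mod S)" if "x \<in> carrier G" for x
    using bc[OF that] by (auto simp: \<phi>_def carrier_FactGroup)
  have hom: "\<phi> (x \<otimes> y) = \<phi> x \<otimes>\<^bsub>Q Mod S\<^esub> \<phi> y" if xy: "x \<in> carrier G" "y \<in> carrier G" for x y
  proof -
    have c: "b x \<in> carrier Q" "b y \<in> carrier Q" "b (x \<otimes> y) \<in> carrier Q" using bc xy by auto
    have "b x \<otimes>\<^bsub>Q\<^esub> b y = (b x \<otimes>\<^bsub>Q\<^esub> inv\<^bsub>Q\<^esub> b (x \<otimes> y) \<otimes>\<^bsub>Q\<^esub> b y) \<otimes>\<^bsub>Q\<^esub> b (x \<otimes> y)"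
      using c by (simp add: Q.m_ac)
    then have "b x \<otimes>\<^bsub>Q\<^esub> b y \<in> S #>\<^bsub>Q\<^esub> b (x \<otimes> y)"
      using cong[OF xy] unfolding r_coset_def by blast
    then have "S #>\<^bsub>Q\<^esub> b (x \<otimes> y) = S #>\<^bsub>Q\<^esub> (b x \<otimes>\<^bsub>Q\<^esub> b y)"
      using Q.repr_independence[OF _ c(3) S] by simp
    then show ?thesis using N.rcos_sum[OF c(1,2)] by (simp add: \<phi>_def)
  qed
  interpret \<phi>: group_hom G "Q Mod S" \<phi>
    by (simp add: group_hom_def group_hom_axioms_def hom_def Pi_def hom \<phi>c F.is_group group_axioms)
  have comm: "\<phi> (x \<otimes> y \<otimes> inv x \<otimes> inv y) = \<one>\<^bsub>Q Mod S\<^esub>" if xy: "x \<in> carrier G" "y \<in> carrier G" for x y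
  proof -
    define k where "k = y \<otimes> x"
    have k: "k \<in> carrier G" using xy by (simp add: k_def)
    have "x \<otimes> y \<otimes> inv x \<otimes> inv y \<otimes> k = x \<otimes> y" using xy by (simp add: k_def m_assoc) (simp add: m_assoc[symmetric])
    then have "\<phi> (x \<otimes> y \<otimes> inv x \<otimes> inv y) \<otimes>\<^bsub>Q Mod S\<^esub> \<phi> k = \<phi> (x \<otimes> y)"
      using hom[of "x \<otimes> y \<otimes> inv x \<otimes> inv y" k] xy k by (simp only: m_closed inv_closed)
    also have "\<dots> = \<phi> k" unfolding k_def hom[OF xy] hom[OF xy(2,1)] by (rule F.m_comm[OF \<phi>c[OF xy(1)] \<phi>c[OF xy(2)]])
    finally show ?thesis using F.l_cancel_one'[OF \<phi>c \<phi>c[OF k]] F.r_cancel_one[OF \<phi>c[OF k]] \<phi>c[OF k] \<phi>c xy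
      by (metis F.one_closed F.l_one F.right_cancel m_closed inv_closed)
  qed
  have "g \<in> generate G (derived_set G (carrier G))" using g perfect by (simp add: derived_def)
  then have "\<phi> g = \<one>\<^bsub>Q Mod S\<^esub>"
  proof (induction rule: generate.induct)
    case one
    show ?case by (rule \<phi>.hom_one)
  next
    case (incl h)
    then obtain x y where h: "x \<in> carrier G" "y \<in> carrier G" "h = x \<otimes> y \<otimes> inv x \<otimes> inv y" by auto
    then show ?case by (simp only: comm)
  next
    case (inv h)
    then obtain x y where h: "x \<in> carrier G" "y \<in> carrier G" "h = x \<otimes> y \<otimes> inv x \<otimes> inv y" by auto
    then have "\<phi> (inv h) = inv\<^bsub>Q Mod S\<^esub> \<phi> h" using \<phi>.hom_inv[of h] by simp
    then show ?case using comm[OF h(1,2)] by (simp only: h(3) F.inv_one)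
  next
    case (eng h1 h2)
    note h = generate_in_carrier[OF derived_set_in_carrier[OF subset_refl] eng.hyps(1)]
      generate_in_carrier[OF derived_set_in_carrier[OF subset_refl] eng.hyps(2)]
    show ?case unfolding hom[OF h] eng.IH by (rule F.r_one[OF F.one_closed])
  qed
  then have "S #>\<^bsub>Q\<^esub> b g = S" by (simp add: \<phi>_def)
  moreover have "b g \<in> S #>\<^bsub>Q\<^esub> b g" using Q.rcos_self[OF bc[OF g] S] .
  ultimately show ?thesis by simp
qed

section \<open>Cochains, and cohomology classes described pointwise\<close>

locale coefficients = G: group G + U: comm_group U
  for G :: "('g, 'm) monoid_scheme" (structure) and U :: "('u, 'n) monoid_scheme"
begin

abbreviation cochain :: "('g \<times> 'g \<Rightarrow> 'u) \<Rightarrow> bool"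
  where "cochain c \<equiv> c \<in> (carrier G \<times> carrier G) \<rightarrow>\<^sub>E carrier U"

definition dif :: "('g \<Rightarrow> 'u) \<Rightarrow> 'g \<Rightarrow> 'g \<Rightarrow> 'u"
  where "dif b g h = b g \<otimes>\<^bsub>U\<^esub> inv\<^bsub>U\<^esub> b (g \<otimes> h) \<otimes>\<^bsub>U\<^esub> b h"

definition cohomologous :: "('g \<times> 'g \<Rightarrow> 'u) \<Rightarrow> ('g \<times> 'g \<Rightarrow> 'u) \<Rightarrow> bool"
  where "cohomologous c d \<longleftrightarrow> (\<exists>b\<in>carrier G \<rightarrow> carrier U. \<forall>g\<in>carrier G. \<forall>h\<in>carrier G. d (g, h) = dif b g h \<otimes>\<^bsub>U\<^esub> c (g, h))"

lemma cochainD [simp]: "cochain c \<Longrightarrow> g \<in> carrier G \<Longrightarrow> h \<in> carrier G \<Longrightarrow> c (g, h) \<in> carrier U"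
  by auto

lemma dif_closed [simp]: "b \<in> carrier G \<rightarrow> carrier U \<Longrightarrow> g \<in> carrier G \<Longrightarrow> h \<in> carrier G \<Longrightarrow> dif b g h \<in> carrier U"
  unfolding dif_def by (auto simp: Pi_iff)

lemma cohomologous_refl: "cochain c \<Longrightarrow> cohomologous c c"
  unfolding cohomologous_def by (rule bexI[of _ "\<lambda>_. \<one>\<^bsub>U\<^esub>"]) (auto simp: dif_def)

lemma cohomologous_sym: "cochain c \<Longrightarrow> cohomologous c d \<Longrightarrow> cohomologous d c"
proof -
  assume c: "cochain c" and "cohomologous c d"
  then obtain b where b: "b \<in> carrier G \<rightarrow> carrier U"
    "\<And>g h. g \<in> carrier G \<Longrightarrow> h \<in> carrier G \<Longrightarrow> d (g, h) = dif b g h \<otimes>\<^bsub>U\<^esub> c (g, h)" unfolding cohomologous_def by blast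
  have bc: "b g \<in> carrier U" if "g \<in> carrier G" for g using b(1) that by auto
  have "c (g, h) = dif (\<lambda>g. inv\<^bsub>U\<^esub> b g) g h \<otimes>\<^bsub>U\<^esub> d (g, h)" if gh: "g \<in> carrier G" "h \<in> carrier G" for g h
  proof -
    have "dif (\<lambda>g. inv\<^bsub>U\<^esub> b g) g h = inv\<^bsub>U\<^esub> dif b g h" using bc gh by (simp add: dif_def U.inv_mult U.m_ac)
    then show ?thesis using b gh c dif_closed[OF b(1) gh] by (simp add: U.m_assoc[symmetric])
  qed
  then show ?thesis unfolding cohomologous_def using b(1) by (intro bexI[of _ "\<lambda>g. inv\<^bsub>U\<^esub> b g"]) auto
qed

lemma cohomologous_trans: "cochain c \<Longrightarrow> cohomologous c d \<Longrightarrow> cohomologous d e \<Longrightarrow> cohomologous c e"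
proof -
  assume c: "cochain c" and cd: "cohomologous c d" and de: "cohomologous d e"
  obtain b where b: "b \<in> carrier G \<rightarrow> carrier U"
    "\<And>g h. g \<in> carrier G \<Longrightarrow> h \<in> carrier G \<Longrightarrow> d (g, h) = dif b g h \<otimes>\<^bsub>U\<^esub> c (g, h)" using cd unfolding cohomologous_def by blast
  obtain b' where b': "b' \<in> carrier G \<rightarrow> carrier U"
    "\<And>g h. g \<in> carrier G \<Longrightarrow> h \<in> carrier G \<Longrightarrow> e (g, h) = dif b' g h \<otimes>\<^bsub>U\<^esub> d (g, h)" using de unfolding cohomologous_def by blast
  have bc: "b g \<in> carrier U" "b' g \<in> carrier U" if "g \<in> carrier G" for g using b(1) b'(1) that by auto
  have "e (g, h) = dif (\<lambda>g. b' g \<otimes>\<^bsub>U\<^esub> b g) g h \<otimes>\<^bsub>U\<^esub> c (g, h)" if gh: "g \<in> carrier G" "h \<in> carrier G" for g h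
  proof -
    have "dif (\<lambda>g. b' g \<otimes>\<^bsub>U\<^esub> b g) g h = dif b' g h \<otimes>\<^bsub>U\<^esub> dif b g h"
      using bc gh by (simp add: dif_def U.inv_mult U.m_ac)
    then show ?thesis using b b' gh c dif_closed[OF b(1) gh] dif_closed[OF b'(1) gh] by (simp add: U.m_assoc)
  qed
  then show ?thesis unfolding cohomologous_def using b(1) b'(1) by (intro bexI[of _ "\<lambda>g. b' g \<otimes>\<^bsub>U\<^esub> b g"]) auto
qed

lemma class_mem:
  assumes "cochain c" shows "d \<in> cohomology_class G U c \<longleftrightarrow> cochain d \<and> cohomologous c d"
proof
  assume "d \<in> cohomology_class G U c"
  then obtain b where b: "b \<in> carrier G \<rightarrow> carrier U"
    "d = (\<lambda>(g, h)\<in>carrier G \<times> carrier G. b g \<otimes>\<^bsub>U\<^esub> inv\<^bsub>U\<^esub> b (g \<otimes> h) \<otimes>\<^bsub>U\<^esub> b h) \<otimes>\<^bsub>cochains2 G U\<^esub> c"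
    unfolding cohomology_class_def r_coset_def coboundaries2_def by blast
  have "d = (\<lambda>(g, h)\<in>carrier G \<times> carrier G. dif b g h \<otimes>\<^bsub>U\<^esub> c (g, h))"
    unfolding b(2) cochains2_def by (auto simp: dif_def fun_eq_iff)
  then show "cochain d \<and> cohomologous c d"
    using b(1) assms unfolding cohomologous_def by (auto intro!: bexI[of _ b])
next
  assume "cochain d \<and> cohomologous c d"
  then obtain b where d: "cochain d" and b: "b \<in> carrier G \<rightarrow> carrier U"
    "\<And>g h. g \<in> carrier G \<Longrightarrow> h \<in> carrier G \<Longrightarrow> d (g, h) = dif b g h \<otimes>\<^bsub>U\<^esub> c (g, h)" unfolding cohomologous_def by blast
  have "d = (\<lambda>(g, h)\<in>carrier G \<times> carrier G. b g \<otimes>\<^bsub>U\<^esub> inv\<^bsub>U\<^esub> b (g \<otimes> h) \<otimes>\<^bsub>U\<^esub> b h) \<otimes>\<^bsub>cochains2 G U\<^esub> c"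
  proof
    fix p show "d p = ((\<lambda>(g, h)\<in>carrier G \<times> carrier G. b g \<otimes>\<^bsub>U\<^esub> inv\<^bsub>U\<^esub> b (g \<otimes> h) \<otimes>\<^bsub>U\<^esub> b h) \<otimes>\<^bsub>cochains2 G U\<^esub> c) p"
      using b(2) d PiE_arb[OF d, of p] by (cases p) (auto simp: cochains2_def dif_def)
  qed
  then show "d \<in> cohomology_class G U c"
    using b(1) unfolding cohomology_class_def r_coset_def coboundaries2_def by blast
qed

lemma class_eq_iff:
  assumes "cochain c" "cochain d"
  shows "cohomology_class G U c = cohomology_class G U d \<longleftrightarrow> cohomologous c d"
proof
  assume "cohomology_class G U c = cohomology_class G U d"
  then show "cohomologous c d" using class_mem[OF assms(1), of d] class_mem[OF assms(2), of d] cohomologous_refl assms(2) by blast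
next
  assume r: "cohomologous c d"
  show "cohomology_class G U c = cohomology_class G U d"
    using class_mem[OF assms(1)] class_mem[OF assms(2)] cohomologous_trans[OF assms(2) cohomologous_sym[OF assms(1) r]]
      cohomologous_trans[OF assms(1) r] by blast
qed

lemma cocycle_cochain: "c \<in> cocycles2 G U \<Longrightarrow> cochain c"
  by (auto simp: cocycles2_def cochains2_def)

lemma cohomology2_carrier: "carrier (cohomology2 G U) = cohomology_class G U ` cocycles2 G U"
  unfolding cohomology2_def FactGroup_def RCOSETS_def cohomology_class_def r_coset_def by auto

lemma cocycle_cohomologous:
  assumes c: "c \<in> cocycles2 G U" and d: "cochain d" and cd: "cohomologous c d"
  shows "d \<in> cocycles2 G U"
proof -
  note cc = cocycle_cochain[OF c]
  obtain b where b: "b \<in> carrier G \<rightarrow> carrier U"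
    "\<And>g h. g \<in> carrier G \<Longrightarrow> h \<in> carrier G \<Longrightarrow> d (g, h) = dif b g h \<otimes>\<^bsub>U\<^esub> c (g, h)" using cd unfolding cohomologous_def by blast
  have bc: "b g \<in> carrier U" if "g \<in> carrier G" for g using b(1) that by auto
  have "d (h, k) \<otimes>\<^bsub>U\<^esub> d (g, h \<otimes> k) = d (g \<otimes> h, k) \<otimes>\<^bsub>U\<^esub> d (g, h)"
    if ghk: "g \<in> carrier G" "h \<in> carrier G" "k \<in> carrier G" for g h k
  proof -
    have coc: "c (h, k) \<otimes>\<^bsub>U\<^esub> c (g, h \<otimes> k) = c (g \<otimes> h, k) \<otimes>\<^bsub>U\<^esub> c (g, h)" using c ghk by (auto simp: cocycles2_def)
    have bb: "dif b h k \<otimes>\<^bsub>U\<^esub> dif b g (h \<otimes> k) = dif b (g \<otimes> h) k \<otimes>\<^bsub>U\<^esub> dif b g h"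
    proof -
      have "dif b h k \<otimes>\<^bsub>U\<^esub> dif b g (h \<otimes> k) = (inv\<^bsub>U\<^esub> b (h \<otimes> k) \<otimes>\<^bsub>U\<^esub> b (h \<otimes> k)) \<otimes>\<^bsub>U\<^esub> (b h \<otimes>\<^bsub>U\<^esub> b k \<otimes>\<^bsub>U\<^esub> b g \<otimes>\<^bsub>U\<^esub> inv\<^bsub>U\<^esub> b (g \<otimes> (h \<otimes> k)))"
        unfolding dif_def using bc ghk by (simp only: U.m_ac U.m_closed U.inv_closed G.m_closed)
      also have "\<dots> = (inv\<^bsub>U\<^esub> b (g \<otimes> h) \<otimes>\<^bsub>U\<^esub> b (g \<otimes> h)) \<otimes>\<^bsub>U\<^esub> (b h \<otimes>\<^bsub>U\<^esub> b k \<otimes>\<^bsub>U\<^esub> b g \<otimes>\<^bsub>U\<^esub> inv\<^bsub>U\<^esub> b (g \<otimes> (h \<otimes> k)))"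
        using bc ghk by simp
      also have "\<dots> = dif b (g \<otimes> h) k \<otimes>\<^bsub>U\<^esub> dif b g h"
        unfolding dif_def using bc ghk by (simp only: G.m_assoc U.m_ac U.m_closed U.inv_closed G.m_closed)
      finally show ?thesis .
    qed
    have "d (h, k) \<otimes>\<^bsub>U\<^esub> d (g, h \<otimes> k) = (dif b h k \<otimes>\<^bsub>U\<^esub> dif b g (h \<otimes> k)) \<otimes>\<^bsub>U\<^esub> (c (h, k) \<otimes>\<^bsub>U\<^esub> c (g, h \<otimes> k))"
      using b ghk cc dif_closed[OF b(1)] by (simp add: U.m_ac)
    also have "\<dots> = (dif b (g \<otimes> h) k \<otimes>\<^bsub>U\<^esub> dif b g h) \<otimes>\<^bsub>U\<^esub> (c (g \<otimes> h, k) \<otimes>\<^bsub>U\<^esub> c (g, h))" by (simp only: bb coc)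
    also have "\<dots> = d (g \<otimes> h, k) \<otimes>\<^bsub>U\<^esub> d (g, h)"
      using b ghk cc dif_closed[OF b(1)] by (simp add: U.m_ac)
    finally show ?thesis .
  qed
  then show ?thesis using d by (simp add: cocycles2_def cochains2_def)
qed

lemma class_member_cocycle:
  "c \<in> cocycles2 G U \<Longrightarrow> d \<in> cohomology_class G U c \<Longrightarrow> d \<in> cocycles2 G U \<and> cohomology_class G U d = cohomology_class G U c"
  using class_mem[OF cocycle_cochain, of c d] cocycle_cohomologous[of c d] class_eq_iff[OF cocycle_cochain, of c d] by auto

lemma class_self: "c \<in> cocycles2 G U \<Longrightarrow> c \<in> cohomology_class G U c"
  using class_mem[OF cocycle_cochain] cohomologous_refl[OF cocycle_cochain] cocycle_cochain by blast

end

definition push_cochain :: "('g, 'm) monoid_scheme \<Rightarrow> ('u \<Rightarrow> 'v) \<Rightarrow> ('g \<times> 'g \<Rightarrow> 'u) \<Rightarrow> 'g \<times> 'g \<Rightarrow> 'v"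
  where "push_cochain G f c = (\<lambda>p\<in>carrier G \<times> carrier G. f (c p))"

lemma push_cochain_simp [simp]: "g \<in> carrier G \<Longrightarrow> h \<in> carrier G \<Longrightarrow> push_cochain G f c (g, h) = f (c (g, h))"
  by (simp add: push_cochain_def)

locale coefficient_hom = C: coefficients G U + D: coefficients G V + group_hom U V f
  for G :: "('g, 'm) monoid_scheme" (structure) and U :: "('u, 'n) monoid_scheme" and V :: "('v, 'p) monoid_scheme" and f
begin

lemma push_cochain: "C.cochain c \<Longrightarrow> D.cochain (push_cochain G f c)"
  unfolding push_cochain_def by (auto intro!: hom_closed)

lemma push_cocycle: "c \<in> cocycles2 G U \<Longrightarrow> push_cochain G f c \<in> cocycles2 G V"
proof -
  assume c: "c \<in> cocycles2 G U"
  note cc = C.cocycle_cochain[OF c]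
  have "f (c (h, k)) \<otimes>\<^bsub>V\<^esub> f (c (g, h \<otimes> k)) = f (c (g \<otimes> h, k)) \<otimes>\<^bsub>V\<^esub> f (c (g, h))"
    if ghk: "g \<in> carrier G" "h \<in> carrier G" "k \<in> carrier G" for g h k
  proof -
    have "c (h, k) \<otimes>\<^bsub>U\<^esub> c (g, h \<otimes> k) = c (g \<otimes> h, k) \<otimes>\<^bsub>U\<^esub> c (g, h)" using c ghk by (simp add: cocycles2_def)
    then have "f (c (h, k) \<otimes>\<^bsub>U\<^esub> c (g, h \<otimes> k)) = f (c (g \<otimes> h, k) \<otimes>\<^bsub>U\<^esub> c (g, h))" by simp
    then show ?thesis using C.cochainD[OF cc] ghk by simp
  qed
  then show ?thesis using push_cochain[OF cc] by (simp add: cocycles2_def cochains2_def)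
qed

lemma push_cohomologous:
  assumes "C.cochain c" "C.cohomologous c d" shows "D.cohomologous (push_cochain G f c) (push_cochain G f d)"
proof -
  obtain b where b: "b \<in> carrier G \<rightarrow> carrier U"
    "\<And>g h. g \<in> carrier G \<Longrightarrow> h \<in> carrier G \<Longrightarrow> d (g, h) = C.dif b g h \<otimes>\<^bsub>U\<^esub> c (g, h)" using assms(2) unfolding C.cohomologous_def by blast
  have bc: "b g \<in> carrier U" if "g \<in> carrier G" for g using b(1) that by auto
  have "f (d (g, h)) = D.dif (\<lambda>g. f (b g)) g h \<otimes>\<^bsub>V\<^esub> f (c (g, h))" if "g \<in> carrier G" "h \<in> carrier G" for g h
    using b(2)[OF that] bc that assms(1) C.dif_closed[OF b(1) that] by (simp add: hom_mult) (simp add: C.dif_def D.dif_def)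
  then show ?thesis unfolding D.cohomologous_def using bc by (intro bexI[of _ "\<lambda>g. f (b g)"]) auto
qed

lemma induced_map_class:
  assumes c: "c \<in> cocycles2 G U"
  shows "induced_map G V f (cohomology_class G U c) = cohomology_class G V (push_cochain G f c)"
proof -
  note cc = C.cocycle_cochain[OF c]
  have "cohomology_class G V (push_cochain G f d) = cohomology_class G V (push_cochain G f c)"
    if "d \<in> cohomology_class G U c" for d
  proof -
    have d: "C.cochain d" "C.cohomologous c d" using that C.class_mem[OF cc] by auto
    show ?thesis using D.class_eq_iff[OF push_cochain[OF cc] push_cochain[OF d(1)]] push_cohomologous[OF cc d(2)] by simp
  qed
  moreover have "c \<in> cohomology_class G U c" by (rule C.class_self[OF c])
  ultimately show ?thesis unfolding induced_map_def push_cochain_def[symmetric] by blast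
qed

end

section \<open>The bar complex\<close>

lemma hom_free_eq:
  assumes "group V" "f \<in> hom (free_Abelian_group S) V" "f' \<in> hom (free_Abelian_group S) V"
    and "\<And>s. s \<in> S \<Longrightarrow> f (frag_of s) = f' (frag_of s)" and z: "Poly_Mapping.keys z \<subseteq> S"
  shows "f z = f' z"
proof -
  interpret f: group_hom "free_Abelian_group S" V f using assms by (simp add: group_hom_def group_hom_axioms_def)
  interpret f': group_hom "free_Abelian_group S" V f' using assms by (simp add: group_hom_def group_hom_axioms_def)
  show ?thesis using z
  proof (induction z rule: free_Abelian_group_induct[consumes 1, case_names zero diff one])
    case zero
    then show ?case using f.hom_one f'.hom_one by simp
  next
    case (diff x y)
    have "f (x - y) = f x \<otimes>\<^bsub>V\<^esub> inv\<^bsub>V\<^esub> f y" "f' (x - y) = f' x \<otimes>\<^bsub>V\<^esub> inv\<^bsub>V\<^esub> f' y"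
      using f.hom_mult[of x "- y"] f.hom_inv[of y] f'.hom_mult[of x "- y"] f'.hom_inv[of y] diff by auto
    then show ?case using diff by simp
  next
    case (one a)
    then show ?case using assms(4) by simp
  qed
qed

lemma hom_frag_extend:
  assumes "\<And>s. s \<in> S \<Longrightarrow> Poly_Mapping.keys (f s) \<subseteq> T"
  shows "frag_extend f \<in> hom (free_Abelian_group S) (free_Abelian_group T)"
proof (rule homI)
  fix x assume "x \<in> carrier (free_Abelian_group S)"
  then show "frag_extend f x \<in> carrier (free_Abelian_group T)"
    using keys_frag_extend[of f x] assms by fastforce
qed (simp add: frag_extend_add)

context coefficients
begin

lemma eval_cochain_hom:
  assumes c: "cochain c"
  shows "eval_cochain U c \<in> hom (free_Abelian_group (carrier G \<times> carrier G)) U"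
    and "\<And>p. p \<in> carrier G \<times> carrier G \<Longrightarrow> eval_cochain U c (frag_of p) = c p"
proof -
  let ?S = "carrier G \<times> carrier G"
  have cp: "c p \<in> carrier U" if "p \<in> ?S" for p using c that by auto
  have fin: "finite {p \<in> ?S. c p [^]\<^bsub>U\<^esub> poly_mapping.lookup z p \<noteq> \<one>\<^bsub>U\<^esub>}" for z :: "'g \<times> 'g \<Rightarrow>\<^sub>0 int"
    by (rule finite_subset[OF _ finite_keys[of z]]) (auto simp: in_keys_iff intro: ccontr)
  \<comment> \<open>The product over the support of \<open>z\<close> is replaced by one over a fixed
    index set, so that additivity in \<open>z\<close> becomes termwise.\<close>
  have gf: "eval_cochain U c z = gfinprod U (\<lambda>p. c p [^]\<^bsub>U\<^esub> poly_mapping.lookup z p) ?S"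
    if z: "Poly_Mapping.keys z \<subseteq> ?S" for z
    unfolding eval_cochain_def gfinprod_def using fin[of z]
    by (auto intro!: U.finprod_mono_neutral_cong_right[symmetric] U.finprod_mono_neutral_cong_left[symmetric] U.finprod_mono_neutral_cong
        dest: subsetD[OF z] simp: in_keys_iff cp)
  show "eval_cochain U c \<in> hom (free_Abelian_group ?S) U"
  proof (rule homI)
    fix x assume "x \<in> carrier (free_Abelian_group ?S)"
    then show "eval_cochain U c x \<in> carrier U"
      unfolding eval_cochain_def by (intro U.finprod_closed) (auto intro!: cp)
  next
    fix x y assume xy: "x \<in> carrier (free_Abelian_group ?S)" "y \<in> carrier (free_Abelian_group ?S)"
    have k: "Poly_Mapping.keys (x + y) \<subseteq> ?S" using keys_add[of x y] xy by auto
    have "gfinprod U (\<lambda>p. c p [^]\<^bsub>U\<^esub> poly_mapping.lookup (x + y) p) ?S =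
        gfinprod U (\<lambda>p. c p [^]\<^bsub>U\<^esub> poly_mapping.lookup x p \<otimes>\<^bsub>U\<^esub> c p [^]\<^bsub>U\<^esub> poly_mapping.lookup y p) ?S"
      by (rule U.gfinprod_cong) (auto simp: Poly_Mapping.lookup_add U.int_pow_mult cp simp_implies_def)
    also have "\<dots> = gfinprod U (\<lambda>p. c p [^]\<^bsub>U\<^esub> poly_mapping.lookup x p) ?S \<otimes>\<^bsub>U\<^esub> gfinprod U (\<lambda>p. c p [^]\<^bsub>U\<^esub> poly_mapping.lookup y p) ?S"
      by (rule U.gfinprod_distrib[OF fin fin]) (auto intro!: cp)
    finally show "eval_cochain U c (x \<otimes>\<^bsub>free_Abelian_group ?S\<^esub> y) = eval_cochain U c x \<otimes>\<^bsub>U\<^esub> eval_cochain U c y"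
      using gf[OF k] gf[of x] gf[of y] xy by simp
  qed
  show "eval_cochain U c (frag_of p) = c p" if "p \<in> ?S" for p
    using cp[OF that] by (simp add: eval_cochain_def)
qed

end

section \<open>Cycles, boundaries and the second homology group\<close>

locale bar_complex = group G for G :: "('g, 'm) monoid_scheme" (structure)
begin

abbreviation "F1 \<equiv> free_Abelian_group (carrier G)"
abbreviation "F2 \<equiv> free_Abelian_group (carrier G \<times> carrier G)"
abbreviation "F3 \<equiv> free_Abelian_group (carrier G \<times> carrier G \<times> carrier G)"
abbreviation "Z2 \<equiv> F2\<lparr>carrier := cycles2 G\<rparr>"
abbreviation "H2 \<equiv> homology2 G"

lemma keys_sum: "Poly_Mapping.keys x \<subseteq> S \<Longrightarrow> Poly_Mapping.keys y \<subseteq> S \<Longrightarrow> Poly_Mapping.keys (x + y :: 'z \<Rightarrow>\<^sub>0 int) \<subseteq> S"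
  using keys_add[of x y] by blast

lemma keys_difference: "Poly_Mapping.keys x \<subseteq> S \<Longrightarrow> Poly_Mapping.keys y \<subseteq> S \<Longrightarrow> Poly_Mapping.keys (x - y :: 'z \<Rightarrow>\<^sub>0 int) \<subseteq> S"
  using keys_diff[of x y] by blast

lemma bar_d2_hom: "bar_d2 G \<in> hom F2 F1"
  unfolding bar_d2_def by (rule hom_frag_extend, erule SigmaE, hypsubst, unfold prod.case, intro keys_sum keys_difference) auto

lemma bar_d3_hom: "bar_d3 G \<in> hom F3 F2"
  unfolding bar_d3_def by (rule hom_frag_extend, (erule SigmaE)+, hypsubst, unfold prod.case, intro keys_sum keys_difference) auto

lemma bar_d2_simps [simp]: "bar_d2 G (frag_of (g, h)) = frag_of h - frag_of (g \<otimes> h) + frag_of g"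
  "bar_d2 G (x + y) = bar_d2 G x + bar_d2 G y" "bar_d2 G (x - y) = bar_d2 G x - bar_d2 G y" "bar_d2 G 0 = 0"
  "bar_d2 G (- x) = - bar_d2 G x"
  by (simp_all add: bar_d2_def frag_extend_add frag_extend_diff frag_extend_minus)

lemma bar_d3_simps [simp]: "bar_d3 G (frag_of (g, h, k)) =
    frag_of (h, k) - frag_of (g \<otimes> h, k) + frag_of (g, h \<otimes> k) - frag_of (g, h)"
  by (simp add: bar_d3_def)

lemma cycles2_iff: "z \<in> cycles2 G \<longleftrightarrow> Poly_Mapping.keys z \<subseteq> carrier G \<times> carrier G \<and> bar_d2 G z = 0"
  by (auto simp: cycles2_def kernel_def)

lemma cycles2_subgroup: "subgroup (cycles2 G) F2"
proof (rule group.subgroupI[OF group_free_Abelian_group])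
  have "0 \<in> cycles2 G" by (simp add: cycles2_iff)
  then show "cycles2 G \<noteq> {}" by blast
qed (auto simp: cycles2_iff dest: subsetD[OF keys_add])

lemma bar_d2_d3: "Poly_Mapping.keys y \<subseteq> carrier G \<times> carrier G \<times> carrier G \<Longrightarrow> bar_d2 G (bar_d3 G y) = 0"
proof -
  assume y: "Poly_Mapping.keys y \<subseteq> carrier G \<times> carrier G \<times> carrier G"
  have "(bar_d2 G \<circ> bar_d3 G) y = (\<lambda>_. 0) y"
  proof (rule hom_free_eq[OF group_free_Abelian_group[of "carrier G"] _ _ _ y])
    show "bar_d2 G \<circ> bar_d3 G \<in> hom F3 F1" by (rule Group.hom_compose[OF bar_d3_hom bar_d2_hom])
    show "(\<lambda>_. 0) \<in> hom F3 F1" by (rule homI) auto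
    fix s assume "s \<in> carrier G \<times> carrier G \<times> carrier G"
    then show "(bar_d2 G \<circ> bar_d3 G) (frag_of s) = 0" by (auto simp: m_assoc)
  qed
  then show ?thesis by simp
qed

lemma boundaries2_subset: "boundaries2 G \<subseteq> cycles2 G"
  unfolding boundaries2_def
  using bar_d2_d3 hom_in_carrier[OF bar_d3_hom] by (auto simp: cycles2_iff)

lemma Z2_comm_group: "comm_group Z2"
proof -
  interpret comm_group F2 by (rule abelian_free_Abelian_group)
  have "group Z2" by (rule subgroup.subgroup_is_group[OF cycles2_subgroup group_free_Abelian_group])
  then show ?thesis by (rule group.group_comm_groupI) (simp add: add.commute)
qed

lemma boundaries2_subgroup: "subgroup (boundaries2 G) Z2"
proof -
  have "subgroup (boundaries2 G) F2"
    unfolding boundaries2_def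
    using group_hom.img_is_subgroup[of F3 F2 "bar_d3 G"] bar_d3_hom by (simp add: group_hom_def group_hom_axioms_def)
  then show ?thesis
    by (rule group.subgroup_incl[OF group_free_Abelian_group _ cycles2_subgroup boundaries2_subset])
qed

lemma homology2_eq: "H2 = Z2 Mod boundaries2 G"
  by (simp add: homology2_def)

lemma homology2_comm_group: "comm_group H2"
  unfolding homology2_eq by (rule comm_group.abelian_FactGroup[OF Z2_comm_group boundaries2_subgroup])

definition cls :: "('g \<times> 'g \<Rightarrow>\<^sub>0 int) \<Rightarrow> ('g \<times> 'g \<Rightarrow>\<^sub>0 int) set"
  where "cls z = boundaries2 G #>\<^bsub>Z2\<^esub> z"

lemma cls_hom: "cls \<in> hom Z2 H2"
  unfolding homology2_eq cls_def
  by (rule normal.r_coset_hom_Mod[OF comm_group.subgroup_imp_normal[OF Z2_comm_group boundaries2_subgroup]])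

lemma homology2_carrier: "carrier H2 = cls ` cycles2 G"
  unfolding homology2_eq carrier_FactGroup by (simp add: cls_def)

lemma cls_closed [simp]: "z \<in> cycles2 G \<Longrightarrow> cls z \<in> carrier H2"
  by (simp add: homology2_carrier)

lemma cls_add: "x \<in> cycles2 G \<Longrightarrow> y \<in> cycles2 G \<Longrightarrow> cls (x + y) = cls x \<otimes>\<^bsub>H2\<^esub> cls y"
  using hom_mult[OF cls_hom, of x y] by simp

lemma cls_eqI:
  assumes "x \<in> cycles2 G" "y \<in> cycles2 G" "x - y \<in> boundaries2 G" shows "cls x = cls y"
proof -
  have "x \<in> boundaries2 G #>\<^bsub>Z2\<^esub> y" unfolding r_coset_def using assms(3) by (auto intro!: bexI[of _ "x - y"])
  then show ?thesis unfolding cls_def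
    using group.repr_independence[OF comm_group.axioms(2)[OF Z2_comm_group] _ _ boundaries2_subgroup, of x y] assms by simp
qed

lemma mem_cls: "z \<in> cls z' \<longleftrightarrow> (\<exists>y. Poly_Mapping.keys y \<subseteq> carrier G \<times> carrier G \<times> carrier G \<and> z = bar_d3 G y + z')"
proof
  assume "z \<in> cls z'"
  then obtain y where "y \<in> carrier F3" "z = bar_d3 G y + z'" unfolding cls_def r_coset_def boundaries2_def by auto
  then show "\<exists>y. Poly_Mapping.keys y \<subseteq> carrier G \<times> carrier G \<times> carrier G \<and> z = bar_d3 G y + z'"
    by (intro exI[of _ y] conjI) simp_all
qed (auto simp: cls_def r_coset_def boundaries2_def)

end

section \<open>The pairing between cocycles and cycles\<close>

locale bar_coefficients = coefficients G U + bar_complex G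
  for G :: "('g, 'm) monoid_scheme" (structure) and U :: "('u, 'n) monoid_scheme"
begin

lemma eval_add:
  assumes "cochain c" "Poly_Mapping.keys x \<subseteq> carrier G \<times> carrier G" "Poly_Mapping.keys y \<subseteq> carrier G \<times> carrier G"
  shows "eval_cochain U c (x + y) = eval_cochain U c x \<otimes>\<^bsub>U\<^esub> eval_cochain U c y"
  using hom_mult[OF eval_cochain_hom(1)[OF assms(1)], of x y] assms by simp

lemma eval_closed [simp]:
  "cochain c \<Longrightarrow> Poly_Mapping.keys x \<subseteq> carrier G \<times> carrier G \<Longrightarrow> eval_cochain U c x \<in> carrier U"
  using hom_in_carrier[OF eval_cochain_hom(1)] by simp

lemma eval_minus:
  assumes "cochain c" "Poly_Mapping.keys x \<subseteq> carrier G \<times> carrier G"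
  shows "eval_cochain U c (- x) = inv\<^bsub>U\<^esub> eval_cochain U c x"
proof -
  interpret e: group_hom F2 U "eval_cochain U c"
    using eval_cochain_hom(1)[OF assms(1)] by (simp add: group_hom_def group_hom_axioms_def)
  show ?thesis using e.hom_inv[of x] assms by simp
qed

lemma eval_diff:
  assumes "cochain c" "Poly_Mapping.keys x \<subseteq> carrier G \<times> carrier G" "Poly_Mapping.keys y \<subseteq> carrier G \<times> carrier G"
  shows "eval_cochain U c (x - y) = eval_cochain U c x \<otimes>\<^bsub>U\<^esub> inv\<^bsub>U\<^esub> eval_cochain U c y"
  using eval_add[OF assms(1,2), of "- y"] eval_minus[OF assms(1,3)] assms(3) by simp

text \<open>On a basis element (g, h, k) the claim is the cocycle identity, and both sides are
  homomorphisms on a free abelian group.\<close>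

lemma eval_boundary:
  assumes c: "c \<in> cocycles2 G U" and y: "Poly_Mapping.keys y \<subseteq> carrier G \<times> carrier G \<times> carrier G"
  shows "eval_cochain U c (bar_d3 G y) = \<one>\<^bsub>U\<^esub>"
proof -
  note cc = cocycle_cochain[OF c]
  have "(eval_cochain U c \<circ> bar_d3 G) y = (\<lambda>_. \<one>\<^bsub>U\<^esub>) y"
  proof (rule hom_free_eq[OF U.is_group _ _ _ y])
    show "eval_cochain U c \<circ> bar_d3 G \<in> hom F3 U" by (rule Group.hom_compose[OF bar_d3_hom eval_cochain_hom(1)[OF cc]])
    show "(\<lambda>_. \<one>\<^bsub>U\<^esub>) \<in> hom F3 U" by (rule homI) auto
    fix s assume "s \<in> carrier G \<times> carrier G \<times> carrier G"
    then obtain g h k where s: "s = (g, h, k)" "g \<in> carrier G" "h \<in> carrier G" "k \<in> carrier G" by auto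
    have coc: "c (h, k) \<otimes>\<^bsub>U\<^esub> c (g, h \<otimes> k) = c (g \<otimes> h, k) \<otimes>\<^bsub>U\<^esub> c (g, h)" using c s by (auto simp: cocycles2_def)
    have "eval_cochain U c (bar_d3 G (frag_of s)) =
        c (h, k) \<otimes>\<^bsub>U\<^esub> inv\<^bsub>U\<^esub> c (g \<otimes> h, k) \<otimes>\<^bsub>U\<^esub> c (g, h \<otimes> k) \<otimes>\<^bsub>U\<^esub> inv\<^bsub>U\<^esub> c (g, h)"
      using s cc by (simp add: eval_add eval_diff keys_sum keys_difference eval_cochain_hom(2))
    also have "\<dots> = (c (h, k) \<otimes>\<^bsub>U\<^esub> c (g, h \<otimes> k)) \<otimes>\<^bsub>U\<^esub> inv\<^bsub>U\<^esub> (c (g \<otimes> h, k) \<otimes>\<^bsub>U\<^esub> c (g, h))"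
      using s cc by (simp add: U.inv_mult U.m_ac)
    also have "\<dots> = \<one>\<^bsub>U\<^esub>" unfolding coc using s cc by simp
    finally show "(eval_cochain U c \<circ> bar_d3 G) (frag_of s) = \<one>\<^bsub>U\<^esub>" by simp
  qed
  then show ?thesis by simp
qed

text \<open>The cochain b extends to a homomorphism \<beta> on 1-chains, and evaluating the
  coboundary of b is \<beta> after \<open>bar_d2\<close>, which vanishes on cycles.\<close>

lemma eval_cohomologous:
  assumes c: "cochain c" and d: "cochain d" and cd: "cohomologous c d" and z: "z \<in> cycles2 G"
  shows "eval_cochain U d z = eval_cochain U c z"
proof -
  obtain b where b: "b \<in> carrier G \<rightarrow> carrier U"
    "\<And>g h. g \<in> carrier G \<Longrightarrow> h \<in> carrier G \<Longrightarrow> d (g, h) = dif b g h \<otimes>\<^bsub>U\<^esub> c (g, h)" using cd unfolding cohomologous_def by blast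
  have bc: "b g \<in> carrier U" if "g \<in> carrier G" for g using b(1) that by auto
  obtain \<beta> where \<beta>: "\<beta> \<in> hom F1 U" "\<And>g. g \<in> carrier G \<Longrightarrow> \<beta> (frag_of g) = b g"
    using U.free_Abelian_group_universal[of b "carrier G"] b(1) by blast
  interpret \<beta>: group_hom F1 U \<beta> using \<beta>(1) by (simp add: group_hom_def group_hom_axioms_def)
  have zk: "Poly_Mapping.keys z \<subseteq> carrier G \<times> carrier G" "bar_d2 G z = 0" using z by (auto simp: cycles2_iff)
  have \<beta>d: "\<beta> (x - y) = \<beta> x \<otimes>\<^bsub>U\<^esub> inv\<^bsub>U\<^esub> \<beta> y" if "Poly_Mapping.keys x \<subseteq> carrier G" "Poly_Mapping.keys y \<subseteq> carrier G" for x y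
    using \<beta>.hom_mult[of x "- y"] \<beta>.hom_inv[of y] that by simp
  have \<beta>a: "\<beta> (x + y) = \<beta> x \<otimes>\<^bsub>U\<^esub> \<beta> y" if "Poly_Mapping.keys x \<subseteq> carrier G" "Poly_Mapping.keys y \<subseteq> carrier G" for x y
    using \<beta>.hom_mult[of x y] that by simp
  have "eval_cochain U d z = (\<lambda>z. \<beta> (bar_d2 G z) \<otimes>\<^bsub>U\<^esub> eval_cochain U c z) z"
  proof (rule hom_free_eq[OF U.is_group eval_cochain_hom(1)[OF d] _ _ zk(1)])
    show "(\<lambda>z. \<beta> (bar_d2 G z) \<otimes>\<^bsub>U\<^esub> eval_cochain U c z) \<in> hom F2 U"
    proof (rule homI)
      have k: "Poly_Mapping.keys (bar_d2 G x) \<subseteq> carrier G" if "x \<in> carrier F2" for x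
        using hom_in_carrier[OF bar_d2_hom that] by simp
      show "\<beta> (bar_d2 G x) \<otimes>\<^bsub>U\<^esub> eval_cochain U c x \<in> carrier U" if "x \<in> carrier F2" for x
        using k[OF that] c that \<beta>.hom_closed by simp
      show "\<beta> (bar_d2 G (x \<otimes>\<^bsub>F2\<^esub> y)) \<otimes>\<^bsub>U\<^esub> eval_cochain U c (x \<otimes>\<^bsub>F2\<^esub> y) =
          \<beta> (bar_d2 G x) \<otimes>\<^bsub>U\<^esub> eval_cochain U c x \<otimes>\<^bsub>U\<^esub> (\<beta> (bar_d2 G y) \<otimes>\<^bsub>U\<^esub> eval_cochain U c y)"
        if "x \<in> carrier F2" "y \<in> carrier F2" for x y
        using k[OF that(1)] k[OF that(2)] c that \<beta>.hom_closed
        by (simp add: \<beta>a eval_add) (simp add: U.m_ac)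
    qed
    fix s assume "s \<in> carrier G \<times> carrier G"
    then obtain g h where s: "s = (g, h)" "g \<in> carrier G" "h \<in> carrier G" by auto
    have "\<beta> (bar_d2 G (frag_of s)) = dif b g h"
      using s bc by (simp add: \<beta>a \<beta>d keys_difference \<beta>(2) dif_def U.m_ac)
    then show "eval_cochain U d (frag_of s) = \<beta> (bar_d2 G (frag_of s)) \<otimes>\<^bsub>U\<^esub> eval_cochain U c (frag_of s)"
      using s c d b(2) by (simp add: eval_cochain_hom(2) del: bar_d2_simps)
  qed
  then show ?thesis using zk c \<beta>.hom_one by simp
qed

text \<open>All pairs of representatives evaluate alike, by \<open>eval_cohomologous\<close> and
  \<open>eval_boundary\<close>, so \<open>the_elem\<close> is applied to a singleton.\<close>

lemma univ_coeff_class: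
  assumes c: "c \<in> cocycles2 G U" and z: "z \<in> cycles2 G"
  shows "univ_coeff G U (cohomology_class G U c) (cls z) = eval_cochain U c z"
proof -
  note cc = cocycle_cochain[OF c]
  have zk: "Poly_Mapping.keys z \<subseteq> carrier G \<times> carrier G" using z by (simp add: cycles2_iff)
  have ev: "eval_cochain U c' z' = eval_cochain U c z" if c': "c' \<in> cohomology_class G U c" and z': "z' \<in> cls z" for c' z'
  proof -
    have d: "cochain c'" "cohomologous c c'" using c' class_mem[OF cc] by auto
    obtain y where y: "Poly_Mapping.keys y \<subseteq> carrier G \<times> carrier G \<times> carrier G" "z' = bar_d3 G y + z"
      using z' unfolding mem_cls by blast
    have yk: "Poly_Mapping.keys (bar_d3 G y) \<subseteq> carrier G \<times> carrier G" using hom_in_carrier[OF bar_d3_hom, of y] y by simp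
    have "bar_d2 G z' = 0" using y z bar_d2_d3 by (simp add: cycles2_iff)
    then have "z' \<in> cycles2 G" using keys_sum[OF yk zk] by (simp add: y(2) cycles2_iff)
    then have "eval_cochain U c' z' = eval_cochain U c z'" by (rule eval_cohomologous[OF cc d])
    also have "\<dots> = eval_cochain U c z" using y(2) yk zk cc eval_boundary[OF c y(1)] by (simp add: eval_add)
    finally show ?thesis .
  qed
  have "z \<in> cls z" unfolding mem_cls by (rule exI[of _ 0]) (simp add: bar_d3_def)
  then have "(c, z) \<in> cohomology_class G U c \<times> cls z" using class_self[OF c] by simp
  from rev_image_eqI[OF this, of "eval_cochain U c z" "\<lambda>(c, z). eval_cochain U c z"]
  have "(\<lambda>(c, z). eval_cochain U c z) ` (cohomology_class G U c \<times> cls z) = {eval_cochain U c z}"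
    by (intro equalityI) (auto simp del: mem_cls intro!: ev)
  then show ?thesis using z by (simp add: univ_coeff_def)
qed

end

section \<open>Perfect groups and the Moore class\<close>

locale perfect_bar = bar_complex G for G :: "('g, 'm) monoid_scheme" (structure) +
  assumes perfect: "derived G (carrier G) = carrier G"
begin

definition bounding :: "'g \<Rightarrow> ('g \<times> 'g \<Rightarrow>\<^sub>0 int)"
  where "bounding g = (SOME z. Poly_Mapping.keys z \<subseteq> carrier G \<times> carrier G \<and> bar_d2 G z = frag_of g)"

text \<open>This is H_1(G, Z) = 0: the coboundary of g |-> \<open>frag_of g\<close> takes values in
  the image of \<open>bar_d2\<close>, so \<open>perfect_values\<close> applies.\<close>

lemma bounding:
  assumes g: "g \<in> carrier G"
  shows "Poly_Mapping.keys (bounding g) \<subseteq> carrier G \<times> carrier G" "bar_d2 G (bounding g) = frag_of g"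
proof -
  have "frag_of g \<in> bar_d2 G ` carrier F2"
  proof (rule perfect_values[OF perfect abelian_free_Abelian_group[of "carrier G"] _ _ _ g])
    show "subgroup (bar_d2 G ` carrier F2) F1"
      using group_hom.img_is_subgroup[of F2 F1 "bar_d2 G"] bar_d2_hom by (simp add: group_hom_def group_hom_axioms_def)
    show "frag_of g \<otimes>\<^bsub>F1\<^esub> inv\<^bsub>F1\<^esub> frag_of (g \<otimes> h) \<otimes>\<^bsub>F1\<^esub> frag_of h \<in> bar_d2 G ` carrier F2"
      if "g \<in> carrier G" "h \<in> carrier G" for g h
      using that by (intro image_eqI[of _ _ "frag_of (g, h)"]) auto
  qed auto
  then obtain z where "z \<in> carrier F2" "bar_d2 G z = frag_of g" by (elim imageE) simp
  then have "\<exists>z. Poly_Mapping.keys z \<subseteq> carrier G \<times> carrier G \<and> bar_d2 G z = frag_of g" by (intro exI[of _ z]) simp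
  then show "Poly_Mapping.keys (bounding g) \<subseteq> carrier G \<times> carrier G" "bar_d2 G (bounding g) = frag_of g"
    unfolding bounding_def by (rule someI2_ex; blast)+
qed

text \<open>The basis chain (g, h) corrected to a cycle by chains with the same boundary. It is the
  image of (g, h) under a retraction of the 2-chains onto the 2-cycles.\<close>

definition moore_cycle :: "'g \<Rightarrow> 'g \<Rightarrow> ('g \<times> 'g \<Rightarrow>\<^sub>0 int)"
  where "moore_cycle g h = frag_of (g, h) - bounding h + bounding (g \<otimes> h) - bounding g"

lemma moore_cycle: "g \<in> carrier G \<Longrightarrow> h \<in> carrier G \<Longrightarrow> moore_cycle g h \<in> cycles2 G"
  unfolding moore_cycle_def cycles2_iff
  by (intro conjI keys_sum keys_difference) (simp_all add: bounding)

definition moore_cocycle :: "'g \<times> 'g \<Rightarrow> ('g \<times> 'g \<Rightarrow>\<^sub>0 int) set"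
  where "moore_cocycle = (\<lambda>(g, h)\<in>carrier G \<times> carrier G. cls (moore_cycle g h))"

lemma moore_cocycle: "moore_cocycle \<in> cocycles2 G H2"
proof -
  have "moore_cocycle (h, k) \<otimes>\<^bsub>H2\<^esub> moore_cocycle (g, h \<otimes> k) = moore_cocycle (g \<otimes> h, k) \<otimes>\<^bsub>H2\<^esub> moore_cocycle (g, h)"
    if ghk: "g \<in> carrier G" "h \<in> carrier G" "k \<in> carrier G" for g h k
  proof -
    note m = moore_cycle[OF ghk(2,3)] moore_cycle[OF ghk(1) m_closed[OF ghk(2,3)]]
      moore_cycle[OF m_closed[OF ghk(1,2)] ghk(3)] moore_cycle[OF ghk(1,2)]
    have Zadd: "x + y \<in> cycles2 G" if "x \<in> cycles2 G" "y \<in> cycles2 G" for x y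
      using subgroup.m_closed[OF cycles2_subgroup that] by simp
    have "cls (moore_cycle h k + moore_cycle g (h \<otimes> k)) = cls (moore_cycle (g \<otimes> h) k + moore_cycle g h)"
    proof (rule cls_eqI[OF Zadd[OF m(1,2)] Zadd[OF m(3,4)]])
      have "moore_cycle h k + moore_cycle g (h \<otimes> k) - (moore_cycle (g \<otimes> h) k + moore_cycle g h) = bar_d3 G (frag_of (g, h, k))"
        unfolding moore_cycle_def using ghk by (simp add: m_assoc)
      then show "moore_cycle h k + moore_cycle g (h \<otimes> k) - (moore_cycle (g \<otimes> h) k + moore_cycle g h) \<in> boundaries2 G"
        unfolding boundaries2_def using ghk by (auto intro!: imageI simp del: bar_d3_simps)
    qed
    then show ?thesis using ghk m by (simp add: moore_cocycle_def cls_add)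
  qed
  then show ?thesis
    using moore_cycle by (auto simp: cocycles2_def cochains2_def moore_cocycle_def)
qed

end

locale perfect_coefficients = perfect_bar G + bar_coefficients G U
  for G :: "('g, 'm) monoid_scheme" (structure) and U :: "('u, 'n) monoid_scheme"
begin

text \<open>The injectivity of the universal coefficients map. The connecting cochain is the
  quotient of the two evaluations on \<open>bounding g\<close>; equality on
  \<open>moore_cycle g h\<close> says precisely that its coboundary accounts for the difference of
  the values at (g, h).\<close>

lemma cohomologous_if_eval_eq:
  assumes c: "cochain c" and d: "cochain d"
    and eq: "\<And>z. z \<in> cycles2 G \<Longrightarrow> eval_cochain U c z = eval_cochain U d z"
  shows "cohomologous c d"
proof -
  have bk: "Poly_Mapping.keys (bounding g) \<subseteq> carrier G \<times> carrier G" if "g \<in> carrier G" for g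
    using bounding[OF that] by simp
  define b where "b g = eval_cochain U d (bounding g) \<otimes>\<^bsub>U\<^esub> inv\<^bsub>U\<^esub> eval_cochain U c (bounding g)" for g
  have bc: "b g \<in> carrier U" if "g \<in> carrier G" for g using bk[OF that] c d by (simp add: b_def)
  have "d (g, h) = dif b g h \<otimes>\<^bsub>U\<^esub> c (g, h)" if gh: "g \<in> carrier G" "h \<in> carrier G" for g h
  proof -
    have ev: "eval_cochain U e (moore_cycle g h) = e (g, h) \<otimes>\<^bsub>U\<^esub> inv\<^bsub>U\<^esub> eval_cochain U e (bounding h) \<otimes>\<^bsub>U\<^esub>
        eval_cochain U e (bounding (g \<otimes> h)) \<otimes>\<^bsub>U\<^esub> inv\<^bsub>U\<^esub> eval_cochain U e (bounding g)" if e: "cochain e" for e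
      unfolding moore_cycle_def using e gh bk[OF gh(1)] bk[OF gh(2)] bk[OF m_closed[OF gh]]
      by (simp add: eval_add eval_diff keys_sum keys_difference eval_cochain_hom(2))
    define x y z x' y' z' where "x = eval_cochain U d (bounding h)" and "y = eval_cochain U d (bounding (g \<otimes> h))"
      and "z = eval_cochain U d (bounding g)" and "x' = eval_cochain U c (bounding h)"
      and "y' = eval_cochain U c (bounding (g \<otimes> h))" and "z' = eval_cochain U c (bounding g)"
    have cl: "x \<in> carrier U" "y \<in> carrier U" "z \<in> carrier U" "x' \<in> carrier U" "y' \<in> carrier U" "z' \<in> carrier U"
      "c (g, h) \<in> carrier U" "d (g, h) \<in> carrier U"
      using c d gh bk[OF gh(1)] bk[OF gh(2)] bk[OF m_closed[OF gh]] by (auto simp: x_def y_def z_def x'_def y'_def z'_def)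
    have "c (g, h) \<otimes>\<^bsub>U\<^esub> inv\<^bsub>U\<^esub> x' \<otimes>\<^bsub>U\<^esub> y' \<otimes>\<^bsub>U\<^esub> inv\<^bsub>U\<^esub> z' = d (g, h) \<otimes>\<^bsub>U\<^esub> inv\<^bsub>U\<^esub> x \<otimes>\<^bsub>U\<^esub> y \<otimes>\<^bsub>U\<^esub> inv\<^bsub>U\<^esub> z"
      using ev[OF c] ev[OF d] eq[OF moore_cycle[OF gh]] by (simp add: x_def y_def z_def x'_def y'_def z'_def)
    then have "(c (g, h) \<otimes>\<^bsub>U\<^esub> inv\<^bsub>U\<^esub> x' \<otimes>\<^bsub>U\<^esub> y' \<otimes>\<^bsub>U\<^esub> inv\<^bsub>U\<^esub> z') \<otimes>\<^bsub>U\<^esub> (x \<otimes>\<^bsub>U\<^esub> inv\<^bsub>U\<^esub> y \<otimes>\<^bsub>U\<^esub> z) =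
        (d (g, h) \<otimes>\<^bsub>U\<^esub> inv\<^bsub>U\<^esub> x \<otimes>\<^bsub>U\<^esub> y \<otimes>\<^bsub>U\<^esub> inv\<^bsub>U\<^esub> z) \<otimes>\<^bsub>U\<^esub> (x \<otimes>\<^bsub>U\<^esub> inv\<^bsub>U\<^esub> y \<otimes>\<^bsub>U\<^esub> z)" by simp
    also have "\<dots> = d (g, h) \<otimes>\<^bsub>U\<^esub> ((inv\<^bsub>U\<^esub> x \<otimes>\<^bsub>U\<^esub> x) \<otimes>\<^bsub>U\<^esub> (y \<otimes>\<^bsub>U\<^esub> inv\<^bsub>U\<^esub> y) \<otimes>\<^bsub>U\<^esub> (inv\<^bsub>U\<^esub> z \<otimes>\<^bsub>U\<^esub> z))"
      using cl by (simp only: U.m_ac U.m_closed U.inv_closed)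
    also have "\<dots> = d (g, h)" using cl by simp
    finally have "d (g, h) = (c (g, h) \<otimes>\<^bsub>U\<^esub> inv\<^bsub>U\<^esub> x' \<otimes>\<^bsub>U\<^esub> y' \<otimes>\<^bsub>U\<^esub> inv\<^bsub>U\<^esub> z') \<otimes>\<^bsub>U\<^esub> (x \<otimes>\<^bsub>U\<^esub> inv\<^bsub>U\<^esub> y \<otimes>\<^bsub>U\<^esub> z)" by simp
    also have "\<dots> = (z \<otimes>\<^bsub>U\<^esub> inv\<^bsub>U\<^esub> z') \<otimes>\<^bsub>U\<^esub> inv\<^bsub>U\<^esub> (y \<otimes>\<^bsub>U\<^esub> inv\<^bsub>U\<^esub> y') \<otimes>\<^bsub>U\<^esub> (x \<otimes>\<^bsub>U\<^esub> inv\<^bsub>U\<^esub> x') \<otimes>\<^bsub>U\<^esub> c (g, h)"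
      using cl by (simp only: U.m_ac U.m_closed U.inv_closed U.inv_mult U.inv_inv)
    finally show ?thesis by (simp add: dif_def b_def x_def y_def z_def x'_def y'_def z'_def)
  qed
  then show ?thesis unfolding cohomologous_def using bc by (intro bexI[of _ b]) auto
qed

lemma univ_coeff_inj: "inj_on (univ_coeff G U) (carrier (cohomology2 G U))"
proof (rule inj_onI)
  fix x y assume "x \<in> carrier (cohomology2 G U)" "y \<in> carrier (cohomology2 G U)" and eq: "univ_coeff G U x = univ_coeff G U y"
  then obtain c d where c: "c \<in> cocycles2 G U" "x = cohomology_class G U c" and d: "d \<in> cocycles2 G U" "y = cohomology_class G U d"
    by (auto simp: cohomology2_carrier)
  have "cohomologous c d"
    by (rule cohomologous_if_eval_eq[OF cocycle_cochain[OF c(1)] cocycle_cochain[OF d(1)]])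
      (use eq c d univ_coeff_class in metis)
  then show "x = y" using class_eq_iff[OF cocycle_cochain[OF c(1)] cocycle_cochain[OF d(1)]] c d by simp
qed

end

context perfect_bar
begin

lemma perfect_coefficients_homology: "perfect_coefficients G H2"
  by (simp add: perfect_coefficients_def bar_coefficients_def coefficients_def bar_complex_axioms perfect_bar_axioms
      is_group homology2_comm_group)

lemma eval_moore_cocycle:
  assumes z: "z \<in> cycles2 G" shows "eval_cochain H2 moore_cocycle z = cls z"
proof -
  interpret M: perfect_coefficients G H2 by (rule perfect_coefficients_homology)
  note cc = M.cocycle_cochain[OF moore_cocycle]
  \<comment> \<open>The retraction onto cycles given by \<open>bounding\<close>. Followed by
    \<open>cls\<close> it is a homomorphism on all 2-chains that agrees with the Moore cocycle on
    basis elements and with \<open>cls\<close> on cycles.\<close>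
  define ret where "ret x = x - frag_extend bounding (bar_d2 G x)" for x
  have bh: "frag_extend bounding \<in> hom F1 F2" by (rule hom_frag_extend) (use bounding in auto)
  have ret: "ret x \<in> cycles2 G" if x: "x \<in> carrier F2" for x
  proof -
    have k: "bar_d2 G x \<in> carrier F1" by (rule hom_in_carrier[OF bar_d2_hom x])
    have "(bar_d2 G \<circ> frag_extend bounding) (bar_d2 G x) = id (bar_d2 G x)"
    proof (rule hom_free_eq[where f = "bar_d2 G \<circ> frag_extend bounding" and f' = id and S = "carrier G", OF group_free_Abelian_group[of "carrier G"]])
      show "bar_d2 G \<circ> frag_extend bounding \<in> hom F1 F1" by (rule Group.hom_compose[OF bh bar_d2_hom])
      show "id \<in> hom F1 F1" by (rule homI) simp_all
      show "Poly_Mapping.keys (bar_d2 G x) \<subseteq> carrier G" using k by simp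
    qed (simp add: bounding)
    then show ?thesis unfolding cycles2_iff ret_def
      using x hom_in_carrier[OF bh k] by (intro conjI keys_difference) simp_all
  qed
  have ret_add: "ret (x + y) = ret x + ret y" for x y by (simp add: ret_def frag_extend_add)
  have "eval_cochain H2 moore_cocycle z = (\<lambda>x. cls (ret x)) z"
  proof (rule hom_free_eq[OF comm_group.axioms(2)[OF homology2_comm_group] M.eval_cochain_hom(1)[OF cc]])
    show "(\<lambda>x. cls (ret x)) \<in> hom F2 H2"
      by (rule homI) (use ret in \<open>auto simp: ret_add cls_add\<close>)
    show "Poly_Mapping.keys z \<subseteq> carrier G \<times> carrier G" using z by (simp add: cycles2_iff)
    fix s assume "s \<in> carrier G \<times> carrier G"
    then obtain g h where s: "s = (g, h)" "g \<in> carrier G" "h \<in> carrier G" by auto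
    have "ret (frag_of s) = moore_cycle g h" by (simp add: s ret_def moore_cycle_def frag_extend_add frag_extend_diff)
    moreover have "eval_cochain H2 moore_cocycle (frag_of s) = moore_cocycle s"
      by (rule M.eval_cochain_hom(2)[OF cc]) (simp add: s)
    moreover have "moore_cocycle s = cls (moore_cycle g h)" using s by (simp add: moore_cocycle_def)
    ultimately show "eval_cochain H2 moore_cocycle (frag_of s) = cls (ret (frag_of s))" by simp
  qed
  also have "\<dots> = cls z" using z by (simp add: ret_def cycles2_iff)
  finally show ?thesis .
qed

lemma moore_class_eq: "moore_class G = cohomology_class G H2 moore_cocycle"
proof -
  interpret M: perfect_coefficients G H2 by (rule perfect_coefficients_homology)
  have "univ_coeff G H2 (cohomology_class G H2 moore_cocycle) = (\<lambda>X\<in>carrier H2. X)"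
  proof
    fix X show "univ_coeff G H2 (cohomology_class G H2 moore_cocycle) X = (\<lambda>X\<in>carrier H2. X) X"
    proof (cases "X \<in> carrier H2")
      case True
      then obtain z where z: "z \<in> cycles2 G" "X = cls z" by (auto simp: homology2_carrier)
      then show ?thesis using M.univ_coeff_class[OF moore_cocycle z(1)] eval_moore_cocycle[OF z(1)] by simp
    qed (simp add: univ_coeff_def)
  qed
  then show ?thesis unfolding moore_class_def
    by (intro the_inv_into_f_eq[OF M.univ_coeff_inj]) (use moore_cocycle in \<open>auto simp: M.cohomology2_carrier\<close>)
qed

text \<open>A name for the representative that \<open>comm_subgroup\<close> selects by choice. What
  is used of it is that it is a cocycle and evaluates on cycles as \<open>cls\<close>.\<close>

definition moore_rep :: "'g \<times> 'g \<Rightarrow> ('g \<times> 'g \<Rightarrow>\<^sub>0 int) set"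
  where "moore_rep = (SOME u. u \<in> moore_class G)"

lemma moore_rep: "moore_rep \<in> cocycles2 G H2" "z \<in> cycles2 G \<Longrightarrow> eval_cochain H2 moore_rep z = cls z"
proof -
  interpret M: perfect_coefficients G H2 by (rule perfect_coefficients_homology)
  have m: "moore_rep \<in> cohomology_class G H2 moore_cocycle"
    unfolding moore_rep_def moore_class_eq by (rule someI[of _ moore_cocycle]) (rule M.class_self[OF moore_cocycle])
  show "moore_rep \<in> cocycles2 G H2" using M.class_member_cocycle[OF moore_cocycle m] by simp
  show "eval_cochain H2 moore_rep z = cls z" if "z \<in> cycles2 G"
    using m M.class_mem[OF M.cocycle_cochain[OF moore_cocycle]] M.eval_cohomologous[OF M.cocycle_cochain[OF moore_cocycle] _ _ that]
      eval_moore_cocycle[OF that] by auto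
qed

lemma comm_subgroup_eq: "comm_subgroup G = generate H2
    {moore_rep (g, h) \<otimes>\<^bsub>H2\<^esub> inv\<^bsub>H2\<^esub> moore_rep (h, g) | g h. g \<in> carrier G \<and> h \<in> carrier G \<and> g \<otimes> h = h \<otimes> g}"
  by (simp add: comm_subgroup_def moore_rep_def Let_def)

end

section \<open>The reduced Witt class\<close>

interpretation SW: coefficients "SL2 :: 'a::field mat monoid" "add_monoid (witt_ring :: 'a mat set ring)"
  using W.a_comm_group SL2_group by (simp only: coefficients_def)

interpretation SI: coefficients "SL2 :: 'a::field mat monoid" "I2_group :: 'a mat set monoid"
  by (simp add: coefficients_def SL2_group I2_comm_group)

lemma reduced_value_closed:
  assumes g: "g \<in> carrier SL2" and h: "h \<in> carrier SL2"
  shows "reduced_value g h \<in> carrier I2_group"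
proof -
  have neg: "\<ominus>\<^bsub>witt_ring\<^esub> x \<in> carrier I2_group" if "x \<in> carrier I2_group" for x :: "'a mat set"
    using SI.U.inv_closed[OF that] I2_inv[OF that] by simp
  have add: "x \<oplus>\<^bsub>witt_ring\<^esub> y \<in> carrier I2_group" if "x \<in> carrier I2_group" "y \<in> carrier I2_group" for x y :: "'a mat set"
    using SI.U.m_closed[OF that] by simp
  obtain a b p d where G: "g = mat22 a b p d" "a * d - b * p = 1" using g by (rule SL2_cases)
  obtain a' b' q d' where K: "h = mat22 a' b' q d'" "a' * d' - b' * q = 1" using h by (rule SL2_cases)
  have up: "x \<noteq> 0 \<and> y = 1 / x" if "x * y = 1" for x y :: 'a
    using that by (cases "x = 0") (auto simp: eq_divide_eq mult.commute)
  consider "p = 0" "q = 0" | "p = 0" "q \<noteq> 0" | "p \<noteq> 0" "q = 0" | "p \<noteq> 0" "q \<noteq> 0" "p * a' + d * q = 0"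
    | "p \<noteq> 0" "q \<noteq> 0" "p * a' + d * q \<noteq> 0" by blast
  then show ?thesis
  proof cases
    case 1
    then have "a \<noteq> 0" "a' \<noteq> 0" using up G(2) K(2) by auto
    then show ?thesis using 1 by (simp add: G(1) K(1) reduced_value_upper_upper)
  next
    case 2
    then have "a \<noteq> 0" "d = 1 / a" using up G(2) by auto
    then show ?thesis using reduced_value_upper_big[of a d q b a' b' d'] 2 by (simp add: G(1) K(1))
  next
    case 3
    then have "a' \<noteq> 0" using up K(2) by auto
    then show ?thesis using reduced_value_big_upper[of a' p a b d b' d'] 3 by (simp add: G(1) K(1))
  next
    case 4
    have "(a * a' + b * q) * p = a * (p * a') + b * p * q" by (simp add: algebra_simps)
    also have "p * a' = - (d * q)" using 4(3) by (simp add: eq_neg_iff_add_eq_0)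
    also have "a * - (d * q) + b * p * q = - ((a * d - b * p) * q)" by (simp add: algebra_simps)
    finally have "a * a' + b * q = - (q / p)" using 4(1) by (simp add: G(2) field_simps)
    then show ?thesis
      using reduced_value_big_big_0[OF 4(1,2,3), of a b b' d'] neg[OF pfister_I2[of p "- (q / p)"]] 4(1,2)
      by (simp add: G(1) K(1))
  next
    case 5
    define r where "r = p * a' + d * q"
    have r: "r \<noteq> 0" using 5(3) by (simp add: r_def)
    show ?thesis
      unfolding G(1) K(1) reduced_value_big_big[OF 5(1,2) r_def[symmetric] r] a_minus_def
      using 5(1,2) r by (intro add neg pfister_I2) auto
  qed
qed

definition reduced_cocycle :: "'a::field mat \<times> 'a mat \<Rightarrow> 'a mat set"
  where "reduced_cocycle = (\<lambda>(g, h)\<in>carrier SL2 \<times> carrier SL2. reduced_value g h)"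

lemma reduced_cocycle_apply [simp]:
  "g \<in> carrier SL2 \<Longrightarrow> h \<in> carrier SL2 \<Longrightarrow> reduced_cocycle (g, h) = reduced_value g h"
  by (simp add: reduced_cocycle_def)

lemma witt_cocycle_cocycle: "witt_cocycle \<in> cocycles2 SL2 (add_monoid (witt_ring :: 'a::field mat set ring))"
proof -
  have eq: "witt_cocycle (g, h) = witt_value g h" if "g \<in> carrier SL2" "h \<in> carrier SL2" for g h :: "'a mat"
    using that by (simp add: witt_cocycle_def witt_value_def)
  have "SW.cochain (witt_cocycle :: 'a mat \<times> 'a mat \<Rightarrow> _)"
    unfolding PiE_iff
  proof
    show "\<forall>p\<in>carrier SL2 \<times> carrier SL2. witt_cocycle p \<in> carrier (add_monoid (witt_ring :: 'a mat set ring))" by (auto simp: eq)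
  qed (simp add: witt_cocycle_def)
  then show ?thesis by (simp add: cocycles2_def cochains2_def eq witt_value_cocycle)
qed

lemma reduced_cocycle_cochain: "SI.cochain reduced_cocycle"
  unfolding PiE_iff
proof
  show "\<forall>p\<in>carrier SL2 \<times> carrier SL2. reduced_cocycle p \<in> carrier I2_group" by (auto intro: reduced_value_closed)
qed (simp add: reduced_cocycle_def)

lemma I2_cochain: "SI.cochain c \<Longrightarrow> SW.cochain c"
  by (erule rev_subsetD, rule PiE_mono) (auto intro: I2_subset)

lemma reduced_cocycle_cohomologous: "SW.cohomologous witt_cocycle reduced_cocycle"
  unfolding SW.cohomologous_def
proof (rule bexI[of _ witt_correction], intro ballI)
  fix g h :: "'a mat" assume gh: "g \<in> carrier SL2" "h \<in> carrier SL2"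
  have dif: "SW.dif witt_correction g h = witt_correction g \<ominus>\<^bsub>witt_ring\<^esub> witt_correction (g * h) \<oplus>\<^bsub>witt_ring\<^esub> witt_correction h"
    unfolding SW.dif_def a_minus_def a_inv_def by simp
  have "reduced_cocycle (g, h) = witt_value g h \<oplus>\<^bsub>witt_ring\<^esub> SW.dif witt_correction g h"
    unfolding dif using gh by (simp add: reduced_value_def)
  also have "\<dots> = SW.dif witt_correction g h \<oplus>\<^bsub>witt_ring\<^esub> witt_value g h"
    unfolding dif by (rule W.a_comm) simp_all
  also have "witt_value g h = witt_cocycle (g, h)" using gh by (simp add: witt_cocycle_def witt_value_def)
  finally show "reduced_cocycle (g, h) = SW.dif witt_correction g h \<otimes>\<^bsub>add_monoid witt_ring\<^esub> witt_cocycle (g, h)" by simp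
qed auto

text \<open>Being cohomologous to the Witt cocycle, it is a cocycle with values in W(K). Its values
  lie in I^2(K), where the operation is the restricted one.\<close>

lemma reduced_cocycle: "reduced_cocycle \<in> cocycles2 (SL2 :: 'a::field mat monoid) I2_group"
proof -
  have "reduced_cocycle \<in> cocycles2 (SL2 :: 'a mat monoid) (add_monoid witt_ring)"
    by (rule SW.cocycle_cohomologous[OF witt_cocycle_cocycle I2_cochain[OF reduced_cocycle_cochain] reduced_cocycle_cohomologous])
  then show ?thesis
    using reduced_cocycle_cochain[where 'a = 'a] by (simp add: cocycles2_def cochains2_def del: reduced_cocycle_apply)
qed

interpretation inclusion: coefficient_hom "SL2 :: 'a::field mat monoid" "I2_group :: 'a mat set monoid"
    "add_monoid (witt_ring :: 'a mat set ring)" "\<lambda>x. x"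
proof -
  have "group_hom (I2_group :: 'a mat set monoid) (add_monoid witt_ring) (\<lambda>x. x)"
    unfolding group_hom_def group_hom_axioms_def
    by (intro conjI SI.U.is_group W.add.is_group homI) (simp_all add: I2_subset)
  then show "coefficient_hom (SL2 :: 'a mat monoid) (I2_group :: 'a mat set monoid) (add_monoid witt_ring) (\<lambda>x. x)"
    unfolding coefficient_hom_def using SI.coefficients_axioms SW.coefficients_axioms by blast
qed

lemma inclusion_class:
  assumes "c \<in> cocycles2 (SL2 :: 'a::field mat monoid) (I2_group :: 'a mat set monoid)"
  shows "induced_map SL2 (add_monoid witt_ring) (\<lambda>x. x) (cohomology_class SL2 I2_group c) =
    cohomology_class SL2 (add_monoid witt_ring) c"
proof -
  have "push_cochain SL2 (\<lambda>x. x) c = c"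
    using SI.cocycle_cochain[OF assms] by (auto simp: push_cochain_def fun_eq_iff PiE_iff extensional_def restrict_def)
  then show ?thesis using inclusion.induced_map_class[OF assms] by simp
qed

text \<open>If two I^2(K)-valued cocycles differ by the coboundary of a W(K)-valued b, this
  coboundary lies in I^2(K), and by perfectness so do the values of b.\<close>

lemma inclusion_inj:
  assumes "infinite (UNIV :: 'a::field set)"
  shows "inj_on (induced_map (SL2 :: 'a mat monoid) (add_monoid (witt_ring :: 'a mat set ring)) (\<lambda>x. x)) (carrier (cohomology2 SL2 I2_group))"
proof (rule inj_onI)
  fix x y :: "('a mat \<times> 'a mat \<Rightarrow> 'a mat set) set"
  assume "x \<in> carrier (cohomology2 SL2 I2_group)" "y \<in> carrier (cohomology2 SL2 I2_group)"
    and eq: "induced_map SL2 (add_monoid witt_ring) (\<lambda>x. x) x = induced_map SL2 (add_monoid witt_ring) (\<lambda>x. x) y"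
  then obtain c d where c: "c \<in> cocycles2 SL2 I2_group" "x = cohomology_class SL2 I2_group c"
    and d: "d \<in> cocycles2 SL2 I2_group" "y = cohomology_class SL2 I2_group d"
    by (auto simp: SI.cohomology2_carrier)
  note cc = SI.cocycle_cochain[OF c(1)] and dc = SI.cocycle_cochain[OF d(1)]
  have "SW.cohomologous c d"
    using eq unfolding c(2) d(2) inclusion_class[OF c(1)] inclusion_class[OF d(1)]
      SW.class_eq_iff[OF I2_cochain[OF cc] I2_cochain[OF dc]] .
  then obtain b where b: "b \<in> carrier SL2 \<rightarrow> carrier (add_monoid witt_ring)"
    "\<And>g h. g \<in> carrier SL2 \<Longrightarrow> h \<in> carrier SL2 \<Longrightarrow> d (g, h) = SW.dif b g h \<oplus>\<^bsub>witt_ring\<^esub> c (g, h)"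
    unfolding SW.cohomologous_def by auto
  have bI: "b g \<in> carrier I2_group" if g: "g \<in> carrier SL2" for g
  proof (rule group.perfect_values[OF SL2_group SL2_perfect[OF assms] W.a_comm_group I2_subgroup b(1) _ g])
    fix g h :: "'a mat" assume gh: "g \<in> carrier SL2" "h \<in> carrier SL2"
    have m: "d (g, h) \<in> carrier I2_group" "c (g, h) \<in> carrier I2_group" using SI.cochainD[OF dc gh] SI.cochainD[OF cc gh] .
    have k: "SW.dif b g h \<in> carrier witt_ring" using SW.dif_closed[OF b(1) gh] by simp
    have "SW.dif b g h = d (g, h) \<oplus>\<^bsub>witt_ring\<^esub> \<ominus>\<^bsub>witt_ring\<^esub> c (g, h)"
      unfolding b(2)[OF gh] using k I2_subset[OF m(2)] by (simp add: W.a_assoc W.r_neg)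
    then have "SW.dif b g h \<in> carrier I2_group"
      using SI.U.m_closed[OF m(1) SI.U.inv_closed[OF m(2)]] I2_inv[OF m(2)] by simp
    then show "b g \<otimes>\<^bsub>add_monoid witt_ring\<^esub> inv\<^bsub>add_monoid witt_ring\<^esub> b (g \<otimes>\<^bsub>SL2\<^esub> h) \<otimes>\<^bsub>add_monoid witt_ring\<^esub> b h \<in> carrier I2_group"
      unfolding SW.dif_def .
  qed
  have "SI.cohomologous c d" unfolding SI.cohomologous_def
  proof (rule bexI[of _ b], intro ballI)
    fix g h :: "'a mat" assume gh: "g \<in> carrier SL2" "h \<in> carrier SL2"
    have "SI.dif b g h = SW.dif b g h"
      unfolding SI.dif_def SW.dif_def I2_inv[OF bI[OF SL.m_closed[OF gh]]] a_inv_def by simp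
    then show "d (g, h) = SI.dif b g h \<otimes>\<^bsub>I2_group\<^esub> c (g, h)" using b(2)[OF gh] by simp
  qed (use bI in auto)
  then show "x = y" using SI.class_eq_iff[OF cc dc] by (simp add: c(2) d(2))
qed

lemma reduced_witt_class_eq:
  assumes "infinite (UNIV :: 'a::field set)"
  shows "reduced_witt_class = cohomology_class SL2 (I2_group :: 'a mat set monoid) reduced_cocycle"
  unfolding reduced_witt_class_def
proof (rule the_inv_into_f_eq[OF inclusion_inj[OF assms]])
  show "induced_map SL2 (add_monoid witt_ring) (\<lambda>x. x) (cohomology_class SL2 I2_group reduced_cocycle) = (witt_class :: ('a mat \<times> 'a mat \<Rightarrow> 'a mat set) set)"
    unfolding inclusion_class[OF reduced_cocycle] witt_class_def
    by (rule sym, rule iffD2[OF SW.class_eq_iff[OF SW.cocycle_cochain[OF witt_cocycle_cocycle] I2_cochain[OF reduced_cocycle_cochain]]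
          reduced_cocycle_cohomologous])
qed (use reduced_cocycle in \<open>auto simp: SI.cohomology2_carrier\<close>)

text \<open>For commuting g and h both the Witt value and the coboundary of
  \<open>witt_correction\<close> are symmetric expressions in g and h.\<close>

lemma reduced_cocycle_equicommutative: "equicommutative_cocycle SL2 I2_group reduced_cocycle"
  unfolding equicommutative_cocycle_def
proof (intro conjI ballI impI reduced_cocycle)
  fix g h :: "'a mat" assume gh: "g \<in> carrier SL2" "h \<in> carrier SL2" and "g \<otimes>\<^bsub>SL2\<^esub> h = h \<otimes>\<^bsub>SL2\<^esub> g"
  then have comm: "g * h = h * g" by simp
  have "witt_value g h = witt_value h g" unfolding witt_value_def comm by (simp add: mult_ac)
  moreover have "witt_correction g \<ominus>\<^bsub>witt_ring\<^esub> witt_correction (g * h) \<oplus>\<^bsub>witt_ring\<^esub> witt_correction h =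
      witt_correction h \<ominus>\<^bsub>witt_ring\<^esub> witt_correction (h * g) \<oplus>\<^bsub>witt_ring\<^esub> witt_correction g"
    unfolding comm a_minus_def by (simp add: W.a_ac)
  ultimately show "reduced_cocycle (g, h) = reduced_cocycle (h, g)"
    using gh by (simp add: reduced_value_def)
qed

section \<open>Central extensions\<close>

context coefficients
begin

text \<open>Cocycles are not normalised, so the neutral element has the inverse of c(1, 1) as first
  component.\<close>

definition extension :: "('g \<times> 'g \<Rightarrow> 'u) \<Rightarrow> ('u \<times> 'g) monoid"
  where "extension c = \<lparr>carrier = carrier U \<times> carrier G,
    monoid.mult = (\<lambda>(x, g) (y, h). (x \<otimes>\<^bsub>U\<^esub> y \<otimes>\<^bsub>U\<^esub> c (g, h), g \<otimes> h)), one = (inv\<^bsub>U\<^esub> c (\<one>, \<one>), \<one>)\<rparr>"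

lemma cocycle_one_left:
  assumes "c \<in> cocycles2 G U" "g \<in> carrier G" shows "c (\<one>, g) = c (\<one>, \<one>)"
proof -
  have "c (\<one>, g) \<otimes>\<^bsub>U\<^esub> c (\<one>, \<one> \<otimes> g) = c (\<one> \<otimes> \<one>, g) \<otimes>\<^bsub>U\<^esub> c (\<one>, \<one>)"
    using assms G.one_closed unfolding cocycles2_def by blast
  then show ?thesis using assms(2) cochainD[OF cocycle_cochain[OF assms(1)]] by simp
qed

lemma extension_group:
  assumes c: "c \<in> cocycles2 G U" shows "group (extension c)"
proof -
  note cc = cochainD[OF cocycle_cochain[OF c]]
  show ?thesis
  proof (rule groupI)
    fix u v w assume uvw: "u \<in> carrier (extension c)" "v \<in> carrier (extension c)" "w \<in> carrier (extension c)"
    obtain x g y h z k where e: "u = (x, g)" "v = (y, h)" "w = (z, k)" by (cases u, cases v, cases w)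
    have cl: "x \<in> carrier U" "y \<in> carrier U" "z \<in> carrier U" "g \<in> carrier G" "h \<in> carrier G" "k \<in> carrier G"
      using uvw by (auto simp: e extension_def)
    have coc: "c (h, k) \<otimes>\<^bsub>U\<^esub> c (g, h \<otimes> k) = c (g \<otimes> h, k) \<otimes>\<^bsub>U\<^esub> c (g, h)" using c cl by (simp add: cocycles2_def)
    have "x \<otimes>\<^bsub>U\<^esub> (y \<otimes>\<^bsub>U\<^esub> z \<otimes>\<^bsub>U\<^esub> c (h, k)) \<otimes>\<^bsub>U\<^esub> c (g, h \<otimes> k) = x \<otimes>\<^bsub>U\<^esub> y \<otimes>\<^bsub>U\<^esub> z \<otimes>\<^bsub>U\<^esub> (c (h, k) \<otimes>\<^bsub>U\<^esub> c (g, h \<otimes> k))"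
      using cl cc by (simp add: U.m_assoc)
    also have "\<dots> = x \<otimes>\<^bsub>U\<^esub> y \<otimes>\<^bsub>U\<^esub> c (g, h) \<otimes>\<^bsub>U\<^esub> z \<otimes>\<^bsub>U\<^esub> c (g \<otimes> h, k)"
      unfolding coc using cl cc by (simp add: U.m_ac)
    finally show "u \<otimes>\<^bsub>extension c\<^esub> v \<otimes>\<^bsub>extension c\<^esub> w = u \<otimes>\<^bsub>extension c\<^esub> (v \<otimes>\<^bsub>extension c\<^esub> w)"
      using cl by (simp add: e extension_def G.m_assoc)
  next
    fix u v assume "u \<in> carrier (extension c)" "v \<in> carrier (extension c)"
    then show "u \<otimes>\<^bsub>extension c\<^esub> v \<in> carrier (extension c)" using cc by (auto simp: extension_def)
  next
    show "\<one>\<^bsub>extension c\<^esub> \<in> carrier (extension c)" using cc by (simp add: extension_def)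
  next
    fix u assume u: "u \<in> carrier (extension c)"
    obtain x g where e: "u = (x, g)" by (cases u)
    have cl: "x \<in> carrier U" "g \<in> carrier G" using u by (auto simp: e extension_def)
    have "inv\<^bsub>U\<^esub> c (\<one>, \<one>) \<otimes>\<^bsub>U\<^esub> x \<otimes>\<^bsub>U\<^esub> c (\<one>, \<one>) = x \<otimes>\<^bsub>U\<^esub> (inv\<^bsub>U\<^esub> c (\<one>, \<one>) \<otimes>\<^bsub>U\<^esub> c (\<one>, \<one>))"
      using cl cc[of \<one> \<one>] by (simp only: U.m_ac U.m_closed U.inv_closed G.one_closed)
    then show "\<one>\<^bsub>extension c\<^esub> \<otimes>\<^bsub>extension c\<^esub> u = u"
      using cl cc[of \<one> \<one>] by (simp add: e extension_def cocycle_one_left[OF c cl(2)])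
    let ?v = "(inv\<^bsub>U\<^esub> (x \<otimes>\<^bsub>U\<^esub> c (inv g, g)) \<otimes>\<^bsub>U\<^esub> inv\<^bsub>U\<^esub> c (\<one>, \<one>), inv g)"
    have "inv\<^bsub>U\<^esub> (x \<otimes>\<^bsub>U\<^esub> c (inv g, g)) \<otimes>\<^bsub>U\<^esub> inv\<^bsub>U\<^esub> c (\<one>, \<one>) \<otimes>\<^bsub>U\<^esub> x \<otimes>\<^bsub>U\<^esub> c (inv g, g) =
        inv\<^bsub>U\<^esub> (x \<otimes>\<^bsub>U\<^esub> c (inv g, g)) \<otimes>\<^bsub>U\<^esub> (x \<otimes>\<^bsub>U\<^esub> c (inv g, g)) \<otimes>\<^bsub>U\<^esub> inv\<^bsub>U\<^esub> c (\<one>, \<one>)"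
      using cl cc[of \<one> \<one>] cc[of "inv g" g] by (simp only: U.m_ac U.m_closed U.inv_closed G.inv_closed G.one_closed)
    then have "?v \<otimes>\<^bsub>extension c\<^esub> u = \<one>\<^bsub>extension c\<^esub>"
      using cl cc[of \<one> \<one>] cc[of "inv g" g] by (simp add: e extension_def)
    moreover have "?v \<in> carrier (extension c)" using cl cc by (simp add: extension_def)
    ultimately show "\<exists>v\<in>carrier (extension c). v \<otimes>\<^bsub>extension c\<^esub> u = \<one>\<^bsub>extension c\<^esub>" by blast
  qed
qed

end

text \<open>The embedding of A carries the inverse of c(1, 1) for the same reason: it must be
  multiplicative for an unnormalised cocycle. Equality of c(g, h) and c(h, g) for commuting g, h is
  commutativity of the lifts.\<close>

lemma equicommutative_extension_cocycle:
  fixes A :: "('b, 'n) monoid_scheme"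
  assumes inf: "infinite (UNIV :: 'a::field set)" and A: "comm_group A"
    and c: "equicommutative_cocycle (SL2 :: 'a mat monoid) A c"
  shows "equicommutative_extension (coefficients.extension SL2 A c) A (snd :: 'b \<times> 'a mat \<Rightarrow> 'a mat)
    (\<lambda>z. (z \<otimes>\<^bsub>A\<^esub> inv\<^bsub>A\<^esub> c (\<one>\<^bsub>SL2\<^esub>, \<one>\<^bsub>SL2\<^esub>), \<one>\<^bsub>SL2\<^esub>))"
proof -
  interpret C: coefficients "SL2 :: 'a mat monoid" A by (simp add: coefficients_def SL2_group A)
  have coc: "c \<in> cocycles2 SL2 A" using c by (simp add: equicommutative_cocycle_def)
  have comm: "c (g, h) = c (h, g)" if "g \<in> carrier SL2" "h \<in> carrier SL2" "g * h = h * g" for g h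
  proof -
    have "g \<otimes>\<^bsub>SL2\<^esub> h = h \<otimes>\<^bsub>SL2\<^esub> g" using that by simp
    then show ?thesis using c that unfolding equicommutative_cocycle_def by blast
  qed
  note cc = C.cochainD[OF C.cocycle_cochain[OF coc]]
  define k where "k = c (\<one>\<^bsub>SL2\<^esub>, \<one>\<^bsub>SL2\<^esub>)"
  have k: "k \<in> carrier A" unfolding k_def by (rule cc) simp_all
  have ce: "carrier (C.extension c) = carrier A \<times> carrier SL2" by (simp add: C.extension_def)
  have me: "(x, g) \<otimes>\<^bsub>C.extension c\<^esub> (y, h) = (x \<otimes>\<^bsub>A\<^esub> y \<otimes>\<^bsub>A\<^esub> c (g, h), g * h)" for x g y h by (simp add: C.extension_def)
  have "equicommutative_extension_axioms (C.extension c) A (snd :: 'b \<times> 'a mat \<Rightarrow> 'a mat) (\<lambda>z. (z \<otimes>\<^bsub>A\<^esub> inv\<^bsub>A\<^esub> k, \<one>\<^bsub>SL2\<^esub>))"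
  proof (rule equicommutative_extension_axioms.intro)
    show "infinite (UNIV :: 'a set)" by (rule inf)
    show "snd u \<in> carrier SL2" if "u \<in> carrier (C.extension c)" for u using that by (auto simp: ce)
    show "snd (u \<otimes>\<^bsub>C.extension c\<^esub> v) = snd u * snd v" for u v by (cases u, cases v) (simp add: me)
    show "\<exists>u\<in>carrier (C.extension c). snd u = g" if "g \<in> carrier SL2" for g
      using that by (intro bexI[of _ "(\<one>\<^bsub>A\<^esub>, g)"]) (simp_all add: ce)
    show "(z \<otimes>\<^bsub>A\<^esub> inv\<^bsub>A\<^esub> k, \<one>\<^bsub>SL2\<^esub>) \<in> carrier (C.extension c)" if "z \<in> carrier A" for z
      using that k by (simp add: ce)
    show "(z \<otimes>\<^bsub>A\<^esub> z' \<otimes>\<^bsub>A\<^esub> inv\<^bsub>A\<^esub> k, \<one>\<^bsub>SL2\<^esub>) = (z \<otimes>\<^bsub>A\<^esub> inv\<^bsub>A\<^esub> k, \<one>\<^bsub>SL2\<^esub>) \<otimes>\<^bsub>C.extension c\<^esub> (z' \<otimes>\<^bsub>A\<^esub> inv\<^bsub>A\<^esub> k, \<one>\<^bsub>SL2\<^esub>)"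
      if "z \<in> carrier A" "z' \<in> carrier A" for z z'
    proof -
      have "z \<otimes>\<^bsub>A\<^esub> inv\<^bsub>A\<^esub> k \<otimes>\<^bsub>A\<^esub> (z' \<otimes>\<^bsub>A\<^esub> inv\<^bsub>A\<^esub> k) \<otimes>\<^bsub>A\<^esub> k = z \<otimes>\<^bsub>A\<^esub> z' \<otimes>\<^bsub>A\<^esub> inv\<^bsub>A\<^esub> k \<otimes>\<^bsub>A\<^esub> (inv\<^bsub>A\<^esub> k \<otimes>\<^bsub>A\<^esub> k)"
        using that k by (simp only: C.U.m_ac C.U.m_closed C.U.inv_closed)
      also have "\<dots> = z \<otimes>\<^bsub>A\<^esub> z' \<otimes>\<^bsub>A\<^esub> inv\<^bsub>A\<^esub> k" using that k by simp
      finally show ?thesis by (simp add: me k_def)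
    qed
    show "z = z'" if "z \<in> carrier A" "z' \<in> carrier A" "(z \<otimes>\<^bsub>A\<^esub> inv\<^bsub>A\<^esub> k, \<one>\<^bsub>SL2\<^esub>) = (z' \<otimes>\<^bsub>A\<^esub> inv\<^bsub>A\<^esub> k, \<one>\<^bsub>SL2\<^esub> :: 'a mat)" for z z'
      using that k by simp
    show "snd (z \<otimes>\<^bsub>A\<^esub> inv\<^bsub>A\<^esub> k, \<one>\<^bsub>SL2\<^esub>) = mat22 1 0 0 1" for z by simp
    show "\<exists>z\<in>carrier A. u = (z \<otimes>\<^bsub>A\<^esub> inv\<^bsub>A\<^esub> k, \<one>\<^bsub>SL2\<^esub>)" if "u \<in> carrier (C.extension c)" "snd u = mat22 1 0 0 1" for u
      using that k by (intro bexI[of _ "fst u \<otimes>\<^bsub>A\<^esub> k"]) (auto simp: ce C.U.m_assoc)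
    show "u \<otimes>\<^bsub>C.extension c\<^esub> v = v \<otimes>\<^bsub>C.extension c\<^esub> u"
      if uv: "u \<in> carrier (C.extension c)" "v \<in> carrier (C.extension c)" "snd u * snd v = snd v * snd u" for u v
    proof -
      obtain x g y h where e: "u = (x, g)" "v = (y, h)" by (cases u, cases v)
      show ?thesis using uv comm[of g h] by (simp add: e me) (simp add: ce C.U.m_comm)
    qed
  qed
  then show ?thesis unfolding equicommutative_extension_def k_def by (simp add: C.extension_group[OF coc] A)
qed

text \<open>The first components of the Bruhat section form the cochain b that relates c to the
  pushed reduced cocycle; \<open>sect_mult\<close> is exactly this relation, read in first
  components.\<close>

lemma universal_existence:
  fixes A :: "('b, 'n) monoid_scheme"
  assumes inf: "infinite (UNIV :: 'a::field set)" and A: "comm_group A"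
    and c: "equicommutative_cocycle (SL2 :: 'a mat monoid) A c"
  obtains f where "f \<in> hom (I2_group :: 'a mat set monoid) A" "f \<in> extensional (carrier I2_group)"
    "coefficients.cohomologous SL2 A c (push_cochain SL2 f reduced_cocycle)"
proof -
  interpret C: coefficients "SL2 :: 'a mat monoid" A by (simp add: coefficients_def SL2_group A)
  have coc: "c \<in> cocycles2 SL2 A" using c by (simp add: equicommutative_cocycle_def)
  note cc = C.cochainD[OF C.cocycle_cochain[OF coc]]
  define k where "k = c (\<one>\<^bsub>SL2\<^esub>, \<one>\<^bsub>SL2\<^esub>)"
  have k: "k \<in> carrier A" unfolding k_def by (rule cc) simp_all
  define \<iota> where "\<iota> z = (z \<otimes>\<^bsub>A\<^esub> inv\<^bsub>A\<^esub> k, \<one>\<^bsub>SL2\<^esub> :: 'a mat)" for z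
  interpret X: equicommutative_extension "C.extension c" A "snd :: 'b \<times> 'a mat \<Rightarrow> 'a mat" \<iota>
    using equicommutative_extension_cocycle[OF inf A c] unfolding \<iota>_def k_def .
  obtain f where f: "X.pullback f" "f \<in> extensional (carrier I2_group)" by (rule X.pullback_ex)
  define b where "b g = fst (X.sect g)" for g
  have s: "X.sect g = (b g, g)" if "g \<in> carrier SL2" for g
    using X.sect_image[OF that] by (simp add: b_def prod_eq_iff)
  have bc: "b g \<in> carrier A" for g using X.sect_closed[of g] by (auto simp: b_def C.extension_def)
  note fh = X.I2_hom_values(1)[OF f(1)]
  have "push_cochain SL2 f reduced_cocycle (g, h) = C.dif b g h \<otimes>\<^bsub>A\<^esub> c (g, h)" if gh: "g \<in> carrier SL2" "h \<in> carrier SL2" for g h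
  proof -
    define r where "r = f (reduced_value g h)"
    have r: "r \<in> carrier A" unfolding r_def by (rule hom_in_carrier[OF fh reduced_value_closed[OF gh]])
    have gh': "g * h \<in> carrier SL2" using gh by simp
    \<comment> \<open>Multiplication by the central factor brings in c(1, gh), which equals c(1, 1)
      and cancels the normalisation of \<iota>.\<close>
    have "c (\<one>\<^bsub>SL2\<^esub>, g * h) = k" unfolding k_def by (rule C.cocycle_one_left[OF coc gh'])
    then have "b g \<otimes>\<^bsub>A\<^esub> b h \<otimes>\<^bsub>A\<^esub> c (g, h) = r \<otimes>\<^bsub>A\<^esub> inv\<^bsub>A\<^esub> k \<otimes>\<^bsub>A\<^esub> b (g * h) \<otimes>\<^bsub>A\<^esub> k"
      using X.sect_mult[OF gh f(1)] unfolding s[OF gh(1)] s[OF gh(2)] s[OF gh'] \<iota>_def r_def[symmetric]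
      by (simp add: C.extension_def)
    also have "\<dots> = r \<otimes>\<^bsub>A\<^esub> b (g * h) \<otimes>\<^bsub>A\<^esub> (inv\<^bsub>A\<^esub> k \<otimes>\<^bsub>A\<^esub> k)"
      using r k bc by (simp only: C.U.m_ac C.U.m_closed C.U.inv_closed)
    also have "\<dots> = r \<otimes>\<^bsub>A\<^esub> b (g * h)" using r k bc by simp
    finally have 1: "b g \<otimes>\<^bsub>A\<^esub> b h \<otimes>\<^bsub>A\<^esub> c (g, h) = r \<otimes>\<^bsub>A\<^esub> b (g * h)" .
    have "r = r \<otimes>\<^bsub>A\<^esub> b (g * h) \<otimes>\<^bsub>A\<^esub> inv\<^bsub>A\<^esub> b (g * h)" using r bc by (simp add: C.U.m_assoc)
    also have "\<dots> = C.dif b g h \<otimes>\<^bsub>A\<^esub> c (g, h)"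
      unfolding 1[symmetric] C.dif_def SL2_simps using bc cc[OF gh] by (simp only: C.U.m_ac C.U.m_closed C.U.inv_closed)
    finally show ?thesis using gh by (simp add: r_def)
  qed
  then have "C.cohomologous c (push_cochain SL2 f reduced_cocycle)"
    unfolding C.cohomologous_def using bc by (intro bexI[of _ b]) auto
  then show thesis using that[OF fh f(2)] by blast
qed

section \<open>Uniqueness\<close>

lemma pfister_one [simp]: "pfister 1 a = \<zero>\<^bsub>witt_ring\<^esub>" "pfister a 1 = \<zero>\<^bsub>witt_ring\<^esub>"
  by (simp_all add: pfister_def unit_diff_def a_minus_def W.r_neg)

text \<open>The value of the reduced cocycle on two elements of the big cell whose product is again
  in the big cell, as a function of the three lower left entries.\<close>

definition big_value :: "'a::field \<Rightarrow> 'a \<Rightarrow> 'a \<Rightarrow> 'a mat set"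
  where "big_value p q r = pfister (- p) (- q) \<oplus>\<^bsub>witt_ring\<^esub> (pfister (p * q) (r / (p * q)) \<ominus>\<^bsub>witt_ring\<^esub> pfister (- (1 / r)) (- r))"

lemma big_value_zero:
  assumes "p \<noteq> 0" "q \<noteq> (0 :: 'a::field)" shows "big_value p q q = \<zero>\<^bsub>witt_ring\<^esub>"
proof -
  define u x y z where "u = witt_rank1 (1 :: 'a)" and "x = witt_rank1 p" and "y = witt_rank1 q" and "z = witt_rank1 (p * q)"
  have cl: "u \<in> carrier witt_ring" "x \<in> carrier witt_ring" "y \<in> carrier witt_ring" "z \<in> carrier witt_ring"
    by (simp_all add: u_def x_def y_def z_def)
  have e: "q / (p * q) = 1 / p" using assms by simp
  have "witt_rank1 (p * q * (1 / p)) = y" using assms by (simp add: y_def)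
  then have 2: "pfister (p * q) (q / (p * q)) = u \<oplus>\<^bsub>witt_ring\<^esub> (\<ominus>\<^bsub>witt_ring\<^esub> z \<oplus>\<^bsub>witt_ring\<^esub> (\<ominus>\<^bsub>witt_ring\<^esub> x \<oplus>\<^bsub>witt_ring\<^esub> y))"
    unfolding e using assms pfister_expand[of "p * q" "1 / p"] by (simp add: u_def x_def z_def witt_rank1_inverse)
  have 1: "pfister (- p) (- q) = u \<oplus>\<^bsub>witt_ring\<^esub> (x \<oplus>\<^bsub>witt_ring\<^esub> (y \<oplus>\<^bsub>witt_ring\<^esub> z))"
    using assms pfister_expand[of "- p" "- q"] by (simp add: u_def x_def y_def z_def witt_rank1_inv)
  have 3: "pfister (- (1 / q)) (- q) = u \<oplus>\<^bsub>witt_ring\<^esub> (y \<oplus>\<^bsub>witt_ring\<^esub> (y \<oplus>\<^bsub>witt_ring\<^esub> u))"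
    using assms pfister_expand[of "- (1 / q)" "- q"] by (simp add: u_def y_def witt_rank1_inv witt_rank1_inverse)
  have "pfister (- p) (- q) \<oplus>\<^bsub>witt_ring\<^esub> pfister (p * q) (q / (p * q)) =
      (x \<oplus>\<^bsub>witt_ring\<^esub> \<ominus>\<^bsub>witt_ring\<^esub> x) \<oplus>\<^bsub>witt_ring\<^esub> ((z \<oplus>\<^bsub>witt_ring\<^esub> \<ominus>\<^bsub>witt_ring\<^esub> z) \<oplus>\<^bsub>witt_ring\<^esub> (u \<oplus>\<^bsub>witt_ring\<^esub> (y \<oplus>\<^bsub>witt_ring\<^esub> (y \<oplus>\<^bsub>witt_ring\<^esub> u))))"
    unfolding 1 2 using cl by (simp only: W.a_ac W.a_closed W.a_inv_closed)
  also have "\<dots> = pfister (- (1 / q)) (- q)" unfolding 3 using cl by (simp add: W.r_neg)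
  finally show ?thesis unfolding big_value_def a_minus_def by (simp flip: W.a_assoc add: W.r_neg)
qed

text \<open>Shows that every generator of I^2(K) is a value of the reduced cocycle on the big
  cell.\<close>

lemma big_value_pfister:
  assumes "a \<noteq> 0" "b \<noteq> (0 :: 'a::field)" shows "big_value 1 (- a) b = pfister a b"
proof -
  define u x y z where "u = witt_rank1 (1 :: 'a)" and "x = witt_rank1 a" and "y = witt_rank1 b" and "z = witt_rank1 (a * b)"
  have cl: "u \<in> carrier witt_ring" "x \<in> carrier witt_ring" "y \<in> carrier witt_ring" "z \<in> carrier witt_ring"
    by (simp_all add: u_def x_def y_def z_def)
  have 1: "pfister (- 1) a = u \<oplus>\<^bsub>witt_ring\<^esub> (u \<oplus>\<^bsub>witt_ring\<^esub> (\<ominus>\<^bsub>witt_ring\<^esub> x \<oplus>\<^bsub>witt_ring\<^esub> \<ominus>\<^bsub>witt_ring\<^esub> x))"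
    using assms pfister_expand[of "- 1" a] by (simp add: u_def x_def witt_rank1_inv)
  have 2: "pfister (- a) (- (b / a)) = u \<oplus>\<^bsub>witt_ring\<^esub> (x \<oplus>\<^bsub>witt_ring\<^esub> (z \<oplus>\<^bsub>witt_ring\<^esub> y))"
    using assms pfister_expand[of "- a" "- (b / a)"] by (simp add: u_def x_def y_def z_def witt_rank1_inv witt_rank1_divide)
  have 3: "pfister (- (1 / b)) (- b) = u \<oplus>\<^bsub>witt_ring\<^esub> (y \<oplus>\<^bsub>witt_ring\<^esub> (y \<oplus>\<^bsub>witt_ring\<^esub> u))"
    using assms pfister_expand[of "- (1 / b)" "- b"] by (simp add: u_def y_def witt_rank1_inv witt_rank1_inverse)
  have 4: "pfister a b = u \<oplus>\<^bsub>witt_ring\<^esub> (\<ominus>\<^bsub>witt_ring\<^esub> x \<oplus>\<^bsub>witt_ring\<^esub> (\<ominus>\<^bsub>witt_ring\<^esub> y \<oplus>\<^bsub>witt_ring\<^esub> z))"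
    using assms pfister_expand[of a b] by (simp add: u_def x_def y_def z_def)
  have "pfister (- 1) a \<oplus>\<^bsub>witt_ring\<^esub> pfister (- a) (- (b / a)) =
      (x \<oplus>\<^bsub>witt_ring\<^esub> \<ominus>\<^bsub>witt_ring\<^esub> x) \<oplus>\<^bsub>witt_ring\<^esub> (u \<oplus>\<^bsub>witt_ring\<^esub> u \<oplus>\<^bsub>witt_ring\<^esub> u \<oplus>\<^bsub>witt_ring\<^esub> \<ominus>\<^bsub>witt_ring\<^esub> x \<oplus>\<^bsub>witt_ring\<^esub> z \<oplus>\<^bsub>witt_ring\<^esub> y)"
    unfolding 1 2 using cl by (simp only: W.a_ac W.a_closed W.a_inv_closed)
  also have "\<dots> = (y \<oplus>\<^bsub>witt_ring\<^esub> \<ominus>\<^bsub>witt_ring\<^esub> y) \<oplus>\<^bsub>witt_ring\<^esub> (u \<oplus>\<^bsub>witt_ring\<^esub> u \<oplus>\<^bsub>witt_ring\<^esub> u \<oplus>\<^bsub>witt_ring\<^esub> \<ominus>\<^bsub>witt_ring\<^esub> x \<oplus>\<^bsub>witt_ring\<^esub> z \<oplus>\<^bsub>witt_ring\<^esub> y)"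
    using cl by (simp add: W.r_neg)
  also have "\<dots> = pfister a b \<oplus>\<^bsub>witt_ring\<^esub> pfister (- (1 / b)) (- b)"
    unfolding 3 4 using cl by (simp only: W.a_ac W.a_closed W.a_inv_closed)
  finally have "pfister (- 1) a \<oplus>\<^bsub>witt_ring\<^esub> pfister (- a) (- (b / a)) \<oplus>\<^bsub>witt_ring\<^esub> \<ominus>\<^bsub>witt_ring\<^esub> pfister (- (1 / b)) (- b) =
      pfister a b \<oplus>\<^bsub>witt_ring\<^esub> (pfister (- (1 / b)) (- b) \<oplus>\<^bsub>witt_ring\<^esub> \<ominus>\<^bsub>witt_ring\<^esub> pfister (- (1 / b)) (- b))"
    by (simp only: W.a_assoc pfister_closed W.a_closed W.a_inv_closed)
  then have "pfister (- 1) a \<oplus>\<^bsub>witt_ring\<^esub> (pfister (- a) (- (b / a)) \<oplus>\<^bsub>witt_ring\<^esub> \<ominus>\<^bsub>witt_ring\<^esub> pfister (- (1 / b)) (- b)) = pfister a b"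
    by (simp add: W.r_neg W.a_assoc)
  then show ?thesis unfolding big_value_def a_minus_def by simp
qed

text \<open>Where the reduced cocycle vanishes, b is multiplicative. This makes b trivial on
  unipotent matrices and, on the big cell, a function \<beta> of the lower left entry. Comparison
  with \<open>big_value\<close> shows that \<beta> is trivial and hence that f kills all Pfister
  classes.\<close>

lemma coboundary_hom_trivial:
  fixes A :: "('b, 'n) monoid_scheme" and f :: "'a::field mat set \<Rightarrow> 'b"
  assumes inf: "infinite (UNIV :: 'a set)" and A: "comm_group A" and f: "f \<in> hom I2_group A"
    and b: "b \<in> carrier SL2 \<rightarrow> carrier A"
    and eq: "\<And>g h. g \<in> carrier SL2 \<Longrightarrow> h \<in> carrier SL2 \<Longrightarrow> f (reduced_value g h) = coefficients.dif SL2 A b g h"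
    and x: "x \<in> carrier I2_group"
  shows "f x = \<one>\<^bsub>A\<^esub>"
proof -
  interpret C: coefficients "SL2 :: 'a mat monoid" A by (simp add: coefficients_def SL2_group A)
  interpret f: group_hom "I2_group :: 'a mat set monoid" A f
    by (simp add: group_hom_def group_hom_axioms_def SI.U.is_group C.U.is_group f)
  have f0: "f \<zero>\<^bsub>witt_ring\<^esub> = \<one>\<^bsub>A\<^esub>" using f.hom_one by simp
  have bc: "b g \<in> carrier A" if "g \<in> carrier SL2" for g using b that by auto
  have mult: "b (g * h) = b g \<otimes>\<^bsub>A\<^esub> b h"
    if gh: "g \<in> carrier SL2" "h \<in> carrier SL2" and z: "reduced_value g h = \<zero>\<^bsub>witt_ring\<^esub>" for g h
  proof -
    have c: "b g \<in> carrier A" "b h \<in> carrier A" "b (g * h) \<in> carrier A" using bc gh by auto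
    have "b g \<otimes>\<^bsub>A\<^esub> b h = (b g \<otimes>\<^bsub>A\<^esub> inv\<^bsub>A\<^esub> b (g * h) \<otimes>\<^bsub>A\<^esub> b h) \<otimes>\<^bsub>A\<^esub> b (g * h)"
      using c by (simp add: C.U.m_ac)
    also have "b g \<otimes>\<^bsub>A\<^esub> inv\<^bsub>A\<^esub> b (g * h) \<otimes>\<^bsub>A\<^esub> b h = \<one>\<^bsub>A\<^esub>" using eq[OF gh] by (simp add: z f0 C.dif_def)
    finally show ?thesis using c by simp
  qed
  obtain e :: 'a where "nondegenerate_scale e" using nondegenerate_scale_ex[OF inf] by blast
  then have e: "e \<noteq> 0" "e\<^sup>2 - 1 \<noteq> 0" by (auto simp: nondegenerate_scale_def)
  have upper_trivial: "b (mat22 1 t 0 1) = \<one>\<^bsub>A\<^esub>" for t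
  proof -
    define s where "s = t / (e\<^sup>2 - 1)"
    \<comment> \<open>With D = diag(e, 1/e), D times the unipotent of parameter s equals the
      unipotent of parameter e^2 s = t + s times D. As b is multiplicative on these products, its
      value at parameter t cancels to 1.\<close>
    have t: "t + s = e\<^sup>2 * s" using e(2) by (simp add: s_def field_simps)
    have c: "b (mat22 1 t 0 1) \<in> carrier A" "b (mat22 1 s 0 1) \<in> carrier A" "b (mat22 e 0 0 (1 / e)) \<in> carrier A"
      using e(1) by (auto intro!: bc)
    have 1: "b (mat22 1 (t + s) 0 1) = b (mat22 1 t 0 1) \<otimes>\<^bsub>A\<^esub> b (mat22 1 s 0 1)"
      using mult[of "mat22 1 t 0 1" "mat22 1 s 0 1"] by (simp add: reduced_value_upper_upper add.commute)
    have 2: "b (mat22 e (e * s) 0 (1 / e)) = b (mat22 e 0 0 (1 / e)) \<otimes>\<^bsub>A\<^esub> b (mat22 1 s 0 1)"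
      using mult[of "mat22 e 0 0 (1 / e)" "mat22 1 s 0 1"] e(1) by (simp add: reduced_value_upper_upper)
    have "mat22 1 (t + s) 0 1 * mat22 e 0 0 (1 / e) = mat22 e (e * s) 0 (1 / e)"
      unfolding t using e(1) by (simp add: power2_eq_square)
    then have 3: "b (mat22 e (e * s) 0 (1 / e)) = b (mat22 1 (t + s) 0 1) \<otimes>\<^bsub>A\<^esub> b (mat22 e 0 0 (1 / e))"
      using mult[of "mat22 1 (t + s) 0 1" "mat22 e 0 0 (1 / e)"] e(1) by (simp add: reduced_value_upper_upper del: mat22_mult)
    have "b (mat22 1 s 0 1) \<otimes>\<^bsub>A\<^esub> b (mat22 e 0 0 (1 / e)) = b (mat22 1 t 0 1) \<otimes>\<^bsub>A\<^esub> b (mat22 1 s 0 1) \<otimes>\<^bsub>A\<^esub> b (mat22 e 0 0 (1 / e))"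
      using 2 3 C.U.m_comm[OF c(2,3)] unfolding 1 by simp
    then have "b (mat22 1 s 0 1) = b (mat22 1 t 0 1) \<otimes>\<^bsub>A\<^esub> b (mat22 1 s 0 1)"
      using C.U.right_cancel c by (metis C.U.m_closed)
    then show ?thesis using c C.U.r_cancel_one' by metis
  qed
  define \<beta> where "\<beta> p = b (mat22 0 (- (1 / p)) p 0)" for p
  have \<beta>c: "\<beta> p \<in> carrier A" if "p \<noteq> 0" for p using that by (auto simp: \<beta>_def intro!: bc)
  \<comment> \<open>A matrix of the big cell is an antidiagonal one between two unipotents. The
    reduced cocycle vanishes on both multiplications because one argument of \<open>pfister\<close>
    is 1.\<close>
  have big: "b (mat22 a a' p d) = \<beta> p" if p: "p \<noteq> 0" and det: "a * d - a' * p = 1" for a a' p d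
  proof -
    have 1: "b (mat22 a (- (1 / p)) p 0) = \<beta> p"
      using mult[of "mat22 1 (a / p) 0 1" "mat22 0 (- (1 / p)) p 0"] p reduced_value_upper_big[of 1 1 p "a / p" 0 "- (1 / p)" 0] \<beta>c[OF p]
      by (simp add: upper_trivial \<beta>_def)
    have "a' = (a * d - 1) / p" using det p by (simp add: field_simps)
    then have "mat22 a (- (1 / p)) p 0 * mat22 1 (d / p) 0 1 = mat22 a a' p d" using p by (simp add: field_simps)
    then have "b (mat22 a a' p d) = b (mat22 a (- (1 / p)) p 0) \<otimes>\<^bsub>A\<^esub> b (mat22 1 (d / p) 0 1)"
      using mult[of "mat22 a (- (1 / p)) p 0" "mat22 1 (d / p) 0 1"] p reduced_value_big_upper[of 1 p a "- (1 / p)" 0 "d / p" 1]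
      by (simp del: mat22_mult)
    then show ?thesis unfolding 1 upper_trivial using \<beta>c[OF p] by simp
  qed
  have main: "f (big_value p q r) = \<beta> p \<otimes>\<^bsub>A\<^esub> inv\<^bsub>A\<^esub> \<beta> r \<otimes>\<^bsub>A\<^esub> \<beta> q" if pqr: "p \<noteq> 0" "q \<noteq> 0" "r \<noteq> 0" for p q r
  proof -
    let ?g = "mat22 0 (- (1 / p)) p 0" and ?h = "mat22 (r / p) (- (1 / q)) q 0"
    have gh: "?g \<in> carrier SL2" "?h \<in> carrier SL2" using pqr by auto
    have "?g * ?h = mat22 (- (q / p)) 0 r (- (p / q))" using pqr by simp
    moreover have "b (mat22 (- (q / p)) 0 r (- (p / q))) = \<beta> r" by (rule big) (use pqr in auto)
    moreover have "b ?h = \<beta> q" by (rule big) (use pqr in auto)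
    moreover have "reduced_value ?g ?h = big_value p q r"
      unfolding big_value_def by (rule reduced_value_big_big) (use pqr in auto)
    ultimately show ?thesis using eq[OF gh] by (simp add: C.dif_def \<beta>_def[of p, symmetric] del: mat22_mult)
  qed
  \<comment> \<open>For p = q = r the value of the cocycle is zero and the coboundary of \<beta>
    collapses to \<open>\<beta> p\<close>.\<close>
  have \<beta>1: "\<beta> p = \<one>\<^bsub>A\<^esub>" if p: "p \<noteq> 0" for p
    using main[OF p p p] \<beta>c[OF p] by (simp add: big_value_zero p f0)
  have pf: "f (pfister a c) = \<one>\<^bsub>A\<^esub>" if "a \<noteq> 0" "c \<noteq> 0" for a c
    using main[of 1 "- a" c] that by (simp add: big_value_pfister \<beta>1)
  have "x \<in> generate (add_monoid witt_ring) pfister_set" using x by (simp add: I2_carrier)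
  then show ?thesis
  proof (induction rule: generate.induct)
    case one
    show ?case using f0 by simp
  next
    case (incl h)
    then show ?case using pf by (auto simp: pfister_set_def)
  next
    case (inv h)
    then have h: "h \<in> carrier I2_group" "f h = \<one>\<^bsub>A\<^esub>" using pf by (auto simp: pfister_set_def)
    then show ?case using f.hom_inv[OF h(1)] I2_inv[OF h(1)] by (simp add: a_inv_def)
  next
    case (eng h1 h2)
    then have "h1 \<in> carrier I2_group" "h2 \<in> carrier I2_group" by (simp_all add: I2_carrier)
    then show ?case using f.hom_mult[of h1 h2] eng.IH by simp
  qed
qed

lemma universal_uniqueness:
  fixes A :: "('b, 'n) monoid_scheme" and f f' :: "'a::field mat set \<Rightarrow> 'b"
  assumes inf: "infinite (UNIV :: 'a set)" and A: "comm_group A" and f: "f \<in> hom I2_group A" and f': "f' \<in> hom I2_group A"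
    and coh: "coefficients.cohomologous SL2 A (push_cochain SL2 f reduced_cocycle) (push_cochain SL2 f' reduced_cocycle)"
    and x: "x \<in> carrier I2_group"
  shows "f x = f' x"
proof -
  interpret C: coefficients "SL2 :: 'a mat monoid" A by (simp add: coefficients_def SL2_group A)
  have fc: "f x \<in> carrier A" "f' x \<in> carrier A" if "x \<in> carrier I2_group" for x
    using hom_in_carrier[OF f that] hom_in_carrier[OF f' that] .
  obtain b where b: "b \<in> carrier SL2 \<rightarrow> carrier A"
    "\<And>g h. g \<in> carrier SL2 \<Longrightarrow> h \<in> carrier SL2 \<Longrightarrow> f' (reduced_value g h) = C.dif b g h \<otimes>\<^bsub>A\<^esub> f (reduced_value g h)"
    using coh unfolding C.cohomologous_def by auto
  have "f' x \<otimes>\<^bsub>A\<^esub> inv\<^bsub>A\<^esub> f x = \<one>\<^bsub>A\<^esub>"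
  proof (rule coboundary_hom_trivial[OF inf A _ b(1) _ x])
    show "(\<lambda>x. f' x \<otimes>\<^bsub>A\<^esub> inv\<^bsub>A\<^esub> f x) \<in> hom I2_group A"
    proof (rule homI)
      show "f' (x \<otimes>\<^bsub>I2_group\<^esub> y) \<otimes>\<^bsub>A\<^esub> inv\<^bsub>A\<^esub> f (x \<otimes>\<^bsub>I2_group\<^esub> y) = (f' x \<otimes>\<^bsub>A\<^esub> inv\<^bsub>A\<^esub> f x) \<otimes>\<^bsub>A\<^esub> (f' y \<otimes>\<^bsub>A\<^esub> inv\<^bsub>A\<^esub> f y)"
        if "x \<in> carrier I2_group" "y \<in> carrier I2_group" for x y
        unfolding hom_mult[OF f that] hom_mult[OF f' that] using fc[OF that(1)] fc[OF that(2)]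
        by (simp only: C.U.m_ac C.U.inv_mult C.U.m_closed C.U.inv_closed)
    qed (use fc in simp)
    show "f' (reduced_value g h) \<otimes>\<^bsub>A\<^esub> inv\<^bsub>A\<^esub> f (reduced_value g h) = C.dif b g h" if gh: "g \<in> carrier SL2" "h \<in> carrier SL2" for g h
      unfolding b(2)[OF gh] using fc[OF reduced_value_closed[OF gh]] C.dif_closed[OF b(1) gh] by (simp add: C.U.m_assoc)
  qed
  then have "f' x \<otimes>\<^bsub>A\<^esub> inv\<^bsub>A\<^esub> f x \<otimes>\<^bsub>A\<^esub> f x = f x" using fc[OF x] by simp
  then show ?thesis using fc[OF x] by (simp add: C.U.m_assoc)
qed

lemma (in coefficient_hom) eval_push_cochain:
  assumes c: "C.cochain c" and z: "Poly_Mapping.keys z \<subseteq> carrier G \<times> carrier G"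
  shows "eval_cochain V (push_cochain G f c) z = f (eval_cochain U c z)"
proof -
  note pc = push_cochain[OF c]
  have "eval_cochain V (push_cochain G f c) z = (f \<circ> eval_cochain U c) z"
  proof (rule hom_free_eq[where f' = "f \<circ> eval_cochain U c", OF D.U.is_group D.eval_cochain_hom(1)[OF pc] _ _ z])
    show "f \<circ> eval_cochain U c \<in> hom (free_Abelian_group (carrier G \<times> carrier G)) V"
      by (rule Group.hom_compose[OF C.eval_cochain_hom(1)[OF c] homh])
    show "eval_cochain V (push_cochain G f c) (frag_of p) = (f \<circ> eval_cochain U c) (frag_of p)"
      if "p \<in> carrier G \<times> carrier G" for p
      using that D.eval_cochain_hom(2)[OF pc that] C.eval_cochain_hom(2)[OF c that] by (simp add: push_cochain_def)
  qed
  then show ?thesis by simp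
qed

text \<open>A coboundary takes equal values on a commuting pair in either order, so symmetry on such
  a pair passes between cohomologous cochains.\<close>

lemma (in coefficients) cohomologous_comm:
  assumes cd: "cohomologous c d" and c: "cochain c" and gh: "g \<in> carrier G" "h \<in> carrier G" "g \<otimes> h = h \<otimes> g"
    and d: "d (g, h) = d (h, g)"
  shows "c (g, h) = c (h, g)"
proof -
  obtain b where b: "b \<in> carrier G \<rightarrow> carrier U"
    "\<And>g h. g \<in> carrier G \<Longrightarrow> h \<in> carrier G \<Longrightarrow> d (g, h) = dif b g h \<otimes>\<^bsub>U\<^esub> c (g, h)" using cd unfolding cohomologous_def by blast
  have bc: "b g \<in> carrier U" if "g \<in> carrier G" for g using b(1) that by auto
  have "dif b g h = dif b h g" unfolding dif_def gh(3)
    using bc[OF gh(1)] bc[OF gh(2)] bc[OF G.m_closed[OF gh(2,1)]] by (simp only: U.m_ac U.m_closed U.inv_closed)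
  then have "dif b g h \<otimes>\<^bsub>U\<^esub> c (g, h) = dif b g h \<otimes>\<^bsub>U\<^esub> c (h, g)"
    using b(2)[OF gh(1,2)] b(2)[OF gh(2,1)] d by simp
  then show ?thesis using dif_closed[OF b(1) gh(1,2)] cochainD[OF c gh(1,2)] cochainD[OF c gh(2,1)] by simp
qed

section \<open>The universal equicommutative class\<close>

lemma coefficient_hom_SL2:
  fixes A :: "('b, 'n) monoid_scheme"
  assumes "comm_group A" "f \<in> hom (I2_group :: 'a::field mat set monoid) A"
  shows "coefficient_hom (SL2 :: 'a mat monoid) (I2_group :: 'a mat set monoid) A f"
proof -
  interpret A: comm_group A by fact
  show ?thesis
    unfolding coefficient_hom_def coefficients_def group_hom_def group_hom_axioms_def
    using assms A.is_group SI.U.is_group SL2_group I2_comm_group by blast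
qed

lemma universal_property:
  fixes A :: "('b, 'n) monoid_scheme"
  assumes inf: "infinite (UNIV :: 'a::field set)" and A: "comm_group A"
    and v: "equicommutative_class (SL2 :: 'a mat monoid) A v"
  shows "\<exists>!f. f \<in> hom (I2_group :: 'a mat set monoid) A \<and> f \<in> extensional (carrier I2_group) \<and>
    induced_map (SL2 :: 'a mat monoid) A f reduced_witt_class = v"
proof -
  interpret C: coefficients "SL2 :: 'a mat monoid" A by (simp add: coefficients_def SL2_group A)
  obtain c where c: "equicommutative_cocycle SL2 A c" and vc: "v = cohomology_class SL2 A c"
  proof -
    obtain c where c: "c \<in> v" "equicommutative_cocycle SL2 A c" and vH: "v \<in> carrier (cohomology2 SL2 A)"
      using v unfolding equicommutative_class_def by blast
    obtain c' where "c' \<in> cocycles2 SL2 A" "v = cohomology_class SL2 A c'" using vH unfolding C.cohomology2_carrier by blast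
    then show thesis using that[OF c(2)] C.class_member_cocycle[of c' c] c(1) by simp
  qed
  have cc: "C.cochain c" using c C.cocycle_cochain unfolding equicommutative_cocycle_def by blast
  have ind: "induced_map SL2 A f reduced_witt_class = v \<longleftrightarrow> C.cohomologous c (push_cochain SL2 f reduced_cocycle)"
    if f: "f \<in> hom I2_group A" for f
  proof -
    interpret f: coefficient_hom "SL2 :: 'a mat monoid" "I2_group :: 'a mat set monoid" A f
      by (rule coefficient_hom_SL2[OF A f])
    have "induced_map SL2 A f reduced_witt_class = cohomology_class SL2 A (push_cochain SL2 f reduced_cocycle)"
      unfolding reduced_witt_class_eq[OF inf] by (rule f.induced_map_class[OF reduced_cocycle])
    then show ?thesis using C.class_eq_iff[OF cc f.push_cochain[OF reduced_cocycle_cochain]] vc by auto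
  qed
  obtain f where f: "f \<in> hom I2_group A" "f \<in> extensional (carrier I2_group)"
    "C.cohomologous c (push_cochain SL2 f reduced_cocycle)"
    by (rule universal_existence[OF inf A c])
  show ?thesis
  proof (rule ex1I[of _ f])
    show "f \<in> hom I2_group A \<and> f \<in> extensional (carrier I2_group) \<and> induced_map SL2 A f reduced_witt_class = v"
      using f ind[OF f(1)] by blast
    fix f' assume f': "f' \<in> hom (I2_group :: 'a mat set monoid) A \<and> f' \<in> extensional (carrier I2_group) \<and> induced_map SL2 A f' reduced_witt_class = v"
    then have coh: "C.cohomologous c (push_cochain SL2 f' reduced_cocycle)" using ind by blast
    have "C.cohomologous (push_cochain SL2 f' reduced_cocycle) (push_cochain SL2 f reduced_cocycle)"
    proof (rule C.cohomologous_trans[OF _ C.cohomologous_sym[OF cc coh] f(3)])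
      interpret f': coefficient_hom "SL2 :: 'a mat monoid" "I2_group :: 'a mat set monoid" A f'
        using coefficient_hom_SL2[OF A] f' by blast
      show "C.cochain (push_cochain SL2 f' reduced_cocycle)" by (rule f'.push_cochain[OF reduced_cocycle_cochain])
    qed
    then have "f' x = f x" if "x \<in> carrier I2_group" for x
      using universal_uniqueness[OF inf A _ f(1) _ that] f' by blast
    then show "f' = f" using f' f(2) by (intro extensionalityI[of f' "carrier I2_group" f]) auto
  qed
qed

lemma Eq_SL2_iso:
  assumes inf: "infinite (UNIV :: 'a::field set)"
  shows "Eq_group (SL2 :: 'a mat monoid) \<cong> (I2_group :: 'a mat set monoid)"
proof -
  interpret P: perfect_bar "SL2 :: 'a mat monoid"
    by (simp add: perfect_bar_def bar_complex_def perfect_bar_axioms_def SL2_group SL2_perfect[OF inf])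
  have perf: "perfect_coefficients (SL2 :: 'a mat monoid) U" if "comm_group U" for U :: "('u, 'n) monoid_scheme"
    by (simp add: perfect_coefficients_def bar_coefficients_def coefficients_def P.bar_complex_axioms P.perfect_bar_axioms
      SL2_group that)
  interpret I: perfect_coefficients "SL2 :: 'a mat monoid" "I2_group :: 'a mat set monoid" by (rule perf[OF I2_comm_group])
  interpret H: perfect_coefficients "SL2 :: 'a mat monoid" "homology2 (SL2 :: 'a mat monoid)"
    by (rule perf[OF P.homology2_comm_group])
  let ?w = "reduced_cocycle :: 'a mat \<times> 'a mat \<Rightarrow> 'a mat set"
  let ?H = "homology2 (SL2 :: 'a mat monoid)" and ?N = "comm_subgroup (SL2 :: 'a mat monoid)" and ?u = P.moore_rep
  have keys: "Poly_Mapping.keys z \<subseteq> carrier SL2 \<times> carrier SL2" if "z \<in> cycles2 (SL2 :: 'a mat monoid)" for z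
    using that by (simp add: P.cycles2_iff)
  define \<phi> where "\<phi> = univ_coeff SL2 I2_group (cohomology_class SL2 I2_group ?w)"
  have \<phi>: "\<phi> (P.cls z) = eval_cochain I2_group ?w z" if "z \<in> cycles2 SL2" for z
    unfolding \<phi>_def by (rule I.univ_coeff_class[OF reduced_cocycle that])
  have \<phi>_hom: "\<phi> \<in> hom ?H I2_group"
  proof (rule homI)
    show "\<phi> X \<in> carrier I2_group" if X: "X \<in> carrier ?H" for X
    proof -
      obtain z where z: "z \<in> cycles2 SL2" "X = P.cls z" using X unfolding P.homology2_carrier by blast
      then show ?thesis
        using hom_in_carrier[OF SI.eval_cochain_hom(1)[OF reduced_cocycle_cochain], of z] keys[OF z(1)] by (simp add: \<phi>)
    qed
    show "\<phi> (X \<otimes>\<^bsub>?H\<^esub> Y) = \<phi> X \<otimes>\<^bsub>I2_group\<^esub> \<phi> Y" if XY: "X \<in> carrier ?H" "Y \<in> carrier ?H" for X Y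
    proof -
      obtain x y where xy: "x \<in> cycles2 SL2" "y \<in> cycles2 SL2" "X = P.cls x" "Y = P.cls y"
        using XY unfolding P.homology2_carrier by blast
      have "x + y \<in> cycles2 SL2" using subgroup.m_closed[OF P.cycles2_subgroup xy(1,2)] by simp
      then show ?thesis
        unfolding xy(3,4) P.cls_add[OF xy(1,2), symmetric] \<phi>[OF xy(1)] \<phi>[OF xy(2)]
        using \<phi> I.eval_add[OF reduced_cocycle_cochain keys[OF xy(1)] keys[OF xy(2)]] by simp
    qed
  qed
  interpret \<phi>: group_hom ?H "I2_group :: 'a mat set monoid" \<phi>
    by (simp add: group_hom_def group_hom_axioms_def H.U.is_group SI.U.is_group \<phi>_hom)
  have sub: "subgroup ?N ?H"
    unfolding P.comm_subgroup_eq
    by (rule H.U.generate_is_subgroup) (use H.cochainD[OF H.cocycle_cochain[OF P.moore_rep(1)]] in auto)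
  have uc: "H.cochain ?u" by (rule H.cocycle_cochain[OF P.moore_rep(1)])
  \<comment> \<open>Both cocycles have the same evaluation on cycles, since the Moore cocycle
    evaluates as \<open>cls\<close>; over a perfect group this makes them cohomologous.\<close>
  have \<phi>u: "SI.cohomologous (push_cochain SL2 \<phi> ?u) ?w"
  proof -
    interpret K: coefficient_hom "SL2 :: 'a mat monoid" ?H "I2_group :: 'a mat set monoid" \<phi>
      by (simp add: coefficient_hom_def H.coefficients_axioms SI.coefficients_axioms \<phi>.group_hom_axioms)
    show ?thesis
      by (rule I.cohomologous_if_eval_eq[OF K.push_cochain[OF uc] reduced_cocycle_cochain])
        (simp add: K.eval_push_cochain[OF uc keys] P.moore_rep(2) \<phi>)
  qed
  have N_kernel: "?N \<subseteq> kernel ?H I2_group \<phi>"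
    unfolding P.comm_subgroup_eq
  proof (rule H.U.generate_subgroup_incl[OF _ \<phi>.subgroup_kernel], clarify)
    fix g h :: "'a mat" assume gh: "g \<in> carrier SL2" "h \<in> carrier SL2" "g \<otimes>\<^bsub>SL2\<^esub> h = h \<otimes>\<^bsub>SL2\<^esub> g"
    note u = H.cochainD[OF uc gh(1,2)] H.cochainD[OF uc gh(2,1)]
    have pc: "SI.cochain (push_cochain SL2 \<phi> ?u)"
      using uc \<phi>.hom_closed unfolding push_cochain_def by auto
    have "?w (g, h) = ?w (h, g)"
      using reduced_cocycle_equicommutative gh unfolding equicommutative_cocycle_def by blast
    then have "\<phi> (?u (g, h)) = \<phi> (?u (h, g))"
      using SI.cohomologous_comm[OF \<phi>u pc gh] gh by simp
    then show "?u (g, h) \<otimes>\<^bsub>?H\<^esub> inv\<^bsub>?H\<^esub> ?u (h, g) \<in> kernel ?H I2_group \<phi>"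
      using \<phi>.hom_mult[OF u(1) H.U.inv_closed[OF u(2)]] \<phi>.hom_inv[OF u(2)] SI.U.r_inv[OF \<phi>.hom_closed[OF u(2)]]
        H.U.m_closed[OF u(1) H.U.inv_closed[OF u(2)]]
      unfolding kernel_def by simp
  qed
  have kernel_N: "kernel ?H I2_group \<phi> \<subseteq> ?N"
  proof
    interpret N: normal ?N ?H by (rule H.U.subgroup_imp_normal[OF sub])
    have Q: "comm_group (?H Mod ?N)" by (rule H.U.abelian_FactGroup[OF sub])
    interpret Q: perfect_coefficients "SL2 :: 'a mat monoid" "?H Mod ?N" by (rule perf[OF Q])
    let ?\<pi> = "\<lambda>X. ?N #>\<^bsub>?H\<^esub> X"
    have \<pi>_hom: "?\<pi> \<in> hom ?H (?H Mod ?N)" by (rule N.r_coset_hom_Mod)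
    interpret \<pi>: coefficient_hom "SL2 :: 'a mat monoid" ?H "?H Mod ?N" ?\<pi>
      by (simp add: coefficient_hom_def H.coefficients_axioms Q.coefficients_axioms group_hom_def group_hom_axioms_def
          H.U.is_group Q.U.is_group \<pi>_hom)
    \<comment> \<open>Modulo \<open>?N\<close> the Moore cocycle becomes symmetric on commuting
      pairs, so universal existence gives f such that the projection to the quotient is f after
      \<phi>. An element killed by \<phi> therefore lies in \<open>?N\<close>.\<close>
    have "equicommutative_cocycle SL2 (?H Mod ?N) (push_cochain SL2 ?\<pi> ?u)"
      unfolding equicommutative_cocycle_def
    proof (intro conjI ballI impI \<pi>.push_cocycle P.moore_rep(1))
      fix g h :: "'a mat" assume gh: "g \<in> carrier SL2" "h \<in> carrier SL2" "g \<otimes>\<^bsub>SL2\<^esub> h = h \<otimes>\<^bsub>SL2\<^esub> g"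
      note u = H.cochainD[OF uc gh(1,2)] H.cochainD[OF uc gh(2,1)]
      have "?u (g, h) \<otimes>\<^bsub>?H\<^esub> inv\<^bsub>?H\<^esub> ?u (h, g) \<in> ?N"
        unfolding P.comm_subgroup_eq using gh by (intro generate.incl) blast
      moreover have "?u (g, h) = (?u (g, h) \<otimes>\<^bsub>?H\<^esub> inv\<^bsub>?H\<^esub> ?u (h, g)) \<otimes>\<^bsub>?H\<^esub> ?u (h, g)"
        using u by (simp add: H.U.m_assoc)
      ultimately have "?u (g, h) \<in> ?\<pi> (?u (h, g))" unfolding r_coset_def by blast
      then have "?\<pi> (?u (h, g)) = ?\<pi> (?u (g, h))" by (rule H.U.repr_independence[OF _ u(2) sub])
      then show "push_cochain SL2 ?\<pi> ?u (g, h) = push_cochain SL2 ?\<pi> ?u (h, g)"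
        using gh by simp
    qed
    then obtain f where f: "f \<in> hom (I2_group :: 'a mat set monoid) (?H Mod ?N)"
      "Q.cohomologous (push_cochain SL2 ?\<pi> ?u) (push_cochain SL2 f ?w)"
      by (rule universal_existence[OF inf Q])
    interpret f: coefficient_hom "SL2 :: 'a mat monoid" "I2_group :: 'a mat set monoid" "?H Mod ?N" f
      by (rule coefficient_hom_SL2[OF Q f(1)])
    fix X assume X: "X \<in> kernel ?H I2_group \<phi>"
    then obtain z where z: "z \<in> cycles2 SL2" "X = P.cls z" unfolding kernel_def P.homology2_carrier by blast
    have "?\<pi> X = ?\<pi> (eval_cochain ?H ?u z)" using P.moore_rep(2)[OF z(1)] z(2) by simp
    also have "\<dots> = eval_cochain (?H Mod ?N) (push_cochain SL2 ?\<pi> ?u) z"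
      by (rule \<pi>.eval_push_cochain[OF uc keys[OF z(1)], symmetric])
    also have "\<dots> = eval_cochain (?H Mod ?N) (push_cochain SL2 f ?w) z"
      by (rule Q.eval_cohomologous[OF \<pi>.push_cochain[OF uc] f.push_cochain[OF reduced_cocycle_cochain] f(2) z(1), symmetric])
    also have "\<dots> = f (eval_cochain I2_group ?w z)"
      by (rule f.eval_push_cochain[OF reduced_cocycle_cochain keys[OF z(1)]])
    also have "eval_cochain I2_group ?w z = \<one>\<^bsub>I2_group\<^esub>"
      using X \<phi>[OF z(1)] z(2) by (simp add: kernel_def)
    also have "f \<one>\<^bsub>I2_group\<^esub> = ?N" using f.hom_one by simp
    finally have "?\<pi> X = ?N" .
    moreover have "X \<in> ?\<pi> X" using X by (intro H.U.rcos_self[OF _ sub]) (simp add: kernel_def)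
    ultimately show "X \<in> ?N" by simp
  qed
  have surj: "\<phi> ` carrier ?H = carrier I2_group"
  proof
    let ?S = "\<phi> ` carrier ?H"
    have S: "subgroup ?S I2_group" by (rule \<phi>.img_is_subgroup)
    interpret S: normal ?S "I2_group :: 'a mat set monoid" by (rule SI.U.subgroup_imp_normal[OF S])
    have Q: "comm_group (I2_group Mod ?S)" by (rule SI.U.abelian_FactGroup[OF S])
    interpret Q: perfect_coefficients "SL2 :: 'a mat monoid" "I2_group Mod ?S" by (rule perf[OF Q])
    let ?q = "\<lambda>x. ?S #>\<^bsub>I2_group\<^esub> x" and ?t = "\<lambda>x :: 'a mat set. \<one>\<^bsub>I2_group Mod ?S\<^esub>"
    have q: "?q \<in> hom I2_group (I2_group Mod ?S)" by (rule S.r_coset_hom_Mod)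
    have t: "?t \<in> hom I2_group (I2_group Mod ?S)"
      by (rule homI) (simp_all only: Q.U.one_closed Q.U.r_one)
    interpret q: coefficient_hom "SL2 :: 'a mat monoid" "I2_group :: 'a mat set monoid" "I2_group Mod ?S" ?q
      by (rule coefficient_hom_SL2[OF Q q])
    interpret t: coefficient_hom "SL2 :: 'a mat monoid" "I2_group :: 'a mat set monoid" "I2_group Mod ?S" ?t
      by (rule coefficient_hom_SL2[OF Q t])
    \<comment> \<open>Evaluations of the reduced cocycle on cycles lie in the image
      \<open>?S\<close>, so the projection modulo \<open>?S\<close> and the trivial homomorphism
      push it to cohomologous cocycles. Uniqueness makes the two homomorphisms equal, that is,
      \<open>?S\<close> is everything.\<close>
    have coh: "Q.cohomologous (push_cochain SL2 ?q ?w) (push_cochain SL2 ?t ?w)"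
    proof (rule Q.cohomologous_if_eval_eq[OF q.push_cochain[OF reduced_cocycle_cochain] t.push_cochain[OF reduced_cocycle_cochain]])
      fix z assume z: "z \<in> cycles2 (SL2 :: 'a mat monoid)"
      have ev: "eval_cochain I2_group ?w z \<in> ?S" using imageI[OF P.cls_closed[OF z], of \<phi>] unfolding \<phi>[OF z] .
      have "?q (eval_cochain I2_group ?w z) = ?S" by (rule SI.U.coset_join2[OF subgroup.mem_carrier[OF S ev] S ev])
      then show "eval_cochain (I2_group Mod ?S) (push_cochain SL2 ?q ?w) z = eval_cochain (I2_group Mod ?S) (push_cochain SL2 ?t ?w) z"
        unfolding q.eval_push_cochain[OF reduced_cocycle_cochain keys[OF z]] t.eval_push_cochain[OF reduced_cocycle_cochain keys[OF z]]
        by simp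
    qed
    show "carrier I2_group \<subseteq> ?S"
    proof
      fix x :: "'a mat set" assume x: "x \<in> carrier I2_group"
      have "?q x = ?t x" by (rule universal_uniqueness[OF inf Q q t coh x])
      then have "?q x = ?S" by simp
      then show "x \<in> ?S" using SI.U.rcos_self[OF x S] by simp
    qed
  qed (use \<phi>.hom_closed in blast)
  have "?N = kernel ?H I2_group \<phi>" using N_kernel kernel_N by blast
  then show ?thesis using \<phi>.FactGroup_iso[OF surj] by (simp add: Eq_group_def)
qed

theorem theoremA:
  assumes "infinite (UNIV :: 'a::field set)"
  shows "Eq_group (SL2 :: 'a mat monoid) \<cong> (I2_group :: 'a mat set monoid)
    \<and> equicommutative_class (SL2 :: 'a mat monoid) I2_group reduced_witt_class
    \<and> (\<forall>A :: 'b monoid. comm_group A \<longrightarrow>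
         (\<forall>v. equicommutative_class (SL2 :: 'a mat monoid) A v \<longrightarrow>
           (\<exists>!f. f \<in> hom I2_group A \<and> f \<in> extensional (carrier I2_group) \<and>
                 induced_map (SL2 :: 'a mat monoid) A f reduced_witt_class = v)))"
proof (intro conjI allI impI)
  show "Eq_group (SL2 :: 'a mat monoid) \<cong> (I2_group :: 'a mat set monoid)"
    by (rule Eq_SL2_iso[OF assms])
  show "equicommutative_class (SL2 :: 'a mat monoid) I2_group reduced_witt_class"
    unfolding equicommutative_class_def reduced_witt_class_eq[OF assms] SI.cohomology2_carrier
    using reduced_cocycle SI.class_self[OF reduced_cocycle] reduced_cocycle_equicommutative by blast
next
  fix A :: "'b monoid" and v
  assume "comm_group A" "equicommutative_class (SL2 :: 'a mat monoid) A v"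
  then show "\<exists>!f. f \<in> hom I2_group A \<and> f \<in> extensional (carrier I2_group) \<and>
      induced_map (SL2 :: 'a mat monoid) A f reduced_witt_class = v"
    by (rule universal_property[OF assms])
qed

end
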